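(* Work in the setting of the context: in particular the hypotheses (A1)–(A4) of the context hold, $U^\varepsilon$ are the weak entropy solutions appearing there, and $u$ is the limit function, i.e. $U^\varepsilon\to(u,e(u))$ in $[L^p_{loc}(\mathbb R\times(0,\infty)\times\Gamma)]^2$, $1\le p<\infty$, along a subsequence $\varepsilon\to0$. Then $$\lim_{T\to0^+}\frac1T\int_0^T\int_V\int_\Gamma|u(x,t,y)-u_0(x,y)|\,\rho(y)\,dy\,dx\,dt=0\qquad\text{for every }V\Subset\mathbb R .$$ Further, suppose in addition that for every convex entropy pair $(\ell,q)$ over $\pi_1(D)$ (i.e. $\ell$ convex and $C^2$, $q'=\ell'f'$) one has $$\int_0^\infty\int_{\mathbb R}\int_\Gamma\big(\ell(u)\,\partial_t\varphi+q(u)\,\partial_x\varphi\big)\rho\,dy\,dx\,dt\ge0\qquad\text{for all }0\le\varphi\in C_c^\infty(\mathbb R\times(0,\infty)\times\Gamma).$$ Then $u$ is the unique weak entropy solution of the reduced equation $\partial_tu+\partial_xf(u)=0$ with initial condition $u_0$.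
   Context: Parameter domain. $N\in\mathbb N$, $\Gamma=[-1,1]^N$, and $\rho(y)=\prod_{j=1}^N\rho_j(y_j):\Gamma\to[0,\infty)$ is a probability density with $\rho\in L^\infty(\Gamma)$ and $\operatorname{supp}\rho:=\overline{\{y\in\Gamma:\rho(y)\ne0\}}=\overline\Gamma$. System. $D\subseteq\mathbb R^2$ is open and convex; $U=(u,v)$; $\pi_1(u,v)=u$. $F=(f_1,f_2):\overline D\to\mathbb R^2$ and $r:\overline D\to\mathbb R$ are $C^2$. The matrix $\partial_UF(U)$ has real distinct eigenvalues $\Lambda_-(U)<\Lambda_+(U)$. For each $u\in\pi_1(\overline D)$ there is a unique point $(u,e(u))\in\overline D$ with $r(u,e(u))=0$, and $\partial_vr(u,e(u))>0$; $e$ is $C^2$; $\partial_{vv}r\equiv0$ on $\overline D$; $\partial_vf_1(u,e(u))\ne0$ for all $u\in\pi_1(\overline D)$. $K:=\{(u,e(u)):u\in\pi_1(\overline D)\}$, $f(u):=f_1(u,e(u))$. Full system ($\varepsilon>0$): $\partial_tU^\varepsilon+\partial_xF(U^\varepsilon)+\frac1\varepsilon(0,r(U^\varepsilon))=0$, $U^\varepsilon(x,0,y)=U_0^\varepsilon(x,y)$. Reduced equation: $\partial_tu+\partial_xf(u)=0$, $u(x,0,y)=u_0(x,y)$. Entropies. For $S\subset\overline D$, a convex entropy over $S$ is a $C^2$ function $\eta:S\to\mathbb R$ such that on $S$: (i) $\partial_{UU}\eta\,\partial_UF$ is symmetric; (ii) $\partial_v\eta(U)r(U)\ge0$, with equality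 iff $U\in K$ (equivalently $r(U)=0$); (iii) $\partial_{UU}\eta\ge0$ as a quadratic form. Strongly convex: $\partial_{UU}\eta\ge c>0$ on $S$. An entropy pair $(\eta,Q)$ also has $Q:S\to\mathbb R$ with $\partial_U\eta\,\partial_UF=\partial_UQ$. Weak entropy solution of the full system with data $U_0^\varepsilon\in[L^\infty(\mathbb R\times\Gamma)]^2$ taking values in $\overline D$: $U^\varepsilon\in[L^\infty(\mathbb R\times(0,\infty)\times\Gamma)]^2$ with values in $\overline D$ such that (a) $\int_0^\infty\!\int_{\mathbb R}\!\int_\Gamma(U^\varepsilon\cdot\partial_t\varphi+F(U^\varepsilon)\cdot\partial_x\varphi-\frac1\varepsilon r(U^\varepsilon)\varphi_2)\rho+\int_{\mathbb R}\!\int_\Gamma U_0^\varepsilon\cdot\varphi(x,0,y)\rho=0$ for all $\varphi=(\varphi_1,\varphi_2)\in[C_c^\infty(\mathbb R\times[0,\infty)\times\Gamma)]^2$; (b) $\int_0^\infty\!\int_{\mathbb R}\!\int_\Gamma(\eta(U^\varepsilon)\partial_t\varphi+Q(U^\varepsilon)\partial_x\varphi-\frac1\varepsilon\partial_v\eta(U^\varepsilon)r(U^\varepsilon)\varphi)\rho\ge0$ for every convex entropy pair $(\eta,Q)$ over $\overline D$ and every $0\le\varphi\in C_c^\infty(\mathbb R\times(0,\infty)\times\Gamma)$; (c) $\lim_{T\to0^+}\frac1T\int_0^T\!\int_V\!\int_\Gamma|U^\varepsilon-U_0^\varepsilon|\rho=0$ for every $V\Subset\mathbb R$. Weak entropy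 solution of the reduced equation with data $u_0\in L^\infty(\mathbb R\times\Gamma)$ taking values in $\pi_1(\overline D)$: $u\in L^\infty(\mathbb R\times(0,\infty)\times\Gamma)$ with values in $\pi_1(\overline D)$ such that (a) $\int_0^\infty\!\int_{\mathbb R}\!\int_\Gamma(u\,\partial_t\varphi+f(u)\partial_x\varphi)\rho+\int_{\mathbb R}\!\int_\Gamma u_0\varphi(x,0,y)\rho=0$ for all $\varphi\in C_c^\infty(\mathbb R\times[0,\infty)\times\Gamma)$; (b) $\int_0^\infty\!\int_{\mathbb R}\!\int_\Gamma(\ell(u)\partial_t\varphi+q(u)\partial_x\varphi)\rho\ge0$ for every convex $\ell:\mathbb R\to\mathbb R$ of class $C^2(\pi_1(\overline D))$, $q(u)=\int^u\ell'f'$, and every $0\le\varphi\in C_c^\infty(\mathbb R\times(0,\infty)\times\Gamma)$; (c) $\lim_{T\to0^+}\frac1T\int_0^T\!\int_V\!\int_\Gamma|u-u_0|\rho=0$ for every $V\Subset\mathbb R$. Weighted local spaces: $g_n\to g$ in $L^1_{\rho^k,loc}$ means $\int_{C}|g_n-g|\rho^k\to0$ on every compact subset $C$ of the domain. Hypotheses. (A1) Strict subcharacteristic condition: $\Lambda_-(u,e(u))<f'(u)<\Lambda_+(u,e(u))$, $u\in\pi_1(D)$. $B,B'$ are bounded open convex subsets of $D$, $B\cap K\ne\emptyset$, $B\Subset B'\Subset D$; $\ell_1:\pi_1(D)\to\mathbb R$ is a strictly convex $C^2$ function, $\ell_2=\ell_1+Cf$ with $0<C<\inf_{\overline{\pi_1(B')}}\ell_1''/\sup_{\overline{\pi_1(B')}}|f''|$.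 $\gamma>0$ is such that, with $B_\gamma:=B\cap\{(u,v)\in D:|v-e(u)|<\gamma\}$, there are strongly convex entropy pairs $(\eta_i,Q_i)$, $i=1,2$, on $\overline{B_\gamma}$ with $\eta_i(u,e(u))=\ell_i(u)$ on $\pi_1(\overline{B_\gamma})$, $\partial_v\eta_i\,r>0$ on $\overline{B_\gamma}\setminus K$, $\partial_v\eta_i(u,e(u))=0$ (note that $B_\gamma$ is bounded, open, and convex). Without loss of generality one can assume that there exists an entropy pair $(\eta,Q)$ on $B_\gamma$ such that $\eta$ is an extension of $u\mapsto|u|^2$, i.e. $\eta(u,e(u))=|u|^2$ (if this is not the case, the constant $\gamma$ can be further restricted). (A2) $\varepsilon$ ranges over a positive sequence tending to $0$; $U_0^\varepsilon$ takes values in $\overline{B_\gamma}$; $U^\varepsilon$ are weak entropy solutions of the full system with data $U_0^\varepsilon$, taking values in $\overline{B_\gamma}$; there are $\overline U:\Gamma\to K$ and $\beta>0$ independent of $\varepsilon$ with $\int_{\mathbb R}\int_\Gamma|U_0^\varepsilon-\overline U|^2\rho\,dy\,dx\le\beta^2$; $f''\ne0$ a.e. in $\pi_1(\overline{B_\gamma})$. (A3) $U_0^\varepsilon=(u_0^\varepsilon,v_0^\varepsilon)$ converges almost everywhere to a function $(u_0,v_0)$ taking values in $D$ and satisfying $v_0=e(u_0)$. (A4) For every $\varepsilon$, $U^\varepsilon$ is the unique limit in $[L^1_{\rho^2,loc}(\mathbb R\times(0,\infty)\times\Gamma)]^2$ as $\nu\to0$ of classical solutions $U^{\varepsilon,\nu}=(u^{\varepsilon,\nu},v^{\varepsilon,\nu})$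 of $\partial_tU^{\varepsilon,\nu}+\partial_xF(U^{\varepsilon,\nu})+\frac1\varepsilon(0,r(U^{\varepsilon,\nu}))=\nu\,\partial_{xx}U^{\varepsilon,\nu}$, $U^{\varepsilon,\nu}|_{t=0}=U_0^{\varepsilon,\nu}$, where $U_0^{\varepsilon,\nu}$ are smooth approximations of $U_0^\varepsilon$ converging to $U_0^\varepsilon$ in $[L^1_{\rho,loc}(\mathbb R\times\Gamma)]^2$; both $U^{\varepsilon,\nu}$ and $U_0^{\varepsilon,\nu}$ take values in $\overline{B_\gamma}$ for every $\nu$.
   Formalization: Uniqueness is meant almost everywhere with respect to ρ dy dx dt (ρ may vanish on a set of positive measure), and a weak entropy solution of the reduced equation is also required to have f(u) bounded, which is automatic when π₁(D̄) is closed, so that the flux integrals are defined. *)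

theory Defs
  imports "HOL-Analysis.Analysis"
begin

abbreviation pr1 :: "real^2 \<Rightarrow> real" where
  "pr1 U \<equiv> U $ 1"

abbreviation st :: "real \<Rightarrow> real \<Rightarrow> real^2" where
  "st u v \<equiv> vector [u, v]"

text \<open>
  \<open>C\<^sup>2\<close> regularity on a set \<open>S\<close> that need not be open. The derivatives are one-sided (relative
  to \<open>S\<close>) at boundary points; for a convex \<open>S\<close> with nonempty interior this is the same as
  \<open>C\<^sup>2\<close> in the interior with derivatives up to order two extending continuously to \<open>S\<close>.
  The gradient and the Hessian are arguments, because a derivative relative to \<open>S\<close> can fail to
  be unique at a cusp of \<open>S\<close>; as continuous functions on \<open>S\<close> they are determined by their values
  in the interior whenever \<open>S\<close> lies in the closure of its interior.
\<close>

definition C2_with :: "(real^2) set \<Rightarrow> (real^2 \<Rightarrow> real) \<Rightarrow> (real^2 \<Rightarrow> real^2) \<Rightarrow>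
    (real^2 \<Rightarrow> real^2^2) \<Rightarrow> bool" where
  "C2_with S g Dg Hg \<longleftrightarrow>
     (\<forall>U\<in>S. (g has_derivative (\<lambda>h. Dg U \<bullet> h)) (at U within S)) \<and>
     (\<forall>U\<in>S. (Dg has_derivative (\<lambda>h. Hg U *v h)) (at U within S)) \<and>
     continuous_on S Hg"

definition C2_real_with :: "real set \<Rightarrow> (real \<Rightarrow> real) \<Rightarrow> (real \<Rightarrow> real) \<Rightarrow> (real \<Rightarrow> real) \<Rightarrow> bool" where
  "C2_real_with I g g' g'' \<longleftrightarrow>
     (\<forall>s\<in>I. (g has_real_derivative g' s) (at s within I)) \<and>
     (\<forall>s\<in>I. (g' has_real_derivative g'' s) (at s within I)) \<and>
     continuous_on I g''"

definition strictly_convex_on :: "real set \<Rightarrow> (real \<Rightarrow> real) \<Rightarrow> bool" where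
  "strictly_convex_on I g \<longleftrightarrow> convex I \<and>
     (\<forall>a\<in>I. \<forall>b\<in>I. \<forall>s. a \<noteq> b \<and> 0 < s \<and> s < 1 \<longrightarrow>
        g ((1 - s) * a + s * b) < (1 - s) * g a + s * g b)"

primrec Ck :: "nat \<Rightarrow> ('a::euclidean_space \<Rightarrow> 'b::real_normed_vector) \<Rightarrow> bool" where
  "Ck 0 g \<longleftrightarrow> continuous_on UNIV g"
| "Ck (Suc k) g \<longleftrightarrow> (\<forall>z. g differentiable (at z)) \<and>
     (\<forall>b\<in>Basis. Ck k (\<lambda>z. frechet_derivative g (at z) b))"

definition smooth :: "('a::euclidean_space \<Rightarrow> 'b::real_normed_vector) \<Rightarrow> bool" where
  "smooth g \<longleftrightarrow> (\<forall>k. Ck k g)"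

definition smooth_on :: "'a::euclidean_space set \<Rightarrow> ('a \<Rightarrow> 'b::real_normed_vector) \<Rightarrow> bool" where
  "smooth_on S g \<longleftrightarrow> (\<exists>h. smooth h \<and> (\<forall>z\<in>S. h z = g z))"

text \<open>
  \<open>C\<^sub>c\<^sup>\<infinity>(S)\<close> for a set \<open>S\<close> that is not open: (globally smooth extensions of) functions on \<open>S\<close>
  whose support is a compact subset of \<open>S\<close>. They need not vanish on the part of the boundary that
  belongs to \<open>S\<close>.
\<close>

definition test_fun :: "'a::euclidean_space set \<Rightarrow> ('a \<Rightarrow> real) \<Rightarrow> bool" where
  "test_fun S \<phi> \<longleftrightarrow> smooth \<phi> \<and> (\<exists>C. compact C \<and> C \<subseteq> S \<and> (\<forall>z\<in>S - C. \<phi> z = 0))"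

definition Linf :: "'a::euclidean_space set \<Rightarrow> ('a \<Rightarrow> 'b::real_normed_vector) \<Rightarrow> bool" where
  "Linf S g \<longleftrightarrow> g \<in> borel_measurable (lebesgue_on S) \<and>
     (\<exists>M. AE z in lebesgue_on S. norm (g z) \<le> M)"

definition tendsto_Lp_loc :: "real \<Rightarrow> ('a::euclidean_space \<Rightarrow> real) \<Rightarrow> 'a set \<Rightarrow>
    ('i \<Rightarrow> 'a \<Rightarrow> 'b::real_normed_vector) \<Rightarrow> ('a \<Rightarrow> 'b) \<Rightarrow> 'i filter \<Rightarrow> bool" where
  "tendsto_Lp_loc p w S G g Fl \<longleftrightarrow>
     (\<forall>C. compact C \<and> C \<subseteq> S \<longrightarrow>
        ((\<lambda>i. \<integral>\<^sup>+ z. ennreal (norm (G i z - g z) powr p * w z) \<partial>lebesgue_on C) \<longlongrightarrow> 0) Fl)"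

text \<open>Space-time-parameter points are triples \<open>(x, t, y)\<close>, points of the initial data are pairs \<open>(x, y)\<close>.\<close>

definition Gam :: "(real^'n) set" where
  "Gam = cbox (- 1) 1"

definition domT :: "(real \<times> real \<times> (real^'n)) set" where
  "domT = UNIV \<times> {0<..} \<times> Gam"

definition domT0 :: "(real \<times> real \<times> (real^'n)) set" where
  "domT0 = UNIV \<times> {0..} \<times> Gam"

definition dom0 :: "(real \<times> (real^'n)) set" where
  "dom0 = UNIV \<times> Gam"

definition parameter_density :: "((real^'n) \<Rightarrow> real) \<Rightarrow> bool" where
  "parameter_density \<rho> \<longleftrightarrow>
     (\<exists>\<rho>j :: 'n \<Rightarrow> real \<Rightarrow> real. \<forall>y\<in>Gam. \<rho> y = (\<Prod>j\<in>UNIV. \<rho>j j (y $ j))) \<and>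
     (\<forall>y\<in>Gam. 0 \<le> \<rho> y) \<and>
     Linf Gam \<rho> \<and>
     (LINT y|lebesgue_on Gam. \<rho> y) = 1 \<and>
     closure {y\<in>Gam. \<rho> y \<noteq> 0} = Gam"

definition dx :: "(real \<times> real \<times> (real^'n) \<Rightarrow> real) \<Rightarrow> real \<times> real \<times> (real^'n) \<Rightarrow> real" where
  "dx \<phi> z = frechet_derivative \<phi> (at z) (1, 0, 0)"

definition dt :: "(real \<times> real \<times> (real^'n) \<Rightarrow> real) \<Rightarrow> real \<times> real \<times> (real^'n) \<Rightarrow> real" where
  "dt \<phi> z = frechet_derivative \<phi> (at z) (0, 1, 0)"

text \<open>The condition \<open>V \<Subset> \<real>\<close> is rendered as: \<open>V\<close> measurable and bounded.\<close>

definition attains_initial_data :: "((real^'n) \<Rightarrow> real) \<Rightarrow> (real \<times> real \<times> (real^'n) \<Rightarrow> 'b::real_normed_vector) \<Rightarrow>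
    (real \<times> (real^'n) \<Rightarrow> 'b) \<Rightarrow> bool" where
  "attains_initial_data \<rho> w w0 \<longleftrightarrow>
     (\<forall>V. V \<in> sets lebesgue \<and> bounded V \<longrightarrow>
        ((\<lambda>T. 1 / T * (LINT (x, t, y)|lebesgue_on (V \<times> {0<..<T} \<times> Gam).
                 norm (w (x, t, y) - w0 (x, y)) * \<rho> y)) \<longlongrightarrow> 0) (at_right 0))"

definition eigval :: "real^2^2 \<Rightarrow> real \<Rightarrow> bool" where
  "eigval A \<mu> \<longleftrightarrow> (\<exists>\<xi>. \<xi> \<noteq> 0 \<and> A *v \<xi> = \<mu> *\<^sub>R \<xi>)"

definition equil :: "(real^2) set \<Rightarrow> (real \<Rightarrow> real) \<Rightarrow> (real^2) set" where
  "equil D e = (\<lambda>u. st u (e u)) ` (pr1 ` closure D)"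

definition flux :: "(real^2 \<Rightarrow> real^2) \<Rightarrow> (real \<Rightarrow> real) \<Rightarrow> real \<Rightarrow> real" where
  "flux F e u = F (st u (e u)) $ 1"

definition relaxation_system :: "(real^2) set \<Rightarrow> (real^2 \<Rightarrow> real^2) \<Rightarrow> (real^2 \<Rightarrow> real^2^2) \<Rightarrow>
    (real^2 \<Rightarrow> real) \<Rightarrow> (real^2 \<Rightarrow> real) \<Rightarrow> (real^2 \<Rightarrow> real) \<Rightarrow> (real \<Rightarrow> real) \<Rightarrow> bool" where
  "relaxation_system D F DF \<Lambda>m \<Lambda>p r e \<longleftrightarrow>
     open D \<and> convex D \<and>
     (\<forall>i. \<exists>HF. C2_with (closure D) (\<lambda>U. F U $ i) (\<lambda>U. DF U $ i) HF) \<and>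
     (\<forall>U\<in>closure D. \<Lambda>m U < \<Lambda>p U \<and> eigval (DF U) (\<Lambda>m U) \<and> eigval (DF U) (\<Lambda>p U)) \<and>
     (\<exists>Dr Hr. C2_with (closure D) r Dr Hr \<and>
        (\<forall>u\<in>pr1 ` closure D. Dr (st u (e u)) $ 2 > 0) \<and>
        (\<forall>U\<in>closure D. Hr U $ 2 $ 2 = 0)) \<and>
     (\<forall>u\<in>pr1 ` closure D. \<forall>v. st u v \<in> closure D \<and> r (st u v) = 0 \<longleftrightarrow> v = e u) \<and>
     (\<exists>e' e''. C2_real_with (pr1 ` closure D) e e' e'') \<and>
     (\<forall>u\<in>pr1 ` closure D. DF (st u (e u)) $ 1 $ 2 \<noteq> 0)"

definition convex_entropy :: "(real^2) set \<Rightarrow> (real^2 \<Rightarrow> real^2^2) \<Rightarrow> (real^2 \<Rightarrow> real) \<Rightarrow> (real^2) set \<Rightarrow>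
    (real^2 \<Rightarrow> real) \<Rightarrow> (real^2 \<Rightarrow> real^2) \<Rightarrow> (real^2 \<Rightarrow> real^2^2) \<Rightarrow> bool" where
  "convex_entropy K DF r S \<eta> D\<eta> H\<eta> \<longleftrightarrow>
     C2_with S \<eta> D\<eta> H\<eta> \<and>
     (\<forall>U\<in>S. transpose (H\<eta> U ** DF U) = H\<eta> U ** DF U) \<and>
     (\<forall>U\<in>S. D\<eta> U $ 2 * r U \<ge> 0 \<and> (D\<eta> U $ 2 * r U = 0 \<longleftrightarrow> U \<in> K)) \<and>
     (\<forall>U\<in>S. \<forall>\<xi>. \<xi> \<bullet> (H\<eta> U *v \<xi>) \<ge> 0)"

definition strongly_convex_entropy :: "(real^2) set \<Rightarrow> (real^2 \<Rightarrow> real^2^2) \<Rightarrow> (real^2 \<Rightarrow> real) \<Rightarrow> (real^2) set \<Rightarrow>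
    (real^2 \<Rightarrow> real) \<Rightarrow> (real^2 \<Rightarrow> real^2) \<Rightarrow> (real^2 \<Rightarrow> real^2^2) \<Rightarrow> bool" where
  "strongly_convex_entropy K DF r S \<eta> D\<eta> H\<eta> \<longleftrightarrow>
     convex_entropy K DF r S \<eta> D\<eta> H\<eta> \<and>
     (\<exists>c>0. \<forall>U\<in>S. \<forall>\<xi>. \<xi> \<bullet> (H\<eta> U *v \<xi>) \<ge> c * (norm \<xi>)\<^sup>2)"

definition entropy_flux :: "(real^2 \<Rightarrow> real^2^2) \<Rightarrow> (real^2) set \<Rightarrow> (real^2 \<Rightarrow> real^2) \<Rightarrow> (real^2 \<Rightarrow> real) \<Rightarrow> bool" where
  "entropy_flux DF S D\<eta> Q \<longleftrightarrow>
     (\<forall>U\<in>S. (Q has_derivative (\<lambda>h. (D\<eta> U v* DF U) \<bullet> h)) (at U within S))"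

definition weak_entropy_sol_full :: "((real^'n) \<Rightarrow> real) \<Rightarrow> (real^2) set \<Rightarrow> (real^2 \<Rightarrow> real^2) \<Rightarrow>
    (real^2 \<Rightarrow> real^2^2) \<Rightarrow> (real^2 \<Rightarrow> real) \<Rightarrow> (real \<Rightarrow> real) \<Rightarrow> real \<Rightarrow>
    (real \<times> (real^'n) \<Rightarrow> real^2) \<Rightarrow> (real \<times> real \<times> (real^'n) \<Rightarrow> real^2) \<Rightarrow> bool" where
  "weak_entropy_sol_full \<rho> D F DF r e \<epsilon> U0 U \<longleftrightarrow>
     Linf dom0 U0 \<and> (AE z in lebesgue_on dom0. U0 z \<in> closure D) \<and>
     Linf domT U \<and> (AE z in lebesgue_on domT. U z \<in> closure D) \<and>
     (\<forall>\<phi>1 \<phi>2. test_fun domT0 \<phi>1 \<and> test_fun domT0 \<phi>2 \<longrightarrow>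
        (LINT (x, t, y)|lebesgue_on domT.
           (U (x, t, y) \<bullet> st (dt \<phi>1 (x, t, y)) (dt \<phi>2 (x, t, y))
            + F (U (x, t, y)) \<bullet> st (dx \<phi>1 (x, t, y)) (dx \<phi>2 (x, t, y))
            - 1 / \<epsilon> * r (U (x, t, y)) * \<phi>2 (x, t, y)) * \<rho> y)
        + (LINT (x, y)|lebesgue_on dom0. (U0 (x, y) \<bullet> st (\<phi>1 (x, 0, y)) (\<phi>2 (x, 0, y))) * \<rho> y)
        = 0) \<and>
     (\<forall>\<eta> D\<eta> H\<eta> Q \<phi>.
        convex_entropy (equil D e) DF r (closure D) \<eta> D\<eta> H\<eta> \<and> entropy_flux DF (closure D) D\<eta> Q \<and>
        test_fun domT \<phi> \<and> (\<forall>z\<in>domT. 0 \<le> \<phi> z) \<longrightarrow>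
        (LINT (x, t, y)|lebesgue_on domT.
           (\<eta> (U (x, t, y)) * dt \<phi> (x, t, y) + Q (U (x, t, y)) * dx \<phi> (x, t, y)
            - 1 / \<epsilon> * (D\<eta> (U (x, t, y)) $ 2) * r (U (x, t, y)) * \<phi> (x, t, y)) * \<rho> y) \<ge> 0) \<and>
     attains_initial_data \<rho> U U0"

text \<open>
  Weak entropy solutions of the reduced equation. The clause \<open>Linf domT (\<lambda>z. f (u z))\<close> says that the
  flux term is a bounded function, so that the integrals are meaningful. It only matters when the
  interval \<open>\<pi>\<^sub>1(closure D)\<close> omits one of its finite end points (where \<open>f\<close> may be unbounded); otherwise
  it follows from \<open>u\<close> being bounded with values in that interval, see \<open>Linf_compose\<close> below.
\<close>

definition weak_entropy_sol_reduced :: "((real^'n) \<Rightarrow> real) \<Rightarrow> (real^2) set \<Rightarrow> (real \<Rightarrow> real) \<Rightarrow>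
    (real \<times> (real^'n) \<Rightarrow> real) \<Rightarrow> (real \<times> real \<times> (real^'n) \<Rightarrow> real) \<Rightarrow> bool" where
  "weak_entropy_sol_reduced \<rho> D f u0 u \<longleftrightarrow>
     Linf dom0 u0 \<and> (AE z in lebesgue_on dom0. u0 z \<in> pr1 ` closure D) \<and>
     Linf domT u \<and> (AE z in lebesgue_on domT. u z \<in> pr1 ` closure D) \<and>
     Linf domT (\<lambda>z. f (u z)) \<and>
     (\<forall>\<phi>. test_fun domT0 \<phi> \<longrightarrow>
        (LINT (x, t, y)|lebesgue_on domT.
           (u (x, t, y) * dt \<phi> (x, t, y) + f (u (x, t, y)) * dx \<phi> (x, t, y)) * \<rho> y)
        + (LINT (x, y)|lebesgue_on dom0. u0 (x, y) * \<phi> (x, 0, y) * \<rho> y) = 0) \<and>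
     (\<forall>l l' l'' q \<phi>.
        convex_on UNIV l \<and> C2_real_with (pr1 ` closure D) l l' l'' \<and>
        (\<forall>s\<in>pr1 ` closure D. (q has_real_derivative
             l' s * vector_derivative f (at s within pr1 ` closure D)) (at s within pr1 ` closure D)) \<and>
        test_fun domT \<phi> \<and> (\<forall>z\<in>domT. 0 \<le> \<phi> z) \<longrightarrow>
        (LINT (x, t, y)|lebesgue_on domT.
           (l (u (x, t, y)) * dt \<phi> (x, t, y) + q (u (x, t, y)) * dx \<phi> (x, t, y)) * \<rho> y) \<ge> 0) \<and>
     attains_initial_data \<rho> u u0"

text \<open>
  The hypotheses only see \<open>\<rho>\<close>-weighted integrals, and \<open>closure {\<rho> \<noteq> 0} = \<Gamma>\<close> does not prevent \<open>\<rho>\<close> from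
  vanishing on a set of positive Lebesgue measure. Uniqueness is therefore meant almost everywhere
  with respect to \<open>\<rho> dy dx dt\<close>.
\<close>

definition unique_weak_entropy_sol_reduced :: "((real^'n) \<Rightarrow> real) \<Rightarrow> (real^2) set \<Rightarrow> (real \<Rightarrow> real) \<Rightarrow>
    (real \<times> (real^'n) \<Rightarrow> real) \<Rightarrow> (real \<times> real \<times> (real^'n) \<Rightarrow> real) \<Rightarrow> bool" where
  "unique_weak_entropy_sol_reduced \<rho> D f u0 u \<longleftrightarrow>
     weak_entropy_sol_reduced \<rho> D f u0 u \<and>
     (\<forall>w. weak_entropy_sol_reduced \<rho> D f u0 w \<longrightarrow>
        (AE (x, t, y) in lebesgue_on domT. \<rho> y \<noteq> 0 \<longrightarrow> w (x, t, y) = u (x, t, y)))"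

lemma Linf_compose:
  fixes w :: "'a::euclidean_space \<Rightarrow> real" and g :: "real \<Rightarrow> real"
  assumes S: "S \<in> sets lebesgue" and w: "Linf S w" and I: "closed I" "continuous_on I g"
    and wI: "AE z in lebesgue_on S. w z \<in> I"
  shows "Linf S (\<lambda>z. g (w z))"
proof -
  from w obtain M where M: "AE z in lebesgue_on S. norm (w z) \<le> M"
    and wm: "w \<in> borel_measurable (lebesgue_on S)"
    by (auto simp: Linf_def)
  have "compact (I \<inter> {-M..M})"
    using I(1) by (simp add: closed_Int_compact)
  then have "compact (g ` (I \<inter> {-M..M}))"
    using I(2) by (meson compact_continuous_image continuous_on_subset inf_le1)
  then obtain B where B: "\<And>s. s \<in> I \<inter> {-M..M} \<Longrightarrow> norm (g s) \<le> B"
    using compact_imp_bounded bounded_iff by (metis imageI)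
  have bd: "AE z in lebesgue_on S. norm (g (w z)) \<le> B"
    using M wI by eventually_elim (rule B, auto simp: abs_le_iff)
  have gm: "(\<lambda>s. indicat_real I s *\<^sub>R g s) \<in> borel_measurable borel"
    using I by (intro borel_measurable_continuous_on_indicator) auto
  have m1: "(\<lambda>z. indicat_real I (w z) *\<^sub>R g (w z)) \<in> borel_measurable (lebesgue_on S)"
    using measurable_compose[OF wm gm] .
  have "AE z in lebesgue. z \<in> S \<longrightarrow> w z \<in> I"
    using wI S by (simp add: AE_restrict_space_iff)
  then have "AE z in lebesgue. (if z \<in> S then indicat_real I (w z) *\<^sub>R g (w z) else 0)
      = (if z \<in> S then g (w z) else 0)"
    by eventually_elim simp
  then have "(\<lambda>z. if z \<in> S then g (w z) else 0) \<in> borel_measurable lebesgue"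
    by (rule borel_measurable_AE[OF borel_measurable_if_I[OF m1 S]])
  then have "(\<lambda>z. g (w z)) \<in> borel_measurable (lebesgue_on S)"
    by (rule borel_measurable_if_D)
  with bd show ?thesis by (auto simp: Linf_def)
qed

definition Bgam :: "(real^2) set \<Rightarrow> (real \<Rightarrow> real) \<Rightarrow> (real^2) set \<Rightarrow> real \<Rightarrow> (real^2) set" where
  "Bgam D e B \<gamma> = B \<inter> {U\<in>D. \<bar>U $ 2 - e (U $ 1)\<bar> < \<gamma>}"

definition compactly_in :: "'a::euclidean_space set \<Rightarrow> 'a set \<Rightarrow> bool" where
  "compactly_in A A' \<longleftrightarrow> compact (closure A) \<and> closure A \<subseteq> A'"

text \<open>
  In the bound on \<open>C\<close> the denominator is positive, since \<open>f'' \<noteq> 0\<close> almost everywhere on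
  \<open>\<pi>\<^sub>1(closure B\<^sub>\<gamma>)\<close> by \<open>hyp_A2\<close>.
\<close>

definition hyp_A1 :: "(real^2) set \<Rightarrow> (real^2 \<Rightarrow> real^2) \<Rightarrow> (real^2 \<Rightarrow> real^2^2) \<Rightarrow> (real^2 \<Rightarrow> real) \<Rightarrow>
    (real^2 \<Rightarrow> real) \<Rightarrow> (real^2 \<Rightarrow> real) \<Rightarrow> (real \<Rightarrow> real) \<Rightarrow> (real^2) set \<Rightarrow> (real^2) set \<Rightarrow>
    (real \<Rightarrow> real) \<Rightarrow> (real \<Rightarrow> real) \<Rightarrow> real \<Rightarrow> real \<Rightarrow> bool" where
  "hyp_A1 D F DF \<Lambda>m \<Lambda>p r e B B' l1 l2 C \<gamma> \<longleftrightarrow>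
     (\<forall>u\<in>pr1 ` D. \<Lambda>m (st u (e u)) < deriv (flux F e) u \<and> deriv (flux F e) u < \<Lambda>p (st u (e u))) \<and>
     bounded B \<and> open B \<and> convex B \<and> B \<subseteq> D \<and>
     bounded B' \<and> open B' \<and> convex B' \<and> B' \<subseteq> D \<and>
     B \<inter> equil D e \<noteq> {} \<and> compactly_in B B' \<and> compactly_in B' D \<and>
     strictly_convex_on (pr1 ` D) l1 \<and>
     (\<exists>l1' l1''. C2_real_with (pr1 ` D) l1 l1' l1'') \<and>
     (\<forall>u\<in>pr1 ` D. l2 u = l1 u + C * flux F e u) \<and>
     0 < C \<and>
     C < (INF u\<in>closure (pr1 ` B'). deriv (deriv l1) u) /
         (SUP u\<in>closure (pr1 ` B'). \<bar>deriv (deriv (flux F e)) u\<bar>) \<and>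
     0 < \<gamma> \<and>
     (\<forall>l\<in>{l1, l2}. \<exists>\<eta> D\<eta> H\<eta> Q.
        strongly_convex_entropy (equil D e) DF r (closure (Bgam D e B \<gamma>)) \<eta> D\<eta> H\<eta> \<and>
        entropy_flux DF (closure (Bgam D e B \<gamma>)) D\<eta> Q \<and>
        (\<forall>u\<in>pr1 ` closure (Bgam D e B \<gamma>). \<eta> (st u (e u)) = l u) \<and>
        (\<forall>U\<in>closure (Bgam D e B \<gamma>) - equil D e. D\<eta> U $ 2 * r U > 0) \<and>
        (\<forall>u\<in>pr1 ` closure (Bgam D e B \<gamma>). D\<eta> (st u (e u)) $ 2 = 0)) \<and>
     (\<exists>\<eta> D\<eta> H\<eta> Q.
        convex_entropy (equil D e) DF r (Bgam D e B \<gamma>) \<eta> D\<eta> H\<eta> \<and>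
        entropy_flux DF (Bgam D e B \<gamma>) D\<eta> Q \<and>
        (\<forall>u\<in>pr1 ` Bgam D e B \<gamma>. \<eta> (st u (e u)) = \<bar>u\<bar>\<^sup>2))"

definition hyp_A2 :: "((real^'n) \<Rightarrow> real) \<Rightarrow> (real^2) set \<Rightarrow> (real^2 \<Rightarrow> real^2) \<Rightarrow> (real^2 \<Rightarrow> real^2^2) \<Rightarrow>
    (real^2 \<Rightarrow> real) \<Rightarrow> (real \<Rightarrow> real) \<Rightarrow> (real^2) set \<Rightarrow> real \<Rightarrow> (nat \<Rightarrow> real) \<Rightarrow>
    (nat \<Rightarrow> real \<times> (real^'n) \<Rightarrow> real^2) \<Rightarrow> (nat \<Rightarrow> real \<times> real \<times> (real^'n) \<Rightarrow> real^2) \<Rightarrow> bool" where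
  "hyp_A2 \<rho> D F DF r e B \<gamma> \<epsilon> U0 U \<longleftrightarrow>
     (\<forall>n. 0 < \<epsilon> n) \<and> \<epsilon> \<longlonglongrightarrow> 0 \<and>
     (\<forall>n. AE z in lebesgue_on dom0. U0 n z \<in> closure (Bgam D e B \<gamma>)) \<and>
     (\<forall>n. weak_entropy_sol_full \<rho> D F DF r e (\<epsilon> n) (U0 n) (U n)) \<and>
     (\<forall>n. AE z in lebesgue_on domT. U n z \<in> closure (Bgam D e B \<gamma>)) \<and>
     (\<exists>Ub \<beta>. Ub \<in> borel_measurable (lebesgue_on Gam) \<and> (\<forall>y\<in>Gam. Ub y \<in> equil D e) \<and> 0 < \<beta> \<and>
        (\<forall>n. (\<integral>\<^sup>+ (x, y). ennreal ((norm (U0 n (x, y) - Ub y))\<^sup>2 * \<rho> y) \<partial>lebesgue_on dom0)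
              \<le> ennreal (\<beta>\<^sup>2))) \<and>
     (AE u in lebesgue_on (pr1 ` closure (Bgam D e B \<gamma>)). deriv (deriv (flux F e)) u \<noteq> 0)"

definition hyp_A3 :: "(real^2) set \<Rightarrow> (real \<Rightarrow> real) \<Rightarrow> (nat \<Rightarrow> real \<times> (real^'n) \<Rightarrow> real^2) \<Rightarrow>
    (real \<times> (real^'n) \<Rightarrow> real) \<Rightarrow> (real \<times> (real^'n) \<Rightarrow> real) \<Rightarrow> bool" where
  "hyp_A3 D e U0 u0 v0 \<longleftrightarrow>
     (AE z in lebesgue_on dom0. (\<lambda>n. U0 n z) \<longlonglongrightarrow> st (u0 z) (v0 z)) \<and>
     (AE z in lebesgue_on dom0. st (u0 z) (v0 z) \<in> D \<and> v0 z = e (u0 z))"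

definition classical_viscous_sol :: "(real^2 \<Rightarrow> real^2) \<Rightarrow> (real^2 \<Rightarrow> real) \<Rightarrow> real \<Rightarrow> real \<Rightarrow>
    (real \<times> (real^'n) \<Rightarrow> real^2) \<Rightarrow> (real \<times> real \<times> (real^'n) \<Rightarrow> real^2) \<Rightarrow> bool" where
  "classical_viscous_sol F r \<epsilon> \<nu> W0 W \<longleftrightarrow>
     (\<forall>y\<in>Gam.
        continuous_on (UNIV \<times> {0..}) (\<lambda>(x, t). W (x, t, y)) \<and>
        (\<forall>x. W (x, 0, y) = W0 (x, y)) \<and>
        (\<exists>Wt Wx Wxx :: real \<times> real \<Rightarrow> real^2.
           continuous_on (UNIV \<times> {0<..}) Wt \<and>
           continuous_on (UNIV \<times> {0<..}) Wx \<and>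
           continuous_on (UNIV \<times> {0<..}) Wxx \<and>
           (\<forall>x. \<forall>t>0.
              ((\<lambda>s. W (x, s, y)) has_vector_derivative Wt (x, t)) (at t) \<and>
              ((\<lambda>s. W (s, t, y)) has_vector_derivative Wx (x, t)) (at x) \<and>
              ((\<lambda>s. Wx (s, t)) has_vector_derivative Wxx (x, t)) (at x) \<and>
              Wt (x, t) + vector_derivative (\<lambda>s. F (W (s, t, y))) (at x)
                + (1 / \<epsilon>) *\<^sub>R st 0 (r (W (x, t, y))) = \<nu> *\<^sub>R Wxx (x, t))))"

text \<open>
  The last clause spells out that the limit is unique; as limits in the weighted space it can only be
  so up to sets that are null for \<open>\<rho> dy dx dt\<close>.
\<close>

definition hyp_A4 :: "((real^'n) \<Rightarrow> real) \<Rightarrow> (real^2) set \<Rightarrow> (real^2 \<Rightarrow> real^2) \<Rightarrow> (real^2 \<Rightarrow> real) \<Rightarrow>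
    (real \<Rightarrow> real) \<Rightarrow> (real^2) set \<Rightarrow> real \<Rightarrow> (nat \<Rightarrow> real) \<Rightarrow>
    (nat \<Rightarrow> real \<times> (real^'n) \<Rightarrow> real^2) \<Rightarrow> (nat \<Rightarrow> real \<times> real \<times> (real^'n) \<Rightarrow> real^2) \<Rightarrow> bool" where
  "hyp_A4 \<rho> D F r e B \<gamma> \<epsilon> U0 U \<longleftrightarrow>
     (\<forall>n. \<exists>W0 W.
        (\<forall>\<nu>>0. smooth_on dom0 (W0 \<nu>) \<and>
           W \<nu> \<in> borel_measurable (lebesgue_on domT) \<and>
           classical_viscous_sol F r (\<epsilon> n) \<nu> (W0 \<nu>) (W \<nu>) \<and>
           (\<forall>z\<in>dom0. W0 \<nu> z \<in> closure (Bgam D e B \<gamma>)) \<and>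
           (\<forall>z\<in>domT. W \<nu> z \<in> closure (Bgam D e B \<gamma>))) \<and>
        tendsto_Lp_loc 1 (\<lambda>(x, y). \<rho> y) dom0 W0 (U0 n) (at_right 0) \<and>
        tendsto_Lp_loc 1 (\<lambda>(x, t, y). (\<rho> y)\<^sup>2) domT W (U n) (at_right 0) \<and>
        (\<forall>Z. Z \<in> borel_measurable (lebesgue_on domT) \<and>
           tendsto_Lp_loc 1 (\<lambda>(x, t, y). (\<rho> y)\<^sup>2) domT W Z (at_right 0) \<longrightarrow>
           (AE (x, t, y) in lebesgue_on domT. \<rho> y \<noteq> 0 \<longrightarrow> Z (x, t, y) = U n (x, t, y))))"

end

theory Submission
  imports Defs "HOL-Library.Diagonal_Subsequence"
begin

text \<open>
  The a.e. limit of the weak forms of the full systems is the weak form of the reduced equation for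
  \<open>u\<close> with data \<open>u\<^sub>0\<close>. The entropy inequality for the extension of \<open>\<ell>\<^sub>1\<close> is derived from the classical
  viscous solutions, for fixed \<open>y\<close> and with test functions that do not vanish at \<open>t = 0\<close>, and passed
  to the limits \<open>\<nu> \<rightarrow> 0\<close> and \<open>\<epsilon> \<rightarrow> 0\<close>; so it carries the initial term \<open>\<ell>\<^sub>1(u\<^sub>0)\<close>. With cutoffs concentrated
  on a layer of thickness \<open>T\<close>, the two together show that the time average over the layer of the
  relative entropy \<open>\<ell>\<^sub>1(u) - \<ell>\<^sub>1(u\<^sub>0) - \<ell>\<^sub>1'(u\<^sub>0) (u - u\<^sub>0)\<close> tends to \<open>0\<close>, where \<open>\<ell>\<^sub>1'(u\<^sub>0)\<close> is approximated
  by polynomials to serve as a test function. Strict convexity turns this into the initial trace.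

  Uniqueness is Kruzhkov's argument. The variables are doubled in all of \<open>(x, t, y)\<close>, since the
  entropy inequalities hold only integrated over \<open>y\<close>; as \<open>\<rho>\<close> is merely bounded and measurable, this yields
  Kato's inequality with the weight \<open>\<rho>\<^sup>2\<close>, which vanishes exactly where \<open>\<rho>\<close> does. A cutoff to a backward
  cone finishes the proof: \<open>u\<close> stays in a compact subinterval of the interior of \<open>\<pi>\<^sub>1(closure D)\<close>, so
  \<open>\<bar>f(w) - f(u)\<bar> \<le> L \<bar>w - u\<bar>\<close> for every competitor \<open>w\<close>, even if \<open>w\<close> reaches the boundary.
\<close>

subsection \<open>Smooth functions\<close>

lemma Ck_Suc_imp_Ck: "Ck (Suc k) g \<Longrightarrow> Ck k g"
proof (induction k arbitrary: g)
  case 0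
  then show ?case
    by (auto simp: continuous_on_eq_continuous_at differentiable_imp_continuous_within)
next
  case (Suc k)
  then show ?case by (metis Ck.simps(2))
qed

lemma Ck_SucI:
  assumes "\<And>z. (g has_derivative g' z) (at z)" "\<And>b. b \<in> Basis \<Longrightarrow> Ck k (\<lambda>z. g' z b)"
  shows "Ck (Suc k) g"
proof -
  have "frechet_derivative g (at z) = g' z" for z
    using frechet_derivative_at[OF assms(1)] by simp
  then show ?thesis
    using assms by (auto simp: differentiable_def)
qed

lemma Ck_SucD:
  assumes "Ck (Suc k) g"
  shows "(g has_derivative frechet_derivative g (at z)) (at z)"
    and "b \<in> Basis \<Longrightarrow> Ck k (\<lambda>z. frechet_derivative g (at z) b)"
  using assms frechet_derivative_works by auto

lemma Ck_const: "Ck k (\<lambda>z. c)"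
proof (induction k arbitrary: c)
  case (Suc k)
  show ?case by (rule Ck_SucI[where g' = "\<lambda>z h. 0"]) (auto intro: Suc)
qed auto

lemma Ck_add: "Ck k f \<Longrightarrow> Ck k g \<Longrightarrow> Ck k (\<lambda>z. f z + g z)"
proof (induction k arbitrary: f g)
  case (Suc k)
  show ?case
    by (rule Ck_SucI[OF has_derivative_add[OF Ck_SucD(1)[OF Suc.prems(1)] Ck_SucD(1)[OF Suc.prems(2)]]])
       (intro Suc.IH Ck_SucD(2) Suc.prems)
qed (auto intro: continuous_intros)

lemma Ck_sum: "(\<And>i. i \<in> A \<Longrightarrow> Ck k (f i)) \<Longrightarrow> Ck k (\<lambda>z. \<Sum>i\<in>A. f i z)"
  by (induction A rule: infinite_finite_induct) (auto intro: Ck_const Ck_add)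

lemma Ck_bounded_linear_compose:
  assumes L: "bounded_linear L"
  shows "Ck k g \<Longrightarrow> Ck k (\<lambda>z. L (g z))"
proof (induction k arbitrary: g)
  case 0
  then show ?case using bounded_linear.continuous_on[OF L] by simp
next
  case (Suc k)
  show ?case
    by (rule Ck_SucI[OF bounded_linear.has_derivative[OF L Ck_SucD(1)[OF Suc.prems]]])
       (rule Suc.IH[OF Ck_SucD(2)[OF Suc.prems]])
qed

lemma Ck_bounded_linear: "bounded_linear L \<Longrightarrow> Ck k L"
proof (cases k)
  case 0
  then show "bounded_linear L \<Longrightarrow> Ck k L" by (simp add: linear_continuous_on)
next
  case (Suc m)
  show "bounded_linear L \<Longrightarrow> Ck k L"
    unfolding Suc by (rule Ck_SucI[OF bounded_linear_imp_has_derivative Ck_const])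
qed

lemma Ck_bounded_bilinear:
  assumes B: "bounded_bilinear B"
  shows "Ck k f \<Longrightarrow> Ck k g \<Longrightarrow> Ck k (\<lambda>z. B (f z) (g z))"
proof (induction k arbitrary: f g)
  case 0
  then show ?case by (simp add: bounded_bilinear.continuous_on[OF B])
next
  case (Suc k)
  note derivative = bounded_bilinear.FDERIV[OF B Ck_SucD(1)[OF Suc.prems(1)] Ck_SucD(1)[OF Suc.prems(2)]]
  show ?case
    by (rule Ck_SucI[OF derivative]) (intro Ck_add Suc.IH Ck_SucD(2) Suc.prems Ck_Suc_imp_Ck[OF Suc.prems(1)]
        Ck_Suc_imp_Ck[OF Suc.prems(2)])
qed

lemma Ck_compose:
  fixes f :: "'b::euclidean_space \<Rightarrow> 'c::real_normed_vector" and g :: "'a::euclidean_space \<Rightarrow> 'b"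
  shows "Ck k f \<Longrightarrow> Ck k g \<Longrightarrow> Ck k (\<lambda>z. f (g z))"
proof (induction k arbitrary: f)
  case 0
  then show ?case by (auto intro: continuous_on_compose2)
next
  case (Suc k)
  let ?Df = "\<lambda>w. frechet_derivative f (at w)" and ?Dg = "\<lambda>z. frechet_derivative g (at z)"
  have Df_linear: "linear (?Df w)" for w
    by (rule has_derivative_linear[OF Ck_SucD(1)[OF Suc.prems(1)]])
  have Df_expand: "?Df w v = (\<Sum>i\<in>Basis. (v \<bullet> i) *\<^sub>R ?Df w i)" for w v
  proof -
    have "?Df w (\<Sum>i\<in>Basis. (v \<bullet> i) *\<^sub>R i) = (\<Sum>i\<in>Basis. ?Df w ((v \<bullet> i) *\<^sub>R i))"
      by (rule linear_sum[OF Df_linear])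
    also have "\<dots> = (\<Sum>i\<in>Basis. (v \<bullet> i) *\<^sub>R ?Df w i)"
      by (simp only: linear_scale[OF Df_linear])
    finally show ?thesis by (simp only: euclidean_representation)
  qed
  have "((\<lambda>z. f (g z)) has_derivative (\<lambda>h. \<Sum>i\<in>Basis. (?Dg z h \<bullet> i) *\<^sub>R ?Df (g z) i)) (at z)" for z
    by (rule has_derivative_eq_rhs[OF has_derivative_compose[OF Ck_SucD(1)[OF Suc.prems(2)]
        Ck_SucD(1)[OF Suc.prems(1)]]])
       (intro ext Df_expand)
  then show ?case
  proof (rule Ck_SucI)
    fix b :: 'a assume "b \<in> Basis"
    then have "Ck k (\<lambda>z. ?Dg z b \<bullet> i)" for i
      by (intro Ck_bounded_linear_compose[OF bounded_linear_inner_left] Ck_SucD(2)[OF Suc.prems(2)])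
    moreover have "Ck k (\<lambda>z. ?Df (g z) i)" if "i \<in> Basis" for i
      by (rule Suc.IH[OF Ck_SucD(2)[OF Suc.prems(1) that] Ck_Suc_imp_Ck[OF Suc.prems(2)]])
    ultimately show "Ck k (\<lambda>z. \<Sum>i\<in>Basis. (?Dg z b \<bullet> i) *\<^sub>R ?Df (g z) i)"
      by (intro Ck_sum Ck_bounded_bilinear[OF bounded_bilinear_scaleR])
  qed
qed

lemma smooth_const: "smooth (\<lambda>z. c)"
  and smooth_bounded_linear: "bounded_linear L \<Longrightarrow> smooth L"
  and smooth_add: "smooth f \<Longrightarrow> smooth g \<Longrightarrow> smooth (\<lambda>z. f z + g z)"
  unfolding smooth_def using Ck_const Ck_bounded_linear Ck_add by blast+

lemma smooth_bounded_linear_compose: "bounded_linear L \<Longrightarrow> smooth g \<Longrightarrow> smooth (\<lambda>z. L (g z))"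
  unfolding smooth_def using Ck_bounded_linear_compose by blast

lemma smooth_bounded_bilinear:
  "bounded_bilinear B \<Longrightarrow> smooth f \<Longrightarrow> smooth g \<Longrightarrow> smooth (\<lambda>z. B (f z) (g z))"
  unfolding smooth_def using Ck_bounded_bilinear by blast

lemma smooth_compose:
  fixes f :: "'b::euclidean_space \<Rightarrow> 'c::real_normed_vector" and g :: "'a::euclidean_space \<Rightarrow> 'b"
  shows "smooth f \<Longrightarrow> smooth g \<Longrightarrow> smooth (\<lambda>z. f (g z))"
  unfolding smooth_def using Ck_compose by blast

lemma smooth_mult:
  fixes f g :: "'a::euclidean_space \<Rightarrow> real"
  shows "smooth f \<Longrightarrow> smooth g \<Longrightarrow> smooth (\<lambda>z. f z * g z)"
  by (rule smooth_bounded_bilinear[OF bounded_bilinear_mult])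

lemma smooth_diff: "smooth f \<Longrightarrow> smooth g \<Longrightarrow> smooth (\<lambda>z. f z - g z)"
  using smooth_add[OF _ smooth_bounded_linear_compose[OF bounded_linear_minus[OF bounded_linear_ident]], of f g]
  by simp

lemma smooth_ident: "smooth (\<lambda>z. z)"
  by (rule smooth_bounded_linear[OF bounded_linear_ident])

lemma smooth_fst: "smooth (\<lambda>z. fst z)" and smooth_snd: "smooth (\<lambda>z. snd z)"
  by (rule smooth_bounded_linear[OF bounded_linear_fst], rule smooth_bounded_linear[OF bounded_linear_snd])

lemma smooth_has_derivative: "smooth g \<Longrightarrow> (g has_derivative frechet_derivative g (at z)) (at z)"
  by (rule Ck_SucD(1)[of 0]) (simp add: smooth_def del: Ck.simps)

lemma smooth_frechet_derivative: "smooth g \<Longrightarrow> b \<in> Basis \<Longrightarrow> smooth (\<lambda>z. frechet_derivative g (at z) b)"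
  unfolding smooth_def by (blast intro: Ck_SucD(2))

lemma smooth_imp_continuous_on: "smooth g \<Longrightarrow> continuous_on S g"
  by (metis Ck.simps(1) continuous_on_subset smooth_def subset_UNIV)

lemma smooth_imp_borel_measurable: "smooth g \<Longrightarrow> g \<in> borel_measurable borel"
  by (rule borel_measurable_continuous_onI[OF smooth_imp_continuous_on])

lemma smooth_real_polynomial_function:
  fixes p :: "'a::euclidean_space \<Rightarrow> real"
  shows "real_polynomial_function p \<Longrightarrow> smooth p"
  by (induction rule: real_polynomial_function.induct)
     (auto intro: smooth_bounded_linear smooth_const smooth_add smooth_mult)

lemma smooth_DERIV:
  fixes g :: "real \<Rightarrow> real"
  assumes "smooth g"
  shows "(g has_real_derivative deriv g s) (at s)" and "smooth (deriv g)"
proof -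
  have scale: "h * frechet_derivative g (at s) 1 = frechet_derivative g (at s) h" for s h
    using linear_scale[OF has_derivative_linear[OF smooth_has_derivative[OF assms]], of s h 1] by simp
  have "(g has_real_derivative frechet_derivative g (at s) 1) (at s)" for s
    by (rule has_derivative_imp_has_field_derivative[OF smooth_has_derivative[OF assms] scale])
  moreover from this have "deriv g = (\<lambda>s. frechet_derivative g (at s) 1)"
    by (intro ext DERIV_imp_deriv)
  ultimately show "(g has_real_derivative deriv g s) (at s)" "smooth (deriv g)"
    using smooth_frechet_derivative[OF assms, of 1] by simp_all
qed

definition flat_exp :: "nat \<Rightarrow> real \<Rightarrow> real" where
  "flat_exp k x = (if x > 0 then inverse x ^ k * exp (- inverse x) else 0)"

abbreviation bump :: "real \<Rightarrow> real" where
  "bump \<equiv> flat_exp 0"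

lemma flat_exp_nonneg: "0 \<le> flat_exp k x"
  by (simp add: flat_exp_def)

lemma flat_exp_pos: "0 < x \<Longrightarrow> 0 < flat_exp k x"
  by (simp add: flat_exp_def)

lemma flat_exp_eq_0: "x \<le> 0 \<Longrightarrow> flat_exp k x = 0"
  by (simp add: flat_exp_def)

lemma bump_less_1: "bump x < 1"
  by (simp add: flat_exp_def)

lemma bump_mono: "x \<le> y \<Longrightarrow> bump x \<le> bump y"
  by (auto simp: flat_exp_def le_imp_inverse_le)

lemma flat_exp_tendsto_0: "(flat_exp k \<longlongrightarrow> 0) (at 0)"
proof -
  have "((\<lambda>x. (\<lambda>y. y ^ k / exp y) (inverse x)) \<longlongrightarrow> (0::real)) (at_right 0)"
    by (rule filterlim_compose[OF tendsto_power_div_exp_0 filterlim_inverse_at_top_right])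
  moreover have "\<forall>\<^sub>F x in at_right 0. inverse x ^ k / exp (inverse x) = flat_exp k x"
    using eventually_at_right_less[of 0]
    by eventually_elim (simp add: flat_exp_def exp_minus divide_inverse)
  ultimately have right: "(flat_exp k \<longlongrightarrow> 0) (at_right 0)"
    by (blast intro: Lim_transform_eventually)
  have "\<forall>\<^sub>F x::real in at_left 0. 0 = flat_exp k x"
    by (auto simp: eventually_at_left_field flat_exp_def intro!: exI[of _ "-1"])
  then have "(flat_exp k \<longlongrightarrow> 0) (at_left 0)"
    using tendsto_const[of 0 "at_left (0::real)"] by (blast intro: Lim_transform_eventually)
  with right show ?thesis by (simp add: filterlim_at_split)
qed

lemma flat_exp_has_derivative:
  "(flat_exp k has_real_derivative flat_exp (k + 2) x - real k * flat_exp (k + 1) x) (at x)"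
proof -
  consider (pos) "x > 0" | (neg) "x < 0" | (zero) "x = 0" by linarith
  then show ?thesis
  proof cases
    case pos
    have "((\<lambda>x. inverse x ^ k * exp (- inverse x)) has_real_derivative
        (- real k * inverse x ^ (k + 1)) * exp (- inverse x) + (inverse x ^ 2 * exp (- inverse x))
            * inverse x ^ k) (at x)"
    proof (rule DERIV_mult)
      show "((\<lambda>x. inverse x ^ k) has_real_derivative - real k * inverse x ^ (k + 1)) (at x)"
        using DERIV_power[OF DERIV_inverse[of x], of k] pos
        by (cases k) (auto simp: power2_eq_square algebra_simps)
      show "((\<lambda>x. exp (- inverse x)) has_real_derivative inverse x ^ 2 * exp (- inverse x)) (at x)"
        using pos by (auto intro!: derivative_eq_intros simp: power2_eq_square)
    qed
    then have "((\<lambda>x. inverse x ^ k * exp (- inverse x)) has_real_derivative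
        flat_exp (k + 2) x - real k * flat_exp (k + 1) x) (at x)"
      using pos by (simp add: flat_exp_def power2_eq_square algebra_simps)
    then show ?thesis
      by (rule has_field_derivative_transform_within_open[where S = "{0<..}"])
         (use pos in \<open>auto simp: flat_exp_def\<close>)
  next
    case neg
    then have "((\<lambda>x. 0) has_real_derivative flat_exp (k + 2) x - real k * flat_exp (k + 1) x) (at x)"
      by (auto simp: flat_exp_eq_0)
    then show ?thesis
      by (rule has_field_derivative_transform_within_open[where S = "{..<0}"])
         (use neg in \<open>auto simp: flat_exp_def\<close>)
  next
    case zero
    have "(flat_exp k x - flat_exp k 0) / (x - 0) = flat_exp (k + 1) x" for x
      by (simp add: flat_exp_def divide_inverse)
    then have "(flat_exp k has_real_derivative 0) (at 0)"
      using flat_exp_tendsto_0[of "k + 1"] by (simp add: has_field_derivative_iff)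
    then show ?thesis using zero by (simp add: flat_exp_eq_0)
  qed
qed

lemma bump_has_derivative: "(bump has_real_derivative flat_exp 2 x) (at x)"
  using flat_exp_has_derivative[of 0 x] by (simp add: numeral_2_eq_2)

lemma has_derivative_bump_compose [derivative_intros]:
  assumes "(g has_derivative g') (at z)"
  shows "((\<lambda>z. bump (g z)) has_derivative (\<lambda>h. g' h * flat_exp 2 (g z))) (at z)"
  using has_derivative_compose[OF assms bump_has_derivative[of "g z", unfolded has_field_derivative_def]]
  by (simp add: mult.commute)

lemma smooth_flat_exp: "smooth (flat_exp k)"
  unfolding smooth_def
proof
  fix m show "Ck m (flat_exp k)"
  proof (induction m arbitrary: k)
    case 0
    then show ?case
      using DERIV_isCont[OF flat_exp_has_derivative[of k]] by (simp add: continuous_on_eq_continuous_at)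
  next
    case (Suc m)
    have "Ck m (\<lambda>x. flat_exp (k + 2) x + (- real k) * flat_exp (k + 1) x)"
      by (intro Ck_add Ck_bounded_bilinear[OF bounded_bilinear_mult] Ck_const Suc)
    then show ?case
      using flat_exp_has_derivative
      by (intro Ck_SucI[where g' = "\<lambda>x h. (flat_exp (k + 2) x - real k * flat_exp (k + 1) x) * h"])
         (auto simp: has_field_derivative_def)
  qed
qed

lemma borel_measurable_flat_exp [measurable]: "flat_exp k \<in> borel_measurable borel"
  by (rule smooth_imp_borel_measurable[OF smooth_flat_exp])

lemma continuous_on_flat_exp_compose [continuous_intros]:
  "continuous_on A g \<Longrightarrow> continuous_on A (\<lambda>z. flat_exp k (g z))"
  by (rule continuous_on_compose2[OF smooth_imp_continuous_on[OF smooth_flat_exp, of UNIV]]) auto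

definition smooth_step :: "real \<Rightarrow> real" where
  "smooth_step s = bump (exp (- 1) - bump (2 - s)) / bump (exp (- 1))"

lemma bump_exp_pos: "0 < bump (exp (- 1))"
  by (intro flat_exp_pos) simp

lemma smooth_step_eq_0: "s \<le> 1 \<Longrightarrow> smooth_step s = 0"
  unfolding smooth_step_def using bump_mono[of 1 "2 - s"] by (simp add: flat_exp_eq_0 flat_exp_def[of 0 1])

lemma smooth_step_eq_1: "2 \<le> s \<Longrightarrow> smooth_step s = 1"
  using bump_exp_pos by (simp add: smooth_step_def flat_exp_eq_0)

lemma smooth_step_nonneg: "0 \<le> smooth_step s"
  by (simp add: smooth_step_def flat_exp_nonneg)

lemma smooth_step_le_1: "smooth_step s \<le> 1"
  unfolding smooth_step_def using bump_exp_pos flat_exp_nonneg by (auto intro!: bump_mono simp: divide_le_eq_1)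

lemma mono_smooth_step: "mono smooth_step"
  unfolding smooth_step_def using bump_exp_pos
  by (intro monoI divide_right_mono bump_mono diff_left_mono) auto

lemma smooth_smooth_step: "smooth smooth_step"
proof -
  have "smooth (\<lambda>s. bump (exp (- 1) - bump (2 - s)) * (1 / bump (exp (- 1))))"
    by (intro smooth_mult smooth_compose[OF smooth_flat_exp] smooth_diff smooth_const smooth_ident)
  then show ?thesis by (simp add: smooth_step_def[abs_def])
qed

lemmas smooth_step_has_derivative = smooth_DERIV(1)[OF smooth_smooth_step]

lemma has_derivative_smooth_step_compose [derivative_intros]:
  assumes "(g has_derivative g') (at z)"
  shows "((\<lambda>z. smooth_step (g z)) has_derivative (\<lambda>h. g' h * deriv smooth_step (g z))) (at z)"
  using has_derivative_compose[OF assms smooth_step_has_derivative[unfolded has_field_derivative_def]]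
  by (simp add: mult.commute)

lemma continuous_on_smooth_step_compose [continuous_intros]:
  assumes "continuous_on A g"
  shows "continuous_on A (\<lambda>z. smooth_step (g z))" "continuous_on A (\<lambda>z. deriv smooth_step (g z))"
  using smooth_imp_continuous_on[OF smooth_smooth_step, of UNIV]
    smooth_imp_continuous_on[OF smooth_DERIV(2)[OF smooth_smooth_step], of UNIV]
  by (auto intro: continuous_on_compose2[OF _ assms])

lemma deriv_smooth_step_nonneg: "0 \<le> deriv smooth_step s"
  using mono_on_imp_deriv_nonneg[OF mono_smooth_step smooth_step_has_derivative] by simp

lemma deriv_smooth_step_eq_0:
  assumes "s \<le> 1 \<or> 2 \<le> s"
  shows "deriv smooth_step s = 0"
  using assms
proof
  assume "s \<le> 1"
  then show ?thesis
    using smooth_step_has_derivative smooth_step_nonneg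
    by (intro DERIV_local_min[where d = 1 and f = smooth_step]) (auto simp: smooth_step_eq_0)
next
  assume "2 \<le> s"
  then show ?thesis
    using smooth_step_has_derivative smooth_step_le_1
    by (intro DERIV_local_max[where d = 1 and f = smooth_step]) (auto simp: smooth_step_eq_1)
qed

lemma deriv_smooth_step_bounded: obtains M where "0 < M" "\<And>s. deriv smooth_step s \<le> M"
proof -
  have "bounded (deriv smooth_step ` {1..2})"
    by (intro compact_imp_bounded compact_continuous_image continuous_intros) auto
  then obtain M where M: "0 < M" "\<And>s. s \<in> {1..2} \<Longrightarrow> \<bar>deriv smooth_step s\<bar> \<le> M"
    by (force simp: bounded_pos)
  have "deriv smooth_step s \<le> M" for s
    using M(1) M(2)[of s] deriv_smooth_step_eq_0[of s] by (cases "s \<in> {1..2}") auto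
  with M(1) show ?thesis by (rule that)
qed

subsection \<open>Lebesgue integration\<close>

lemma measurable_lebesgue_null_preserving:
  fixes f :: "'a::euclidean_space \<Rightarrow> 'b::euclidean_space"
  assumes f [measurable]: "f \<in> borel \<rightarrow>\<^sub>M borel"
    and null: "\<And>N. N \<in> null_sets lborel \<Longrightarrow> f -` N \<in> null_sets lborel"
  shows "f \<in> lebesgue \<rightarrow>\<^sub>M lebesgue"
    and "AE y in lborel. Q y \<Longrightarrow> AE x in lborel. Q (f x)"
proof -
  show "f \<in> lebesgue \<rightarrow>\<^sub>M lebesgue"
  proof (rule completion.measurable_completion2)
    show "f \<in> lebesgue \<rightarrow>\<^sub>M lborel" by (rule measurable_completion) simp
    then show "null_sets lborel \<subseteq> null_sets (distr lebesgue lborel f)"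
      using null null_setsD2[of _ lborel] by (auto simp: null_sets_distr_iff null_sets_completionI)
  qed
  assume "AE y in lborel. Q y"
  from AE_E3[OF this] obtain N where N: "\<And>y. y \<notin> N \<Longrightarrow> Q y" "N \<in> null_sets lborel" by auto
  show "AE x in lborel. Q (f x)"
    by (rule AE_I'[OF null[OF N(2)]]) (use N(1) in auto)
qed

lemma null_sets_lborel_vimage_fst:
    "N \<in> null_sets lborel \<Longrightarrow> fst -` N \<in> null_sets (lborel :: ('a::euclidean_space \<times> 'b::euclidean_space) measure)"
  and null_sets_lborel_vimage_snd:
    "N' \<in> null_sets lborel \<Longrightarrow> snd -` N' \<in> null_sets (lborel :: ('a \<times> 'b) measure)"
  using lborel.times_in_null_sets1[of N "lborel :: 'a measure" "UNIV :: 'b set"]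
    lborel.times_in_null_sets2[of "UNIV :: 'a set" "lborel :: 'a measure" N']
  unfolding lborel_prod fst_vimage_eq_Times snd_vimage_eq_Times by auto

lemma fst_borel: "fst \<in> (borel :: ('a::second_countable_topology \<times> 'b::second_countable_topology) measure) \<rightarrow>\<^sub>M borel"
  and snd_borel: "snd \<in> (borel :: ('a \<times> 'b) measure) \<rightarrow>\<^sub>M borel"
  unfolding borel_prod[symmetric] by measurable

lemma measurable_lebesgue_fst:
    "fst \<in> (lebesgue :: ('a::euclidean_space \<times> 'b::euclidean_space) measure) \<rightarrow>\<^sub>M lebesgue"
  and measurable_lebesgue_snd: "snd \<in> (lebesgue :: ('a \<times> 'b) measure) \<rightarrow>\<^sub>M lebesgue"
  by (rule measurable_lebesgue_null_preserving(1)[OF fst_borel], erule null_sets_lborel_vimage_fst)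
     (rule measurable_lebesgue_null_preserving(1)[OF snd_borel], erule null_sets_lborel_vimage_snd)

lemma AE_lborel_snd:
  "AE y in lborel. Q y \<Longrightarrow> AE z in (lborel :: ('a::euclidean_space \<times> 'b::euclidean_space) measure). Q (snd z)"
  by (rule measurable_lebesgue_null_preserving(2)[OF snd_borel null_sets_lborel_vimage_snd])

definition swap12 :: "'a \<times> 'b \<times> 'c \<Rightarrow> 'b \<times> 'a \<times> 'c" where
  "swap12 z = (fst (snd z), fst z, snd (snd z))"

lemma swap12_borel:
  "swap12 \<in> (borel :: ('a::euclidean_space \<times> 'b::euclidean_space \<times> 'c::euclidean_space) measure) \<rightarrow>\<^sub>M borel"
  unfolding swap12_def by (intro borel_measurable_continuous_onI continuous_intros)

lemma lborel_distr_swap12: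
  "distr lborel borel swap12 = (lborel :: ('a::euclidean_space \<times> 'b::euclidean_space \<times> 'c::euclidean_space) measure)"
proof (rule lborel_eqI[symmetric])
  have emeasure_Times: "emeasure lborel (X \<times> Y) = emeasure lborel X * emeasure lborel Y"
    if "X \<in> sets borel" "Y \<in> sets borel" for X :: "'x::euclidean_space set" and Y :: "'y::euclidean_space set"
    using lborel.emeasure_pair_measure_Times[of X lborel Y] that by (simp add: lborel_prod)
  fix l u :: "'a \<times> 'b \<times> 'c" assume lu: "\<And>b. b \<in> Basis \<Longrightarrow> l \<bullet> b \<le> u \<bullet> b"
  obtain l1 l2 l3 u1 u2 u3 where l: "l = (l1, l2, l3)" and u: "u = (u1, u2, u3)" by (cases l, cases u) auto
  have box: "box l u = box l1 u1 \<times> box l2 u2 \<times> box l3 u3"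
    by (auto simp: l u box_def Basis_prod_def ball_Un)
  have "emeasure (distr lborel borel swap12) (box l u) = emeasure lborel (swap12 -` box l u)"
    using emeasure_distr[of swap12 lborel borel "box l u"] swap12_borel by simp
  also have "swap12 -` box l u = box l2 u2 \<times> box l1 u1 \<times> box l3 u3"
    by (auto simp: box swap12_def)
  also have "emeasure lborel \<dots> = emeasure lborel (box l u)"
    by (simp add: box emeasure_Times borel_Times mult_ac)
  also have "\<dots> = (\<Prod>b\<in>Basis. (u - l) \<bullet> b)" by (rule emeasure_lborel_box[OF lu])
  finally show "emeasure (distr lborel borel swap12) (box l u) = ennreal (\<Prod>b\<in>Basis. (u - l) \<bullet> b)" .
qed simp

definition drop_middle :: "'a \<times> 'b \<times> 'c \<Rightarrow> 'a \<times> 'c" where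
  "drop_middle z = (fst z, snd (snd z))"

lemma drop_middle_simp [simp]: "drop_middle (x, t, y) = (x, y)"
  by (simp add: drop_middle_def)

lemma bounded_linear_drop_middle: "bounded_linear drop_middle"
  unfolding drop_middle_def
  by (intro bounded_linear_Pair bounded_linear_fst bounded_linear_compose[OF bounded_linear_snd bounded_linear_snd])

lemma drop_middle_borel:
  "drop_middle \<in> (borel :: ('a::euclidean_space \<times> 'b::euclidean_space \<times> 'c::euclidean_space) measure) \<rightarrow>\<^sub>M borel"
  by (rule borel_measurable_continuous_onI[OF linear_continuous_on[OF bounded_linear_drop_middle]])

lemma null_sets_lborel_vimage_drop_middle:
  assumes "N \<in> null_sets lborel"
  shows "drop_middle -` N \<in> null_sets (lborel :: ('a::euclidean_space \<times> 'b::euclidean_space \<times>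
      'c::euclidean_space) measure)"
proof -
  have "snd -` N \<in> null_sets (distr lborel borel (swap12 :: 'a \<times> 'b \<times> 'c \<Rightarrow> _))"
    using null_sets_lborel_vimage_snd[OF assms] by (simp add: lborel_distr_swap12)
  then have "swap12 -` (snd -` N) \<in> null_sets (lborel :: ('a \<times> 'b \<times> 'c) measure)"
    using swap12_borel by (subst (asm) null_sets_distr_iff) auto
  moreover have "swap12 -` (snd -` N) = (drop_middle -` N :: ('a \<times> 'b \<times> 'c) set)"
    by (auto simp: swap12_def drop_middle_def)
  ultimately show ?thesis by simp
qed

lemma measurable_lebesgue_drop_middle:
  "drop_middle \<in> (lebesgue :: ('a::euclidean_space \<times> 'b::euclidean_space \<times> 'c::euclidean_space) measure) \<rightarrow>\<^sub>M lebesgue"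
  by (rule measurable_lebesgue_null_preserving(1)[OF drop_middle_borel]) (rule null_sets_lborel_vimage_drop_middle)

lemma AE_lborel_drop_middle:
  "AE p in lborel. Q p \<Longrightarrow>
   AE z in (lborel :: ('a::euclidean_space \<times> 'b::euclidean_space \<times> 'c::euclidean_space) measure). Q (drop_middle z)"
  by (rule measurable_lebesgue_null_preserving(2)[OF drop_middle_borel null_sets_lborel_vimage_drop_middle])

lemma borel_measurable_lebesgue_onI:
  "f \<in> borel_measurable borel \<Longrightarrow> f \<in> borel_measurable (lebesgue_on S)"
  by (rule measurable_restrict_space1, rule measurable_completion) simp

lemma borel_measurable_lebesgue_on_AE:
  fixes f g :: "'a::euclidean_space \<Rightarrow> real"
  assumes f: "f \<in> borel_measurable (lebesgue_on S)" and S: "S \<in> sets lebesgue"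
    and eq: "AE z in lebesgue_on S. f z = g z"
  shows "g \<in> borel_measurable (lebesgue_on S)"
proof -
  have "AE z in lebesgue. (if z \<in> S then f z else 0) = (if z \<in> S then g z else 0)"
    using eq S by (auto simp: AE_restrict_space_iff elim!: eventually_mono)
  then show ?thesis
    by (intro borel_measurable_if_D borel_measurable_AE[OF borel_measurable_if_I[OF f S]])
qed

lemma AE_lebesgue_on_mem: "S \<in> sets lebesgue \<Longrightarrow> AE z in lebesgue_on S. z \<in> S"
  by (simp add: AE_restrict_space_iff)

lemma borel_measurable_compose_AE:
  fixes W :: "'a::euclidean_space \<Rightarrow> 'b::euclidean_space" and g :: "'b \<Rightarrow> real"
  assumes X: "X \<in> sets lebesgue" and W: "W \<in> borel_measurable (lebesgue_on X)"
    and S: "S \<in> sets borel" "continuous_on S g" and WS: "AE z in lebesgue_on X. W z \<in> S"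
  shows "(\<lambda>z. g (W z)) \<in> borel_measurable (lebesgue_on X)"
proof (rule borel_measurable_lebesgue_on_AE[OF _ X])
  have "(\<lambda>s. indicat_real S s *\<^sub>R g s) \<in> borel_measurable borel"
    using S by (intro borel_measurable_continuous_on_indicator) auto
  then show "(\<lambda>z. indicat_real S (W z) *\<^sub>R g (W z)) \<in> borel_measurable (lebesgue_on X)"
    by (rule measurable_compose[OF W])
  show "AE z in lebesgue_on X. indicat_real S (W z) *\<^sub>R g (W z) = g (W z)"
    using WS by eventually_elim simp
qed

lemma borel_representative_in:
  fixes w :: "'a::euclidean_space \<Rightarrow> real"
  assumes w: "w \<in> borel_measurable (lebesgue_on S)" "S \<in> sets lebesgue" "AE z in lebesgue_on S. w z \<in> A"
    and A [measurable]: "A \<in> sets borel" and k: "k \<in> A"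
  obtains w' where "w' \<in> borel_measurable borel" "\<And>z. w' z \<in> A" "AE z in lebesgue_on S. w z = w' z"
proof -
  have "(\<lambda>z. if z \<in> S then w z else 0) \<in> borel_measurable lebesgue"
    by (rule borel_measurable_if_I[OF w(1,2)])
  from completion_ex_borel_measurable_real[OF this] obtain w1 where
    w1: "w1 \<in> borel_measurable lborel" "AE z in lborel. (if z \<in> S then w z else 0) = w1 z"
    by blast
  then have [measurable]: "w1 \<in> borel_measurable borel" by simp
  have "AE z in lebesgue. (if z \<in> S then w z else 0) = w1 z"
    using w1(2) by (rule AE_completion)
  then have eq: "AE z in lebesgue_on S. w z = w1 z"
    using w(2) by (auto simp: AE_restrict_space_iff elim!: eventually_mono)
  show ?thesis
  proof (rule that[of "\<lambda>z. if w1 z \<in> A then w1 z else k"])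
    show "AE z in lebesgue_on S. w z = (if w1 z \<in> A then w1 z else k)"
      using eq w(3) by eventually_elim auto
  qed (use k in auto)
qed

lemma has_bochner_integral_lebesgueE:
  fixes g :: "'a::euclidean_space \<Rightarrow> real"
  assumes "has_bochner_integral lebesgue g c"
  obtains g' where "has_bochner_integral lborel g' c" "AE z in lborel. g z = g' z"
proof -
  from completion_ex_borel_measurable_real[of g lborel] assms
  obtain g' where g': "g' \<in> borel_measurable lborel" "AE z in lborel. g z = g' z"
    by (auto simp: borel_measurable_has_bochner_integral)
  have "has_bochner_integral lebesgue g' c"
    using assms g' by (subst has_bochner_integral_cong_AE[of _ _ g])
      (auto simp: measurable_completion borel_measurable_has_bochner_integral intro: AE_completion
          elim: eventually_mono)
  then have "has_bochner_integral lborel g' c"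
    using g'(1) by (simp add: has_bochner_integral_iff integrable_completion integral_completion)
  then show ?thesis using g'(2) by (rule that)
qed

lemma has_bochner_integral_lebesgueI:
  fixes g g' :: "'a::euclidean_space \<Rightarrow> real"
  assumes g': "has_bochner_integral lborel g' c" and eq: "AE z in lborel. g' z = g z"
  shows "has_bochner_integral lebesgue g c"
proof -
  have g'_borel: "g' \<in> borel_measurable lborel" by (rule borel_measurable_has_bochner_integral[OF g'])
  then have "g \<in> borel_measurable lebesgue"
    using eq by (intro borel_measurable_AE[of g' g]) (auto simp: measurable_completion AE_completion_iff)
  moreover have "has_bochner_integral lebesgue g' c"
    using g' g'_borel by (simp add: has_bochner_integral_iff integrable_completion integral_completion)
  ultimately show ?thesis
    using eq g'_borel by (subst has_bochner_integral_cong_AE[of _ _ g'])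
      (auto simp: measurable_completion AE_completion_iff)
qed

lemma AE_lborel_sections:
  fixes Q :: "'a::euclidean_space \<times> 'b::euclidean_space \<Rightarrow> bool"
  assumes "AE z in lborel. Q z"
  shows "AE y in lborel. AE x in lborel. Q (x, y)"
proof -
  from AE_E3[OF assms] obtain N where N: "\<And>z. z \<notin> N \<Longrightarrow> Q z" "N \<in> null_sets (lborel \<Otimes>\<^sub>M lborel)"
    by (auto simp: lborel_prod)
  have "AE x in lborel. AE y in lborel. (x, y) \<notin> N"
    by (rule lborel_pair.AE_pair[OF AE_not_in[OF N(2)]])
  moreover have "{z \<in> space (lborel \<Otimes>\<^sub>M lborel). (fst z, snd z) \<notin> N} \<in> sets (lborel \<Otimes>\<^sub>M lborel)"
    using sets.compl_sets[OF null_setsD2[OF N(2)]] by (simp add: set_diff_eq)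
  ultimately have "AE y in lborel. AE x in lborel. (x, y) \<notin> N"
    using lborel_pair.AE_commute[of "\<lambda>x y. (x, y) \<notin> N"] by simp
  then show ?thesis by (rule eventually_mono) (auto elim!: eventually_mono intro: N(1))
qed

lemma lebesgue_Fubini:
  fixes g :: "'a::euclidean_space \<times> 'b::euclidean_space \<Rightarrow> real"
  assumes "has_bochner_integral lebesgue g c"
  shows "has_bochner_integral lebesgue (\<lambda>y. LINT x|lebesgue. g (x, y)) c"
proof -
  from assms obtain g' where g': "has_bochner_integral lborel g' c" and eq: "AE z in lborel. g z = g' z"
    by (rule has_bochner_integral_lebesgueE)
  then have int: "integrable (lborel \<Otimes>\<^sub>M lborel) (case_prod (\<lambda>x y. g' (x, y)))"
    by (simp add: lborel_prod has_bochner_integral_iff)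
  show ?thesis
  proof (rule has_bochner_integral_lebesgueI)
    show "has_bochner_integral lborel (\<lambda>y. LINT x|lborel. g' (x, y)) c"
      using lborel_pair.integrable_snd[OF int] lborel_pair.integral_snd[OF int] g'
      by (simp add: has_bochner_integral_iff lborel_prod)
    show "AE y in lborel. (LINT x|lborel. g' (x, y)) = (LINT x|lebesgue. g (x, y))"
      using lborel_pair.AE_integrable_snd[OF int] AE_lborel_sections[OF eq]
    proof eventually_elim
      case (elim y)
      have "has_bochner_integral lebesgue (\<lambda>x. g (x, y)) (LINT x|lborel. g' (x, y))"
        by (rule has_bochner_integral_lebesgueI[OF has_bochner_integral_integrable[OF elim(1)]])
           (use elim(2) in eventually_elim, simp)
      then show ?case by (simp add: has_bochner_integral_iff)
    qed
  qed
qed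

lemma has_bochner_integral_lebesgue_insert_middle:
  fixes k :: "'b::euclidean_space \<Rightarrow> real" and b :: "'a::euclidean_space \<times> 'c::euclidean_space \<Rightarrow> real"
  assumes k: "has_bochner_integral lborel k ck" and b: "has_bochner_integral lebesgue b cb"
  shows "has_bochner_integral lebesgue (\<lambda>z. k (fst (snd z)) * b (drop_middle z)) (ck * cb)"
proof -
  from b obtain b' where b': "has_bochner_integral lborel b' cb" and eq: "AE p in lborel. b p = b' p"
    by (rule has_bochner_integral_lebesgueE)
  have [measurable]: "k \<in> borel_measurable lborel" "b' \<in> borel_measurable lborel"
    using k b' by (auto intro: borel_measurable_has_bochner_integral)
  let ?prod = "\<lambda>q. k (fst q) * b' (snd q)"
  have prod_int: "integrable (lborel \<Otimes>\<^sub>M lborel) ?prod"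
    by (rule lborel_pair.Fubini_integrable) (use k b' in \<open>auto simp: abs_mult has_bochner_integral_iff\<close>)
  then have "has_bochner_integral lborel ?prod (ck * cb)"
    using lborel_pair.integral_fst'[OF prod_int] k b' by (simp add: has_bochner_integral_iff lborel_prod)
  moreover have "?prod \<in> borel_measurable borel"
    using borel_measurable_integrable[OF prod_int] by (simp add: lborel_prod)
  ultimately have "has_bochner_integral lborel (\<lambda>z. ?prod (swap12 z)) (ck * cb)"
    using integrable_distr_eq[of "swap12 :: 'a \<times> 'b \<times> 'c \<Rightarrow> _" lborel borel ?prod]
      integral_distr[of "swap12 :: 'a \<times> 'b \<times> 'c \<Rightarrow> _" lborel borel ?prod]
      swap12_borel[where 'a = 'a and 'b = 'b and 'c = 'c]
    by (simp add: has_bochner_integral_iff lborel_distr_swap12)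
  then show ?thesis
    by (rule has_bochner_integral_lebesgueI)
       (use AE_lborel_drop_middle[OF eq] in eventually_elim, simp add: swap12_def drop_middle_def)
qed

lemma LINT_lebesgue_eq_integral:
  fixes f :: "real \<Rightarrow> real"
  assumes "continuous_on {a..b} f" "\<And>x. x \<notin> {a..b} \<Longrightarrow> f x = 0"
  shows "(LINT x|lebesgue. f x) = integral {a..b} f"
proof -
  have "(LINT x|lebesgue. f x) = (LINT x|lebesgue. indicat_real {a..b} x *\<^sub>R f x)"
    by (rule Bochner_Integration.integral_cong) (use assms(2) in \<open>auto simp: indicator_def\<close>)
  also have "\<dots> = (LINT x|lebesgue_on {a..b}. f x)"
    by (rule integral_restrict_space[symmetric]) simp
  also have "\<dots> = integral {a..b} f"
    by (rule lebesgue_integral_eq_integral[OF continuous_imp_integrable_real[OF assms(1)]]) simp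
  finally show ?thesis .
qed

lemma compact_continuous_abs_bound:
  fixes h :: "'a::topological_space \<Rightarrow> real"
  assumes "compact K" "continuous_on K h"
  obtains M where "0 \<le> M" "\<And>s. s \<in> K \<Longrightarrow> \<bar>h s\<bar> \<le> M"
proof -
  have "bounded (h ` K)" by (rule compact_imp_bounded[OF compact_continuous_image[OF assms(2,1)]])
  then obtain M where "\<forall>s\<in>K. \<bar>h s\<bar> \<le> M" by (auto simp: bounded_iff)
  then show ?thesis by (intro that[of "\<bar>M\<bar>"]) force+
qed

lemma integrable_mult_bounded:
  fixes w G :: "'a \<Rightarrow> real"
  assumes "integrable M w" "G \<in> borel_measurable M" "AE z in M. \<bar>G z\<bar> \<le> B"
  shows "integrable M (\<lambda>z. G z * w z)"
proof (rule Bochner_Integration.integrable_bound[OF integrable_mult_right[OF integrable_abs[OF assms(1)], of B]])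
  show "AE z in M. norm (G z * w z) \<le> norm (B * \<bar>w z\<bar>)"
    using assms(3)
  proof eventually_elim
    case (elim z)
    then have "\<bar>G z\<bar> \<le> \<bar>B\<bar>" by linarith
    then show ?case by (simp add: abs_mult mult_right_mono)
  qed
qed (use assms in measurable)

lemma bounded_convergence_weighted:
  fixes w g :: "'a \<Rightarrow> real" and G :: "nat \<Rightarrow> 'a \<Rightarrow> real"
  assumes w: "integrable M w" and G: "\<And>i. G i \<in> borel_measurable M" and g: "g \<in> borel_measurable M"
    and B: "\<And>i. AE z in M. \<bar>G i z\<bar> \<le> B" and lim: "AE z in M. w z \<noteq> 0 \<longrightarrow> (\<lambda>i. G i z) \<longlonglongrightarrow> g z"
  shows "(\<lambda>i. LINT z|M. G i z * w z) \<longlonglongrightarrow> (LINT z|M. g z * w z)"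
proof (rule integral_dominated_convergence)
  show "integrable M (\<lambda>z. \<bar>B\<bar> * \<bar>w z\<bar>)" using w by simp
  show "AE z in M. (\<lambda>i. G i z * w z) \<longlonglongrightarrow> g z * w z"
    using lim
  proof eventually_elim
    case (elim z)
    then show ?case by (cases "w z = 0") (auto intro: tendsto_mult)
  qed
  show "AE z in M. norm (G i z * w z) \<le> \<bar>B\<bar> * \<bar>w z\<bar>" for i
    using B[of i] by eventually_elim (auto simp: abs_mult intro!: mult_right_mono)
qed (use w G g in measurable)

lemma integrable_compose_weighted:
  fixes W :: "'a::euclidean_space \<Rightarrow> 'b::euclidean_space" and h :: "'b \<Rightarrow> real"
  assumes X: "X \<in> sets lebesgue" and S: "compact S" "continuous_on S h"
    and W: "W \<in> borel_measurable (lebesgue_on X)" "AE z in lebesgue_on X. W z \<in> S"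
    and w: "integrable (lebesgue_on X) w"
  shows "integrable (lebesgue_on X) (\<lambda>z. h (W z) * w z)"
proof -
  obtain B where B: "\<And>s. s \<in> S \<Longrightarrow> \<bar>h s\<bar> \<le> B" using compact_continuous_abs_bound[OF S] by blast
  show ?thesis
    by (rule integrable_mult_bounded[OF w borel_measurable_compose_AE[OF X W(1) borel_compact[OF S(1)] S(2) W(2)]])
       (use W(2) in eventually_elim, rule B)
qed

lemma LINT_compose_weighted_tendsto:
  fixes V :: "nat \<Rightarrow> 'a::euclidean_space \<Rightarrow> 'b::euclidean_space" and h :: "'b \<Rightarrow> real"
  assumes X: "X \<in> sets lebesgue" and S: "compact S" "continuous_on S h"
    and V: "\<And>i. V i \<in> borel_measurable (lebesgue_on X)" "\<And>i. AE z in lebesgue_on X. V i z \<in> S"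
    and W: "W \<in> borel_measurable (lebesgue_on X)" "AE z in lebesgue_on X. W z \<in> S"
    and lim: "AE z in lebesgue_on X. w z \<noteq> 0 \<longrightarrow> (\<lambda>i. V i z) \<longlonglongrightarrow> W z"
    and w: "integrable (lebesgue_on X) w"
  shows "(\<lambda>i. LINT z|lebesgue_on X. h (V i z) * w z) \<longlonglongrightarrow> (LINT z|lebesgue_on X. h (W z) * w z)"
proof -
  obtain B where B: "\<And>s. s \<in> S \<Longrightarrow> \<bar>h s\<bar> \<le> B" using compact_continuous_abs_bound[OF S] by blast
  note measurable = borel_measurable_compose_AE[OF X _ borel_compact[OF S(1)] S(2)]
  have V_all: "AE z in lebesgue_on X. \<forall>i. V i z \<in> S" using V(2) by (simp add: AE_all_countable)
  show ?thesis
  proof (rule bounded_convergence_weighted[OF w measurable[OF V] measurable[OF W], where B = B])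
    show "AE z in lebesgue_on X. \<bar>h (V i z)\<bar> \<le> B" for i
      using V(2)[of i] by eventually_elim (rule B)
    show "AE z in lebesgue_on X. w z \<noteq> 0 \<longrightarrow> (\<lambda>i. h (V i z)) \<longlonglongrightarrow> h (W z)"
      using V_all lim W(2) by eventually_elim (auto intro: continuous_on_tendsto_compose[OF S(2)])
  qed
qed

lemma nn_integral_tendsto_0_AE_subseq:
  fixes d :: "nat \<Rightarrow> 'a \<Rightarrow> real"
  assumes d [measurable]: "\<And>i. d i \<in> borel_measurable M" and nonneg: "\<And>i. AE z in M. 0 \<le> d i z"
    and lim: "(\<lambda>i. \<integral>\<^sup>+ z. ennreal (d i z) \<partial>M) \<longlonglongrightarrow> 0"
  obtains r where "strict_mono r" "AE z in M. (\<lambda>k. d (r k) z) \<longlonglongrightarrow> 0"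
proof -
  let ?I = "\<lambda>i. \<integral>\<^sup>+ z. ennreal (d i z) \<partial>M"
  have "\<forall>\<^sub>F i in sequentially. ?I i < \<infinity>" using order_tendstoD(2)[OF lim, of \<infinity>] by simp
  then obtain N where N: "\<And>i. N \<le> i \<Longrightarrow> ?I i < \<infinity>" unfolding eventually_sequentially by blast
  have int: "integrable M (d (i + N))" for i
    using nonneg N[of "i + N"] by (intro integrableI_nonneg) auto
  have "(LINT z|M. norm (d (i + N) z)) = enn2real (?I (i + N))" for i
  proof -
    have "(LINT z|M. norm (d (i + N) z)) = (LINT z|M. d (i + N) z)"
      using nonneg[of "i + N"] by (intro integral_cong_AE) (auto elim: eventually_mono)
    also have "\<dots> = enn2real (?I (i + N))" by (rule integral_eq_nn_integral[OF d nonneg])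
    finally show ?thesis .
  qed
  moreover have "(\<lambda>i. enn2real (?I (i + N))) \<longlonglongrightarrow> 0"
    using LIMSEQ_ignore_initial_segment[OF lim] by (intro tendsto_enn2real) auto
  ultimately have "(\<lambda>i. LINT z|M. norm (d (i + N) z)) \<longlonglongrightarrow> 0" by simp
  from tendsto_L1_AE_subseq[OF int this] obtain r where r: "strict_mono r"
    "AE z in M. (\<lambda>k. d (r k + N) z) \<longlonglongrightarrow> 0" by blast
  have "strict_mono (\<lambda>k. r k + N)" using r(1) by (simp add: strict_mono_def)
  then show ?thesis using r(2) by (rule that)
qed

lemma tendsto_Lp_loc_compose:
  assumes "tendsto_Lp_loc p w S G g Fl" "filterlim s Fl F'"
  shows "tendsto_Lp_loc p w S (\<lambda>i. G (s i)) g F'"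
  using assms(1) filterlim_compose[OF _ assms(2)] unfolding tendsto_Lp_loc_def by blast

lemma tendsto_Lp_loc_AE_subseq_compact:
  fixes G :: "nat \<Rightarrow> 'a::euclidean_space \<Rightarrow> 'b::euclidean_space"
  assumes lim: "tendsto_Lp_loc 1 w S G g sequentially" and C: "compact C" "C \<subseteq> S"
    and G: "\<And>i. G i \<in> borel_measurable (lebesgue_on S)" and g: "g \<in> borel_measurable (lebesgue_on S)"
    and w: "w \<in> borel_measurable (lebesgue_on S)" "\<And>z. z \<in> S \<Longrightarrow> 0 \<le> w z"
  obtains r where "strict_mono r" "AE z in lebesgue_on C. w z \<noteq> 0 \<longrightarrow> (\<lambda>k. G (r k) z) \<longlonglongrightarrow> g z"
proof -
  let ?d = "\<lambda>i z. norm (G i z - g z) powr 1 * w z"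
  have C_mem: "AE z in lebesgue_on C. z \<in> C"
    by (intro AE_lebesgue_on_mem fmeasurableD lmeasurable_compact C)
  have "?d i \<in> borel_measurable (lebesgue_on S)" for i
    using G g w(1) by measurable
  then have measurable: "?d i \<in> borel_measurable (lebesgue_on C)" for i
    by (rule measurable_restrict_mono[OF _ C(2)])
  have nonneg: "AE z in lebesgue_on C. 0 \<le> ?d i z" for i
    using C_mem by eventually_elim (use w(2) C(2) in auto)
  have "(\<lambda>i. \<integral>\<^sup>+ z. ennreal (?d i z) \<partial>lebesgue_on C) \<longlonglongrightarrow> 0"
    using lim C unfolding tendsto_Lp_loc_def by blast
  from nn_integral_tendsto_0_AE_subseq[OF measurable nonneg this] obtain r where
    r: "strict_mono r" "AE z in lebesgue_on C. (\<lambda>k. ?d (r k) z) \<longlonglongrightarrow> 0" by blast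
  have "AE z in lebesgue_on C. w z \<noteq> 0 \<longrightarrow> (\<lambda>k. G (r k) z) \<longlonglongrightarrow> g z"
    using r(2)
  proof eventually_elim
    case (elim z)
    show ?case
    proof
      assume "w z \<noteq> 0"
      with tendsto_divide[OF elim tendsto_const, of "w z"]
      have "(\<lambda>k. norm (G (r k) z - g z)) \<longlonglongrightarrow> 0" by simp
      then show "(\<lambda>k. G (r k) z) \<longlonglongrightarrow> g z"
        by (simp add: tendsto_norm_zero_iff LIM_zero_iff)
    qed
  qed
  with r(1) show ?thesis by (rule that)
qed

lemma tendsto_Lp_loc_AE_subseq:
  fixes G :: "nat \<Rightarrow> 'a::euclidean_space \<Rightarrow> 'b::euclidean_space" and C :: "nat \<Rightarrow> 'a set"
  assumes lim: "tendsto_Lp_loc 1 w S G g sequentially"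
    and G: "\<And>i. G i \<in> borel_measurable (lebesgue_on S)" and g: "g \<in> borel_measurable (lebesgue_on S)"
    and w: "w \<in> borel_measurable (lebesgue_on S)" "\<And>z. z \<in> S \<Longrightarrow> 0 \<le> w z"
    and C: "\<And>j. compact (C j)" "S = (\<Union>j. C j)"
  obtains r where "strict_mono r" "AE z in lebesgue_on S. w z \<noteq> 0 \<longrightarrow> (\<lambda>k. G (r k) z) \<longlonglongrightarrow> g z"
proof -
  have C_sets: "C j \<in> sets lebesgue" for j using C(1) by (simp add: lmeasurable_compact fmeasurableD)
  then have S_sets: "S \<in> sets lebesgue" unfolding C(2) by auto
  interpret subseqs "\<lambda>j s. AE z in lebesgue_on (C j). w z \<noteq> 0 \<longrightarrow> (\<lambda>k. G (s k) z) \<longlonglongrightarrow> g z"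
  proof
    fix j :: nat and s :: "nat \<Rightarrow> nat" assume "strict_mono s"
    then have "tendsto_Lp_loc 1 w S (\<lambda>k. G (s k)) g sequentially"
      by (intro tendsto_Lp_loc_compose[OF lim] filterlim_subseq)
    then obtain r where "strict_mono r" "AE z in lebesgue_on (C j). w z \<noteq> 0 \<longrightarrow> (\<lambda>k. G (s (r k)) z) \<longlonglongrightarrow> g z"
      by (rule tendsto_Lp_loc_AE_subseq_compact[OF _ C(1)[of j] _ G g w]) (use C(2) in blast)
    then show "\<exists>r. strict_mono r \<and> (AE z in lebesgue_on (C j). w z \<noteq> 0 \<longrightarrow> (\<lambda>k. G ((s \<circ> r) k) z) \<longlonglongrightarrow> g z)"
      by (auto simp: o_def)
  qed
  have subseq_stable: "AE z in lebesgue_on (C j). w z \<noteq> 0 \<longrightarrow> (\<lambda>k. G ((s \<circ> r) k) z) \<longlonglongrightarrow> g z"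
    if "strict_mono r" "AE z in lebesgue_on (C j). w z \<noteq> 0 \<longrightarrow> (\<lambda>k. G (s k) z) \<longlonglongrightarrow> g z" for r s j
    using that(2) by eventually_elim (use LIMSEQ_subseq_LIMSEQ[OF _ that(1)] in \<open>auto simp: o_def\<close>)
  have "AE z in lebesgue_on (C j). w z \<noteq> 0 \<longrightarrow> (\<lambda>k. G (diagseq k) z) \<longlonglongrightarrow> g z" for j
  proof -
    have "AE z in lebesgue_on (C j). w z \<noteq> 0 \<longrightarrow> (\<lambda>k. G ((diagseq \<circ> (+) (Suc j)) k) z) \<longlonglongrightarrow> g z"
      by (rule diagseq_holds) (rule subseq_stable)
    then show ?thesis
      by eventually_elim (auto simp: add.commute intro: LIMSEQ_offset[where k = "Suc j"])
  qed
  then have "\<forall>j. AE z in lebesgue. z \<in> C j \<longrightarrow> w z \<noteq> 0 \<longrightarrow> (\<lambda>k. G (diagseq k) z) \<longlonglongrightarrow> g z"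
    using C_sets by (simp add: AE_restrict_space_iff)
  then have "AE z in lebesgue. \<forall>j. z \<in> C j \<longrightarrow> w z \<noteq> 0 \<longrightarrow> (\<lambda>k. G (diagseq k) z) \<longlonglongrightarrow> g z"
    unfolding AE_all_countable .
  then have "AE z in lebesgue. z \<in> S \<longrightarrow> w z \<noteq> 0 \<longrightarrow> (\<lambda>k. G (diagseq k) z) \<longlonglongrightarrow> g z"
    unfolding C(2) by (rule eventually_mono) blast
  then have "AE z in lebesgue_on S. w z \<noteq> 0 \<longrightarrow> (\<lambda>k. G (diagseq k) z) \<longlonglongrightarrow> g z"
    using S_sets by (simp add: AE_restrict_space_iff)
  with subseq_diagseq show ?thesis by (rule that)
qed

lemma integrable_lebesgue_on_bounded_support:
  fixes k :: "'a::euclidean_space \<Rightarrow> real"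
  assumes X: "X \<in> sets lebesgue" and k: "k \<in> borel_measurable (lebesgue_on X)" and K: "bounded K"
    and bound: "AE z in lebesgue_on X. \<bar>k z\<bar> \<le> M" and support: "AE z in lebesgue_on X. z \<notin> K \<longrightarrow> k z = 0"
  shows "integrable (lebesgue_on X) k"
proof (rule integrableI_bounded_set[where A = "closure K \<inter> X" and B = M])
  have "emeasure lebesgue (closure K \<inter> X) \<le> emeasure lebesgue (closure K)"
    using X by (intro emeasure_mono) auto
  also have "\<dots> < \<infinity>"
    using lmeasurable_compact[of "closure K"] K by (simp add: fmeasurable_def)
  finally show "emeasure (lebesgue_on X) (closure K \<inter> X) < \<infinity>"
    using X by (subst emeasure_restrict_space) auto
  show "closure K \<inter> X \<in> sets (lebesgue_on X)"
    using X by (auto simp: sets_restrict_space_iff)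
  show "AE z in lebesgue_on X. z \<in> closure K \<inter> X \<longrightarrow> norm (k z) \<le> M"
    using bound by eventually_elim simp
  show "AE z in lebesgue_on X. z \<notin> closure K \<inter> X \<longrightarrow> k z = 0"
    using support AE_lebesgue_on_mem[OF X] by eventually_elim (use closure_subset in auto)
qed (rule k)

lemma integrable_lborel_bounded_support:
  fixes f :: "'a::euclidean_space \<Rightarrow> real"
  assumes f: "f \<in> borel_measurable borel" and K: "bounded K"
    and bound: "\<And>z. \<bar>f z\<bar> \<le> M" and support: "\<And>z. z \<notin> K \<Longrightarrow> f z = 0"
  shows "integrable lborel f"
  using integrable_lebesgue_on_bounded_support[OF _ borel_measurable_lebesgue_onI[OF f] K, of UNIV M] bound support f
  by (simp add: lebesgue_on_UNIV_eq integrable_completion)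

lemma integrable_lborel_abs_difference:
  fixes g h :: "'a::euclidean_space \<Rightarrow> real"
  assumes [measurable]: "K \<in> sets borel" "g \<in> borel_measurable borel" "h \<in> borel_measurable borel"
    and K: "bounded K" and M: "\<And>z. \<bar>g z\<bar> \<le> M" "\<And>z. \<bar>h z\<bar> \<le> M"
  shows "integrable lborel (\<lambda>z. indicator K z * \<bar>g z - h z\<bar>)"
proof (rule integrable_lborel_bounded_support[OF _ K, of _ "2 * M"])
  show "\<bar>indicator K z * \<bar>g z - h z\<bar>\<bar> \<le> 2 * M" for z using M(1)[of z] M(2)[of z] by (auto simp: indicator_def)
qed auto

lemma continuous_L1_approx:
  fixes g :: "'a::euclidean_space \<Rightarrow> real"
  assumes g: "g \<in> borel_measurable (lebesgue_on K)" and M: "\<And>z. z \<in> K \<Longrightarrow> \<bar>g z\<bar> \<le> M"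
    and K: "compact K" and e: "0 < e" and M_nonneg: "0 \<le> M"
  obtains c where "continuous_on UNIV c" "\<And>z. \<bar>c z\<bar> \<le> M" "(LINT z|lebesgue_on K. \<bar>g z - c z\<bar>) < e"
proof -
  have K_sets: "K \<in> sets lebesgue" using lmeasurable_compact[OF K] by (simp add: fmeasurableD)
  have "g measurable_on K" using g K_sets by (simp add: measurable_on_iff_borel_measurable)
  then obtain N h where N: "negligible N" and h: "\<And>n::nat. continuous_on UNIV (h n)"
    and lim: "\<And>z. z \<notin> N \<Longrightarrow> (\<lambda>n. h n z) \<longlonglongrightarrow> (if z \<in> K then g z else 0)"
    unfolding measurable_on_def by blast
  define c where "c n z = max (- M) (min M (h n z))" for n z
  have c_continuous: "continuous_on UNIV (c n)" for n unfolding c_def by (intro continuous_intros h)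
  have c_bound: "\<bar>c n z\<bar> \<le> M" for n z using M_nonneg by (auto simp: c_def)
  have "(\<lambda>n. LINT z|lebesgue_on K. \<bar>g z - c n z\<bar>) \<longlonglongrightarrow> (LINT z|lebesgue_on K. 0)"
  proof (rule integral_dominated_convergence)
    show "integrable (lebesgue_on K) (\<lambda>z. 2 * M)"
      by (rule finite_measure.integrable_const[OF finite_measure_lebesgue_on[OF lmeasurable_compact[OF K]]])
    have "AE z in lebesgue. z \<notin> N" using N by (simp add: negligible_iff_null_sets AE_not_in)
    then have "AE z in lebesgue_on K. z \<notin> N" using K_sets by (auto simp: AE_restrict_space_iff elim: eventually_mono)
    with AE_lebesgue_on_mem[OF K_sets] show "AE z in lebesgue_on K. (\<lambda>n. \<bar>g z - c n z\<bar>) \<longlonglongrightarrow> 0"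
    proof eventually_elim
      case (elim z)
      then have "(\<lambda>n. \<bar>g z - c n z\<bar>) \<longlonglongrightarrow> \<bar>g z - max (- M) (min M (g z))\<bar>"
        unfolding c_def using lim[of z] by (intro tendsto_intros) simp
      moreover have "max (- M) (min M (g z)) = g z" using M[OF elim(1)] by auto
      ultimately show ?case by simp
    qed
    show "AE z in lebesgue_on K. norm \<bar>g z - c n z\<bar> \<le> 2 * M" for n
      using AE_lebesgue_on_mem[OF K_sets]
    proof eventually_elim
      case (elim z)
      show ?case using M[OF elim] c_bound[of n z] by simp
    qed
    show "(\<lambda>z. \<bar>g z - c n z\<bar>) \<in> borel_measurable (lebesgue_on K)" for n
      using g borel_measurable_lebesgue_onI[OF borel_measurable_continuous_onI[OF c_continuous]] by measurable
  qed simp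
  then have "\<forall>\<^sub>F n in sequentially. (LINT z|lebesgue_on K. \<bar>g z - c n z\<bar>) < e"
    using e by (intro order_tendstoD(2)) auto
  then obtain n where "(LINT z|lebesgue_on K. \<bar>g z - c n z\<bar>) < e"
    using eventually_happens'[OF sequentially_bot] by blast
  with c_continuous c_bound show ?thesis by (rule that)
qed

lemma polynomial_L1_approx:
  fixes g :: "'a::euclidean_space \<Rightarrow> real"
  assumes g: "g \<in> borel_measurable (lebesgue_on K)" and M: "\<And>z. z \<in> K \<Longrightarrow> \<bar>g z\<bar> \<le> M" "0 \<le> M"
    and K: "compact K" and e: "0 < e"
  obtains p where "real_polynomial_function p" "integrable (lebesgue_on K) (\<lambda>z. \<bar>g z - p z\<bar>)"
    "(LINT z|lebesgue_on K. \<bar>g z - p z\<bar>) < e"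
proof -
  have K_sets: "K \<in> sets lebesgue" using lmeasurable_compact[OF K] by (simp add: fmeasurableD)
  have int_const: "integrable (lebesgue_on K) (\<lambda>z. r)" for r :: real
    by (rule finite_measure.integrable_const[OF finite_measure_lebesgue_on[OF lmeasurable_compact[OF K]]])
  have int_diff: "integrable (lebesgue_on K) (\<lambda>z. \<bar>g z - h z\<bar>)" if h: "continuous_on UNIV h" for h
  proof -
    obtain B where B: "\<And>z. z \<in> K \<Longrightarrow> \<bar>h z\<bar> \<le> B"
      using compact_continuous_abs_bound[OF K continuous_on_subset[OF h]] by auto
    have "integrable (lebesgue_on K) (\<lambda>z. \<bar>g z - h z\<bar> * 1)"
    proof (rule integrable_mult_bounded[OF int_const])
      show "(\<lambda>z. \<bar>g z - h z\<bar>) \<in> borel_measurable (lebesgue_on K)"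
        using g borel_measurable_lebesgue_onI[OF borel_measurable_continuous_onI[OF h]] by measurable
      show "AE z in lebesgue_on K. \<bar>\<bar>g z - h z\<bar>\<bar> \<le> M + B"
        using AE_lebesgue_on_mem[OF K_sets] by eventually_elim (use M B in \<open>force simp: abs_le_iff\<close>)
    qed
    then show ?thesis by simp
  qed
  define m where "m = measure lebesgue K"
  have m: "0 \<le> m" by (simp add: m_def)
  obtain c where c: "continuous_on UNIV c" "(LINT z|lebesgue_on K. \<bar>g z - c z\<bar>) < e / 2"
    using continuous_L1_approx[OF g M(1) K _ M(2), of "e / 2"] e by auto
  have "0 < e / (2 * (m + 1))" using e m by simp
  then obtain p where p: "real_polynomial_function p" "\<And>z. z \<in> K \<Longrightarrow> \<bar>c z - p z\<bar> < e / (2 * (m + 1))"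
    using Stone_Weierstrass_real_polynomial_function[OF K continuous_on_subset[OF c(1)]] by (metis subset_UNIV)
  have p_continuous: "continuous_on UNIV p"
    by (rule smooth_imp_continuous_on[OF smooth_real_polynomial_function[OF p(1)]])
  have "(LINT z|lebesgue_on K. \<bar>g z - p z\<bar>) \<le> (LINT z|lebesgue_on K. \<bar>g z - c z\<bar> + e / (2 * (m + 1)))"
  proof (rule integral_mono_AE[OF int_diff[OF p_continuous]
      Bochner_Integration.integrable_add[OF int_diff[OF c(1)] int_const]])
    show "AE z in lebesgue_on K. \<bar>g z - p z\<bar> \<le> \<bar>g z - c z\<bar> + e / (2 * (m + 1))"
      using AE_lebesgue_on_mem[OF K_sets] by eventually_elim (use p(2) in force)
  qed
  also have "\<dots> = (LINT z|lebesgue_on K. \<bar>g z - c z\<bar>) + m * (e / (2 * (m + 1)))"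
    using int_diff[OF c(1)] int_const K_sets by (simp add: m_def measure_restrict_space)
  also have "m * (e / (2 * (m + 1))) \<le> e / 2" using e m by (simp add: field_simps)
  finally have "(LINT z|lebesgue_on K. \<bar>g z - p z\<bar>) < e" using c(2) by linarith
  then show ?thesis by (rule that[OF p(1) int_diff[OF p_continuous]])
qed

lemma lborel_integral_translation:
  fixes f :: "'a::euclidean_space \<Rightarrow> real"
  assumes "f \<in> borel_measurable borel"
  shows "(LINT z|lborel. f (z + c)) = (LINT z|lborel. f z)"
    and "integrable lborel (\<lambda>z. f (z + c)) \<longleftrightarrow> integrable lborel f"
  using integral_distr[of "(+) c" lborel borel f] integrable_distr_eq[of "(+) c" lborel borel f] assms
  by (simp_all add: lborel_distr_plus add.commute)

lemma L1_translation_continuous_of_continuous: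
  fixes c :: "'a::euclidean_space \<Rightarrow> real"
  assumes c: "continuous_on UNIV c" "\<And>z. \<bar>c z\<bar> \<le> M" and K: "compact K"
  shows "((\<lambda>\<zeta>. LINT z|lborel. indicator K z * \<bar>c (z + \<zeta>) - c z\<bar>) \<longlongrightarrow> 0) (at 0)"
  unfolding tendsto_at_iff_sequentially o_def
proof (intro allI impI)
  fix \<zeta> :: "nat \<Rightarrow> 'a" assume "\<zeta> \<longlonglongrightarrow> 0"
  have [measurable]: "K \<in> sets borel" "c \<in> borel_measurable borel"
    using borel_compact[OF K] borel_measurable_continuous_onI[OF c(1)] by auto
  have "(\<lambda>n. LINT z|lborel. indicator K z * \<bar>c (z + \<zeta> n) - c z\<bar>) \<longlonglongrightarrow> (LINT z|(lborel :: 'a measure). 0)"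
  proof (rule integral_dominated_convergence)
    show "integrable lborel (\<lambda>z. indicator K z * (2 * M))"
      by (rule integrable_lborel_bounded_support[OF _ compact_imp_bounded[OF K], of _ "\<bar>2 * M\<bar>"])
         (auto simp: indicator_def)
    have "(\<lambda>n. c (z + \<zeta> n)) \<longlonglongrightarrow> c z" for z
      using continuous_on_tendsto_compose[OF c(1), of "\<lambda>n. z + \<zeta> n" z]
        tendsto_add[OF tendsto_const \<open>\<zeta> \<longlonglongrightarrow> 0\<close>, of z] by simp
    from tendsto_mult[OF tendsto_const tendsto_rabs[OF tendsto_diff[OF this tendsto_const]]]
    have "(\<lambda>n. indicator K z * \<bar>c (z + \<zeta> n) - c z\<bar>) \<longlonglongrightarrow> indicator K z * \<bar>c z - c z\<bar>" for z .
    then show "AE z in lborel. (\<lambda>n. indicator K z * \<bar>c (z + \<zeta> n) - c z\<bar>) \<longlonglongrightarrow> 0" by simp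
    have "\<bar>c (z + h) - c z\<bar> \<le> 2 * M" for z h using c(2)[of z] c(2)[of "z + h"] by linarith
    then show "AE z in lborel. norm (indicator K z * \<bar>c (z + \<zeta> n) - c z\<bar>) \<le> indicator K z * (2 * M)" for n
      by (auto simp: indicator_def)
  qed auto
  then show "(\<lambda>n. LINT z|lborel. indicator K z * \<bar>c (z + \<zeta> n) - c z\<bar>) \<longlonglongrightarrow> 0" by simp
qed

lemma L1_translation_continuous:
  fixes g :: "'a::euclidean_space \<Rightarrow> real"
  assumes g [measurable]: "g \<in> borel_measurable borel" and M: "\<And>z. \<bar>g z\<bar> \<le> M" and K: "compact K"
  shows "((\<lambda>\<zeta>. LINT z|lborel. indicator K z * \<bar>g (z + \<zeta>) - g z\<bar>) \<longlongrightarrow> 0) (at 0)"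
proof (rule tendstoI)
  fix e :: real assume "0 < e"
  define K' where "K' = {z + \<zeta> | z \<zeta>. z \<in> K \<and> \<zeta> \<in> cball 0 1}"
  have K': "compact K'" unfolding K'_def by (rule compact_sums[OF K compact_cball])
  have in_K': "z + \<zeta> \<in> K'" if "z \<in> K" "norm \<zeta> \<le> 1" for z \<zeta> using that unfolding K'_def by auto
  obtain c where c: "continuous_on UNIV c" "\<And>z. \<bar>c z\<bar> \<le> M" "(LINT z|lebesgue_on K'. \<bar>g z - c z\<bar>) < e / 3"
    using continuous_L1_approx[OF borel_measurable_lebesgue_onI[OF g] M K', of "e / 3"] \<open>0 < e\<close>
      order.trans[OF abs_ge_zero M] by auto
  have [measurable]: "K \<in> sets borel" "K' \<in> sets borel" "c \<in> borel_measurable borel"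
    using borel_compact[OF K] borel_compact[OF K'] borel_measurable_continuous_onI[OF c(1)] by auto
  define d where "d z = indicator K' z * \<bar>g z - c z\<bar>" for z
  have d_integrable: "integrable lborel d"
    unfolding d_def using compact_imp_bounded[OF K'] M c(2) by (intro integrable_lborel_abs_difference) auto
  have d_integral: "(LINT z|lborel. d z) < e / 3"
    using c(3) unfolding d_def by (simp add: integral_restrict_space integral_completion)
  have "\<forall>\<^sub>F \<zeta> in at 0. (LINT z|lborel. indicator K z * \<bar>c (z + \<zeta>) - c z\<bar>) < e / 3"
    using L1_translation_continuous_of_continuous[OF c(1,2) K] \<open>0 < e\<close> by (intro order_tendstoD(2)) auto
  moreover have "\<forall>\<^sub>F \<zeta> in at 0. norm (\<zeta> :: 'a) < 1"
    by (rule order_tendstoD(2)[OF tendsto_norm_zero[OF tendsto_ident_at]]) simp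
  ultimately show "\<forall>\<^sub>F \<zeta> in at 0. dist (LINT z|lborel. indicator K z * \<bar>g (z + \<zeta>) - g z\<bar>) 0 < e"
  proof eventually_elim
    case (elim \<zeta>)
    have integrable_c: "integrable lborel (\<lambda>z. indicator K z * \<bar>c (z + \<zeta>) - c z\<bar>)"
      and integrable_g: "integrable lborel (\<lambda>z. indicator K z * \<bar>g (z + \<zeta>) - g z\<bar>)"
      using compact_imp_bounded[OF K] M c(2) by (auto intro!: integrable_lborel_abs_difference)
    have integrable_shift: "integrable lborel (\<lambda>z. d (z + \<zeta>))"
      using lborel_integral_translation(2)[of d \<zeta>] d_integrable by auto
    have "(LINT z|lborel. indicator K z * \<bar>g (z + \<zeta>) - g z\<bar>)
      \<le> (LINT z|lborel. d (z + \<zeta>) + indicator K z * \<bar>c (z + \<zeta>) - c z\<bar> + d z)"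
    proof (rule integral_mono[OF integrable_g])
      show "indicator K z * \<bar>g (z + \<zeta>) - g z\<bar> \<le> d (z + \<zeta>) + indicator K z * \<bar>c (z + \<zeta>) - c z\<bar> + d z" for z
        using in_K'[of z \<zeta>] in_K'[of z 0] elim(2) by (cases "z \<in> K") (auto simp: d_def)
    qed (intro Bochner_Integration.integrable_add integrable_shift integrable_c d_integrable)
    also have "\<dots> = (LINT z|lborel. d z) + (LINT z|lborel. indicator K z * \<bar>c (z + \<zeta>) - c z\<bar>) + (LINT z|lborel. d z)"
      using lborel_integral_translation(1)[of d \<zeta>] d_integrable integrable_shift integrable_c by simp
    also have "\<dots> < e" using elim(1) d_integral by linarith
    finally show ?case by (simp add: abs_of_nonneg integral_nonneg_AE)
  qed
qed

subsection \<open>The space-time-parameter domain\<close>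

lemma compact_Gam: "compact Gam"
  by (simp add: Gam_def)

lemma domains_borel [measurable]: "domT \<in> sets borel" "dom0 \<in> sets borel" "Gam \<in> sets borel"
  unfolding domT_def dom0_def Gam_def by (auto intro!: borel_Times)

lemma domains_lebesgue [simp]: "domT \<in> sets lebesgue" "dom0 \<in> sets lebesgue" "Gam \<in> sets lebesgue"
  by (auto intro!: sets_completionI_sets)

lemma AE_lebesgue_on_iff_lborel: "S \<in> sets lebesgue \<Longrightarrow> (AE z in lebesgue_on S. Q z) \<longleftrightarrow> (AE z in lborel. z \<in> S \<longrightarrow> Q z)"
  by (simp add: AE_restrict_space_iff AE_completion_iff)

lemma AE_lift_dom0:
  assumes "AE p in lebesgue_on dom0. Q p"
  shows "AE z in lebesgue_on domT. Q (drop_middle z)"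
proof -
  have "AE p in lborel. p \<in> dom0 \<longrightarrow> Q p" using assms by (simp add: AE_lebesgue_on_iff_lborel)
  from AE_lborel_drop_middle[OF this, where 'b = real] have "AE z in lborel. z \<in> domT \<longrightarrow> Q (drop_middle z)"
    by (rule eventually_mono) (auto simp: dom0_def domT_def)
  then show ?thesis by (simp add: AE_lebesgue_on_iff_lborel)
qed

lemma AE_lift_Gam:
  assumes "AE y in lebesgue_on Gam. Q y"
  shows "AE p in lebesgue_on dom0. Q (snd p)" and "AE z in lebesgue_on domT. Q (snd (snd z))"
proof -
  have "AE y in lborel. y \<in> Gam \<longrightarrow> Q y" using assms by (simp add: AE_lebesgue_on_iff_lborel)
  from AE_lborel_snd[OF this, where 'a = real] have "AE p in lborel. p \<in> dom0 \<longrightarrow> Q (snd p)"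
    by (rule eventually_mono) (auto simp: dom0_def)
  then show "AE p in lebesgue_on dom0. Q (snd p)" by (simp add: AE_lebesgue_on_iff_lborel)
  from AE_lift_dom0[OF this] show "AE z in lebesgue_on domT. Q (snd (snd z))" by (simp add: drop_middle_def)
qed

lemma borel_measurable_lift_dom0:
  assumes "b \<in> borel_measurable (lebesgue_on dom0)"
  shows "(\<lambda>z. b (drop_middle z)) \<in> borel_measurable (lebesgue_on domT)"
proof (rule measurable_compose[OF _ assms])
  show "drop_middle \<in> lebesgue_on domT \<rightarrow>\<^sub>M lebesgue_on dom0"
    by (intro measurable_restrict_space2 measurable_restrict_space1 measurable_lebesgue_drop_middle)
       (auto simp: domT_def dom0_def)
qed

lemma borel_measurable_lift_Gam:
  assumes "b \<in> borel_measurable (lebesgue_on Gam)"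
  shows "(\<lambda>p. b (snd p)) \<in> borel_measurable (lebesgue_on dom0)"
    and "(\<lambda>z. b (snd (snd z))) \<in> borel_measurable (lebesgue_on domT)"
proof -
  have "snd \<in> lebesgue_on dom0 \<rightarrow>\<^sub>M lebesgue_on Gam"
    by (intro measurable_restrict_space2 measurable_restrict_space1 measurable_lebesgue_snd) (auto simp: dom0_def)
  then show "(\<lambda>p. b (snd p)) \<in> borel_measurable (lebesgue_on dom0)" by (rule measurable_compose[OF _ assms])
  from borel_measurable_lift_dom0[OF this] show "(\<lambda>z. b (snd (snd z))) \<in> borel_measurable (lebesgue_on domT)"
    by (simp add: drop_middle_def)
qed

lemma time_slab_lebesgue:
  fixes V :: "real set" and T :: real
  assumes "V \<in> sets lebesgue"
  shows "V \<times> {0<..<T} \<times> Gam \<in> sets lebesgue"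
proof -
  have "fst -` V \<inter> space lebesgue \<in> sets (lebesgue :: (real \<times> real \<times> (real^'n)) measure)"
    using measurable_sets[OF measurable_lebesgue_fst assms] .
  moreover have "UNIV \<times> {0<..<T} \<times> Gam \<in> sets (lebesgue :: (real \<times> real \<times> (real^'n)) measure)"
    by (intro sets_completionI_sets) (simp add: borel_Times)
  ultimately have "(fst -` V \<inter> space lebesgue) \<inter> (UNIV \<times> {0<..<T} \<times> Gam)
      \<in> sets (lebesgue :: (real \<times> real \<times> (real^'n)) measure)" by (rule sets.Int)
  then show ?thesis by (simp add: fst_vimage_eq_Times Times_Int_Times)
qed

lemma compact_exhaustion_domT:
  fixes C :: "nat \<Rightarrow> (real \<times> real \<times> (real^'n)) set"
  defines "C \<equiv> \<lambda>j. {- real j..real j} \<times> {1 / (real j + 1)..real j} \<times> Gam"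
  shows "compact (C j)" and "domT = (\<Union>j. C j)"
proof -
  show "compact (C j)" unfolding C_def by (intro compact_Times compact_Gam) auto
  show "domT = (\<Union>j. C j)"
  proof (intro subset_antisym subsetI)
    fix z :: "real \<times> real \<times> (real^'n)" assume "z \<in> domT"
    then obtain x t y where z: "z = (x, t, y)" "0 < t" "y \<in> Gam" by (auto simp: domT_def)
    obtain j where j: "max \<bar>x\<bar> (max t (1 / t)) < real j" using reals_Archimedean2 by blast
    then have "1 < t * real j" using z(2) by (simp add: field_simps)
    then have "1 / (real j + 1) \<le> t" using z(2) by (simp add: field_simps)
    then have "z \<in> C j" using j z unfolding C_def by auto
    then show "z \<in> (\<Union>j. C j)" by blast
  next
    fix z assume "z \<in> (\<Union>j. C j)"
    then obtain j x t y where z: "z = (x, t, y)" "1 / (real j + 1) \<le> t" "y \<in> Gam" unfolding C_def by auto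
    moreover have "0 < 1 / (real j + 1)" by simp
    then have "0 < t" using z(2) by linarith
    ultimately show "z \<in> domT" by (simp add: domT_def)
  qed
qed

lemma compact_exhaustion_dom0:
  fixes C :: "nat \<Rightarrow> (real \<times> (real^'n)) set"
  defines "C \<equiv> \<lambda>j. {- real j..real j} \<times> Gam"
  shows "compact (C j)" and "dom0 = (\<Union>j. C j)"
proof -
  show "compact (C j)" unfolding C_def by (intro compact_Times compact_Gam) auto
  have "\<exists>j. x \<in> {- real j..real j}" for x
  proof -
    obtain j where "\<bar>x\<bar> < real j" using reals_Archimedean2 by blast
    then show ?thesis by (intro exI[of _ j]) auto
  qed
  then show "dom0 = (\<Union>j. C j)" unfolding C_def dom0_def by auto
qed


subsection \<open>Test functions and weak forms\<close>

lemma smooth_dx: "smooth \<phi> \<Longrightarrow> smooth (dx \<phi>)"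
  and smooth_dt: "smooth \<phi> \<Longrightarrow> smooth (dt \<phi>)"
  for \<phi> :: "real \<times> real \<times> (real^'n) \<Rightarrow> real"
  unfolding dx_def[abs_def] dt_def[abs_def]
  by (auto intro!: smooth_frechet_derivative simp: Basis_prod_def image_iff zero_prod_def)

lemma smooth_partial_derivatives:
  fixes \<phi> :: "real \<times> real \<times> (real^'n) \<Rightarrow> real"
  assumes "smooth \<phi>"
  shows "((\<lambda>s. \<phi> (x, s, y)) has_real_derivative dt \<phi> (x, t, y)) (at t)"
    and "((\<lambda>s. \<phi> (s, t, y)) has_real_derivative dx \<phi> (x, t, y)) (at x)"
proof -
  note deriv = smooth_has_derivative[OF assms, of "(x, t, y)"]
  have scale: "s * frechet_derivative \<phi> (at (x, t, y)) h = frechet_derivative \<phi> (at (x, t, y)) (s *\<^sub>R h)" for s h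
    using linear_scale[OF has_derivative_linear[OF deriv], of s h] by simp
  have "((\<lambda>s. (x, s, y)) has_derivative (\<lambda>s. s *\<^sub>R (0, 1, 0))) (at t)"
    "((\<lambda>s. (s, t, y)) has_derivative (\<lambda>s. s *\<^sub>R (1, 0, 0))) (at x)"
    by (auto intro!: derivative_eq_intros simp: zero_prod_def)
  from this[THEN has_derivative_compose, of \<phi>, OF deriv]
  show "((\<lambda>s. \<phi> (x, s, y)) has_real_derivative dt \<phi> (x, t, y)) (at t)"
    "((\<lambda>s. \<phi> (s, t, y)) has_real_derivative dx \<phi> (x, t, y)) (at x)"
    unfolding dt_def dx_def by (auto intro: has_derivative_imp_has_field_derivative[OF _ scale])
qed

lemma DERIV_eq_0_of_locally_0:
  fixes f :: "real \<Rightarrow> real"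
  assumes "(f has_real_derivative D) (at x)" "open U" "x \<in> U" "\<And>s. s \<in> U \<Longrightarrow> f s = 0"
  shows "D = 0"
proof -
  have "(f has_real_derivative 0) (at x)"
    by (rule has_field_derivative_transform_within_open[OF DERIV_const assms(2,3)]) (simp add: assms(4))
  with assms(1) show ?thesis by (rule DERIV_unique)
qed

lemma abs_coordinates_le_norm: "\<bar>fst z\<bar> \<le> norm z" "\<bar>fst (snd z)\<bar> \<le> norm z"
  for z :: "real \<times> real \<times> (real^'n)"
  using norm_fst_le[of "fst z" "snd z"] norm_snd_le[of "snd z" "fst z"] norm_fst_le[of "fst (snd z)" "snd (snd z)"]
  by auto

lemma test_fun_support:
  fixes \<phi> :: "real \<times> real \<times> (real^'n) \<Rightarrow> real"
  assumes "test_fun domT0 \<phi>"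
  obtains R where "0 < R"
    "\<And>x t y. 0 \<le> t \<Longrightarrow> y \<in> Gam \<Longrightarrow> R \<le> \<bar>x\<bar> \<or> R \<le> t \<Longrightarrow> \<phi> (x, t, y) = 0"
    "\<And>x t y. 0 < t \<Longrightarrow> y \<in> Gam \<Longrightarrow> R \<le> \<bar>x\<bar> \<or> R \<le> t \<Longrightarrow>
       dt \<phi> (x, t, y) = 0 \<and> dx \<phi> (x, t, y) = 0 \<and> dx (dx \<phi>) (x, t, y) = 0"
proof -
  from assms obtain C where smooth: "smooth \<phi>" and C: "compact C" "\<And>z. z \<in> domT0 - C \<Longrightarrow> \<phi> z = 0"
    by (auto simp: test_fun_def)
  from compact_imp_bounded[OF C(1)] obtain R where R: "0 < R" "\<And>z. z \<in> C \<Longrightarrow> norm z \<le> R"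
    by (auto simp: bounded_pos)
  have "max \<bar>x\<bar> t \<le> norm (x, t, y)" for x t and y :: "real^'n"
    using abs_coordinates_le_norm[of "(x, t, y)"] by auto
  then have \<phi>_zero: "\<phi> (x, t, y) = 0" if "0 \<le> t" "y \<in> Gam" "R < \<bar>x\<bar> \<or> R < t" for x t y
    using that C(2)[of "(x, t, y)"] R(2)[of "(x, t, y)"]
    by (auto simp: domT0_def) (meson not_le max.cobounded1 max.cobounded2 order.trans)+
  have dx_zero: "dx \<phi> (x, t, y) = 0" if "0 < t" "y \<in> Gam" "R < \<bar>x\<bar> \<or> R < t" for x t y
  proof (rule DERIV_eq_0_of_locally_0[OF smooth_partial_derivatives(2)[OF smooth]])
    show "open {s. R < \<bar>s\<bar> \<or> R < t}" by (intro open_Collect_disj open_Collect_less continuous_intros)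
  qed (use that \<phi>_zero in auto)
  have dxx_zero: "dx (dx \<phi>) (x, t, y) = 0" if "0 < t" "y \<in> Gam" "R < \<bar>x\<bar> \<or> R < t" for x t y
  proof (rule DERIV_eq_0_of_locally_0[OF smooth_partial_derivatives(2)[OF smooth_dx[OF smooth]]])
    show "open {s. R < \<bar>s\<bar> \<or> R < t}" by (intro open_Collect_disj open_Collect_less continuous_intros)
  qed (use that dx_zero in auto)
  have dt_zero: "dt \<phi> (x, t, y) = 0" if "0 < t" "y \<in> Gam" "R < \<bar>x\<bar> \<or> R < t" for x t y
  proof (rule DERIV_eq_0_of_locally_0[OF smooth_partial_derivatives(1)[OF smooth]])
    show "open {s. 0 < s \<and> (R < \<bar>x\<bar> \<or> R < s)}"
      by (intro open_Collect_conj open_Collect_disj open_Collect_less continuous_intros)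
  qed (use that \<phi>_zero in auto)
  show ?thesis
    by (rule that[of "R + 1"]) (use R(1) \<phi>_zero dx_zero dxx_zero dt_zero in \<open>force+\<close>)
qed

lemma test_fun_domT_imp_domT0:
  fixes \<phi> :: "real \<times> real \<times> (real^'n) \<Rightarrow> real"
  assumes "test_fun domT \<phi>"
  shows "test_fun domT0 \<phi>"
proof -
  from assms obtain C where smooth: "smooth \<phi>" and C: "compact C" "C \<subseteq> domT" "\<And>z. z \<in> domT - C \<Longrightarrow> \<phi> z = 0"
    by (auto simp: test_fun_def)
  have "\<phi> (x, 0, y) = 0" if y: "y \<in> Gam" for x y
  proof (rule tendsto_unique[of "at_right 0"])
    have "open (- C)" using C(1) by (simp add: compact_imp_closed open_Compl)
    moreover have "(x, 0, y) \<in> - C" using C(2) by (auto simp: domT_def)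
    moreover have tendsto: "((\<lambda>s. (x, s, y)) \<longlongrightarrow> (x, 0, y)) (at_right 0)" by (intro tendsto_intros)
    ultimately have "\<forall>\<^sub>F s in at_right 0. (x, s, y) \<in> - C" by (blast dest: topological_tendstoD)
    then have "\<forall>\<^sub>F s in at_right 0. 0 = \<phi> (x, s, y)"
      using eventually_at_right_less[of 0] by eventually_elim (use C(3) y in \<open>simp add: domT_def\<close>)
    then show "((\<lambda>s. \<phi> (x, s, y)) \<longlongrightarrow> 0) (at_right 0)" using tendsto_const by (rule Lim_transform_eventually[rotated])
    show "((\<lambda>s. \<phi> (x, s, y)) \<longlongrightarrow> \<phi> (x, 0, y)) (at_right 0)"
      by (rule continuous_on_tendsto_compose[OF smooth_imp_continuous_on[OF smooth, of UNIV] tendsto]) auto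
  qed simp
  then have "\<phi> z = 0" if "z \<in> domT0 - C" for z
    using that C(3)[of z] by (cases z; cases "fst (snd z) = 0") (auto simp: domT_def domT0_def)
  moreover have "C \<subseteq> domT0" using C(2) by (auto simp: domT_def domT0_def)
  ultimately show ?thesis unfolding test_fun_def using smooth C(1) by blast
qed

locale parameter_weight =
  fixes \<rho> :: "real^'n \<Rightarrow> real"
  assumes Linf_weight: "Linf Gam \<rho>" and weight_nonneg: "\<And>y. y \<in> Gam \<Longrightarrow> 0 \<le> \<rho> y"
begin

definition weak_form :: "(real \<times> real \<times> (real^'n) \<Rightarrow> real) \<Rightarrow> (real \<times> real \<times> (real^'n) \<Rightarrow> real) \<Rightarrow>
    (real \<times> real \<times> (real^'n) \<Rightarrow> real) \<Rightarrow> real" where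
  "weak_form a b \<phi> = (LINT z|lebesgue_on domT. (a z * dt \<phi> z + b z * dx \<phi> z) * \<rho> (snd (snd z)))"

definition initial_form :: "(real \<times> (real^'n) \<Rightarrow> real) \<Rightarrow> (real \<times> real \<times> (real^'n) \<Rightarrow> real) \<Rightarrow> real" where
  "initial_form c \<phi> = (LINT p|lebesgue_on dom0. c p * \<phi> (fst p, 0, snd p) * \<rho> (snd p))"

lemma weight_measurable: "\<rho> \<in> borel_measurable (lebesgue_on Gam)"
  using Linf_weight by (simp add: Linf_def)

lemma weight_bounded: obtains B where "0 < B" "AE y in lebesgue_on Gam. \<bar>\<rho> y\<bar> \<le> B"
proof -
  obtain B where "AE y in lebesgue_on Gam. norm (\<rho> y) \<le> B" using Linf_weight by (auto simp: Linf_def)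
  then have "AE y in lebesgue_on Gam. \<bar>\<rho> y\<bar> \<le> max 1 B" by (rule eventually_mono) auto
  then show ?thesis by (intro that[of "max 1 B"]) auto
qed

lemma integrable_domT_weighted:
  assumes "integrable (lebesgue_on domT) k"
  shows "integrable (lebesgue_on domT) (\<lambda>z. k z * \<rho> (snd (snd z)))"
proof -
  obtain B where "AE y in lebesgue_on Gam. \<bar>\<rho> y\<bar> \<le> B" by (rule weight_bounded)
  from integrable_mult_bounded[OF assms borel_measurable_lift_Gam(2)[OF weight_measurable] AE_lift_Gam(2)[OF this]]
  show ?thesis by (simp add: mult.commute)
qed

lemma integrable_dom0_weighted:
  assumes "integrable (lebesgue_on dom0) k"
  shows "integrable (lebesgue_on dom0) (\<lambda>p. k p * \<rho> (snd p))"
proof -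
  obtain B where "AE y in lebesgue_on Gam. \<bar>\<rho> y\<bar> \<le> B" by (rule weight_bounded)
  from integrable_mult_bounded[OF assms borel_measurable_lift_Gam(1)[OF weight_measurable] AE_lift_Gam(1)[OF this]]
  show ?thesis by (simp add: mult.commute)
qed

lemma integrable_domT_continuous:
  assumes h: "continuous_on UNIV h"
    and support: "\<And>x t y. 0 < t \<Longrightarrow> y \<in> Gam \<Longrightarrow> R \<le> \<bar>x\<bar> \<or> R \<le> t \<Longrightarrow> h (x, t, y) = 0"
  shows "integrable (lebesgue_on domT) (\<lambda>z. h z * \<rho> (snd (snd z)))"
proof (rule integrable_domT_weighted)
  let ?K = "{-R..R} \<times> {0..R} \<times> (Gam :: (real^'n) set)"
  have K: "compact ?K" by (intro compact_Times compact_Gam) auto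
  obtain M where M: "0 \<le> M" "\<And>z. z \<in> ?K \<Longrightarrow> \<bar>h z\<bar> \<le> M"
    using compact_continuous_abs_bound[OF K continuous_on_subset[OF h]] by auto
  have zero: "h z = 0" if mem: "z \<in> domT" and outside: "z \<notin> ?K" for z
  proof -
    obtain x t y where z: "z = (x, t, y)" "0 < t" "y \<in> Gam" by (cases z) (use mem in \<open>auto simp: domT_def\<close>)
    then have "R \<le> \<bar>x\<bar> \<or> R \<le> t" using outside by auto
    with z show ?thesis by (simp add: support)
  qed
  show "integrable (lebesgue_on domT) h"
  proof (rule integrable_lebesgue_on_bounded_support[OF _ _ compact_imp_bounded[OF K]])
    show "h \<in> borel_measurable (lebesgue_on domT)"
      by (intro borel_measurable_lebesgue_onI borel_measurable_continuous_onI h)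
    show "AE z in lebesgue_on domT. \<bar>h z\<bar> \<le> M" "AE z in lebesgue_on domT. z \<notin> ?K \<longrightarrow> h z = 0"
      using AE_lebesgue_on_mem[OF domains_lebesgue(1)]
      by (eventually_elim, use M zero in force, eventually_elim, use zero in blast)
  qed simp
qed

lemma integrable_dom0_continuous:
  assumes h: "continuous_on UNIV h" and support: "\<And>x y. y \<in> Gam \<Longrightarrow> R \<le> \<bar>x\<bar> \<Longrightarrow> h (x, y) = 0"
  shows "integrable (lebesgue_on dom0) (\<lambda>p. h p * \<rho> (snd p))"
proof (rule integrable_dom0_weighted)
  let ?K = "{-R..R} \<times> (Gam :: (real^'n) set)"
  have K: "compact ?K" by (intro compact_Times compact_Gam) auto
  obtain M where M: "0 \<le> M" "\<And>p. p \<in> ?K \<Longrightarrow> \<bar>h p\<bar> \<le> M"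
    using compact_continuous_abs_bound[OF K continuous_on_subset[OF h]] by auto
  have zero: "h p = 0" if mem: "p \<in> dom0" and outside: "p \<notin> ?K" for p
  proof -
    obtain x y where p: "p = (x, y)" "y \<in> Gam" by (cases p) (use mem in \<open>auto simp: dom0_def\<close>)
    then have "R \<le> \<bar>x\<bar>" using outside by auto
    with p show ?thesis by (simp add: support)
  qed
  show "integrable (lebesgue_on dom0) h"
  proof (rule integrable_lebesgue_on_bounded_support[OF _ _ compact_imp_bounded[OF K]])
    show "h \<in> borel_measurable (lebesgue_on dom0)"
      by (intro borel_measurable_lebesgue_onI borel_measurable_continuous_onI h)
    show "AE p in lebesgue_on dom0. \<bar>h p\<bar> \<le> M" "AE p in lebesgue_on dom0. p \<notin> ?K \<longrightarrow> h p = 0"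
      using AE_lebesgue_on_mem[OF domains_lebesgue(2)]
      by (eventually_elim, use M zero in force, eventually_elim, use zero in blast)
  qed simp
qed

lemma integrable_test_fun:
  assumes "test_fun domT0 \<phi>"
  shows "integrable (lebesgue_on domT) (\<lambda>z. dt \<phi> z * \<rho> (snd (snd z)))"
    and "integrable (lebesgue_on domT) (\<lambda>z. dx \<phi> z * \<rho> (snd (snd z)))"
    and "integrable (lebesgue_on domT) (\<lambda>z. dx (dx \<phi>) z * \<rho> (snd (snd z)))"
    and "integrable (lebesgue_on dom0) (\<lambda>p. \<phi> (fst p, 0, snd p) * \<rho> (snd p))"
proof -
  obtain R where R: "0 < R" "\<And>x t y. 0 \<le> t \<Longrightarrow> y \<in> Gam \<Longrightarrow> R \<le> \<bar>x\<bar> \<or> R \<le> t \<Longrightarrow> \<phi> (x, t, y) = 0"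
    "\<And>x t y. 0 < t \<Longrightarrow> y \<in> Gam \<Longrightarrow> R \<le> \<bar>x\<bar> \<or> R \<le> t \<Longrightarrow>
       dt \<phi> (x, t, y) = 0 \<and> dx \<phi> (x, t, y) = 0 \<and> dx (dx \<phi>) (x, t, y) = 0"
    using test_fun_support[OF assms] by blast
  have smooth: "smooth \<phi>" using assms by (simp add: test_fun_def)
  show "integrable (lebesgue_on domT) (\<lambda>z. dt \<phi> z * \<rho> (snd (snd z)))"
    "integrable (lebesgue_on domT) (\<lambda>z. dx \<phi> z * \<rho> (snd (snd z)))"
    "integrable (lebesgue_on domT) (\<lambda>z. dx (dx \<phi>) z * \<rho> (snd (snd z)))"
    using R(3) by (auto intro!: integrable_domT_continuous smooth_imp_continuous_on smooth_dt smooth_dx smooth)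
  show "integrable (lebesgue_on dom0) (\<lambda>p. \<phi> (fst p, 0, snd p) * \<rho> (snd p))"
  proof (rule integrable_dom0_continuous[where R = R])
    show "continuous_on UNIV (\<lambda>p. \<phi> (fst p, 0, snd p))"
      by (rule continuous_on_compose2[OF smooth_imp_continuous_on[OF smooth, of UNIV]]) (auto intro!: continuous_intros)
  qed (use R(2) in simp)
qed

lemma weak_form_split:
  assumes "integrable (lebesgue_on domT) (\<lambda>z. a z * (dt \<phi> z * \<rho> (snd (snd z))))"
    and "integrable (lebesgue_on domT) (\<lambda>z. b z * (dx \<phi> z * \<rho> (snd (snd z))))"
  shows "weak_form a b \<phi> = (LINT z|lebesgue_on domT. a z * (dt \<phi> z * \<rho> (snd (snd z))))
    + (LINT z|lebesgue_on domT. b z * (dx \<phi> z * \<rho> (snd (snd z))))"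
  unfolding weak_form_def Bochner_Integration.integral_add[OF assms, symmetric]
  by (simp add: distrib_right mult.assoc)

lemma weak_form_compose_tendsto:
  fixes V :: "nat \<Rightarrow> real \<times> real \<times> (real^'n) \<Rightarrow> 'b::euclidean_space"
  assumes \<phi>: "test_fun domT0 \<phi>" and S: "compact S" and h: "continuous_on S h" "continuous_on S k"
    and V: "\<And>i. V i \<in> borel_measurable (lebesgue_on domT)" "\<And>i. AE z in lebesgue_on domT. V i z \<in> S"
    and W: "W \<in> borel_measurable (lebesgue_on domT)" "AE z in lebesgue_on domT. W z \<in> S"
    and lim: "AE z in lebesgue_on domT. \<rho> (snd (snd z)) \<noteq> 0 \<longrightarrow> (\<lambda>i. V i z) \<longlonglongrightarrow> W z"
  shows "(\<lambda>i. weak_form (\<lambda>z. h (V i z)) (\<lambda>z. k (V i z)) \<phi>) \<longlonglongrightarrow> weak_form (\<lambda>z. h (W z)) (\<lambda>z. k (W z)) \<phi>"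
proof -
  note weight = integrable_test_fun(1,2)[OF \<phi>]
  have lim_weight: "AE z in lebesgue_on domT. g z * \<rho> (snd (snd z)) \<noteq> 0 \<longrightarrow> (\<lambda>i. V i z) \<longlonglongrightarrow> W z" for g
    using lim by eventually_elim auto
  have split: "weak_form (\<lambda>z. h (w z)) (\<lambda>z. k (w z)) \<phi> =
      (LINT z|lebesgue_on domT. h (w z) * (dt \<phi> z * \<rho> (snd (snd z))))
      + (LINT z|lebesgue_on domT. k (w z) * (dx \<phi> z * \<rho> (snd (snd z))))"
    if "w \<in> borel_measurable (lebesgue_on domT)" "AE z in lebesgue_on domT. w z \<in> S" for w
    by (intro weak_form_split integrable_compose_weighted[OF _ S _ that] h weight) simp_all
  show ?thesis
    unfolding split[OF V] split[OF W]
    by (intro tendsto_add LINT_compose_weighted_tendsto[OF _ S _ V W lim_weight] h weight) simp_all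
qed

lemma initial_form_compose_tendsto:
  fixes V :: "nat \<Rightarrow> real \<times> (real^'n) \<Rightarrow> 'b::euclidean_space"
  assumes \<phi>: "test_fun domT0 \<phi>" and S: "compact S" and h: "continuous_on S h"
    and V: "\<And>i. V i \<in> borel_measurable (lebesgue_on dom0)" "\<And>i. AE p in lebesgue_on dom0. V i p \<in> S"
    and W: "W \<in> borel_measurable (lebesgue_on dom0)" "AE p in lebesgue_on dom0. W p \<in> S"
    and lim: "AE p in lebesgue_on dom0. \<rho> (snd p) \<noteq> 0 \<longrightarrow> (\<lambda>i. V i p) \<longlonglongrightarrow> W p"
  shows "(\<lambda>i. initial_form (\<lambda>p. h (V i p)) \<phi>) \<longlonglongrightarrow> initial_form (\<lambda>p. h (W p)) \<phi>"
proof -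
  have "AE p in lebesgue_on dom0. \<phi> (fst p, 0, snd p) * \<rho> (snd p) \<noteq> 0 \<longrightarrow> (\<lambda>i. V i p) \<longlonglongrightarrow> W p"
    using lim by eventually_elim auto
  from LINT_compose_weighted_tendsto[OF _ S h V W this integrable_test_fun(4)[OF \<phi>]] show ?thesis
    by (simp add: initial_form_def mult.assoc)
qed

end

subsection \<open>The entropy inequality with initial data\<close>

lemma has_vector_derivative_compose_into:
  assumes "(c has_vector_derivative v) (at a)" "open A" "a \<in> A" "c ` A \<subseteq> S"
    and "(g has_derivative g') (at (c a) within S)"
  shows "((\<lambda>s. g (c s)) has_vector_derivative g' v) (at a)"
proof -
  have "(g has_derivative g') (at (c a) within c ` A)"
    by (rule has_derivative_subset[OF assms(5,4)])
  moreover have "(c has_vector_derivative v) (at a within A)"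
    using assms(1) by (rule has_vector_derivative_at_within)
  ultimately have "((g \<circ> c) has_vector_derivative g' v) (at a within A)"
    by (intro vector_derivative_diff_chain_within)
  then show ?thesis by (simp add: at_within_open[OF assms(3,2)] o_def)
qed

lemma le_add_integral_of_derivative_le:
  fixes f g :: "real \<Rightarrow> real"
  assumes "a \<le> b" and f: "continuous_on {a..b} f" and g: "continuous_on {a..b} g"
    and deriv: "\<And>t. a < t \<Longrightarrow> t < b \<Longrightarrow> \<exists>f'. (f has_real_derivative f') (at t) \<and> f' \<le> g t"
  shows "f b \<le> f a + integral {a..b} g"
proof -
  have "f b - integral {a..b} g \<le> f a - integral {a..a} g"
  proof (rule DERIV_nonpos_imp_decreasing_open[OF \<open>a \<le> b\<close>, of "\<lambda>t. f t - integral {a..t} g"])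
    show "continuous_on {a..b} (\<lambda>t. f t - integral {a..t} g)"
      by (intro continuous_intros f indefinite_integral_continuous_1 integrable_continuous_real g)
    fix t assume t: "a < t" "t < b"
    then obtain f' where f': "(f has_real_derivative f') (at t)" "f' \<le> g t" using deriv by blast
    have "((\<lambda>x. integral {a..x} g) has_real_derivative g t) (at t within {a..b})"
      using t by (intro integral_has_real_derivative g) auto
    then have "((\<lambda>x. integral {a..x} g) has_real_derivative g t) (at t)"
      using at_within_interior[of t "{a..b}"] t by simp
    from DERIV_diff[OF f'(1) this] f'(2)
    show "\<exists>y. ((\<lambda>t. f t - integral {a..t} g) has_real_derivative y) (at t) \<and> y \<le> 0"
      by (intro exI[of _ "f' - g t"]) simp
  qed
  then show ?thesis by simp
qed

lemma continuous_on_section: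
  assumes "continuous_on (A \<times> B) (\<lambda>(t, x). h t x)" "t \<in> A"
  shows "continuous_on B (h t)"
proof -
  have "continuous_on B (Pair t)" "Pair t ` B \<subseteq> A \<times> B" using assms(2) by (auto intro!: continuous_intros)
  from continuous_on_compose2[OF assms(1) this] show ?thesis by simp
qed

lemma iterated_LINT_eq_integral:
  fixes h :: "real \<Rightarrow> real \<Rightarrow> real"
  assumes h: "continuous_on ({0..} \<times> UNIV) (\<lambda>(t, x). h t x)" and R: "0 < R"
    and support: "\<And>t x. 0 < t \<Longrightarrow> R \<le> \<bar>x\<bar> \<or> R \<le> t \<Longrightarrow> h t x = 0"
  shows "(LINT t|lebesgue. LINT x|lebesgue. indicator {0<..} t * h t x) = integral {0..R} (\<lambda>t. integral {-R..R} (h t))"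
proof -
  let ?H = "\<lambda>t. integral {-R..R} (h t)"
  have inner: "(LINT x|lebesgue. h t x) = ?H t" if "0 < t" for t
  proof (rule LINT_lebesgue_eq_integral)
    show "continuous_on {-R..R} (h t)"
      by (rule continuous_on_subset[OF continuous_on_section[OF h]]) (use that in auto)
    show "h t x = 0" if "x \<notin> {-R..R}" for x using that \<open>0 < t\<close> by (intro support) auto
  qed
  have "continuous_on {0..} ?H"
    by (rule integral_continuous_on_param[of "{0..}" "-R" R h, unfolded box_real])
       (rule continuous_on_subset[OF h], auto)
  then have H: "continuous_on {0..R} ?H" by (rule continuous_on_subset) auto
  have "(\<lambda>t. indicat_real {0..R} t *\<^sub>R ?H t) \<in> borel_measurable lborel"
    using borel_measurable_continuous_on_indicator[OF _ H] by simp
  then have H_borel: "(\<lambda>t. indicat_real {0..R} t *\<^sub>R ?H t) \<in> borel_measurable lebesgue"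
    by (rule measurable_completion)
  have "AE t in lebesgue. t \<noteq> (0::real)" by (rule AE_completion[OF AE_lborel_singleton])
  then have eq: "AE t in lebesgue. indicat_real {0..R} t *\<^sub>R ?H t = (LINT x|lebesgue. indicator {0<..} t * h t x)"
  proof eventually_elim
    case (elim t)
    have "h t = (\<lambda>x. 0)" if "R < t" by (rule ext) (use that R support[of t] in \<open>simp\<close>)
    then show ?case using elim inner[of t] by (cases "0 < t") (auto simp: indicator_def)
  qed
  have "(LINT t|lebesgue. LINT x|lebesgue. indicator {0<..} t * h t x)
      = (LINT t|lebesgue. indicat_real {0..R} t *\<^sub>R ?H t)"
    by (rule integral_cong_AE[OF borel_measurable_AE[OF H_borel eq] H_borel])
       (use eq in \<open>auto elim: eventually_mono\<close>)
  also have "\<dots> = (LINT t|lebesgue_on {0..R}. ?H t)" by (rule integral_restrict_space[symmetric]) simp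
  also have "\<dots> = integral {0..R} ?H"
    by (rule lebesgue_integral_eq_integral[OF continuous_imp_integrable_real[OF H]]) simp
  finally show ?thesis .
qed

locale convex_entropy_pair =
  fixes K S :: "(real^2) set" and r :: "real^2 \<Rightarrow> real" and F :: "real^2 \<Rightarrow> real^2" and DF :: "real^2 \<Rightarrow> real^2^2"
    and \<eta> :: "real^2 \<Rightarrow> real" and D\<eta> :: "real^2 \<Rightarrow> real^2" and H\<eta> :: "real^2 \<Rightarrow> real^2^2" and Q :: "real^2 \<Rightarrow> real"
  assumes compact_states: "compact S"
    and entropy: "convex_entropy K DF r S \<eta> D\<eta> H\<eta>" and flux: "entropy_flux DF S D\<eta> Q"
    and F_has_derivative: "\<And>V i. V \<in> S \<Longrightarrow> ((\<lambda>U. F U $ i) has_derivative (\<lambda>h. DF V $ i \<bullet> h)) (at V within S)"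
begin

lemma entropy_has_derivative: "V \<in> S \<Longrightarrow> (\<eta> has_derivative (\<lambda>h. D\<eta> V \<bullet> h)) (at V within S)"
  and gradient_has_derivative: "V \<in> S \<Longrightarrow> (D\<eta> has_derivative (\<lambda>h. H\<eta> V *v h)) (at V within S)"
  and flux_has_derivative: "V \<in> S \<Longrightarrow> (Q has_derivative (\<lambda>h. (D\<eta> V v* DF V) \<bullet> h)) (at V within S)"
  and hessian_nonneg: "V \<in> S \<Longrightarrow> 0 \<le> \<xi> \<bullet> (H\<eta> V *v \<xi>)"
  and dissipation_nonneg: "V \<in> S \<Longrightarrow> 0 \<le> D\<eta> V $ 2 * r V"
  using entropy flux by (auto simp: convex_entropy_def C2_with_def entropy_flux_def)

lemma continuous_entropy: "continuous_on S \<eta>" "continuous_on S D\<eta>" "continuous_on S Q"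
  using entropy_has_derivative gradient_has_derivative flux_has_derivative
  by (auto simp: continuous_on_eq_continuous_within intro: has_derivative_continuous)

lemma entropy_production_le:
  assumes V: "V \<in> S" and \<epsilon>: "0 < \<epsilon>" and \<nu>: "0 < \<nu>"
    and pde: "Vt + DF V *v Vx + (1 / \<epsilon>) *\<^sub>R st 0 (r V) = \<nu> *\<^sub>R Vxx"
  shows "D\<eta> V \<bullet> Vt \<le> \<nu> * ((H\<eta> V *v Vx) \<bullet> Vx + D\<eta> V \<bullet> Vxx) - (D\<eta> V v* DF V) \<bullet> Vx"
proof -
  have "Vt = \<nu> *\<^sub>R Vxx - DF V *v Vx - (1 / \<epsilon>) *\<^sub>R st 0 (r V)"
    using pde by (simp add: algebra_simps)
  moreover have "D\<eta> V \<bullet> st 0 (r V) = D\<eta> V $ 2 * r V"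
    by (simp add: inner_vec_def sum_2)
  ultimately have "D\<eta> V \<bullet> Vt = \<nu> * (D\<eta> V \<bullet> Vxx) - (D\<eta> V v* DF V) \<bullet> Vx - (1 / \<epsilon>) * (D\<eta> V $ 2 * r V)"
    by (simp add: inner_diff_right dot_lmul_matrix)
  moreover have "0 \<le> (1 / \<epsilon>) * (D\<eta> V $ 2 * r V)"
    using dissipation_nonneg[OF V] \<epsilon> by simp
  moreover have "0 \<le> \<nu> * ((H\<eta> V *v Vx) \<bullet> Vx)"
    using hessian_nonneg[OF V, of Vx] \<nu> by (simp add: inner_commute)
  ultimately show ?thesis by (simp add: algebra_simps)
qed

lemma F_compose_has_vector_derivative:
  assumes "(c has_vector_derivative v) (at a)" "range c \<subseteq> S"
  shows "((\<lambda>s. F (c s)) has_vector_derivative DF (c a) *v v) (at a)"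
proof -
  have "((\<lambda>s. F (c s) $ i) has_vector_derivative DF (c a) $ i \<bullet> v) (at a)" for i
    using assms(2) by (intro has_vector_derivative_compose_into[OF assms(1) open_UNIV UNIV_I assms(2)]
        F_has_derivative) auto
  then show ?thesis
    unfolding has_vector_derivative_def has_derivative_componentwise_within[of "\<lambda>s. F (c s)"]
    by (auto simp: Basis_vec_def inner_axis matrix_vector_mul_component)
qed

text \<open>
  The time derivative of the entropy is bounded by an exact derivative in \<open>x\<close>, which integrates to \<open>0\<close>,
  plus the terms in which the derivatives fall on the test function.
\<close>

lemma integral_entropy_production_le:
  fixes V V' V'' Vt :: "real \<Rightarrow> real^2" and k k' k'' :: "real \<Rightarrow> real"
  assumes V: "range V \<subseteq> S" "\<And>x. (V has_vector_derivative V' x) (at x)" "\<And>x. (V' has_vector_derivative V'' x) (at x)"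
    and production: "\<And>x. D\<eta> (V x) \<bullet> Vt x
      \<le> \<nu> * ((H\<eta> (V x) *v V' x) \<bullet> V' x + D\<eta> (V x) \<bullet> V'' x) - (D\<eta> (V x) v* DF (V x)) \<bullet> V' x"
    and Vt: "continuous_on {-R..R} Vt"
    and k: "\<And>x. (k has_real_derivative k' x) (at x)" "\<And>x. (k' has_real_derivative k'' x) (at x)"
      "continuous_on {-R..R} k''" "\<And>x. 0 \<le> k x" "\<And>x. R \<le> \<bar>x\<bar> \<Longrightarrow> k x = 0" "\<And>x. R \<le> \<bar>x\<bar> \<Longrightarrow> k' x = 0"
    and R: "0 < R"
  shows "integral {-R..R} (\<lambda>x. (D\<eta> (V x) \<bullet> Vt x) * k x)
    \<le> integral {-R..R} (\<lambda>x. Q (V x) * k' x + \<nu> * (\<eta> (V x) * k'' x))"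
proof -
  define Z where "Z x = \<nu> * (D\<eta> (V x) \<bullet> V' x) * k x - \<nu> * \<eta> (V x) * k' x - Q (V x) * k x" for x
  define Z' where "Z' x = (\<nu> * ((H\<eta> (V x) *v V' x) \<bullet> V' x + D\<eta> (V x) \<bullet> V'' x) - (D\<eta> (V x) v* DF (V x)) \<bullet> V' x) * k x
      - (Q (V x) * k' x + \<nu> * (\<eta> (V x) * k'' x))" for x
  note chain = has_vector_derivative_compose_into[OF V(2) open_UNIV UNIV_I V(1)]
  have mem: "V x \<in> S" for x using V(1) by auto
  have dZ: "(Z has_real_derivative Z' x) (at x)" for x
  proof -
    have "((\<lambda>x. \<eta> (V x)) has_real_derivative D\<eta> (V x) \<bullet> V' x) (at x)"
      "((\<lambda>x. Q (V x)) has_real_derivative (D\<eta> (V x) v* DF (V x)) \<bullet> V' x) (at x)"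
      using chain[OF entropy_has_derivative[OF mem]] chain[OF flux_has_derivative[OF mem]]
      by (simp_all add: has_real_derivative_iff_has_vector_derivative)
    moreover have "((\<lambda>x. D\<eta> (V x) \<bullet> V' x) has_real_derivative
        (H\<eta> (V x) *v V' x) \<bullet> V' x + D\<eta> (V x) \<bullet> V'' x) (at x)"
      using chain[OF gradient_has_derivative[OF mem]] V(3)[of x]
      unfolding has_real_derivative_iff_has_vector_derivative has_vector_derivative_def
      by (auto intro!: derivative_eq_intros simp: algebra_simps)
    ultimately show ?thesis
      unfolding Z_def Z'_def by (auto intro!: derivative_eq_intros k(1,2) simp: algebra_simps)
  qed
  have "(Z' has_integral (Z R - Z (-R))) {-R..R}"
    using R by (intro fundamental_theorem_of_calculus)
      (auto simp: has_real_derivative_iff_has_vector_derivative[symmetric] intro: has_field_derivative_at_within[OF dZ])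
  then have Z'_integral: "(Z' has_integral 0) {-R..R}" by (simp add: Z_def k(5,6))
  have V_continuous: "continuous_on {-R..R} V"
    using V(2) by (intro continuous_on_vector_derivative) (auto intro: has_vector_derivative_at_within)
  have k_continuous: "continuous_on {-R..R} k" "continuous_on {-R..R} k'"
    using k(1,2) by (auto intro: DERIV_continuous_on has_field_derivative_at_within)
  note compose = continuous_on_compose2[OF _ V_continuous]
  have "(\<lambda>x. (D\<eta> (V x) \<bullet> Vt x) * k x) integrable_on {-R..R}"
    "(\<lambda>x. Q (V x) * k' x + \<nu> * (\<eta> (V x) * k'' x)) integrable_on {-R..R}"
    using mem by (intro integrable_continuous_real continuous_intros k_continuous k(3) Vt
        compose[OF continuous_entropy(1)] compose[OF continuous_entropy(2)] compose[OF continuous_entropy(3)]; auto)+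
  note integrals = this[THEN integrable_integral]
  have "(D\<eta> (V x) \<bullet> Vt x) * k x \<le> Z' x + (Q (V x) * k' x + \<nu> * (\<eta> (V x) * k'' x))" for x
    using mult_right_mono[OF production[of x] k(4)[of x]] by (simp add: Z'_def)
  from has_integral_le[OF integrals(1) has_integral_add[OF Z'_integral integrals(2)] this]
  show ?thesis by simp
qed

end

locale viscous_section = convex_entropy_pair +
  fixes w wt wx wxx :: "real \<times> real \<Rightarrow> real^2" and \<psi> \<psi>t \<psi>x \<psi>xx :: "real \<times> real \<Rightarrow> real" and \<epsilon> \<nu> R :: real
  assumes w_continuous: "continuous_on (UNIV \<times> {0..}) w" and w_mem: "\<And>x t. 0 \<le> t \<Longrightarrow> w (x, t) \<in> S"
    and wt_continuous: "continuous_on (UNIV \<times> {0<..}) wt"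
    and w_t: "\<And>x t. 0 < t \<Longrightarrow> ((\<lambda>s. w (x, s)) has_vector_derivative wt (x, t)) (at t)"
    and w_x: "\<And>x t. 0 < t \<Longrightarrow> ((\<lambda>s. w (s, t)) has_vector_derivative wx (x, t)) (at x)"
    and w_xx: "\<And>x t. 0 < t \<Longrightarrow> ((\<lambda>s. wx (s, t)) has_vector_derivative wxx (x, t)) (at x)"
    and pde: "\<And>x t. 0 < t \<Longrightarrow> wt (x, t) + vector_derivative (\<lambda>s. F (w (s, t))) (at x)
        + (1 / \<epsilon>) *\<^sub>R st 0 (r (w (x, t))) = \<nu> *\<^sub>R wxx (x, t)"
    and \<psi>_t: "\<And>x t. ((\<lambda>s. \<psi> (x, s)) has_real_derivative \<psi>t (x, t)) (at t)"
    and \<psi>_x: "\<And>x t. ((\<lambda>s. \<psi> (s, t)) has_real_derivative \<psi>x (x, t)) (at x)"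
    and \<psi>_xx: "\<And>x t. ((\<lambda>s. \<psi>x (s, t)) has_real_derivative \<psi>xx (x, t)) (at x)"
    and \<psi>_continuous: "continuous_on UNIV \<psi>" "continuous_on UNIV \<psi>t" "continuous_on UNIV \<psi>x" "continuous_on UNIV \<psi>xx"
    and \<psi>_nonneg: "\<And>x t. 0 \<le> t \<Longrightarrow> 0 \<le> \<psi> (x, t)"
    and \<psi>_support: "\<And>x t. 0 \<le> t \<Longrightarrow> R \<le> \<bar>x\<bar> \<or> R \<le> t \<Longrightarrow> \<psi> (x, t) = 0"
      "\<And>x t. 0 < t \<Longrightarrow> R \<le> \<bar>x\<bar> \<Longrightarrow> \<psi>x (x, t) = 0"
    and parameters_pos: "0 < \<epsilon>" "0 < \<nu>" "0 < R"
begin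

definition entropy_mass :: "real \<Rightarrow> real" where
  "entropy_mass t = integral {-R..R} (\<lambda>x. \<eta> (w (x, t)) * \<psi> (x, t))"

definition entropy_source :: "real \<Rightarrow> real \<Rightarrow> real" where
  "entropy_source t x = \<eta> (w (x, t)) * \<psi>t (x, t) + (Q (w (x, t)) * \<psi>x (x, t) + \<nu> * (\<eta> (w (x, t)) * \<psi>xx (x, t)))"

lemma continuous_on_swap: "continuous_on UNIV g \<Longrightarrow> continuous_on A (\<lambda>(t, x). g (x, t))"
  for g :: "real \<times> real \<Rightarrow> real"
  unfolding case_prod_beta by (rule continuous_on_compose2[of UNIV g]) (auto intro!: continuous_intros)

lemma continuous_on_compose_w:
  assumes "continuous_on S g" "A \<subseteq> {0..}"
  shows "continuous_on (A \<times> B) (\<lambda>(t, x). g (w (x, t)))"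
proof -
  have "continuous_on (A \<times> B) (\<lambda>p. w (snd p, fst p))"
    by (rule continuous_on_compose2[OF w_continuous]) (use assms(2) in \<open>auto intro!: continuous_intros\<close>)
  then show ?thesis
    unfolding case_prod_beta by (rule continuous_on_compose2[OF assms(1)]) (use w_mem assms(2) in auto)
qed

lemma continuous_entropy_source: "continuous_on ({0..} \<times> B) (\<lambda>(t, x). entropy_source t x)"
  using continuous_on_compose_w[OF continuous_entropy(1), of "{0..}" B]
    continuous_on_compose_w[OF continuous_entropy(3), of "{0..}" B] \<psi>_continuous(2-4)[THEN continuous_on_swap]
  unfolding entropy_source_def case_prod_beta by (auto intro!: continuous_intros)

lemma continuous_entropy_mass: "continuous_on {0..} entropy_mass"
proof -
  have "continuous_on ({0..} \<times> {-R..R}) (\<lambda>(t, x). \<eta> (w (x, t)) * \<psi> (x, t))"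
    using continuous_on_compose_w[OF continuous_entropy(1), of "{0..}" "{-R..R}"]
      \<psi>_continuous(1)[THEN continuous_on_swap]
    unfolding case_prod_beta by (auto intro!: continuous_intros)
  from integral_continuous_on_param[of _ "-R" R, unfolded box_real, OF this] show ?thesis
    unfolding entropy_mass_def .
qed

lemma spatial_production_le:
  assumes t: "0 < t"
  shows "integral {-R..R} (\<lambda>x. (D\<eta> (w (x, t)) \<bullet> wt (x, t)) * \<psi> (x, t))
    \<le> integral {-R..R} (\<lambda>x. Q (w (x, t)) * \<psi>x (x, t) + \<nu> * (\<eta> (w (x, t)) * \<psi>xx (x, t)))"
proof (rule integral_entropy_production_le[OF _ w_x[OF t] w_xx[OF t] _ _ \<psi>_x \<psi>_xx])
  show range: "range (\<lambda>x. w (x, t)) \<subseteq> S" using w_mem t by auto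
  show "D\<eta> (w (x, t)) \<bullet> wt (x, t) \<le> \<nu> * ((H\<eta> (w (x, t)) *v wx (x, t)) \<bullet> wx (x, t) + D\<eta> (w (x, t)) \<bullet> wxx (x, t))
      - (D\<eta> (w (x, t)) v* DF (w (x, t))) \<bullet> wx (x, t)" for x
    using pde[OF t, of x] w_mem[of t x] t parameters_pos
      vector_derivative_at[OF F_compose_has_vector_derivative[OF w_x[OF t] range]]
    by (intro entropy_production_le) auto
  show "continuous_on {-R..R} (\<lambda>x. wt (x, t))" "continuous_on {-R..R} (\<lambda>x. \<psi>xx (x, t))"
    by (rule continuous_on_compose2[OF wt_continuous], use t in \<open>auto intro!: continuous_intros\<close>)
       (rule continuous_on_compose2[OF \<psi>_continuous(4)], auto intro!: continuous_intros)
qed (use t \<psi>_nonneg \<psi>_support parameters_pos in auto)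

definition production :: "real \<Rightarrow> real \<Rightarrow> real" where
  "production t x = (D\<eta> (w (x, t)) \<bullet> wt (x, t)) * \<psi> (x, t)"

definition transport :: "real \<Rightarrow> real \<Rightarrow> real" where
  "transport t x = \<eta> (w (x, t)) * \<psi>t (x, t)"

lemma continuous_production: "continuous_on ({0<..} \<times> B) (\<lambda>(t, x). production t x)"
  and continuous_transport: "continuous_on ({0<..} \<times> B) (\<lambda>(t, x). transport t x)"
proof -
  have greaterThan_subset: "{0<..} \<subseteq> {0::real..}" by auto
  have "continuous_on ({0<..} \<times> B) (\<lambda>(s, x). wt (x, s))"
    unfolding case_prod_beta by (rule continuous_on_compose2[OF wt_continuous]) (auto intro!: continuous_intros)
  then show "continuous_on ({0<..} \<times> B) (\<lambda>(t, x). production t x)"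
    "continuous_on ({0<..} \<times> B) (\<lambda>(t, x). transport t x)"
    using continuous_on_compose_w[OF continuous_entropy(1) greaterThan_subset, of B]
      continuous_on_compose_w[OF continuous_entropy(2) greaterThan_subset, of B]
      \<psi>_continuous(1,2)[THEN continuous_on_swap, of "{0<..} \<times> B"]
    unfolding production_def transport_def case_prod_beta by (auto intro!: continuous_intros)
qed

lemma entropy_mass_has_derivative:
  assumes t: "0 < t"
  shows "(entropy_mass has_real_derivative integral {-R..R} (\<lambda>x. production t x + transport t x)) (at t)"
proof -
  have derivative: "((\<lambda>s. \<eta> (w (x, s)) * \<psi> (x, s)) has_real_derivative production s x + transport s x)
      (at s within {0<..})"
    if "s \<in> {0<..}" for s x
  proof -
    have "((\<lambda>s. \<eta> (w (x, s))) has_real_derivative D\<eta> (w (x, s)) \<bullet> wt (x, s)) (at s)"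
      unfolding has_real_derivative_iff_has_vector_derivative
      by (rule has_vector_derivative_compose_into[OF w_t, of s "{0<..}" _ S])
         (use that w_mem entropy_has_derivative in auto)
    from DERIV_mult[OF this \<psi>_t[of x s]] show ?thesis
      unfolding production_def transport_def by (auto intro: has_field_derivative_at_within
          simp: add.commute mult.commute)
  qed
  have "(entropy_mass has_real_derivative integral {-R..R} (\<lambda>x. production t x + transport t x)) (at t within {0<..})"
    unfolding entropy_mass_def[abs_def]
  proof (rule leibniz_rule_field_derivative[of "{0<..}" "-R" R, unfolded box_real])
    show "(\<lambda>x. \<eta> (w (x, s)) * \<psi> (x, s)) integrable_on {-R..R}" if "s \<in> {0<..}" for s
      using that w_mem by (intro integrable_continuous_real continuous_on_mult
          continuous_on_compose2[OF continuous_entropy(1) continuous_on_compose2[OF w_continuous]]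
          continuous_on_compose2[OF \<psi>_continuous(1)] continuous_intros) auto
    show "continuous_on ({0<..} \<times> {-R..R}) (\<lambda>(s, x). production s x + transport s x)"
      using continuous_production continuous_transport unfolding case_prod_beta by (rule continuous_on_add)
  qed (use derivative t in auto)
  then show ?thesis using t by (simp add: at_within_open[of t "{0<..}"])
qed

lemma entropy_mass_rate_le:
  assumes t: "0 < t"
  shows "integral {-R..R} (\<lambda>x. production t x + transport t x) \<le> integral {-R..R} (entropy_source t)"
proof -
  let ?rest = "\<lambda>x. Q (w (x, t)) * \<psi>x (x, t) + \<nu> * (\<eta> (w (x, t)) * \<psi>xx (x, t))"
  have integrable: "production t integrable_on {-R..R}" "transport t integrable_on {-R..R}"
    "entropy_source t integrable_on {-R..R}"
    using t by (auto intro!: integrable_continuous_real intro: continuous_on_section[OF continuous_production]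
        continuous_on_section[OF continuous_transport] continuous_on_section[OF continuous_entropy_source])
  have "integral {-R..R} (\<lambda>x. production t x + transport t x)
      = integral {-R..R} (production t) + integral {-R..R} (transport t)"
    by (rule Henstock_Kurzweil_Integration.integral_add[OF integrable(1,2)])
  also have "integral {-R..R} (production t) \<le> integral {-R..R} ?rest"
    using spatial_production_le[OF t] unfolding production_def[abs_def] .
  also have "?rest = (\<lambda>x. entropy_source t x - transport t x)"
    by (simp add: entropy_source_def transport_def)
  also have "integral {-R..R} \<dots> = integral {-R..R} (entropy_source t) - integral {-R..R} (transport t)"
    by (rule Henstock_Kurzweil_Integration.integral_diff[OF integrable(3,2)])
  finally show ?thesis by simp
qed

lemma section_entropy_inequality:
  "0 \<le> integral {0..R} (\<lambda>t. integral {-R..R} (entropy_source t)) + integral {-R..R} (\<lambda>x. \<eta> (w (x, 0)) * \<psi> (x, 0))"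
proof -
  have "entropy_mass R \<le> entropy_mass 0 + integral {0..R} (\<lambda>t. integral {-R..R} (entropy_source t))"
  proof (rule le_add_integral_of_derivative_le)
    show "continuous_on {0..R} entropy_mass" by (rule continuous_on_subset[OF continuous_entropy_mass]) auto
    show "continuous_on {0..R} (\<lambda>t. integral {-R..R} (entropy_source t))"
      using integral_continuous_on_param[of _ "-R" R, unfolded box_real, OF continuous_entropy_source]
      by (rule continuous_on_subset) auto
  qed (use entropy_mass_has_derivative entropy_mass_rate_le parameters_pos in auto)
  moreover have "entropy_mass R = 0" using parameters_pos \<psi>_support(1) by (simp add: entropy_mass_def)
  ultimately show ?thesis by (simp add: entropy_mass_def)
qed

lemma section_entropy_inequality_LINT:
  assumes support: "\<And>t x. 0 < t \<Longrightarrow> R \<le> \<bar>x\<bar> \<or> R \<le> t \<Longrightarrow> entropy_source t x = 0"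
  shows "0 \<le> (LINT t|lebesgue. LINT x|lebesgue. indicator {0<..} t * entropy_source t x)
    + (LINT x|lebesgue. \<eta> (w (x, 0)) * \<psi> (x, 0))"
proof -
  have "continuous_on {-R..R} (\<lambda>x. \<eta> (w (x, 0)) * \<psi> (x, 0))"
    using continuous_on_section[OF continuous_on_compose_w[OF continuous_entropy(1)], of "{0..}" 0 "{-R..R}"]
      continuous_on_section[OF continuous_on_swap[OF \<psi>_continuous(1), of "{0} \<times> {-R..R}"], of 0]
    by (intro continuous_on_mult) simp_all
  then have "(LINT x|lebesgue. \<eta> (w (x, 0)) * \<psi> (x, 0)) = integral {-R..R} (\<lambda>x. \<eta> (w (x, 0)) * \<psi> (x, 0))"
    using \<psi>_support(1) by (intro LINT_lebesgue_eq_integral) force+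
  then show ?thesis
    using section_entropy_inequality iterated_LINT_eq_integral[OF continuous_entropy_source parameters_pos(3)
        support] by simp
qed

end

lemma smooth_on_borel_measurable:
  fixes W :: "'a::euclidean_space \<Rightarrow> 'b::euclidean_space"
  assumes "smooth_on S W" "S \<in> sets lebesgue"
  shows "W \<in> borel_measurable (lebesgue_on S)"
proof -
  from assms(1) obtain h where h: "smooth h" "\<And>z. z \<in> S \<Longrightarrow> h z = W z" by (auto simp: smooth_on_def)
  have "h \<in> borel_measurable (lebesgue_on S)"
    by (intro borel_measurable_lebesgue_onI smooth_imp_borel_measurable h(1))
  then show ?thesis
    by (subst measurable_cong[of _ _ h]) (auto simp: h(2)[symmetric])
qed

lemma (in parameter_weight) AE_convergent_viscosities:
  fixes U :: "real \<times> real \<times> (real^'n) \<Rightarrow> 'b::euclidean_space" and U0 :: "real \<times> (real^'n) \<Rightarrow> 'c::euclidean_space"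
  assumes W: "\<And>\<nu>. 0 < \<nu> \<Longrightarrow> smooth_on dom0 (W0 \<nu>)" "\<And>\<nu>. 0 < \<nu> \<Longrightarrow> W \<nu> \<in> borel_measurable (lebesgue_on domT)"
    and lim: "tendsto_Lp_loc 1 (\<lambda>(x, y). \<rho> y) dom0 W0 U0 (at_right 0)"
      "tendsto_Lp_loc 1 (\<lambda>(x, t, y). (\<rho> y)\<^sup>2) domT W U (at_right 0)"
    and U: "U \<in> borel_measurable (lebesgue_on domT)" and U0: "U0 \<in> borel_measurable (lebesgue_on dom0)"
  obtains s :: "nat \<Rightarrow> real" where "s \<longlonglongrightarrow> 0" "\<And>i. 0 < s i"
    "AE z in lebesgue_on domT. \<rho> (snd (snd z)) \<noteq> 0 \<longrightarrow> (\<lambda>i. W (s i) z) \<longlonglongrightarrow> U z"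
    "AE p in lebesgue_on dom0. \<rho> (snd p) \<noteq> 0 \<longrightarrow> (\<lambda>i. W0 (s i) p) \<longlonglongrightarrow> U0 p"
proof -
  define s where "s i = inverse (real (Suc i))" for i
  have pos: "0 < s i" for i by (simp add: s_def)
  have s: "s \<longlonglongrightarrow> 0" unfolding s_def by (rule LIMSEQ_inverse_real_of_nat)
  then have s_right: "filterlim s (at_right 0) sequentially"
    using less_imp_neq[OF pos] pos by (auto simp: filterlim_at intro!: always_eventually)
  have W0_measurable: "W0 (s i) \<in> borel_measurable (lebesgue_on dom0)" for i
    by (rule smooth_on_borel_measurable[OF W(1)[OF pos]]) simp
  have weights_measurable: "(\<lambda>(x, y). \<rho> y) \<in> borel_measurable (lebesgue_on dom0)"
    "(\<lambda>(x, t, y). (\<rho> y)\<^sup>2) \<in> borel_measurable (lebesgue_on domT)"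
    using borel_measurable_lift_Gam(1)[OF weight_measurable]
      borel_measurable_power[OF borel_measurable_lift_Gam(2)[OF weight_measurable], of 2]
    by (simp_all add: case_prod_beta')
  obtain \<tau> where \<tau>: "strict_mono \<tau>"
    and lim_\<tau>: "AE z in lebesgue_on domT. (case z of (x, t, y) \<Rightarrow> (\<rho> y)\<^sup>2) \<noteq> 0 \<longrightarrow> (\<lambda>k. W (s (\<tau> k)) z) \<longlonglongrightarrow> U z"
    by (rule tendsto_Lp_loc_AE_subseq[OF tendsto_Lp_loc_compose[OF lim(2) s_right] W(2)[OF pos] U weights_measurable(2)
        _ compact_exhaustion_domT]) (auto simp: domT_def)
  have \<tau>_lim: "filterlim \<tau> sequentially sequentially" by (rule filterlim_subseq[OF \<tau>])
  obtain \<tau>' where \<tau>': "strict_mono \<tau>'"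
    and lim_\<tau>': "AE p in lebesgue_on dom0. (case p of (x, y) \<Rightarrow> \<rho> y) \<noteq> 0 \<longrightarrow> (\<lambda>k. W0 (s (\<tau> (\<tau>' k))) p) \<longlonglongrightarrow> U0 p"
    by (rule tendsto_Lp_loc_AE_subseq[OF tendsto_Lp_loc_compose[OF tendsto_Lp_loc_compose[OF lim(1) s_right] \<tau>_lim]
        W0_measurable U0 weights_measurable(1) _ compact_exhaustion_dom0])
       (auto simp: dom0_def weight_nonneg)
  have \<tau>'_lim: "filterlim \<tau>' sequentially sequentially" by (rule filterlim_subseq[OF \<tau>'])
  show ?thesis
  proof (rule that[of "\<lambda>k. s (\<tau> (\<tau>' k))"])
    show "(\<lambda>k. s (\<tau> (\<tau>' k))) \<longlonglongrightarrow> 0" by (rule filterlim_compose[OF filterlim_compose[OF s \<tau>_lim] \<tau>'_lim])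
    show "AE z in lebesgue_on domT. \<rho> (snd (snd z)) \<noteq> 0 \<longrightarrow> (\<lambda>k. W (s (\<tau> (\<tau>' k))) z) \<longlonglongrightarrow> U z"
      using lim_\<tau> by eventually_elim (auto simp: case_prod_beta' intro: filterlim_compose[OF _ \<tau>'_lim])
    show "AE p in lebesgue_on dom0. \<rho> (snd p) \<noteq> 0 \<longrightarrow> (\<lambda>k. W0 (s (\<tau> (\<tau>' k))) p) \<longlonglongrightarrow> U0 p"
      using lim_\<tau>' by eventually_elim (simp add: case_prod_beta')
  qed (rule pos)
qed

locale weighted_entropy_pair = convex_entropy_pair K S r F DF \<eta> D\<eta> H\<eta> Q + parameter_weight \<rho>
  for K S r F DF \<eta> D\<eta> H\<eta> Q and \<rho> :: "real^'n \<Rightarrow> real"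
begin

lemma viscous_section_of_classical:
  fixes W :: "real \<times> real \<times> (real^'n) \<Rightarrow> real^2" and \<phi> :: "real \<times> real \<times> (real^'n) \<Rightarrow> real"
  assumes visc: "classical_viscous_sol F r \<epsilon> \<nu> W0 W" and \<epsilon>: "0 < \<epsilon>" and \<nu>: "0 < \<nu>" and y: "y \<in> Gam"
    and W: "\<And>z. z \<in> domT \<Longrightarrow> W z \<in> S" "\<And>p. p \<in> dom0 \<Longrightarrow> W0 p \<in> S"
    and \<phi>: "smooth \<phi>" "\<And>z. z \<in> domT0 \<Longrightarrow> 0 \<le> \<phi> z"
    and support: "\<And>x t. 0 \<le> t \<Longrightarrow> R \<le> \<bar>x\<bar> \<or> R \<le> t \<Longrightarrow> \<phi> (x, t, y) = 0"
      "\<And>x t. 0 < t \<Longrightarrow> R \<le> \<bar>x\<bar> \<Longrightarrow> dx \<phi> (x, t, y) = 0" "0 < R"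
  obtains wt wx wxx where "viscous_section K S r F DF \<eta> D\<eta> H\<eta> Q (\<lambda>(x, t). W (x, t, y)) wt wx wxx
    (\<lambda>(x, t). \<phi> (x, t, y)) (\<lambda>(x, t). dt \<phi> (x, t, y)) (\<lambda>(x, t). dx \<phi> (x, t, y)) (\<lambda>(x, t). dx (dx \<phi>) (x, t, y)) \<epsilon> \<nu> R"
    "\<And>x. W (x, 0, y) = W0 (x, y)"
proof -
  from bspec[OF visc[unfolded classical_viscous_sol_def] y] obtain wt wx wxx :: "real \<times> real \<Rightarrow> real^2"
    where initial: "\<forall>x. W (x, 0, y) = W0 (x, y)"
      and continuous: "continuous_on (UNIV \<times> {0..}) (\<lambda>(x, t). W (x, t, y))" "continuous_on (UNIV \<times> {0<..}) wt"
      and classical: "\<forall>x. \<forall>t>0. ((\<lambda>s. W (x, s, y)) has_vector_derivative wt (x, t)) (at t) \<and>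
        ((\<lambda>s. W (s, t, y)) has_vector_derivative wx (x, t)) (at x) \<and>
        ((\<lambda>s. wx (s, t)) has_vector_derivative wxx (x, t)) (at x) \<and>
        wt (x, t) + vector_derivative (\<lambda>s. F (W (s, t, y))) (at x)
          + (1 / \<epsilon>) *\<^sub>R st 0 (r (W (x, t, y))) = \<nu> *\<^sub>R wxx (x, t)"
    by (elim conjE exE) (rule that)
  have slice: "continuous_on UNIV (\<lambda>(x, t). g (x, t, y))" if "smooth g" for g :: "real \<times> real \<times> (real^'n) \<Rightarrow> real"
    unfolding case_prod_beta
    by (rule continuous_on_compose2[OF smooth_imp_continuous_on[OF that, of UNIV]]) (auto intro!: continuous_intros)
  have mem: "W (x, t, y) \<in> S" if "0 \<le> t" for x t
    using that W(1)[of "(x, t, y)"] W(2)[of "(x, y)"] initial y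
    by (cases "t = 0") (auto simp: domT_def dom0_def)
  have "viscous_section K S r F DF \<eta> D\<eta> H\<eta> Q (\<lambda>(x, t). W (x, t, y)) wt wx wxx
    (\<lambda>(x, t). \<phi> (x, t, y)) (\<lambda>(x, t). dt \<phi> (x, t, y)) (\<lambda>(x, t). dx \<phi> (x, t, y)) (\<lambda>(x, t). dx (dx \<phi>) (x, t, y)) \<epsilon> \<nu> R"
    using continuous classical mem \<epsilon> \<nu> support y \<phi> slice smooth_partial_derivatives[OF \<phi>(1)]
      smooth_partial_derivatives[OF smooth_dx[OF \<phi>(1)]]
    by unfold_locales (auto simp: domT0_def smooth_dx smooth_dt)
  then show ?thesis using initial by (intro that) auto
qed

lemma viscous_slice_entropy_inequality:
  fixes W :: "real \<times> real \<times> (real^'n) \<Rightarrow> real^2" and \<phi> :: "real \<times> real \<times> (real^'n) \<Rightarrow> real"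
  assumes W: "classical_viscous_sol F r \<epsilon> \<nu> W0 W" "0 < \<epsilon>" "0 < \<nu>"
      "\<And>z. z \<in> domT \<Longrightarrow> W z \<in> S" "\<And>p. p \<in> dom0 \<Longrightarrow> W0 p \<in> S"
    and \<phi>: "test_fun domT0 \<phi>" "\<And>z. z \<in> domT0 \<Longrightarrow> 0 \<le> \<phi> z"
  shows "0 \<le> (LINT t|lebesgue. LINT x|lebesgue. indicator domT (x, t, y) *\<^sub>R
      ((\<eta> (W (x, t, y)) * dt \<phi> (x, t, y) + (Q (W (x, t, y)) * dx \<phi> (x, t, y)
          + \<nu> * (\<eta> (W (x, t, y)) * dx (dx \<phi>) (x, t, y)))) * \<rho> y))
    + (LINT x|lebesgue. indicator dom0 (x, y) *\<^sub>R (\<eta> (W0 (x, y)) * \<phi> (x, 0, y) * \<rho> y))"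
proof (cases "y \<in> Gam")
  case False
  then show ?thesis by (simp add: domT_def dom0_def)
next
  case y: True
  obtain R where R: "0 < R" "\<And>x t y. 0 \<le> t \<Longrightarrow> y \<in> Gam \<Longrightarrow> R \<le> \<bar>x\<bar> \<or> R \<le> t \<Longrightarrow> \<phi> (x, t, y) = 0"
    "\<And>x t y. 0 < t \<Longrightarrow> y \<in> Gam \<Longrightarrow> R \<le> \<bar>x\<bar> \<or> R \<le> t \<Longrightarrow>
       dt \<phi> (x, t, y) = 0 \<and> dx \<phi> (x, t, y) = 0 \<and> dx (dx \<phi>) (x, t, y) = 0"
    using test_fun_support[OF \<phi>(1)] by blast
  have smooth: "smooth \<phi>" using \<phi>(1) by (simp add: test_fun_def)
  have support: "\<phi> (x, t, y) = 0" if "0 \<le> t" "R \<le> \<bar>x\<bar> \<or> R \<le> t" for x t using R(2) that y by blast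
  have support_dx: "dx \<phi> (x, t, y) = 0" if "0 < t" "R \<le> \<bar>x\<bar>" for x t using R(3) that y by blast
  obtain wt wx wxx where "viscous_section K S r F DF \<eta> D\<eta> H\<eta> Q (\<lambda>(x, t). W (x, t, y)) wt wx wxx
      (\<lambda>(x, t). \<phi> (x, t, y)) (\<lambda>(x, t). dt \<phi> (x, t, y)) (\<lambda>(x, t). dx \<phi> (x, t, y)) (\<lambda>(x, t). dx (dx \<phi>) (x, t, y)) \<epsilon> \<nu> R"
    and initial: "\<And>x. W (x, 0, y) = W0 (x, y)"
    using viscous_section_of_classical[OF W(1-3) y W(4,5) smooth \<phi>(2) support support_dx R(1)] by blast
  then interpret viscous_section K S r F DF \<eta> D\<eta> H\<eta> Q "\<lambda>(x, t). W (x, t, y)" wt wx wxx "\<lambda>(x, t). \<phi> (x, t, y)"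
    "\<lambda>(x, t). dt \<phi> (x, t, y)" "\<lambda>(x, t). dx \<phi> (x, t, y)" "\<lambda>(x, t). dx (dx \<phi>) (x, t, y)" \<epsilon> \<nu> R by simp
  have source: "\<eta> (W (x, t, y)) * dt \<phi> (x, t, y)
      + (Q (W (x, t, y)) * dx \<phi> (x, t, y) + \<nu> * (\<eta> (W (x, t, y)) * dx (dx \<phi>) (x, t, y))) = entropy_source t x" for x t
    by (simp add: entropy_source_def)
  have indicators: "indicator domT (x, t, y) = indicat_real {0<..} t" "indicator dom0 (x, y) = (1::real)" for x t
    using y by (simp_all add: domT_def dom0_def indicator_def)
  have source_support: "entropy_source t x = 0" if "0 < t" "R \<le> \<bar>x\<bar> \<or> R \<le> t" for t x
    using R(3)[OF that(1) y that(2)] by (simp add: entropy_source_def)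
  have "0 \<le> (LINT t|lebesgue. LINT x|lebesgue. indicator {0<..} t * entropy_source t x)
      + (LINT x|lebesgue. \<eta> (W0 (x, y)) * \<phi> (x, 0, y))"
    using section_entropy_inequality_LINT[OF source_support] by (simp add: initial)
  then show ?thesis
    unfolding source indicators using weight_nonneg[OF y]
    by (simp add: distrib_right[symmetric] mult.assoc[symmetric])
qed

lemma viscous_entropy_inequality:
  fixes W :: "real \<times> real \<times> (real^'n) \<Rightarrow> real^2"
  assumes W: "classical_viscous_sol F r \<epsilon> \<nu> W0 W" "0 < \<epsilon>" "0 < \<nu>"
      "\<And>z. z \<in> domT \<Longrightarrow> W z \<in> S" "\<And>p. p \<in> dom0 \<Longrightarrow> W0 p \<in> S"
    and measurable: "W \<in> borel_measurable (lebesgue_on domT)" "W0 \<in> borel_measurable (lebesgue_on dom0)"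
    and \<phi>: "test_fun domT0 \<phi>" "\<And>z. z \<in> domT0 \<Longrightarrow> 0 \<le> \<phi> z"
  shows "0 \<le> weak_form (\<lambda>z. \<eta> (W z)) (\<lambda>z. Q (W z)) \<phi>
    + \<nu> * (LINT z|lebesgue_on domT. \<eta> (W z) * (dx (dx \<phi>) z * \<rho> (snd (snd z)))) + initial_form (\<lambda>p. \<eta> (W0 p)) \<phi>"
proof -
  let ?\<rho> = "\<lambda>z :: real \<times> real \<times> (real^'n). \<rho> (snd (snd z))"
  let ?source = "\<lambda>z. \<eta> (W z) * dt \<phi> z + (Q (W z) * dx \<phi> z + \<nu> * (\<eta> (W z) * dx (dx \<phi>) z))"
  have mem: "AE z in lebesgue_on domT. W z \<in> S" "AE p in lebesgue_on dom0. W0 p \<in> S"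
    using W(4,5) by (auto simp: AE_lebesgue_on_iff_lborel)
  note integrable = integrable_compose_weighted[OF domains_lebesgue(1) compact_states _ measurable(1) mem(1)]
  have parts: "integrable (lebesgue_on domT) (\<lambda>z. \<eta> (W z) * (dt \<phi> z * ?\<rho> z))"
    "integrable (lebesgue_on domT) (\<lambda>z. Q (W z) * (dx \<phi> z * ?\<rho> z))"
    "integrable (lebesgue_on domT) (\<lambda>z. \<eta> (W z) * (dx (dx \<phi>) z * ?\<rho> z))"
    by (rule integrable continuous_entropy integrable_test_fun \<phi>)+
  note has_bochner_integral_add[OF has_bochner_integral_add[OF parts(1,2)[THEN has_bochner_integral_integrable]]
      has_bochner_integral_mult_right[of \<nu>, OF has_bochner_integral_integrable[OF parts(3)]]]
  then have "has_bochner_integral (lebesgue_on domT) (\<lambda>z. ?source z * ?\<rho> z)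
      (weak_form (\<lambda>z. \<eta> (W z)) (\<lambda>z. Q (W z)) \<phi> + \<nu> * (LINT z|lebesgue_on domT. \<eta> (W z) * (dx (dx \<phi>) z * ?\<rho> z)))"
    unfolding weak_form_split[OF parts(1,2)] by (simp add: algebra_simps)
  then have source: "has_bochner_integral lebesgue (\<lambda>z. indicator domT z *\<^sub>R (?source z * ?\<rho> z))
      (weak_form (\<lambda>z. \<eta> (W z)) (\<lambda>z. Q (W z)) \<phi> + \<nu> * (LINT z|lebesgue_on domT. \<eta> (W z) * (dx (dx \<phi>) z * ?\<rho> z)))"
    by (subst (asm) has_bochner_integral_restrict_space) simp_all
  have "integrable (lebesgue_on dom0) (\<lambda>p. \<eta> (W0 p) * (\<phi> (fst p, 0, snd p) * \<rho> (snd p)))"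
    by (rule integrable_compose_weighted[OF domains_lebesgue(2) compact_states _ measurable(2) mem(2)]
        continuous_entropy
        integrable_test_fun \<phi>)+
  then have "has_bochner_integral (lebesgue_on dom0) (\<lambda>p. \<eta> (W0 p) * \<phi> (fst p, 0, snd p) * \<rho> (snd p))
      (initial_form (\<lambda>p. \<eta> (W0 p)) \<phi>)"
    unfolding initial_form_def by (intro has_bochner_integral_integrable) (simp add: mult.assoc)
  then have initial: "has_bochner_integral lebesgue
      (\<lambda>p. indicator dom0 p *\<^sub>R (\<eta> (W0 p) * \<phi> (fst p, 0, snd p) * \<rho> (snd p))) (initial_form (\<lambda>p. \<eta> (W0 p)) \<phi>)"
    by (subst (asm) has_bochner_integral_restrict_space) simp_all
  note has_bochner_integral_add[OF lebesgue_Fubini[OF lebesgue_Fubini[OF source]] lebesgue_Fubini[OF initial]]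
  from has_bochner_integral_integral_eq[OF this, symmetric] show ?thesis
    by (simp only:) (rule Bochner_Integration.integral_nonneg, use viscous_slice_entropy_inequality[OF W \<phi>] in simp)
qed

lemma entropy_inequality_vanishing_viscosity:
  fixes U :: "real \<times> real \<times> (real^'n) \<Rightarrow> real^2"
  assumes \<epsilon>: "0 < \<epsilon>"
    and W: "\<And>\<nu>. 0 < \<nu> \<Longrightarrow> smooth_on dom0 (W0 \<nu>)" "\<And>\<nu>. 0 < \<nu> \<Longrightarrow> W \<nu> \<in> borel_measurable (lebesgue_on domT)"
      "\<And>\<nu>. 0 < \<nu> \<Longrightarrow> classical_viscous_sol F r \<epsilon> \<nu> (W0 \<nu>) (W \<nu>)"
      "\<And>\<nu> p. 0 < \<nu> \<Longrightarrow> p \<in> dom0 \<Longrightarrow> W0 \<nu> p \<in> S" "\<And>\<nu> z. 0 < \<nu> \<Longrightarrow> z \<in> domT \<Longrightarrow> W \<nu> z \<in> S"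
    and lim: "tendsto_Lp_loc 1 (\<lambda>(x, y). \<rho> y) dom0 W0 U0 (at_right 0)"
      "tendsto_Lp_loc 1 (\<lambda>(x, t, y). (\<rho> y)\<^sup>2) domT W U (at_right 0)"
    and U: "U \<in> borel_measurable (lebesgue_on domT)" "AE z in lebesgue_on domT. U z \<in> S"
    and U0: "U0 \<in> borel_measurable (lebesgue_on dom0)" "AE p in lebesgue_on dom0. U0 p \<in> S"
    and \<phi>: "test_fun domT0 \<phi>" "\<And>z. z \<in> domT0 \<Longrightarrow> 0 \<le> \<phi> z"
  shows "0 \<le> weak_form (\<lambda>z. \<eta> (U z)) (\<lambda>z. Q (U z)) \<phi> + initial_form (\<lambda>p. \<eta> (U0 p)) \<phi>"
proof -
  obtain s where s_lim: "s \<longlonglongrightarrow> 0" and s: "\<And>i. 0 < s i"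
    and lim_U: "AE z in lebesgue_on domT. \<rho> (snd (snd z)) \<noteq> 0 \<longrightarrow> (\<lambda>i. W (s i) z) \<longlonglongrightarrow> U z"
    and lim_U0: "AE p in lebesgue_on dom0. \<rho> (snd p) \<noteq> 0 \<longrightarrow> (\<lambda>i. W0 (s i) p) \<longlonglongrightarrow> U0 p"
    by (rule AE_convergent_viscosities[OF W(1,2) lim U(1) U0(1)]) blast+
  have W0_measurable: "W0 (s i) \<in> borel_measurable (lebesgue_on dom0)" for i
    by (rule smooth_on_borel_measurable[OF W(1)[OF s]]) simp
  have mem: "AE z in lebesgue_on domT. W (s i) z \<in> S" "AE p in lebesgue_on dom0. W0 (s i) p \<in> S" for i
    using W(4,5)[OF s] by (auto simp: AE_lebesgue_on_iff_lborel)
  note lim_weak_form = weak_form_compose_tendsto[OF \<phi>(1) compact_states _ _ W(2)[OF s] mem(1) U lim_U]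
    and lim_initial = initial_form_compose_tendsto[OF \<phi>(1) compact_states continuous_entropy(1) W0_measurable
        mem(2) U0 lim_U0]
  have "(\<lambda>i. LINT z|lebesgue_on domT. \<eta> (W (s i) z) * (dx (dx \<phi>) z * \<rho> (snd (snd z))))
      \<longlonglongrightarrow> (LINT z|lebesgue_on domT. \<eta> (U z) * (dx (dx \<phi>) z * \<rho> (snd (snd z))))"
    using lim_U
    by (intro LINT_compose_weighted_tendsto[OF _ compact_states continuous_entropy(1) W(2)[OF s] mem(1) U]
        integrable_test_fun \<phi>(1)) (auto elim!: eventually_mono)
  from tendsto_add[OF tendsto_add[OF lim_weak_form[OF continuous_entropy(1,3)] tendsto_mult[OF s_lim this]] lim_initial]
  show ?thesis
    using viscous_entropy_inequality[OF W(3)[OF s] \<epsilon> s(1) W(5)[OF s] W(4)[OF s] W(2)[OF s] W0_measurable \<phi>]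
    by (auto intro: LIMSEQ_le_const)
qed

end

subsection \<open>Attainment of the initial data\<close>

lemma has_bochner_integral_lebesgue_on_subset:
  fixes g :: "'a::euclidean_space \<Rightarrow> real"
  assumes "A \<in> sets lebesgue" "S \<in> sets lebesgue" "A \<subseteq> S"
  shows "has_bochner_integral (lebesgue_on S) (\<lambda>z. indicator A z * g z) c \<longleftrightarrow> has_bochner_integral (lebesgue_on A) g c"
proof -
  have "indicat_real S z *\<^sub>R (indicator A z * g z) = indicat_real A z *\<^sub>R g z" for z
    using assms(3) by (auto simp: indicator_def)
  then show ?thesis using assms(1,2) by (simp only: has_bochner_integral_restrict_space sets.Int sets.top)
qed

lemma integral_dominated_nonneg:
  fixes f g :: "'a \<Rightarrow> real"
  assumes f: "f \<in> borel_measurable M" "AE x in M. 0 \<le> f x" and g: "AE x in M. f x \<le> g x" "has_bochner_integral M g c"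
  shows "integrable M f" and "integral\<^sup>L M f \<le> c"
proof -
  have g_integral: "integrable M g" "integral\<^sup>L M g = c" using g(2) by (simp_all add: has_bochner_integral_iff)
  show integrable: "integrable M f"
  proof (rule Bochner_Integration.integrable_bound[OF g_integral(1) f(1)])
    show "AE x in M. norm (f x) \<le> norm (g x)" using f(2) g(1) by eventually_elim simp
  qed
  show "integral\<^sup>L M f \<le> c" using integral_mono_AE[OF integrable g_integral(1) g(1)] g_integral(2) by simp
qed

lemma has_bochner_integral_domT_product:
  fixes b :: "real \<times> (real^'n) \<Rightarrow> real"
  assumes k: "has_bochner_integral lborel (\<lambda>t. indicat_real {0<..} t * k t) ck"
    and b: "has_bochner_integral (lebesgue_on dom0) b cb"
  shows "has_bochner_integral (lebesgue_on domT) (\<lambda>z. k (fst (snd z)) * b (drop_middle z)) (ck * cb)"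
proof -
  have "has_bochner_integral lebesgue (\<lambda>p. indicat_real dom0 p * b p) cb"
    using b by (simp add: has_bochner_integral_restrict_space)
  note has_bochner_integral_lebesgue_insert_middle[OF k this]
  moreover have "indicat_real {0<..} (fst (snd z)) * indicat_real dom0 (drop_middle z) = indicat_real domT z"
    for z :: "real \<times> real \<times> (real^'n)"
    by (cases z) (auto simp: domT_def dom0_def indicator_def)
  then have "indicat_real {0<..} (fst (snd z)) * k (fst (snd z))
      * (indicat_real dom0 (drop_middle z) * b (drop_middle z))
      = indicat_real domT z *\<^sub>R (k (fst (snd z)) * b (drop_middle z))" for z
    by (metis (no_types, opaque_lifting) mult.assoc mult.left_commute real_scaleR_def)
  ultimately show ?thesis by (simp add: has_bochner_integral_restrict_space)
qed

lemma has_bochner_integral_layer_density: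
  assumes T: "0 < T"
  shows "has_bochner_integral lborel (\<lambda>t. indicat_real {0<..} t * (flat_exp 2 (2 - t / T) / T)) (bump 2)"
proof -
  let ?k = "\<lambda>t. flat_exp 2 (2 - t / T) / T"
  have "has_bochner_integral lborel (\<lambda>t. ?k t * indicator {0..2 * T} t)
      (- bump (2 - (2 * T) / T) - (- bump (2 - 0 / T)))"
  proof (rule has_bochner_integral_FTC_Icc_real)
    show "((\<lambda>t. - bump (2 - t / T)) has_real_derivative ?k t) (at t)" for t
      unfolding has_field_derivative_def
      by (rule has_derivative_eq_rhs) (use T in \<open>auto intro!: derivative_eq_intros\<close>)
    show "isCont ?k t" for t
      by (rule continuous_on_interior[of UNIV]) (use T in \<open>auto intro!: continuous_on_divide
          continuous_on_flat_exp_compose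
          continuous_on_diff\<close>)
  qed (use T in simp)
  then have "has_bochner_integral lborel (\<lambda>t. ?k t * indicator {0..2 * T} t) (bump 2)"
    using T by (simp add: flat_exp_eq_0)
  moreover have "AE t in lborel. indicat_real {0<..} t * ?k t = ?k t * indicator {0..2 * T} t"
    using AE_lborel_singleton[of 0]
  proof eventually_elim
    case (elim t)
    have "2 * T < t \<Longrightarrow> ?k t = 0" using T by (simp add: flat_exp_eq_0 field_simps)
    with elim show ?case by (auto simp: indicator_def)
  qed
  ultimately show ?thesis by (subst has_bochner_integral_cong_AE) auto
qed

lemma has_bochner_integral_layer_cutoff:
  assumes T: "0 < T"
  obtains c where "has_bochner_integral lborel (\<lambda>t. indicat_real {0<..} t * bump (2 - t / T)) c" "0 \<le> c" "c \<le> 2 * T"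
proof -
  let ?k = "\<lambda>t. indicat_real {0<..} t * bump (2 - t / T)"
  have "2 * T < t \<Longrightarrow> bump (2 - t / T) = 0" for t using T by (simp add: flat_exp_eq_0 field_simps)
  then have bounds: "0 \<le> ?k t" "?k t \<le> indicat_real {0..2 * T} t" for t
    using bump_less_1[of "2 - t / T"] flat_exp_nonneg[of 0 "2 - t / T"]
    by (auto simp: indicator_def not_le less_imp_le)
  have "has_bochner_integral lborel (indicat_real {0..2 * T}) (2 * T)"
    using has_bochner_integral_real_indicator[of "{0..2 * T}" lborel] T by simp
  from integral_dominated_nonneg[OF _ AE_I2[OF bounds(1)] AE_I2[OF bounds(2)] this]
  have "integrable lborel ?k" "(LINT t|lborel. ?k t) \<le> 2 * T" by simp_all
  then show ?thesis
    using has_bochner_integral_integrable[of lborel ?k] bounds(1) by (intro that) auto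
qed

definition layer_test_fun :: "real \<Rightarrow> (real \<times> (real^'n) \<Rightarrow> real) \<Rightarrow> real \<times> real \<times> (real^'n) \<Rightarrow> real" where
  "layer_test_fun T g z = bump (2 - fst (snd z) / T) * g (drop_middle z)"

lemma layer_test_fun_partial_derivatives:
  fixes g :: "real \<times> (real^'n) \<Rightarrow> real"
  assumes g: "smooth g" and T: "0 < T"
  shows "dt (layer_test_fun T g) z = - (flat_exp 2 (2 - fst (snd z) / T) / T * g (drop_middle z))"
    and "dx (layer_test_fun T g) z = bump (2 - fst (snd z) / T) * frechet_derivative g (at (drop_middle z)) (1, 0)"
proof -
  let ?g' = "frechet_derivative g (at (drop_middle z))"
  have "((\<lambda>z. g (drop_middle z)) has_derivative (\<lambda>h. ?g' (drop_middle h))) (at z)"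
    using has_derivative_compose[OF bounded_linear_imp_has_derivative[OF bounded_linear_drop_middle]
        smooth_has_derivative[OF g]] .
  moreover have "((\<lambda>z::real \<times> real \<times> (real^'n). 2 - fst (snd z) / T) has_derivative (\<lambda>h. - (fst (snd h) / T))) (at z)"
    using T by (auto intro!: derivative_eq_intros)
  ultimately have "(layer_test_fun T g has_derivative (\<lambda>h. bump (2 - fst (snd z) / T) * ?g' (drop_middle h)
      + (- (fst (snd h) / T) * flat_exp 2 (2 - fst (snd z) / T)) * g (drop_middle z))) (at z)"
    unfolding layer_test_fun_def[abs_def] by (intro has_derivative_mult has_derivative_bump_compose)
  note derivative = frechet_derivative_at[OF this, symmetric]
  have "?g' 0 = 0" by (rule linear_0[OF has_derivative_linear[OF smooth_has_derivative[OF g]]])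
  then show "dt (layer_test_fun T g) z = - (flat_exp 2 (2 - fst (snd z) / T) / T * g (drop_middle z))"
    unfolding dt_def derivative by (simp add: zero_prod_def)
  show "dx (layer_test_fun T g) z = bump (2 - fst (snd z) / T) * ?g' (1, 0)"
    unfolding dx_def derivative by simp
qed

lemma test_fun_layer:
  fixes g :: "real \<times> (real^'n) \<Rightarrow> real"
  assumes g: "smooth g" "\<And>x y. R \<le> \<bar>x\<bar> \<Longrightarrow> g (x, y) = 0" and T: "0 < T"
  shows "test_fun domT0 (layer_test_fun T g)"
proof -
  let ?C = "{-R..R} \<times> {0..2 * T} \<times> (Gam :: (real^'n) set)"
  have "smooth (\<lambda>z::real \<times> real \<times> (real^'n). 2 - fst (snd z) * (1 / T))"
    by (intro smooth_diff smooth_const smooth_mult smooth_compose[OF smooth_fst smooth_snd])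
  from smooth_mult[OF smooth_compose[OF smooth_flat_exp[of 0] this]
      smooth_compose[OF g(1) smooth_bounded_linear[OF bounded_linear_drop_middle]]]
  have "smooth (layer_test_fun T g)" unfolding layer_test_fun_def[abs_def] by simp
  moreover have "layer_test_fun T g z = 0" if "z \<in> domT0 - ?C" for z
  proof -
    obtain x t y where z: "z = (x, t, y)" by (cases z) auto
    have "R \<le> \<bar>x\<bar> \<or> 2 * T < t" using that unfolding z domT0_def by auto
    moreover have "bump (2 - t / T) = 0" if "2 * T < t" using that T by (simp add: flat_exp_eq_0 field_simps)
    ultimately show ?thesis using g(2) by (auto simp: z layer_test_fun_def)
  qed
  moreover have "compact ?C" by (intro compact_Times compact_Gam) auto
  moreover have "?C \<subseteq> domT0" by (auto simp: domT0_def)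
  ultimately show ?thesis unfolding test_fun_def by blast
qed

definition space_cutoff :: "real \<Rightarrow> real \<times> (real^'n) \<Rightarrow> real" where
  "space_cutoff R p = bump (R\<^sup>2 - (fst p)\<^sup>2)"

lemma space_cutoff_bounds: "0 \<le> space_cutoff R p" "space_cutoff R p \<le> 1"
  by (simp_all add: space_cutoff_def flat_exp_nonneg bump_less_1 less_imp_le)

lemma space_cutoff_eq_0: "0 \<le> R \<Longrightarrow> R \<le> \<bar>x\<bar> \<Longrightarrow> space_cutoff R (x, y) = 0"
  by (simp add: space_cutoff_def flat_exp_eq_0 abs_le_square_iff[symmetric])

lemma smooth_space_cutoff: "smooth (space_cutoff R)"
proof -
  have "smooth (\<lambda>p::real \<times> (real^'n). R\<^sup>2 - fst p * fst p)"
    by (intro smooth_diff smooth_const smooth_mult smooth_fst)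
  from smooth_compose[OF smooth_flat_exp[of 0] this] show ?thesis
    unfolding space_cutoff_def[abs_def] power2_eq_square .
qed

lemma distance_le_relative_entropy:
  fixes l l' :: "real \<Rightarrow> real"
  assumes J: "compact J" "continuous_on J l" "continuous_on J l'"
    and above_tangent: "\<And>a b. a \<in> J \<Longrightarrow> b \<in> J \<Longrightarrow> a \<noteq> b \<Longrightarrow> l b + l' b * (a - b) < l a" and \<alpha>: "0 < \<alpha>"
  obtains c where "0 \<le> c" "\<And>a b. a \<in> J \<Longrightarrow> b \<in> J \<Longrightarrow> \<bar>a - b\<bar> \<le> \<alpha> + c * (l a - l b - l' b * (a - b))"
proof -
  define A where "A = (J \<times> J) \<inter> {q. \<alpha> \<le> \<bar>fst q - snd q\<bar>}"
  define entropy where "entropy q = l (fst q) - l (snd q) - l' (snd q) * (fst q - snd q)" for q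
  have compact: "compact A"
    unfolding A_def by (intro compact_Int_closed compact_Times J(1) closed_Collect_le continuous_intros)
  have entropy_pos: "0 < entropy q" if "q \<in> A" for q
    using above_tangent[of "fst q" "snd q"] that \<alpha> by (force simp: A_def entropy_def)
  have "continuous_on A (\<lambda>q. \<bar>fst q - snd q\<bar> / entropy q)"
    using entropy_pos unfolding entropy_def
    by (intro continuous_intros continuous_on_compose2[OF J(2)] continuous_on_compose2[OF J(3)])
       (auto simp: A_def less_imp_neq[symmetric])
  with compact obtain c where c: "0 \<le> c" "\<And>q. q \<in> A \<Longrightarrow> \<bar>\<bar>fst q - snd q\<bar> / entropy q\<bar> \<le> c"
    by (rule compact_continuous_abs_bound) blast
  show ?thesis
  proof (rule that[OF c(1)])
    fix a b assume ab: "a \<in> J" "b \<in> J"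
    show "\<bar>a - b\<bar> \<le> \<alpha> + c * (l a - l b - l' b * (a - b))"
    proof (cases "(a, b) \<in> A")
      case True
      with c(2)[OF True] entropy_pos[OF True] have "\<bar>a - b\<bar> \<le> c * (l a - l b - l' b * (a - b))"
        by (simp add: entropy_def abs_of_pos field_simps)
      then show ?thesis using \<alpha> by linarith
    next
      case False
      have "0 \<le> c * (l a - l b - l' b * (a - b))"
        using above_tangent[OF ab] c(1) by (cases "a = b") (auto intro!: mult_nonneg_nonneg)
      with False show ?thesis using ab by (simp add: A_def)
    qed
  qed
qed

lemma tendsto_0_at_right_of_linear_bound:
  fixes f :: "real \<Rightarrow> real"
  assumes nonneg: "\<And>T. 0 < T \<Longrightarrow> 0 \<le> f T" and bound: "\<And>e. 0 < e \<Longrightarrow> \<exists>C. \<forall>T>0. f T \<le> C * T + e"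
  shows "(f \<longlongrightarrow> 0) (at_right 0)"
proof (rule tendstoI)
  fix e :: real assume "0 < e"
  then obtain C where C: "\<And>T. 0 < T \<Longrightarrow> f T \<le> C * T + e / 2" using bound[of "e / 2"] by auto
  have "((\<lambda>T. C * T) \<longlongrightarrow> C * 0) (at_right 0)" by (intro tendsto_intros)
  then have "\<forall>\<^sub>F T in at_right 0. C * T < e / 2" using \<open>0 < e\<close> by (intro order_tendstoD(2)) auto
  moreover have "\<forall>\<^sub>F T::real in at_right 0. 0 < T" by (rule eventually_at_right_less)
  ultimately show "\<forall>\<^sub>F T in at_right 0. dist (f T) 0 < e"
  proof eventually_elim
    case (elim T)
    then show ?case using C[of T] nonneg[of T] by (simp add: dist_real_def)
  qed
qed

context parameter_weight
begin

definition layer_kernel :: "real \<Rightarrow> (real \<times> (real^'n) \<Rightarrow> real) \<Rightarrow> real \<times> real \<times> (real^'n) \<Rightarrow> real" where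
  "layer_kernel T g z = flat_exp 2 (2 - fst (snd z) / T) / T * (g (drop_middle z) * \<rho> (snd (snd z)))"

lemma layer_kernel_nonneg:
  assumes "\<And>p. 0 \<le> g p" "0 < T" "z \<in> domT"
  shows "0 \<le> layer_kernel T g z"
  using assms unfolding layer_kernel_def domT_def
  by (intro mult_nonneg_nonneg divide_nonneg_nonneg flat_exp_nonneg weight_nonneg) auto

lemma layer_kernel_integral:
  assumes "0 < T" "integrable (lebesgue_on dom0) (\<lambda>p. b p * (g p * \<rho> (snd p)))"
  shows "has_bochner_integral (lebesgue_on domT) (\<lambda>z. b (drop_middle z) * layer_kernel T g z)
    (bump 2 * (LINT p|lebesgue_on dom0. b p * (g p * \<rho> (snd p))))"
  using has_bochner_integral_domT_product[OF has_bochner_integral_layer_density[OF assms(1)]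
      has_bochner_integral_integrable[OF assms(2)]]
  by (simp add: layer_kernel_def drop_middle_def mult_ac)

lemma layer_kernel_integrable:
  assumes "0 < T" "integrable (lebesgue_on dom0) (\<lambda>p. g p * \<rho> (snd p))"
  shows "integrable (lebesgue_on domT) (layer_kernel T g)"
  using layer_kernel_integral[of T "\<lambda>_. 1" g] assms by (simp add: has_bochner_integral_iff)

lemma integrable_x_derivative:
  assumes g: "smooth g" "\<And>x y. R \<le> \<bar>x\<bar> \<Longrightarrow> g (x, y) = 0"
  shows "integrable (lebesgue_on dom0) (\<lambda>p. frechet_derivative g (at p) (1, 0) * \<rho> (snd p))"
proof (rule integrable_dom0_continuous[where R = "R + 1"])
  show "continuous_on UNIV (\<lambda>p. frechet_derivative g (at p) (1, 0))"
    by (intro smooth_imp_continuous_on smooth_frechet_derivative g(1)) (simp add: Basis_prod_def)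
  show "frechet_derivative g (at (x, y)) (1, 0) = 0" if "R + 1 \<le> \<bar>x\<bar>" for x y
  proof -
    have "(g has_derivative (\<lambda>h. 0)) (at (x, y))"
    proof (rule has_derivative_transform_within_open[OF has_derivative_const])
      show "open {p::real \<times> (real^'n). R < \<bar>fst p\<bar>}" by (intro open_Collect_less continuous_intros)
    qed (use that g(2) in auto)
    from frechet_derivative_at[OF this] show ?thesis by metis
  qed
qed

lemma layer_flux_le:
  assumes T: "0 < T" and g: "integrable (lebesgue_on dom0) (\<lambda>p. g p * \<rho> (snd p))"
    and b: "b \<in> borel_measurable (lebesgue_on domT)" "AE z in lebesgue_on domT. \<bar>b z\<bar> \<le> M"
  shows "\<bar>LINT z|lebesgue_on domT. b z * (bump (2 - fst (snd z) / T) * (g (drop_middle z) * \<rho> (snd (snd z))))\<bar>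
    \<le> 2 * \<bar>M\<bar> * (LINT p|lebesgue_on dom0. \<bar>g p * \<rho> (snd p)\<bar>) * T"
proof -
  let ?w = "\<lambda>z::real \<times> real \<times> (real^'n). bump (2 - fst (snd z) / T) * (g (drop_middle z) * \<rho> (snd (snd z)))"
  let ?m = "LINT p|lebesgue_on dom0. \<bar>g p * \<rho> (snd p)\<bar>"
  obtain c where c: "has_bochner_integral lborel (\<lambda>t. indicat_real {0<..} t * bump (2 - t / T)) c" "0 \<le> c" "c \<le> 2 * T"
    by (rule has_bochner_integral_layer_cutoff[OF T])
  have "has_bochner_integral (lebesgue_on domT) ?w (c * (LINT p|lebesgue_on dom0. g p * \<rho> (snd p)))"
    using has_bochner_integral_domT_product[OF c(1) has_bochner_integral_integrable[OF g]]
    by (simp add: drop_middle_def)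
  then have "integrable (lebesgue_on domT) ?w" by (simp add: has_bochner_integral_iff)
  note integrable = integrable_mult_bounded[OF this b]
  have abs_integral: "has_bochner_integral (lebesgue_on domT) (\<lambda>z. \<bar>?w z\<bar>) (c * ?m)"
    using has_bochner_integral_domT_product[OF c(1) has_bochner_integral_integrable[OF integrable_abs[OF g]]]
    by (simp add: drop_middle_def abs_mult abs_of_nonneg[OF flat_exp_nonneg])
  have "\<bar>LINT z|lebesgue_on domT. b z * ?w z\<bar> \<le> (LINT z|lebesgue_on domT. \<bar>b z * ?w z\<bar>)"
    by (rule integral_abs_bound)
  also have "\<dots> \<le> (LINT z|lebesgue_on domT. \<bar>M\<bar> * \<bar>?w z\<bar>)"
  proof (rule integral_mono_AE)
    show "AE z in lebesgue_on domT. \<bar>b z * ?w z\<bar> \<le> \<bar>M\<bar> * \<bar>?w z\<bar>"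
      using b(2) by eventually_elim (auto simp: abs_mult[of "b _"] intro!: mult_right_mono)
  qed (use integrable abs_integral in \<open>auto simp: has_bochner_integral_iff\<close>)
  also have "\<dots> = \<bar>M\<bar> * (c * ?m)"
    using abs_integral by (simp add: has_bochner_integral_iff)
  also have "\<dots> \<le> \<bar>M\<bar> * (2 * T * ?m)"
    using c by (intro mult_left_mono mult_right_mono) auto
  finally show ?thesis by (simp add: mult_ac)
qed

lemma slab_distance_integral:
  fixes u :: "real \<times> real \<times> (real^'n) \<Rightarrow> real" and u0 :: "real \<times> (real^'n) \<Rightarrow> real" and T :: real
  assumes V: "V \<in> sets lebesgue" "bounded V"
    and u: "u \<in> borel_measurable (lebesgue_on domT)" "AE z in lebesgue_on domT. \<bar>u z\<bar> \<le> M"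
    and u0: "u0 \<in> borel_measurable (lebesgue_on dom0)" "AE p in lebesgue_on dom0. \<bar>u0 p\<bar> \<le> M0"
  defines "A \<equiv> V \<times> {0<..<T} \<times> (Gam :: (real^'n) set)"
  shows "has_bochner_integral (lebesgue_on domT) (\<lambda>z. indicator A z * (\<bar>u z - u0 (drop_middle z)\<bar> * \<rho> (snd (snd z))))
    (LINT (x, t, y)|lebesgue_on A. norm (u (x, t, y) - u0 (x, y)) * \<rho> y)"
proof -
  have A: "A \<in> sets lebesgue" "A \<subseteq> domT"
    unfolding A_def using time_slab_lebesgue[OF V(1)] by (auto simp: domT_def)
  have "bounded A" unfolding A_def by (intro bounded_Times V(2) compact_imp_bounded[OF compact_Gam]) auto
  then have "integrable (lebesgue_on domT) (indicat_real A)"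
    using A by (intro integrable_lebesgue_on_bounded_support[of _ _ A 1])
        (auto simp: sets_restrict_space_iff intro!: borel_measurable_indicator)
  then have weight: "integrable (lebesgue_on domT) (\<lambda>z. indicator A z * \<rho> (snd (snd z)))"
    by (rule integrable_domT_weighted)
  have "(\<lambda>z. \<bar>u z - u0 (drop_middle z)\<bar>) \<in> borel_measurable (lebesgue_on domT)"
    using u(1) borel_measurable_lift_dom0[OF u0(1)] by measurable
  moreover have "AE z in lebesgue_on domT. \<bar>\<bar>u z - u0 (drop_middle z)\<bar>\<bar> \<le> M + M0"
    using u(2) AE_lift_dom0[OF u0(2)] by eventually_elim simp
  ultimately have "integrable (lebesgue_on domT) (\<lambda>z. \<bar>u z - u0 (drop_middle z)\<bar> * (indicator A z * \<rho> (snd (snd z))))"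
    by (rule integrable_mult_bounded[OF weight])
  then have "integrable (lebesgue_on domT) (\<lambda>z. indicator A z * (\<bar>u z - u0 (drop_middle z)\<bar> * \<rho> (snd (snd z))))"
    by (simp only: mult.left_commute)
  note integral = has_bochner_integral_integrable[OF this]
  have "(\<lambda>(x, t, y). norm (u (x, t, y) - u0 (x, y)) * \<rho> y) = (\<lambda>z. \<bar>u z - u0 (drop_middle z)\<bar> * \<rho> (snd (snd z)))" by auto
  with integral has_bochner_integral_integral_eq[OF integral[unfolded
      has_bochner_integral_lebesgue_on_subset[OF A(1) domains_lebesgue(1) A(2)]]]
  show ?thesis by simp
qed

lemma integrable_space_cutoff:
  assumes "0 < R"
  shows "integrable (lebesgue_on dom0) (\<lambda>x. space_cutoff R x * \<rho> (snd x))"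
  using assms
  by (intro integrable_dom0_continuous[where R = R] smooth_imp_continuous_on smooth_space_cutoff)
     (simp add: space_cutoff_eq_0)

lemma space_cutoff_weight_le:
  assumes R: "0 < R"
  obtains P where "0 < P" "AE x in lebesgue_on dom0. 0 \<le> space_cutoff R x * \<rho> (snd x)"
    "AE x in lebesgue_on dom0. space_cutoff R x * \<rho> (snd x) \<le> indicator ({-R..R} \<times> Gam) x * P"
proof -
  obtain P where P: "0 < P" "AE y in lebesgue_on Gam. \<bar>\<rho> y\<bar> \<le> P" by (rule weight_bounded)
  have nonneg: "AE x in lebesgue_on dom0. 0 \<le> space_cutoff R x * \<rho> (snd x)"
    using AE_lebesgue_on_mem[OF domains_lebesgue(2)]
    by eventually_elim (auto simp: dom0_def intro!: mult_nonneg_nonneg space_cutoff_bounds weight_nonneg)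
  have "AE x in lebesgue_on dom0. space_cutoff R x * \<rho> (snd x) \<le> indicator ({-R..R} \<times> Gam) x * P"
    using AE_lift_Gam(1)[OF P(2)] AE_lebesgue_on_mem[OF domains_lebesgue(2)]
  proof eventually_elim
    case (elim x)
    obtain a y where x: "x = (a, y)" "y \<in> Gam" using elim(2) by (auto simp: dom0_def)
    have "space_cutoff R x * \<rho> y \<le> 1 * P"
      using elim(1) weight_nonneg[OF x(2)] by (intro mult_mono space_cutoff_bounds) (auto simp: x)
    moreover have "space_cutoff R x = 0" if "x \<notin> {-R..R} \<times> Gam"
      using that R x by (auto intro!: space_cutoff_eq_0)
    ultimately show ?case by (auto simp: x indicator_def)
  qed
  with P(1) nonneg show ?thesis by (rule that)
qed

lemma cutoff_integral_le:
  assumes R: "0 < R"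
  obtains P where "0 < P" "\<And>h. h \<in> borel_measurable (lebesgue_on dom0) \<Longrightarrow> (\<And>x. 0 \<le> h x) \<Longrightarrow>
    integrable (lebesgue_on ({-R..R} \<times> Gam)) h \<Longrightarrow>
    integrable (lebesgue_on dom0) (\<lambda>x. h x * (space_cutoff R x * \<rho> (snd x)))
    \<and> (LINT x|lebesgue_on dom0. h x * (space_cutoff R x * \<rho> (snd x))) \<le> P * (LINT x|lebesgue_on ({-R..R} \<times> Gam). h x)"
proof -
  let ?K = "{-R..R} \<times> (Gam :: (real^'n) set)" and ?w = "\<lambda>x. space_cutoff R x * \<rho> (snd x)"
  have K: "?K \<in> sets lebesgue" "?K \<subseteq> dom0" by (auto simp: dom0_def fmeasurableD lmeasurable_compact
      compact_Times compact_Gam)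
  obtain P where P: "0 < P" "AE x in lebesgue_on dom0. 0 \<le> ?w x" "AE x in lebesgue_on dom0. ?w x \<le> indicator ?K x * P"
    by (rule space_cutoff_weight_le[OF R])
  have "integrable (lebesgue_on dom0) (\<lambda>x. h x * ?w x)
      \<and> (LINT x|lebesgue_on dom0. h x * ?w x) \<le> P * (LINT x|lebesgue_on ?K. h x)"
    if measurable: "h \<in> borel_measurable (lebesgue_on dom0)" and h: "\<And>x. 0 \<le> h x" "integrable (lebesgue_on ?K) h" for h
  proof -
    have "has_bochner_integral (lebesgue_on ?K) (\<lambda>x. P * h x) (P * (LINT x|lebesgue_on ?K. h x))"
      by (intro has_bochner_integral_mult_right has_bochner_integral_integrable h(2))
    then have majorant: "has_bochner_integral (lebesgue_on dom0) (\<lambda>x. indicator ?K x * (P * h x))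
        (P * (LINT x|lebesgue_on ?K. h x))"
      by (simp only: has_bochner_integral_lebesgue_on_subset[OF K(1) domains_lebesgue(2) K(2)])
    have product_measurable: "(\<lambda>x. h x * ?w x) \<in> borel_measurable (lebesgue_on dom0)"
      by (rule borel_measurable_times[OF measurable borel_measurable_integrable[OF integrable_space_cutoff[OF R]]])
    have nonneg: "AE x in lebesgue_on dom0. 0 \<le> h x * ?w x" using P(2) by eventually_elim (simp add: h(1))
    have "AE x in lebesgue_on dom0. h x * ?w x \<le> indicator ?K x * (P * h x)"
      using P(3)
    proof eventually_elim
      case (elim x)
      from mult_left_mono[OF this h(1)[of x]] show ?case by (simp only: mult_ac)
    qed
    from integral_dominated_nonneg[OF product_measurable nonneg this majorant] show ?thesis by blast
  qed
  with P(1) show ?thesis by (rule that)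
qed

end

locale initial_layer = parameter_weight \<rho> for \<rho> :: "real^'n \<Rightarrow> real" +
  fixes J :: "real set" and l l' f q :: "real \<Rightarrow> real"
    and u :: "real \<times> real \<times> (real^'n) \<Rightarrow> real" and u0 :: "real \<times> (real^'n) \<Rightarrow> real"
  assumes J: "compact J" "continuous_on J l" "continuous_on J l'" "continuous_on J f" "continuous_on J q"
    and above_tangent: "\<And>a b. a \<in> J \<Longrightarrow> b \<in> J \<Longrightarrow> a \<noteq> b \<Longrightarrow> l b + l' b * (a - b) < l a"
    and u: "u \<in> borel_measurable (lebesgue_on domT)" "AE z in lebesgue_on domT. u z \<in> J"
    and u0: "u0 \<in> borel_measurable (lebesgue_on dom0)" "AE p in lebesgue_on dom0. u0 p \<in> J"
    and weak_solution: "\<And>\<phi>. test_fun domT0 \<phi> \<Longrightarrow> weak_form u (\<lambda>z. f (u z)) \<phi> + initial_form u0 \<phi> = 0"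
    and entropy_inequality: "\<And>\<phi>. test_fun domT0 \<phi> \<Longrightarrow> (\<And>z. z \<in> domT0 \<Longrightarrow> 0 \<le> \<phi> z) \<Longrightarrow>
      0 \<le> weak_form (\<lambda>z. l (u z)) (\<lambda>z. q (u z)) \<phi> + initial_form (\<lambda>p. l (u0 p)) \<phi>"
begin

lemma integrable_pair_compose:
  fixes h :: "real \<Rightarrow> real \<Rightarrow> real"
  assumes "continuous_on (J \<times> J) (\<lambda>(a, b). h a b)" "integrable (lebesgue_on domT) w"
  shows "integrable (lebesgue_on domT) (\<lambda>z. h (u z) (u0 (drop_middle z)) * w z)"
proof -
  have "(\<lambda>z. (u z, u0 (drop_middle z))) \<in> borel_measurable (lebesgue_on domT)"
    using u(1) borel_measurable_lift_dom0[OF u0(1)] by (rule borel_measurable_Pair)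
  moreover have "AE z in lebesgue_on domT. (u z, u0 (drop_middle z)) \<in> J \<times> J"
    using u(2) AE_lift_dom0[OF u0(2)] by eventually_elim simp
  ultimately show ?thesis
    using integrable_compose_weighted[OF domains_lebesgue(1) compact_Times[OF J(1) J(1)] assms(1), of
        "\<lambda>z. (u z, u0 (drop_middle z))" w]
      assms(2) by simp
qed

lemma layer_identity:
  assumes h: "continuous_on J h" and k: "continuous_on J k"
    and g: "smooth g" "\<And>x y. R \<le> \<bar>x\<bar> \<Longrightarrow> g (x, y) = 0" and T: "0 < T"
  shows "weak_form (\<lambda>z. h (u z)) (\<lambda>z. k (u z)) (layer_test_fun T g)
      + initial_form (\<lambda>p. h (u0 p)) (layer_test_fun T g)
      + (LINT z|lebesgue_on domT. (h (u z) - h (u0 (drop_middle z))) * layer_kernel T g z)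
    = (LINT z|lebesgue_on domT. k (u z) * (dx (layer_test_fun T g) z * \<rho> (snd (snd z))))"
proof -
  let ?\<phi> = "layer_test_fun T g" and ?\<rho> = "\<lambda>z::real \<times> real \<times> (real^'n). \<rho> (snd (snd z))"
  have g_integrable: "integrable (lebesgue_on dom0) (\<lambda>p. g p * \<rho> (snd p))"
    by (rule integrable_dom0_continuous[OF smooth_imp_continuous_on[OF g(1)] g(2)])
  note compose = integrable_compose_weighted[OF domains_lebesgue(1) J(1) _ u]
  have "weak_form (\<lambda>z. h (u z)) (\<lambda>z. k (u z)) ?\<phi>
      = (LINT z|lebesgue_on domT. h (u z) * (dt ?\<phi> z * ?\<rho> z)) + (LINT z|lebesgue_on domT. k (u z) * (dx ?\<phi> z * ?\<rho> z))"
    by (intro weak_form_split compose h k integrable_test_fun test_fun_layer[OF g T])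
  moreover have "(LINT z|lebesgue_on domT. h (u z) * (dt ?\<phi> z * ?\<rho> z))
      = - (LINT z|lebesgue_on domT. h (u z) * layer_kernel T g z)"
    unfolding layer_test_fun_partial_derivatives(1)[OF g(1) T] layer_kernel_def by (simp add: mult.assoc)
  moreover have "integrable (lebesgue_on dom0) (\<lambda>p. h (u0 p) * (g p * \<rho> (snd p)))"
    by (rule integrable_compose_weighted[OF domains_lebesgue(2) J(1) h u0 g_integrable])
  note trace = layer_kernel_integral[OF T this]
  then have "initial_form (\<lambda>p. h (u0 p)) ?\<phi> = (LINT z|lebesgue_on domT. h (u0 (drop_middle z)) * layer_kernel T g z)"
    by (simp add: initial_form_def layer_test_fun_def drop_middle_def has_bochner_integral_iff
        integral_mult_right_zero[symmetric] mult_ac)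
  moreover have "(LINT z|lebesgue_on domT. (h (u z) - h (u0 (drop_middle z))) * layer_kernel T g z)
      = (LINT z|lebesgue_on domT. h (u z) * layer_kernel T g z)
          - (LINT z|lebesgue_on domT. h (u0 (drop_middle z)) * layer_kernel T g z)"
    using compose[OF h layer_kernel_integrable[OF T g_integrable]] trace
    by (simp add: left_diff_distrib has_bochner_integral_iff)
  ultimately show ?thesis by simp
qed

lemma layer_estimate:
  assumes h: "continuous_on J h" and k: "continuous_on J k"
    and g: "smooth g" "\<And>x y. R \<le> \<bar>x\<bar> \<Longrightarrow> g (x, y) = 0"
  obtains C where "\<And>T. 0 < T \<Longrightarrow> \<bar>weak_form (\<lambda>z. h (u z)) (\<lambda>z. k (u z)) (layer_test_fun T g)
      + initial_form (\<lambda>p. h (u0 p)) (layer_test_fun T g)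
      + (LINT z|lebesgue_on domT. (h (u z) - h (u0 (drop_middle z))) * layer_kernel T g z)\<bar> \<le> C * T"
proof -
  obtain M where M: "0 \<le> M" "\<And>s. s \<in> J \<Longrightarrow> \<bar>k s\<bar> \<le> M" by (rule compact_continuous_abs_bound[OF J(1) k]) blast
  have k_bounded: "AE z in lebesgue_on domT. \<bar>k (u z)\<bar> \<le> M" using u(2) by eventually_elim (rule M(2))
  have k_measurable: "(\<lambda>z. k (u z)) \<in> borel_measurable (lebesgue_on domT)"
    by (rule borel_measurable_compose_AE[OF _ u(1) borel_compact[OF J(1)] k u(2)]) simp
  show ?thesis
  proof (rule that)
    fix T :: real assume T: "0 < T"
    show "\<bar>weak_form (\<lambda>z. h (u z)) (\<lambda>z. k (u z)) (layer_test_fun T g) + initial_form (\<lambda>p. h (u0 p)) (layer_test_fun T g)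
      + (LINT z|lebesgue_on domT. (h (u z) - h (u0 (drop_middle z))) * layer_kernel T g z)\<bar>
      \<le> 2 * \<bar>M\<bar> * (LINT p|lebesgue_on dom0. \<bar>frechet_derivative g (at p) (1, 0) * \<rho> (snd p)\<bar>) * T"
      using layer_flux_le[OF T integrable_x_derivative[OF g] k_measurable k_bounded]
      by (simp add: layer_identity[OF h k g T] layer_test_fun_partial_derivatives(2)[OF g(1) T] mult.assoc)
  qed
qed

lemma polynomial_multiplier:
  assumes R: "0 < R" and e: "0 < e"
  obtains p where "real_polynomial_function p"
    "integrable (lebesgue_on dom0) (\<lambda>x. \<bar>l' (u0 x) - p x\<bar> * (space_cutoff R x * \<rho> (snd x)))"
    "(LINT x|lebesgue_on dom0. \<bar>l' (u0 x) - p x\<bar> * (space_cutoff R x * \<rho> (snd x))) \<le> e"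
proof -
  let ?K = "{-R..R} \<times> (Gam :: (real^'n) set)" and ?w = "\<lambda>x. space_cutoff R x * \<rho> (snd x)"
  have K: "compact ?K" "?K \<subseteq> dom0" by (auto simp: dom0_def intro: compact_Times compact_Gam)
  obtain M where M: "0 \<le> M" "\<And>s. s \<in> J \<Longrightarrow> \<bar>l' s\<bar> \<le> M" by (rule compact_continuous_abs_bound[OF J(1,3)]) blast
  obtain P where P: "0 < P" "\<And>h. h \<in> borel_measurable (lebesgue_on dom0) \<Longrightarrow> (\<And>x. 0 \<le> h x) \<Longrightarrow>
      integrable (lebesgue_on ?K) h \<Longrightarrow> integrable (lebesgue_on dom0) (\<lambda>x. h x * ?w x)
      \<and> (LINT x|lebesgue_on dom0. h x * ?w x) \<le> P * (LINT x|lebesgue_on ?K. h x)"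
    by (rule cutoff_integral_le[OF R]) (erule that, blast)
  define g where "g x = indicat_real J (u0 x) *\<^sub>R l' (u0 x)" for x
  have g_measurable: "g \<in> borel_measurable (lebesgue_on dom0)"
    unfolding g_def[abs_def]
    by (rule measurable_compose[OF u0(1) borel_measurable_continuous_on_indicator[OF borel_compact[OF J(1)] J(3)]])
  have g_bounded: "\<bar>g x\<bar> \<le> M" for x using M by (auto simp: g_def indicator_def)
  have "0 < e / P" using e P(1) by simp
  from polynomial_L1_approx[OF measurable_restrict_mono[OF g_measurable K(2)] g_bounded M(1) K(1) this]
  obtain p where p: "real_polynomial_function p" "integrable (lebesgue_on ?K) (\<lambda>x. \<bar>g x - p x\<bar>)"
    "(LINT x|lebesgue_on ?K. \<bar>g x - p x\<bar>) < e / P" by blast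
  have p_measurable: "p \<in> borel_measurable (lebesgue_on dom0)"
    by (intro borel_measurable_lebesgue_onI smooth_imp_borel_measurable smooth_real_polynomial_function p(1))
  have "(\<lambda>x. \<bar>g x - p x\<bar>) \<in> borel_measurable (lebesgue_on dom0)" using g_measurable p_measurable by measurable
  note error = P(2)[OF this abs_ge_zero p(2)]
  have eq: "AE x in lebesgue_on dom0. \<bar>l' (u0 x) - p x\<bar> * ?w x = \<bar>g x - p x\<bar> * ?w x"
    using u0(2) by eventually_elim (simp add: g_def)
  have "(\<lambda>x. l' (u0 x)) \<in> borel_measurable (lebesgue_on dom0)"
    by (rule borel_measurable_compose_AE[OF _ u0(1) borel_compact[OF J(1)] J(3) u0(2)]) simp
  then have measurable: "(\<lambda>x. \<bar>l' (u0 x) - p x\<bar> * ?w x) \<in> borel_measurable (lebesgue_on dom0)"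
    by (intro borel_measurable_times[OF _ borel_measurable_integrable[OF integrable_space_cutoff[OF R]]]
        borel_measurable_abs
        borel_measurable_diff p_measurable)
  note error_measurable = borel_measurable_integrable[OF conjunct1[OF error]]
  have "P * (LINT x|lebesgue_on ?K. \<bar>g x - p x\<bar>) \<le> e" using p(3) P(1) by (simp add: field_simps)
  then show ?thesis
    using error integrable_cong_AE[OF measurable error_measurable eq]
        integral_cong_AE[OF measurable error_measurable eq]
    by (intro that[OF p(1)]) simp_all
qed

lemma entropy_defect_le:
  assumes R: "0 < R"
  obtains C where "\<And>T. 0 < T \<Longrightarrow>
    (LINT z|lebesgue_on domT. (l (u z) - l (u0 (drop_middle z))) * layer_kernel T (space_cutoff R) z) \<le> C * T"
proof -
  have support: "space_cutoff R (x, y) = 0" if "R \<le> \<bar>x\<bar>" for x and y :: "real^'n"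
    using R that by (intro space_cutoff_eq_0) auto
  obtain C where C: "\<And>T. 0 < T \<Longrightarrow> \<bar>weak_form (\<lambda>z. l (u z)) (\<lambda>z. q (u z)) (layer_test_fun T (space_cutoff R))
      + initial_form (\<lambda>p. l (u0 p)) (layer_test_fun T (space_cutoff R))
      + (LINT z|lebesgue_on domT. (l (u z) - l (u0 (drop_middle z))) * layer_kernel T (space_cutoff R) z)\<bar> \<le> C * T"
    by (rule layer_estimate[OF J(2,5) smooth_space_cutoff support]) blast+
  show ?thesis
  proof (rule that)
    fix T :: real assume T: "0 < T"
    have "0 \<le> weak_form (\<lambda>z. l (u z)) (\<lambda>z. q (u z)) (layer_test_fun T (space_cutoff R))
        + initial_form (\<lambda>p. l (u0 p)) (layer_test_fun T (space_cutoff R))"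
      by (rule entropy_inequality[OF test_fun_layer[OF smooth_space_cutoff support T]])
         (auto simp: layer_test_fun_def flat_exp_nonneg space_cutoff_bounds)
    with C[OF T]
    show "(LINT z|lebesgue_on domT. (l (u z) - l (u0 (drop_middle z))) * layer_kernel T (space_cutoff R) z) \<le> C * T"
      by linarith
  qed
qed

lemma weak_defect_le:
  assumes R: "0 < R" and p: "real_polynomial_function p"
  obtains C where "\<And>T. 0 < T \<Longrightarrow>
    \<bar>LINT z|lebesgue_on domT. (u z - u0 (drop_middle z)) * layer_kernel T (\<lambda>x. space_cutoff R x * p x) z\<bar> \<le> C * T"
proof -
  have smooth: "smooth (\<lambda>x. space_cutoff R x * p x)"
    by (intro smooth_mult smooth_space_cutoff smooth_real_polynomial_function p)
  have support: "space_cutoff R (x, y) * p (x, y) = 0" if "R \<le> \<bar>x\<bar>" for x y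
    using R that by (simp add: space_cutoff_eq_0)
  obtain C where C: "\<And>T. 0 < T \<Longrightarrow> \<bar>weak_form u (\<lambda>z. f (u z)) (layer_test_fun T (\<lambda>x. space_cutoff R x * p x))
      + initial_form u0 (layer_test_fun T (\<lambda>x. space_cutoff R x * p x))
      + (LINT z|lebesgue_on domT. (u z - u0 (drop_middle z)) * layer_kernel T (\<lambda>x. space_cutoff R x * p x) z)\<bar> \<le> C * T"
    by (rule layer_estimate[OF continuous_on_id J(4) smooth support]) blast+
  show ?thesis
    by (rule that) (use C weak_solution[OF test_fun_layer[OF smooth support]] in simp)
qed

definition relative_entropy :: "real \<times> real \<times> (real^'n) \<Rightarrow> real" where
  "relative_entropy z = l (u z) - l (u0 (drop_middle z)) - l' (u0 (drop_middle z)) * (u z - u0 (drop_middle z))"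

lemma integrable_relative_entropy:
  assumes "integrable (lebesgue_on domT) w"
  shows "integrable (lebesgue_on domT) (\<lambda>z. relative_entropy z * w z)"
  unfolding relative_entropy_def
  by (rule integrable_pair_compose[OF _ assms, of "\<lambda>a b. l a - l b - l' b * (a - b)"])
     (auto simp: case_prod_beta intro!: continuous_intros continuous_on_compose2[OF J(2)]
         continuous_on_compose2[OF J(3)])

lemma relative_entropy_layer_nonneg:
  assumes "0 < T"
  shows "AE z in lebesgue_on domT. 0 \<le> relative_entropy z * layer_kernel T (space_cutoff R) z"
  using u(2) AE_lift_dom0[OF u0(2)] AE_lebesgue_on_mem[OF domains_lebesgue(1)]
proof eventually_elim
  case (elim z)
  have "0 \<le> relative_entropy z"
    using above_tangent[OF elim(1,2)] by (cases "u z = u0 (drop_middle z)") (auto simp: relative_entropy_def)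
  then show ?case by (intro mult_nonneg_nonneg layer_kernel_nonneg space_cutoff_bounds assms elim)
qed

lemma relative_entropy_le_defects:
  assumes R: "0 < R" and T: "0 < T" and N: "\<And>s. s \<in> J \<Longrightarrow> \<bar>s\<bar> \<le> N" and p: "real_polynomial_function p"
    and p_integrable: "integrable (lebesgue_on dom0) (\<lambda>x. \<bar>l' (u0 x) - p x\<bar> * (space_cutoff R x * \<rho> (snd x)))"
  shows "(LINT z|lebesgue_on domT. relative_entropy z * layer_kernel T (space_cutoff R) z)
    \<le> (LINT z|lebesgue_on domT. (l (u z) - l (u0 (drop_middle z))) * layer_kernel T (space_cutoff R) z)
      - (LINT z|lebesgue_on domT. (u z - u0 (drop_middle z)) * layer_kernel T (\<lambda>x. space_cutoff R x * p x) z)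
      + 2 * N * (bump 2 * (LINT x|lebesgue_on dom0. \<bar>l' (u0 x) - p x\<bar> * (space_cutoff R x * \<rho> (snd x))))"
proof (rule integral_dominated_nonneg(2)[OF _ relative_entropy_layer_nonneg[OF T]])
  let ?u0 = "\<lambda>z::real \<times> real \<times> (real^'n). u0 (drop_middle z)" and ?w = "layer_kernel T (space_cutoff R)"
    and ?wp = "layer_kernel T (\<lambda>x. space_cutoff R x * p x)"
  have integrable_w: "integrable (lebesgue_on domT) ?w"
    by (rule layer_kernel_integrable[OF T integrable_space_cutoff[OF R]])
  have integrable_wp: "integrable (lebesgue_on domT) ?wp"
    using R by (intro layer_kernel_integrable[OF T] integrable_dom0_continuous[OF smooth_imp_continuous_on, where R = R]
        smooth_mult smooth_space_cutoff smooth_real_polynomial_function p) (simp add: space_cutoff_eq_0)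
  show "(\<lambda>z. relative_entropy z * ?w z) \<in> borel_measurable (lebesgue_on domT)"
    by (rule borel_measurable_integrable[OF integrable_relative_entropy[OF integrable_w]])
  show "AE z in lebesgue_on domT. relative_entropy z * ?w z
    \<le> (l (u z) - l (?u0 z)) * ?w z - (u z - ?u0 z) * ?wp z + 2 * N * (\<bar>l' (?u0 z) - p (drop_middle z)\<bar> * ?w z)"
    using u(2) AE_lift_dom0[OF u0(2)] AE_lebesgue_on_mem[OF domains_lebesgue(1)]
  proof eventually_elim
    case (elim z)
    have "\<bar>u z - ?u0 z\<bar> \<le> 2 * N" using N[OF elim(1)] N[OF elim(2)] by linarith
    then have "\<bar>l' (?u0 z) - p (drop_middle z)\<bar> * \<bar>u z - ?u0 z\<bar> \<le> \<bar>l' (?u0 z) - p (drop_middle z)\<bar> * (2 * N)"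
      by (intro mult_left_mono) auto
    then have "- ((l' (?u0 z) - p (drop_middle z)) * (u z - ?u0 z)) \<le> 2 * N * \<bar>l' (?u0 z) - p (drop_middle z)\<bar>"
      unfolding abs_mult[symmetric] by (simp add: mult.commute abs_le_iff)
    from mult_right_mono[OF this layer_kernel_nonneg[where g = "space_cutoff R", OF space_cutoff_bounds(1) T elim(3)]]
    moreover have "?wp z = p (drop_middle z) * ?w z" by (simp add: layer_kernel_def)
    ultimately show ?case by (simp add: relative_entropy_def algebra_simps)
  qed
  show "has_bochner_integral (lebesgue_on domT)
    (\<lambda>z. (l (u z) - l (?u0 z)) * ?w z - (u z - ?u0 z) * ?wp z + 2 * N * (\<bar>l' (?u0 z) - p (drop_middle z)\<bar> * ?w z))
    ((LINT z|lebesgue_on domT. (l (u z) - l (?u0 z)) * ?w z) - (LINT z|lebesgue_on domT. (u z - ?u0 z) * ?wp z)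
      + 2 * N * (bump 2 * (LINT x|lebesgue_on dom0. \<bar>l' (u0 x) - p x\<bar> * (space_cutoff R x * \<rho> (snd x)))))"
    by (intro has_bochner_integral_add has_bochner_integral_diff has_bochner_integral_mult_right
        layer_kernel_integral[OF T p_integrable] has_bochner_integral_integrable
        integrable_pair_compose[OF _ integrable_w, of "\<lambda>a b. l a - l b"]
        integrable_pair_compose[OF _ integrable_wp, of "\<lambda>a b. a - b"])
       (auto simp: case_prod_beta intro!: continuous_intros continuous_on_compose2[OF J(2)])
qed

lemma relative_entropy_le:
  assumes R: "0 < R" and e: "0 < e"
  shows "\<exists>C. \<forall>T>0. (LINT z|lebesgue_on domT. relative_entropy z * layer_kernel T (space_cutoff R) z) \<le> C * T + e"
proof -
  obtain N where N: "0 \<le> N" "\<And>s. s \<in> J \<Longrightarrow> \<bar>s\<bar> \<le> N"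
    by (rule compact_continuous_abs_bound[OF J(1) continuous_on_id]) blast
  let ?error = "\<lambda>p. LINT x|lebesgue_on dom0. \<bar>l' (u0 x) - p x\<bar> * (space_cutoff R x * \<rho> (snd x))"
  have "0 < e / (2 * N + 1)" using e N(1) by simp
  then obtain p where p: "real_polynomial_function p"
    "integrable (lebesgue_on dom0) (\<lambda>x. \<bar>l' (u0 x) - p x\<bar> * (space_cutoff R x * \<rho> (snd x)))"
    "?error p \<le> e / (2 * N + 1)"
    by (rule polynomial_multiplier[OF R])
  obtain C1 where C1: "\<And>T. 0 < T \<Longrightarrow>
    (LINT z|lebesgue_on domT. (l (u z) - l (u0 (drop_middle z))) * layer_kernel T (space_cutoff R) z) \<le> C1 * T"
    by (rule entropy_defect_le[OF R]) blast
  obtain C2 where C2: "\<And>T. 0 < T \<Longrightarrow>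
    \<bar>LINT z|lebesgue_on domT. (u z - u0 (drop_middle z)) * layer_kernel T (\<lambda>x. space_cutoff R x * p x) z\<bar> \<le> C2 * T"
    by (rule weak_defect_le[OF R p(1)]) blast
  have "bump 2 * ?error p \<le> 1 * (e / (2 * N + 1))"
  proof (rule order.trans)
    show "bump 2 * ?error p \<le> bump 2 * (e / (2 * N + 1))" by (intro mult_left_mono p(3) flat_exp_nonneg)
    show "bump 2 * (e / (2 * N + 1)) \<le> 1 * (e / (2 * N + 1))"
      using bump_less_1[of 2] e N(1) by (intro mult_right_mono) auto
  qed
  then have "2 * N * (bump 2 * ?error p) \<le> 2 * N * (1 * (e / (2 * N + 1)))" using N(1) by (intro mult_left_mono) auto
  also have "\<dots> \<le> e" using N(1) e by (simp add: field_simps)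
  finally have error: "2 * N * (bump 2 * ?error p) \<le> e" .
  show ?thesis
  proof (intro exI[of _ "C1 + C2"] allI impI)
    fix T :: real assume T: "0 < T"
    from relative_entropy_le_defects[OF R T N(2) p(1,2)] C1[OF T] C2[OF T] error
    show "(LINT z|lebesgue_on domT. relative_entropy z * layer_kernel T (space_cutoff R) z) \<le> (C1 + C2) * T + e"
      unfolding distrib_right by linarith
  qed
qed

lemma integrable_distance:
  assumes "integrable (lebesgue_on domT) w"
  shows "integrable (lebesgue_on domT) (\<lambda>z. \<bar>u z - u0 (drop_middle z)\<bar> * w z)"
  by (rule integrable_pair_compose[OF _ assms]) (auto simp: case_prod_beta intro!: continuous_intros)

lemma distance_le_of_relative_entropy:
  assumes R: "0 < R" and T: "0 < T" and bound: "\<And>a b. a \<in> J \<Longrightarrow> b \<in> J \<Longrightarrow> \<bar>a - b\<bar> \<le> \<alpha> + c * (l a - l b - l' b * (a - b))"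
  shows "(LINT z|lebesgue_on domT. \<bar>u z - u0 (drop_middle z)\<bar> * layer_kernel T (space_cutoff R) z)
    \<le> \<alpha> * (bump 2 * (LINT x|lebesgue_on dom0. space_cutoff R x * \<rho> (snd x)))
      + c * (LINT z|lebesgue_on domT. relative_entropy z * layer_kernel T (space_cutoff R) z)"
proof -
  let ?w = "layer_kernel T (space_cutoff R)" and ?m = "LINT x|lebesgue_on dom0. space_cutoff R x * \<rho> (snd x)"
  have integrable: "integrable (lebesgue_on domT) ?w"
    by (rule layer_kernel_integrable[OF T integrable_space_cutoff[OF R]])
  have "has_bochner_integral (lebesgue_on domT) ?w (bump 2 * ?m)"
    using layer_kernel_integral[OF T, of "\<lambda>_. 1" "space_cutoff R"] integrable_space_cutoff[OF R] by simp
  then have majorant: "has_bochner_integral (lebesgue_on domT) (\<lambda>z. \<alpha> * ?w z + c * (relative_entropy z * ?w z))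
      (\<alpha> * (bump 2 * ?m) + c * (LINT z|lebesgue_on domT. relative_entropy z * ?w z))"
    by (intro has_bochner_integral_add has_bochner_integral_mult_right
        has_bochner_integral_integrable[OF integrable_relative_entropy[OF integrable]])
  show ?thesis
  proof (rule integral_dominated_nonneg(2)[OF borel_measurable_integrable[OF integrable_distance[OF integrable]]
      _ _ majorant])
    have nonneg: "AE z in lebesgue_on domT. 0 \<le> ?w z"
      using AE_lebesgue_on_mem[OF domains_lebesgue(1)]
      by eventually_elim (rule layer_kernel_nonneg[OF space_cutoff_bounds(1) T])
    then show "AE z in lebesgue_on domT. 0 \<le> \<bar>u z - u0 (drop_middle z)\<bar> * ?w z" by eventually_elim simp
    show "AE z in lebesgue_on domT. \<bar>u z - u0 (drop_middle z)\<bar> * ?w z \<le> \<alpha> * ?w z + c * (relative_entropy z * ?w z)"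
      using u(2) AE_lift_dom0[OF u0(2)] nonneg
    proof eventually_elim
      case (elim z)
      from mult_right_mono[OF bound[OF elim(1,2)] elim(3)] show ?case
        by (simp add: relative_entropy_def distrib_right mult.assoc)
    qed
  qed
qed

lemma distance_le:
  assumes R: "0 < R" and e: "0 < e"
  shows "\<exists>C. \<forall>T>0. (LINT z|lebesgue_on domT. \<bar>u z - u0 (drop_middle z)\<bar> * layer_kernel T (space_cutoff R) z)
      \<le> C * T + e"
proof -
  define m where "m = (LINT x|lebesgue_on dom0. space_cutoff R x * \<rho> (snd x))"
  define \<alpha> where "\<alpha> = e / (2 * (1 + \<bar>bump 2 * m\<bar>))"
  have \<alpha>: "0 < \<alpha>" "\<alpha> * (bump 2 * m) \<le> e / 2"
  proof -
    show \<alpha>: "0 < \<alpha>" using e by (simp add: \<alpha>_def)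
    have "\<alpha> * (bump 2 * m) \<le> \<alpha> * (1 + \<bar>bump 2 * m\<bar>)" using \<alpha> by (intro mult_left_mono) auto
    also have "\<dots> = e / 2" by (simp add: \<alpha>_def field_simps)
    finally show "\<alpha> * (bump 2 * m) \<le> e / 2" .
  qed
  obtain c where c: "0 \<le> c" "\<And>a b. a \<in> J \<Longrightarrow> b \<in> J \<Longrightarrow> \<bar>a - b\<bar> \<le> \<alpha> + c * (l a - l b - l' b * (a - b))"
    by (rule distance_le_relative_entropy[OF J(1-3) above_tangent \<alpha>(1)]) blast+
  have "0 < e / (2 * (c + 1))" using e c(1) by simp
  from relative_entropy_le[OF R this]
  obtain C where C: "\<And>T. 0 < T \<Longrightarrow> (LINT z|lebesgue_on domT. relative_entropy z * layer_kernel T (space_cutoff R) z)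
      \<le> C * T + e / (2 * (c + 1))"
    by blast
  have "(LINT z|lebesgue_on domT. \<bar>u z - u0 (drop_middle z)\<bar> * layer_kernel T (space_cutoff R) z) \<le> c * C * T + e"
    if T: "0 < T" for T
  proof -
    note distance_le_of_relative_entropy[OF R T c(2), folded m_def]
    also have "\<alpha> * (bump 2 * m) + c * (LINT z|lebesgue_on domT. relative_entropy z * layer_kernel T (space_cutoff R) z)
        \<le> e / 2 + c * (C * T + e / (2 * (c + 1)))"
      using \<alpha>(2) C[OF T] c(1) by (intro add_mono mult_left_mono) auto
    also have "\<dots> \<le> c * C * T + e" using c(1) e by (simp add: field_simps)
    finally show ?thesis .
  qed
  then show ?thesis by blast
qed

lemma weight_le_layer_kernel:
  assumes r: "0 < r" and T: "0 < T" and z: "z \<in> domT" "\<bar>fst z\<bar> \<le> r" "fst (snd z) < T"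
  shows "\<rho> (snd (snd z)) / T \<le> 4 * exp 1 / bump (3 * r\<^sup>2) * layer_kernel T (space_cutoff (2 * r)) z"
proof -
  obtain x t y where z_eq: "z = (x, t, y)" and t: "0 < t" "t < T" and x: "\<bar>x\<bar> \<le> r" and y: "y \<in> Gam"
    using z by (cases z) (auto simp: domT_def)
  have bump_pos: "0 < bump (3 * r\<^sup>2)" using r by (intro flat_exp_pos) simp
  have "x\<^sup>2 \<le> r\<^sup>2" using x r by (simp add: abs_le_square_iff[symmetric])
  then have space: "bump (3 * r\<^sup>2) \<le> space_cutoff (2 * r) (x, y)"
    unfolding space_cutoff_def by (intro bump_mono) (simp add: power2_eq_square)
  define s where "s = 2 - t / T"
  have s: "1 \<le> s" "s \<le> 2" using t T by (auto simp: s_def field_simps)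
  have "inverse 2 ^ 2 * exp (- 1) \<le> inverse s ^ 2 * exp (- inverse s)"
    using s by (intro mult_mono power_mono le_imp_inverse_le) (auto simp: inverse_le_1_iff)
  then have "1 / (4 * exp 1) \<le> flat_exp 2 s"
    using s by (simp add: flat_exp_def exp_minus power2_eq_square field_simps)
  then have "1 / (4 * exp 1) * bump (3 * r\<^sup>2) \<le> flat_exp 2 s * space_cutoff (2 * r) (x, y)"
    using space bump_pos by (intro mult_mono) (auto simp: flat_exp_nonneg)
  then have "1 \<le> 4 * exp 1 / bump (3 * r\<^sup>2) * (flat_exp 2 s * space_cutoff (2 * r) (x, y))"
    using bump_pos by (simp add: field_simps)
  from mult_left_mono[OF this, of "\<rho> y / T"] weight_nonneg[OF y] T show ?thesis
    by (simp add: z_eq layer_kernel_def s_def mult_ac)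
qed

lemma slab_mean_distance_le:
  assumes V: "V \<in> sets lebesgue" "\<And>x. x \<in> V \<Longrightarrow> \<bar>x\<bar> \<le> r" and r: "0 < r" and T: "0 < T"
  shows "0 \<le> 1 / T * (LINT (x, t, y)|lebesgue_on (V \<times> {0<..<T} \<times> Gam). norm (u (x, t, y) - u0 (x, y)) * \<rho> y)"
    and "1 / T * (LINT (x, t, y)|lebesgue_on (V \<times> {0<..<T} \<times> Gam). norm (u (x, t, y) - u0 (x, y)) * \<rho> y)
      \<le> 4 * exp 1 / bump (3 * r\<^sup>2)
        * (LINT z|lebesgue_on domT. \<bar>u z - u0 (drop_middle z)\<bar> * layer_kernel T (space_cutoff (2 * r)) z)"
proof -
  let ?A = "V \<times> {0<..<T} \<times> (Gam :: (real^'n) set)" and ?C = "4 * exp 1 / bump (3 * r\<^sup>2)"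
  let ?dist = "\<lambda>z. \<bar>u z - u0 (drop_middle z)\<bar>" and ?w = "layer_kernel T (space_cutoff (2 * r))"
  have "integrable (lebesgue_on domT) ?w"
    by (rule layer_kernel_integrable[OF T integrable_space_cutoff]) (use r in simp)
  note majorant = has_bochner_integral_mult_right[of ?C,
      OF has_bochner_integral_integrable[OF integrable_distance[OF this]]]
  obtain N where N: "\<And>s. s \<in> J \<Longrightarrow> \<bar>s\<bar> \<le> N"
    by (rule compact_continuous_abs_bound[OF J(1) continuous_on_id]) blast
  have "bounded V" using V(2) by (auto simp: bounded_iff)
  from has_bochner_integral_mult_right[of "1 / T", OF slab_distance_integral[OF V(1) this u(1)
      eventually_mono[OF u(2) N]
        u0(1) eventually_mono[OF u0(2) N]]]
  have mean: "has_bochner_integral (lebesgue_on domT) (\<lambda>z. 1 / T * (indicator ?A z * (?dist z * \<rho> (snd (snd z)))))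
      (1 / T * (LINT (x, t, y)|lebesgue_on ?A. norm (u (x, t, y) - u0 (x, y)) * \<rho> y))" .
  have bounds: "0 \<le> 1 / T * (indicator ?A z * (?dist z * \<rho> (snd (snd z)))) \<and>
    1 / T * (indicator ?A z * (?dist z * \<rho> (snd (snd z)))) \<le> ?C * (?dist z * ?w z)" if z: "z \<in> domT" for z
  proof -
    have weight: "0 \<le> \<rho> (snd (snd z))" using z by (auto simp: domT_def intro: weight_nonneg)
    have kernel: "0 \<le> ?C * ?w z"
      by (intro mult_nonneg_nonneg divide_nonneg_nonneg layer_kernel_nonneg space_cutoff_bounds T z)
         (simp_all add: flat_exp_nonneg)
    have "indicat_real ?A z * (\<rho> (snd (snd z)) / T) \<le> ?C * ?w z"
      using weight_le_layer_kernel[OF r T z] V(2) kernel by (auto simp: indicator_def)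
    from mult_left_mono[OF this, of "?dist z"] weight T show ?thesis by (simp add: mult_ac)
  qed
  then have AE_bounds: "AE z in lebesgue_on domT. 0 \<le> 1 / T * (indicator ?A z * (?dist z * \<rho> (snd (snd z))))"
    "AE z in lebesgue_on domT. 1 / T * (indicator ?A z * (?dist z * \<rho> (snd (snd z)))) \<le> ?C * (?dist z * ?w z)"
    using AE_lebesgue_on_mem[OF domains_lebesgue(1)] by (auto elim!: eventually_mono)
  note mean_eq = has_bochner_integral_integral_eq[OF mean, symmetric]
  show "0 \<le> 1 / T * (LINT (x, t, y)|lebesgue_on ?A. norm (u (x, t, y) - u0 (x, y)) * \<rho> y)"
    unfolding mean_eq by (rule integral_nonneg_AE[OF AE_bounds(1)])
  show "1 / T * (LINT (x, t, y)|lebesgue_on ?A. norm (u (x, t, y) - u0 (x, y)) * \<rho> y)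
      \<le> ?C * (LINT z|lebesgue_on domT. ?dist z * ?w z)"
    unfolding mean_eq by (rule integral_dominated_nonneg(2)[OF borel_measurable_has_bochner_integral[OF mean]
        AE_bounds majorant])
qed

theorem attains_initial_data: "attains_initial_data \<rho> u u0"
  unfolding attains_initial_data_def
proof (intro allI impI, elim conjE)
  fix V :: "real set" assume V: "V \<in> sets lebesgue" "bounded V"
  let ?mean = "\<lambda>T. 1 / T * (LINT (x, t, y)|lebesgue_on (V \<times> {0<..<T} \<times> Gam). norm (u (x, t, y) - u0 (x, y)) * \<rho> y)"
  from V(2) obtain r where r: "0 < r" "\<And>x. x \<in> V \<Longrightarrow> \<bar>x\<bar> \<le> r" by (auto simp: bounded_pos)
  define C where "C = 4 * exp 1 / bump (3 * r\<^sup>2)"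
  have C: "0 < C" using r(1) unfolding C_def by (intro divide_pos_pos flat_exp_pos) auto
  note mean = slab_mean_distance_le[OF V(1) r(2,1), folded C_def]
  show "(?mean \<longlongrightarrow> 0) (at_right 0)"
  proof (rule tendsto_0_at_right_of_linear_bound[OF mean(1)])
    fix e :: real assume "0 < e"
    then have "0 < e / C" using C by simp
    from distance_le[OF _ this, of "2 * r"] r(1) obtain C' where C':
      "\<And>T. 0 < T \<Longrightarrow> (LINT z|lebesgue_on domT. \<bar>u z - u0 (drop_middle z)\<bar>
          * layer_kernel T (space_cutoff (2 * r)) z) \<le> C' * T + e / C"
      by auto
    have "?mean T \<le> C * C' * T + e" if T: "0 < T" for T
    proof -
      have "?mean T \<le> C * (C' * T + e / C)"
        by (rule order.trans[OF mean(2)[OF _ T] mult_left_mono[OF C'[OF T] less_imp_le[OF C]]])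
      then show ?thesis using C by (simp add: distrib_left mult.assoc)
    qed
    then show "\<exists>C. \<forall>T>0. ?mean T \<le> C * T + e" by blast
  qed
qed

end

subsection \<open>Kruzhkov entropies\<close>

lemma interval_antiderivative:
  fixes I :: "real set" and g :: "real \<Rightarrow> real"
  assumes I: "convex I" and g: "continuous_on I g" and k: "k \<in> I"
  obtains q where "q k = 0" "\<And>s. s \<in> I \<Longrightarrow> (q has_real_derivative g s) (at s within I)"
proof -
  define q where "q s = (LBINT x=k..s. g x)" for s
  have derivative_on_segment: "(q has_real_derivative g x) (at x within closed_segment s y)"
    if s: "s \<in> I" "y \<in> I" and x: "x \<in> closed_segment s y" for s y x
  proof -
    define a b where "a = min k (min s y)" and "b = max k (max s y)"
    have "a \<in> I" "b \<in> I" using s k by (auto simp: a_def b_def min_def max_def)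
    then have "{a..b} \<subseteq> I"
      using closed_segment_subset[OF _ _ I, of a b] by (auto simp: closed_segment_eq_real_ivl)
    moreover have segment: "closed_segment s y \<subseteq> {a..b}" by (auto simp: a_def b_def closed_segment_eq_real_ivl)
    ultimately have "(q has_real_derivative g x) (at x within {a..b})"
      using x continuous_on_subset[OF g]
      unfolding q_def[abs_def] has_real_derivative_iff_has_vector_derivative
      by (intro interval_integral_FTC2) (auto simp: a_def b_def)
    then show ?thesis using segment by (rule has_field_derivative_subset)
  qed
  have "(q has_real_derivative g s) (at s within I)" if s: "s \<in> I" for s
    unfolding has_field_derivative_def has_derivative_within_alt
  proof (intro conjI allI impI)
    fix e :: real assume "0 < e"
    then obtain d where d: "0 < d" "\<And>x. x \<in> I \<Longrightarrow> \<bar>x - s\<bar> < d \<Longrightarrow> \<bar>g x - g s\<bar> < e"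
      using g s unfolding continuous_on_iff dist_real_def by blast
    have "\<bar>q y - q s - g s * (y - s)\<bar> \<le> e * \<bar>y - s\<bar>" if y: "y \<in> I" "\<bar>y - s\<bar> < d" for y
    proof -
      have "norm ((q y - g s * y) - (q s - g s * s)) \<le> e * norm (y - s)"
      proof (rule field_differentiable_bound[OF convex_closed_segment])
        fix x assume x: "x \<in> closed_segment s y"
        show "((\<lambda>x. q x - g s * x) has_real_derivative g x - g s) (at x within closed_segment s y)"
          using derivative_on_segment[OF s y(1) x] by (auto intro!: derivative_eq_intros)
        have "x \<in> I" using x closed_segment_subset[OF s y(1) I] by auto
        moreover have "\<bar>x - s\<bar> < d" using segment_bound(1)[OF x] y(2) by simp
        ultimately show "norm (g x - g s) \<le> e" using d(2) by (simp add: less_imp_le)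
      qed auto
      then show ?thesis by (simp add: algebra_simps)
    qed
    with d(1) show "\<exists>d>0. \<forall>y\<in>I. norm (y - s) < d \<longrightarrow> norm (q y - q s - g s * (y - s)) \<le> e * norm (y - s)" by auto
  qed (rule bounded_linear_mult_right)
  moreover have "q k = 0" by (simp add: q_def)
  ultimately show ?thesis by (intro that)
qed

lemma abs_le_of_derivative_supported_near:
  fixes D D' :: "real \<Rightarrow> real"
  assumes I: "convex I" "k \<in> I" "s \<in> I" and \<delta>: "0 \<le> \<delta>" and D: "D k = 0"
    "\<And>x. x \<in> I \<Longrightarrow> (D has_real_derivative D' x) (at x within I)"
    and near: "\<And>x. x \<in> I \<Longrightarrow> \<bar>x - k\<bar> \<le> \<delta> \<Longrightarrow> \<bar>D' x\<bar> \<le> M"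
    and far: "\<And>x. x \<in> closed_segment k s \<Longrightarrow> \<delta> \<le> \<bar>x - k\<bar> \<Longrightarrow> D' x = 0"
  shows "\<bar>D s\<bar> \<le> M * \<delta>"
proof -
  have segment: "closed_segment k s \<subseteq> I" by (rule closed_segment_subset[OF I(2,3,1)])
  have increment: "\<bar>D b - D a\<bar> \<le> C * \<bar>b - a\<bar>"
    if ab: "a \<in> closed_segment k s" "b \<in> closed_segment k s" and C: "\<And>x. x \<in> closed_segment a b \<Longrightarrow> \<bar>D' x\<bar> \<le> C" for a b C
  proof -
    have "closed_segment a b \<subseteq> I" by (rule order.trans[OF _ segment]) (simp add: subset_closed_segment ab)
    note derivative = has_field_derivative_subset[OF D(2)[OF subsetD[OF this]] this]
    have "norm (D b - D a) \<le> C * norm (b - a)"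
      by (rule field_differentiable_bound[OF convex_closed_segment derivative]) (simp_all add: C)
    then show ?thesis by simp
  qed
  define m where "m = (if \<bar>s - k\<bar> \<le> \<delta> then s else k + sgn (s - k) * \<delta>)"
  have m: "m \<in> closed_segment k s" "\<bar>m - k\<bar> \<le> \<delta>"
    using \<delta> by (auto simp: m_def closed_segment_eq_real_ivl sgn_if)
  have "\<bar>D m - D k\<bar> \<le> M * \<bar>m - k\<bar>"
  proof (rule increment)
    fix x assume x: "x \<in> closed_segment k m"
    moreover have "closed_segment k m \<subseteq> I" by (rule order.trans[OF _ segment]) (simp add: subset_closed_segment m(1))
    ultimately have "x \<in> I" by (rule rev_subsetD)
    then show "\<bar>D' x\<bar> \<le> M" using near segment_bound(1)[OF x] m(2) by simp
  qed (use m in auto)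
  moreover have "\<bar>D s - D m\<bar> \<le> 0 * \<bar>s - m\<bar>"
  proof (cases "\<bar>s - k\<bar> \<le> \<delta>")
    case False
    show ?thesis
    proof (rule increment)
      fix x assume "x \<in> closed_segment m s"
      then have "x \<in> closed_segment k s" "\<delta> \<le> \<bar>x - k\<bar>"
        using False \<delta> by (auto simp: m_def closed_segment_eq_real_ivl sgn_if split: if_splits)
      then show "\<bar>D' x\<bar> \<le> 0" by (simp add: far)
    qed (use m in auto)
  qed (simp add: m_def)
  moreover have "0 \<le> M" using near[OF I(2)] \<delta> by auto
  then have "M * \<bar>m - k\<bar> \<le> M * \<delta>" using m(2) by (intro mult_left_mono)
  ultimately show ?thesis using D(1) by linarith
qed

definition smooth_sgn :: "real \<Rightarrow> real \<Rightarrow> real \<Rightarrow> real" where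
  "smooth_sgn \<delta> k s = 2 * smooth_step ((s - k) / \<delta> + 3 / 2) - 1"

lemma abs_smooth_sgn_le: "\<bar>smooth_sgn \<delta> k s\<bar> \<le> 1"
  using smooth_step_nonneg smooth_step_le_1 by (auto simp: smooth_sgn_def abs_le_iff)

lemma smooth_sgn_eq_sgn:
  assumes "0 < \<delta>" "\<delta> \<le> \<bar>s - k\<bar>"
  shows "smooth_sgn \<delta> k s = sgn (s - k)"
proof (cases "k \<le> s")
  case True
  then have "1 \<le> (s - k) / \<delta>" "k < s" using assms by (auto simp: field_simps)
  then show ?thesis by (simp add: smooth_sgn_def smooth_step_eq_1)
next
  case False
  then have "(s - k) / \<delta> \<le> - 1" using assms by (simp add: field_simps)
  then show ?thesis using False by (simp add: smooth_sgn_def smooth_step_eq_0)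
qed

lemma smooth_sgn_has_derivative:
  assumes "0 < \<delta>"
  shows "(smooth_sgn \<delta> k has_real_derivative 2 * deriv smooth_step ((s - k) / \<delta> + 3 / 2) / \<delta>) (at s)"
  unfolding smooth_sgn_def[abs_def] has_field_derivative_def
  by (rule has_derivative_eq_rhs) (use assms in \<open>auto intro!: derivative_eq_intros\<close>)

definition kflux :: "(real \<Rightarrow> real) \<Rightarrow> real \<Rightarrow> real \<Rightarrow> real" where
  "kflux g a b = sgn (a - b) * (g a - g b)"

lemma kflux_commute: "kflux g a b = kflux g b a"
  by (simp add: kflux_def sgn_if algebra_simps)

lemma abs_kflux_le: "\<bar>kflux g a b\<bar> \<le> \<bar>g a\<bar> + \<bar>g b\<bar>"
  by (auto simp: kflux_def sgn_if)

lemma smooth_sgn_flux_approx: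
  fixes I :: "real set" and f f' q :: "real \<Rightarrow> real"
  assumes I: "convex I" "k \<in> I" "s \<in> I" and \<delta>: "0 < \<delta>"
    and f: "\<And>s. s \<in> I \<Longrightarrow> (f has_real_derivative f' s) (at s within I)"
    and q: "q k = 0" "\<And>s. s \<in> I \<Longrightarrow> (q has_real_derivative smooth_sgn \<delta> k s * f' s) (at s within I)"
    and C: "\<And>s. s \<in> I \<Longrightarrow> \<bar>s - k\<bar> \<le> \<delta> \<Longrightarrow> \<bar>f' s\<bar> \<le> C"
  shows "\<bar>q s - kflux f s k\<bar> \<le> 2 * C * \<delta>"
proof -
  define \<sigma> where "\<sigma> = sgn (s - k)"
  have "\<bar>q s - \<sigma> * (f s - f k)\<bar> \<le> 2 * C * \<delta>"
  proof (rule abs_le_of_derivative_supported_near[OF I less_imp_le[OF \<delta>], of "\<lambda>x. q x - \<sigma> * (f x - f k)"])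
    show "((\<lambda>x. q x - \<sigma> * (f x - f k)) has_real_derivative (smooth_sgn \<delta> k x - \<sigma>) * f' x) (at x within I)"
      if "x \<in> I" for x
      by (rule derivative_eq_intros q(2) f that refl)+ (simp add: algebra_simps)
    show "\<bar>(smooth_sgn \<delta> k x - \<sigma>) * f' x\<bar> \<le> 2 * C" if "x \<in> I" "\<bar>x - k\<bar> \<le> \<delta>" for x
    proof -
      have "\<bar>smooth_sgn \<delta> k x - \<sigma>\<bar> \<le> 2" using abs_smooth_sgn_le[of \<delta> k x] by (auto simp: \<sigma>_def sgn_if)
      with C[OF that] show ?thesis unfolding abs_mult by (intro mult_mono) auto
    qed
    show "(smooth_sgn \<delta> k x - \<sigma>) * f' x = 0" if "x \<in> closed_segment k s" "\<delta> \<le> \<bar>x - k\<bar>" for x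
      using that \<delta> by (auto simp: smooth_sgn_eq_sgn \<sigma>_def sgn_if closed_segment_eq_real_ivl split: if_splits)
  qed (simp add: q(1))
  then show ?thesis by (simp add: kflux_def \<sigma>_def)
qed

lemma kruzkov_entropy_approx:
  fixes I :: "real set" and f f' :: "real \<Rightarrow> real"
  assumes I: "convex I" "k \<in> I" and \<delta>: "0 < \<delta>"
    and f: "\<And>s. s \<in> I \<Longrightarrow> (f has_real_derivative f' s) (at s within I)" "continuous_on I f'"
    and C: "\<And>s. s \<in> I \<Longrightarrow> \<bar>s - k\<bar> \<le> \<delta> \<Longrightarrow> \<bar>f' s\<bar> \<le> C"
  obtains l l' l'' q where "convex_on UNIV l" "C2_real_with I l l' l''"
    "\<And>s. s \<in> I \<Longrightarrow> (q has_real_derivative l' s * f' s) (at s within I)"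
    "\<And>s. s \<in> I \<Longrightarrow> \<bar>l s - \<bar>s - k\<bar>\<bar> \<le> 2 * \<delta>" "\<And>s. s \<in> I \<Longrightarrow> \<bar>q s - kflux f s k\<bar> \<le> 2 * C * \<delta>"
proof -
  have continuous: "continuous_on A (smooth_sgn \<delta> k)" for A
    by (rule DERIV_continuous_on[OF has_field_derivative_at_within[OF smooth_sgn_has_derivative[OF \<delta>]]])
  obtain q where q: "q k = 0" "\<And>s. s \<in> I \<Longrightarrow> (q has_real_derivative smooth_sgn \<delta> k s * f' s) (at s within I)"
    by (rule interval_antiderivative[OF I(1) continuous_on_mult[OF continuous f(2)] I(2)]) blast
  obtain l where l: "l k = 0" "\<And>s. (l has_real_derivative smooth_sgn \<delta> k s) (at s)"
    by (rule interval_antiderivative[OF convex_UNIV continuous UNIV_I[of k]]) auto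
  let ?l'' = "\<lambda>s. 2 * deriv smooth_step ((s - k) / \<delta> + 3 / 2) / \<delta>"
  show ?thesis
  proof (rule that)
    show "convex_on UNIV l"
      by (rule f''_ge0_imp_convex[OF convex_UNIV, of _ "smooth_sgn \<delta> k" ?l''])
         (use l(2) smooth_sgn_has_derivative[OF \<delta>] deriv_smooth_step_nonneg \<delta> in auto)
    show "C2_real_with I l (smooth_sgn \<delta> k) ?l''"
      unfolding C2_real_with_def using l(2) smooth_sgn_has_derivative[OF \<delta>] \<delta>
      by (auto intro: has_field_derivative_at_within intro!: continuous_intros)
    show "(q has_real_derivative smooth_sgn \<delta> k s * f' s) (at s within I)" if "s \<in> I" for s by (rule q(2)[OF that])
    show "\<bar>q s - kflux f s k\<bar> \<le> 2 * C * \<delta>" if "s \<in> I" for s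
      by (rule smooth_sgn_flux_approx[OF I that \<delta> f(1) q C])
    have "\<bar>l s - kflux (\<lambda>s. s) s k\<bar> \<le> 2 * 1 * \<delta>" for s
      by (rule smooth_sgn_flux_approx[OF convex_UNIV UNIV_I UNIV_I \<delta>, of "\<lambda>s. s" "\<lambda>s. 1"]) (use l in auto)
    then show "\<bar>l s - \<bar>s - k\<bar>\<bar> \<le> 2 * \<delta>" for s by (simp add: kflux_def abs_sgn mult.commute)
  qed
qed

context parameter_weight
begin

lemma weak_form_perturbation_le:
  assumes \<phi>: "test_fun domT0 \<phi>"
    and a: "a \<in> borel_measurable (lebesgue_on domT)" "AE z in lebesgue_on domT. \<bar>a z\<bar> \<le> A"
    and b: "b \<in> borel_measurable (lebesgue_on domT)" "AE z in lebesgue_on domT. \<bar>b z\<bar> \<le> B"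
    and a': "a' \<in> borel_measurable (lebesgue_on domT)" "AE z in lebesgue_on domT. \<bar>a' z - a z\<bar> \<le> \<alpha>"
    and b': "b' \<in> borel_measurable (lebesgue_on domT)" "AE z in lebesgue_on domT. \<bar>b' z - b z\<bar> \<le> \<beta>"
  shows "weak_form a' b' \<phi> \<le> weak_form a b \<phi>
    + (\<alpha> * (LINT z|lebesgue_on domT. \<bar>dt \<phi> z * \<rho> (snd (snd z))\<bar>)
      + \<beta> * (LINT z|lebesgue_on domT. \<bar>dx \<phi> z * \<rho> (snd (snd z))\<bar>))"
proof -
  have difference_le: "(LINT z|lebesgue_on domT. c' z * w z)
      \<le> (LINT z|lebesgue_on domT. c z * w z) + \<gamma> * (LINT z|lebesgue_on domT. \<bar>w z\<bar>)"
    and integrable: "integrable (lebesgue_on domT) (\<lambda>z. c z * w z)" "integrable (lebesgue_on domT) (\<lambda>z. c' z * w z)"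
    if c: "c \<in> borel_measurable (lebesgue_on domT)" "AE z in lebesgue_on domT. \<bar>c z\<bar> \<le> C"
      and c': "c' \<in> borel_measurable (lebesgue_on domT)" "AE z in lebesgue_on domT. \<bar>c' z - c z\<bar> \<le> \<gamma>"
      and w: "integrable (lebesgue_on domT) w" for c c' w :: "real \<times> real \<times> (real^'n) \<Rightarrow> real" and C \<gamma>
  proof -
    show integrable: "integrable (lebesgue_on domT) (\<lambda>z. c z * w z)" by (rule integrable_mult_bounded[OF w c])
    have "AE z in lebesgue_on domT. \<bar>c' z\<bar> \<le> C + \<gamma>" using c(2) c'(2) by eventually_elim linarith
    from integrable_mult_bounded[OF w c'(1) this] show integrable': "integrable (lebesgue_on domT) (\<lambda>z. c' z * w z)" .
    have "(LINT z|lebesgue_on domT. c' z * w z) \<le> (LINT z|lebesgue_on domT. c z * w z + \<gamma> * \<bar>w z\<bar>)"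
    proof (rule integral_mono_AE[OF integrable'])
      show "AE z in lebesgue_on domT. c' z * w z \<le> c z * w z + \<gamma> * \<bar>w z\<bar>"
        using c'(2)
      proof eventually_elim
        case (elim z)
        have "(c' z - c z) * w z \<le> \<bar>c' z - c z\<bar> * \<bar>w z\<bar>" by (simp add: abs_mult[symmetric])
        also have "\<dots> \<le> \<gamma> * \<bar>w z\<bar>" using elim by (intro mult_right_mono) auto
        finally show ?case by (simp add: left_diff_distrib)
      qed
    qed (use integrable w in auto)
    also have "\<dots> = (LINT z|lebesgue_on domT. c z * w z) + \<gamma> * (LINT z|lebesgue_on domT. \<bar>w z\<bar>)"
      using integrable w by simp
    finally show "(LINT z|lebesgue_on domT. c' z * w z)
        \<le> (LINT z|lebesgue_on domT. c z * w z) + \<gamma> * (LINT z|lebesgue_on domT. \<bar>w z\<bar>)" .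
  qed
  note weights = integrable_test_fun(1,2)[OF \<phi>]
  show ?thesis
    using difference_le[OF a a' weights(1)] difference_le[OF b b' weights(2)]
      weak_form_split[OF integrable(1)[OF a a' weights(1)] integrable(1)[OF b b' weights(2)]]
      weak_form_split[OF integrable(2)[OF a a' weights(1)] integrable(2)[OF b b' weights(2)]]
    by linarith
qed

lemma kruzkov_inequality:
  fixes w :: "real \<times> real \<times> (real^'n) \<Rightarrow> real"
  assumes I: "convex I" "I \<in> sets borel" and k: "k \<in> I"
    and f: "\<And>s. s \<in> I \<Longrightarrow> (f has_real_derivative f' s) (at s within I)" "continuous_on I f'"
    and w: "w \<in> borel_measurable (lebesgue_on domT)" "AE z in lebesgue_on domT. w z \<in> I"
      "AE z in lebesgue_on domT. \<bar>w z\<bar> \<le> B" "AE z in lebesgue_on domT. \<bar>f (w z)\<bar> \<le> B"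
    and entropy: "\<And>l l' l'' q. convex_on UNIV l \<Longrightarrow> C2_real_with I l l' l'' \<Longrightarrow>
        (\<And>s. s \<in> I \<Longrightarrow> (q has_real_derivative l' s * f' s) (at s within I)) \<Longrightarrow>
        0 \<le> weak_form (\<lambda>z. l (w z)) (\<lambda>z. q (w z)) \<phi>"
    and \<phi>: "test_fun domT \<phi>"
  shows "0 \<le> weak_form (\<lambda>z. \<bar>w z - k\<bar>) (\<lambda>z. kflux f (w z) k) \<phi>"
proof -
  obtain d where d: "0 < d" "\<And>s. s \<in> I \<Longrightarrow> \<bar>s - k\<bar> < d \<Longrightarrow> \<bar>f' s - f' k\<bar> < 1"
    using f(2) k unfolding continuous_on_iff dist_real_def by (metis zero_less_one)
  define C where "C = \<bar>f' k\<bar> + 1"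
  let ?W = "weak_form (\<lambda>z. \<bar>w z - k\<bar>) (\<lambda>z. kflux f (w z) k) \<phi>"
  let ?M = "2 * (LINT z|lebesgue_on domT. \<bar>dt \<phi> z * \<rho> (snd (snd z))\<bar>)
    + 2 * C * (LINT z|lebesgue_on domT. \<bar>dx \<phi> z * \<rho> (snd (snd z))\<bar>)"
  note compose = borel_measurable_compose_AE[OF domains_lebesgue(1) w(1) I(2) _ w(2)]
  have "(\<lambda>z. f (w z)) \<in> borel_measurable (lebesgue_on domT)" by (rule compose) (rule DERIV_continuous_on[OF f(1)])
  then have measurable: "(\<lambda>z. \<bar>w z - k\<bar>) \<in> borel_measurable (lebesgue_on domT)"
    "(\<lambda>z. kflux f (w z) k) \<in> borel_measurable (lebesgue_on domT)"
    using w(1) unfolding kflux_def sgn_if by measurable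
  have bounded: "AE z in lebesgue_on domT. \<bar>\<bar>w z - k\<bar>\<bar> \<le> B + \<bar>k\<bar>"
      "AE z in lebesgue_on domT. \<bar>kflux f (w z) k\<bar> \<le> B + \<bar>f k\<bar>"
    by (use w(3) in eventually_elim, simp) (use w(4) in eventually_elim, use abs_kflux_le[of f _ k]
        in \<open>fastforce intro: order.trans\<close>)
  have "0 \<le> ?W + \<delta> * ?M" if \<delta>: "0 < \<delta>" "\<delta> < d" for \<delta>
  proof -
    have "\<bar>f' s\<bar> \<le> C" if "s \<in> I" "\<bar>s - k\<bar> \<le> \<delta>" for s using d(2)[OF that(1)] that(2) \<delta>(2) by (simp add: C_def)
    from kruzkov_entropy_approx[OF I(1) k \<delta>(1) f this] obtain l l' l'' q
      where l: "convex_on UNIV l" "C2_real_with I l l' l''"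
        and q: "\<And>s. s \<in> I \<Longrightarrow> (q has_real_derivative l' s * f' s) (at s within I)"
        and approx: "\<And>s. s \<in> I \<Longrightarrow> \<bar>l s - \<bar>s - k\<bar>\<bar> \<le> 2 * \<delta>" "\<And>s. s \<in> I \<Longrightarrow> \<bar>q s - kflux f s k\<bar> \<le> 2 * C * \<delta>"
      by blast
    have close: "AE z in lebesgue_on domT. \<bar>l (w z) - \<bar>w z - k\<bar>\<bar> \<le> 2 * \<delta>"
      "AE z in lebesgue_on domT. \<bar>q (w z) - kflux f (w z) k\<bar> \<le> 2 * C * \<delta>"
      by (rule eventually_mono[OF w(2)], erule approx)+
    have "(\<lambda>z. l (w z)) \<in> borel_measurable (lebesgue_on domT)" "(\<lambda>z. q (w z)) \<in> borel_measurable (lebesgue_on domT)"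
      by (rule compose, rule DERIV_continuous_on, use l(2) q in \<open>auto simp: C2_real_with_def\<close>)+
    from weak_form_perturbation_le[OF test_fun_domT_imp_domT0[OF \<phi>] measurable(1) bounded(1) measurable(2) bounded(2)
        this(1) close(1) this(2) close(2)]
    have "weak_form (\<lambda>z. l (w z)) (\<lambda>z. q (w z)) \<phi> \<le> ?W + (2 * \<delta> * (LINT z|lebesgue_on domT. \<bar>dt \<phi> z * \<rho> (snd (snd z))\<bar>)
        + 2 * C * \<delta> * (LINT z|lebesgue_on domT. \<bar>dx \<phi> z * \<rho> (snd (snd z))\<bar>))" .
    with entropy[OF l q] show ?thesis by (simp add: algebra_simps)
  qed
  then have "\<forall>\<^sub>F \<delta> in at_right 0. 0 \<le> ?W + \<delta> * ?M"
    using d(1) by (auto simp: eventually_at_right_field)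
  moreover have "((\<lambda>\<delta>. ?W + \<delta> * ?M) \<longlongrightarrow> ?W + 0 * ?M) (at_right 0)" by (intro tendsto_intros)
  ultimately show ?thesis using tendsto_lowerbound[of "\<lambda>\<delta>. ?W + \<delta> * ?M" ?W "at_right 0" 0] by simp
qed

end

subsection \<open>Doubling of variables\<close>

lemma smooth_Pair:
  assumes "smooth f" "smooth g"
  shows "smooth (\<lambda>z. (f z, g z))"
proof -
  have "smooth (\<lambda>z. (f z, 0) + (0, g z))"
    by (intro smooth_add smooth_bounded_linear_compose[where L = "\<lambda>a. (a, 0)"]
        smooth_bounded_linear_compose[where L = "\<lambda>b. (0, b)"]
        bounded_linear_Pair bounded_linear_ident bounded_linear_zero assms)
  then show ?thesis by simp
qed

lemma frechet_derivative_eq_0_outside: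
  assumes "closed S" "\<And>z. z \<notin> S \<Longrightarrow> f z = 0" "z \<notin> S"
  shows "frechet_derivative f (at z) = (\<lambda>h. 0)"
proof -
  have "(f has_derivative (\<lambda>h. 0)) (at z)"
    by (rule has_derivative_transform_within_open[OF has_derivative_const[of 0] open_Compl[OF assms(1)]])
       (use assms in auto)
  from frechet_derivative_at[OF this] show ?thesis by simp
qed

lemma lborel_distr_shear:
  "distr lborel borel (\<lambda>p. (fst p, fst p + snd p)) = (lborel :: ('a::euclidean_space \<times> 'a) measure)"
proof (rule measure_eqI)
  let ?shear = "\<lambda>p :: 'a \<times> 'a. (fst p, fst p + snd p)"
  have shear: "?shear \<in> borel \<rightarrow>\<^sub>M borel"
    by (intro borel_measurable_continuous_onI continuous_intros)
  fix A :: "('a \<times> 'a) set" assume "A \<in> sets (distr lborel borel ?shear)"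
  then have A: "A \<in> sets borel" by simp
  then have sets: "A \<in> sets (lborel \<Otimes>\<^sub>M lborel)" "?shear -` A \<in> sets (lborel \<Otimes>\<^sub>M lborel)"
    unfolding lborel_prod using A measurable_sets[OF shear A] by simp_all
  have slice: "emeasure lborel (Pair z -` ?shear -` A) = emeasure lborel (Pair z -` A)" for z
  proof -
    have "Pair z \<in> (borel :: 'a measure) \<rightarrow>\<^sub>M borel" by (intro borel_measurable_continuous_onI continuous_intros)
    from measurable_sets[OF this A] have "Pair z -` A \<in> sets borel" by simp
    then have "emeasure (distr lborel borel ((+) z)) (Pair z -` A) = emeasure lborel ((+) z -` Pair z -` A)"
      by (subst emeasure_distr) auto
    moreover have "(+) z -` Pair z -` A = Pair z -` ?shear -` A" by auto
    ultimately show ?thesis by (simp add: lborel_distr_plus)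
  qed
  have "emeasure (distr lborel borel ?shear) A = emeasure (lborel \<Otimes>\<^sub>M lborel) (?shear -` A)"
    using emeasure_distr[of ?shear lborel borel A] shear A by (simp add: lborel_prod)
  also have "\<dots> = (\<integral>\<^sup>+ z. emeasure lborel (Pair z -` A) \<partial>lborel)"
    by (simp only: lborel.emeasure_pair_measure_alt[OF sets(2)] slice)
  also have "\<dots> = emeasure (lborel \<Otimes>\<^sub>M lborel) A" by (rule lborel.emeasure_pair_measure_alt[OF sets(1), symmetric])
  finally show "emeasure (distr lborel borel ?shear) A = emeasure lborel A" by (simp add: lborel_prod)
qed simp

lemma lborel_integral_shear:
  fixes H :: "'a::euclidean_space \<times> 'a \<Rightarrow> real"
  assumes "integrable lborel H"
  shows "integrable lborel (\<lambda>p. H (fst p, fst p + snd p))"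
    and "(LINT p|lborel. H (fst p, fst p + snd p)) = (LINT p|lborel. H p)"
proof -
  have shear: "(\<lambda>p :: 'a \<times> 'a. (fst p, fst p + snd p)) \<in> lborel \<rightarrow>\<^sub>M borel"
    by (subst measurable_lborel2) (intro borel_measurable_continuous_onI continuous_intros)
  have H: "H \<in> borel_measurable borel" using borel_measurable_integrable[OF assms] by simp
  show "integrable lborel (\<lambda>p. H (fst p, fst p + snd p))"
    "(LINT p|lborel. H (fst p, fst p + snd p)) = (LINT p|lborel. H p)"
    using integrable_distr_eq[OF shear H] integral_distr[OF shear H] assms by (simp_all add: lborel_distr_shear)
qed

lemma lborel_Fubini:
  fixes H :: "'a::euclidean_space \<times> 'b::euclidean_space \<Rightarrow> real"
  assumes "integrable lborel H"
  shows "(LINT x|lborel. LINT y|lborel. H (x, y)) = (LINT p|lborel. H p)"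
    and "(LINT y|lborel. LINT x|lborel. H (x, y)) = (LINT p|lborel. H p)"
    and "integrable lborel (\<lambda>y. LINT x|lborel. H (x, y))"
proof -
  have "integrable (lborel \<Otimes>\<^sub>M lborel) (case_prod (\<lambda>x y. H (x, y)))" using assms by (simp add: lborel_prod)
  from lborel_pair.integral_fst[OF this] lborel_pair.integral_snd[OF this] lborel_pair.integrable_snd[OF this]
  show "(LINT x|lborel. LINT y|lborel. H (x, y)) = (LINT p|lborel. H p)"
    "(LINT y|lborel. LINT x|lborel. H (x, y)) = (LINT p|lborel. H p)"
    "integrable lborel (\<lambda>y. LINT x|lborel. H (x, y))" by (simp_all add: lborel_prod)
qed

lemma integrable_bounded_continuous:
  fixes G c :: "'a::euclidean_space \<Rightarrow> real"
  assumes G: "G \<in> borel_measurable borel" "\<And>z. \<bar>G z\<bar> \<le> M" and c: "continuous_on UNIV c"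
    and K: "bounded K" "\<And>z. z \<notin> K \<Longrightarrow> G z * c z = 0"
  shows "integrable lborel (\<lambda>z. G z * c z)"
proof -
  obtain N where N: "0 \<le> N" "\<And>z. z \<in> closure K \<Longrightarrow> \<bar>c z\<bar> \<le> N"
    by (rule compact_continuous_abs_bound[OF _ continuous_on_subset[OF c], of "closure K"]) (use K(1) in auto)
  have "0 \<le> M" using order.trans[OF abs_ge_zero G(2)] .
  have bound: "\<bar>G z * c z\<bar> \<le> M * N" for z
  proof (cases "z \<in> K")
    case True
    then have "\<bar>c z\<bar> \<le> N" using N(2) closure_subset by blast
    with \<open>0 \<le> M\<close> G(2)[of z] show ?thesis unfolding abs_mult by (intro mult_mono) auto
  next
    case False
    then show ?thesis unfolding K(2)[OF False] using \<open>0 \<le> M\<close> N(1) by simp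
  qed
  have "(\<lambda>z. G z * c z) \<in> borel_measurable borel"
    using G(1) borel_measurable_continuous_onI[OF c] by measurable
  then show ?thesis by (rule integrable_lborel_bounded_support[OF _ K(1) bound K(2)])
qed

definition mollifier :: "real \<Rightarrow> 'a::euclidean_space \<Rightarrow> real" where
  "mollifier \<delta> \<zeta> = bump (\<delta>\<^sup>2 - \<zeta> \<bullet> \<zeta>)"

lemma mollifier_nonneg: "0 \<le> mollifier \<delta> \<zeta>"
  by (simp add: mollifier_def flat_exp_nonneg)

lemma mollifier_eq_0: "0 \<le> \<delta> \<Longrightarrow> \<delta> \<le> norm \<zeta> \<Longrightarrow> mollifier \<delta> \<zeta> = 0"
  using power_mono[of \<delta> "norm \<zeta>" 2] by (auto simp: mollifier_def dot_square_norm intro!: flat_exp_eq_0)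

lemma mollifier_pos:
  assumes "norm \<zeta> < \<delta>"
  shows "0 < mollifier \<delta> \<zeta>"
proof -
  have "(norm \<zeta>)\<^sup>2 < \<delta>\<^sup>2" using assms by (intro power_strict_mono) auto
  then show ?thesis unfolding mollifier_def by (intro flat_exp_pos) (simp add: dot_square_norm)
qed

lemma smooth_mollifier: "smooth (mollifier \<delta>)"
  unfolding mollifier_def[abs_def]
  by (intro smooth_compose[OF smooth_flat_exp] smooth_diff smooth_const
      smooth_bounded_bilinear[OF bounded_bilinear_inner] smooth_ident)

lemma mollifier_integral_pos:
  assumes "0 < \<delta>"
  shows "integrable lborel (mollifier \<delta> :: 'a::euclidean_space \<Rightarrow> real)"
    and "0 < (LINT \<zeta>|lborel. mollifier \<delta> (\<zeta>::'a))"
proof -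
  show integrable: "integrable lborel (mollifier \<delta> :: 'a \<Rightarrow> real)"
    using integrable_bounded_continuous[of "\<lambda>_. 1" 1 "mollifier \<delta> :: 'a \<Rightarrow> real" "ball 0 \<delta>"]
      smooth_imp_continuous_on[OF smooth_mollifier, of UNIV \<delta>] mollifier_eq_0[of \<delta>] assms by (auto simp: not_less)
  have "(LINT \<zeta>|lborel. mollifier \<delta> (\<zeta>::'a)) \<noteq> 0"
  proof
    assume "(LINT \<zeta>|lborel. mollifier \<delta> (\<zeta>::'a)) = 0"
    then have "AE \<zeta> in lborel. mollifier \<delta> (\<zeta>::'a) = 0"
      using integral_nonneg_eq_0_iff_AE[OF integrable] by (simp add: mollifier_nonneg)
    then have "AE \<zeta> in lebesgue. (\<zeta>::'a) \<notin> ball 0 \<delta>"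
      by (intro AE_completion) (auto elim!: eventually_mono dest: mollifier_pos)
    then have "negligible (ball (0::'a) \<delta>)" by (simp add: negligible_iff_null_sets AE_iff_null_sets)
    then show False using open_not_negligible[of "ball (0::'a) \<delta>"] assms by simp
  qed
  moreover have "0 \<le> (LINT \<zeta>|lborel. mollifier \<delta> (\<zeta>::'a))" by (intro integral_nonneg_AE AE_I2 mollifier_nonneg)
  ultimately show "0 < (LINT \<zeta>|lborel. mollifier \<delta> (\<zeta>::'a))" by simp
qed

lemma nonneg_of_mollifier_averages_nonneg:
  fixes G :: "'a::euclidean_space \<Rightarrow> real"
  assumes \<tau>: "0 < \<tau>" and G: "(G \<longlongrightarrow> G 0) (at 0)"
    and average: "\<And>\<delta>. 0 < \<delta> \<Longrightarrow> \<delta> < \<tau> \<Longrightarrow> integrable lborel (\<lambda>\<zeta>. mollifier \<delta> \<zeta> * G \<zeta>)"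
      "\<And>\<delta>. 0 < \<delta> \<Longrightarrow> \<delta> < \<tau> \<Longrightarrow> 0 \<le> (LINT \<zeta>|lborel. mollifier \<delta> \<zeta> * G \<zeta>)"
  shows "0 \<le> G 0"
proof (rule ccontr)
  assume "\<not> 0 \<le> G 0"
  then have negative: "G 0 < 0" by simp
  then have "\<forall>\<^sub>F \<zeta> in at 0. G \<zeta> < G 0 / 2" by (intro order_tendstoD(2)[OF G]) simp
  then obtain d where d: "0 < d" "\<And>\<zeta>. \<zeta> \<noteq> 0 \<Longrightarrow> dist \<zeta> 0 < d \<Longrightarrow> G \<zeta> < G 0 / 2" unfolding eventually_at by blast
  have G_le: "G \<zeta> \<le> G 0 / 2" if "norm \<zeta> < d" for \<zeta>
    using d(2)[of \<zeta>] that negative by (cases "\<zeta> = 0") auto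
  define \<delta> where "\<delta> = min (d / 2) (\<tau> / 2)"
  have \<delta>: "0 < \<delta>" "\<delta> < \<tau>" "\<delta> < d" using d(1) \<tau> by (auto simp: \<delta>_def min_def)
  have "(LINT \<zeta>|lborel. mollifier \<delta> \<zeta> * G \<zeta>) \<le> (LINT \<zeta>|lborel. mollifier \<delta> (\<zeta> :: 'a) * (G 0 / 2))"
  proof (rule integral_mono[OF average(1)[OF \<delta>(1,2)]])
    show "integrable lborel (\<lambda>\<zeta>::'a. mollifier \<delta> \<zeta> * (G 0 / 2))"
      by (intro integrable_mult_left mollifier_integral_pos \<delta>)
    show "mollifier \<delta> \<zeta> * G \<zeta> \<le> mollifier \<delta> \<zeta> * (G 0 / 2)" for \<zeta>
      using G_le[of \<zeta>] mollifier_eq_0[of \<delta> \<zeta>] \<delta>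
      by (cases "norm \<zeta> < d") (auto simp del: times_divide_eq_right intro!: mult_left_mono mollifier_nonneg)
  qed
  also have "\<dots> = (LINT \<zeta>|lborel. mollifier \<delta> (\<zeta> :: 'a)) * (G 0 / 2)" by (rule integral_mult_left_zero)
  also have "\<dots> < 0" using mollifier_integral_pos(2)[OF \<delta>(1), where 'a = 'a] negative by (simp add: mult_pos_neg)
  finally show False using average(2)[OF \<delta>(1,2)] by simp
qed

definition interior_box :: "real \<Rightarrow> real \<Rightarrow> (real \<times> real \<times> (real^'n)) set" where
  "interior_box \<tau> R = {z. \<bar>fst z\<bar> \<le> R \<and> \<tau> \<le> fst (snd z) \<and> fst (snd z) \<le> R}"

lemma closed_interior_box: "closed (interior_box \<tau> R)"
  unfolding interior_box_def by (intro closed_Collect_conj closed_Collect_le continuous_intros)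

lemma compact_interior_box_Gam: "compact (interior_box \<tau> R \<inter> UNIV \<times> UNIV \<times> (Gam :: (real^'n) set))"
proof -
  have "interior_box \<tau> R \<inter> UNIV \<times> UNIV \<times> Gam = {-R..R} \<times> {\<tau>..R} \<times> (Gam :: (real^'n) set)"
    by (auto simp: interior_box_def)
  then show ?thesis by (simp add: compact_Times compact_Gam)
qed

lemma test_fun_interior_box:
  fixes \<phi> :: "real \<times> real \<times> (real^'n) \<Rightarrow> real"
  assumes "smooth \<phi>" "0 < \<tau>" "\<And>z. \<phi> z \<noteq> 0 \<Longrightarrow> z \<in> interior_box \<tau> R"
  shows "test_fun domT \<phi>"
  unfolding test_fun_def
proof (intro conjI exI ballI)
  show "interior_box \<tau> R \<inter> UNIV \<times> UNIV \<times> Gam \<subseteq> domT" using assms(2) by (auto simp: interior_box_def domT_def)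
  show "\<phi> z = 0" if "z \<in> domT - interior_box \<tau> R \<inter> UNIV \<times> UNIV \<times> Gam" for z
    using that assms(3)[of z] by (cases z) (auto simp: domT_def)
qed (rule assms(1) compact_interior_box_Gam)+

locale kruzkov_pair =
  fixes w u P :: "real \<times> real \<times> (real^'n) \<Rightarrow> real" and g :: "real \<Rightarrow> real" and B L :: real
  assumes measurable [measurable]: "w \<in> borel_measurable borel" "u \<in> borel_measurable borel"
      "P \<in> borel_measurable borel" "g \<in> borel_measurable borel"
    and bounded: "\<And>z. \<bar>w z\<bar> \<le> B" "\<And>z. \<bar>u z\<bar> \<le> B" "\<And>z. \<bar>g (w z)\<bar> \<le> B" "\<And>z. \<bar>g (u z)\<bar> \<le> B"
    and weight: "\<And>z. 0 \<le> P z" "\<And>z. P z \<le> B" "\<And>z. z \<notin> domT \<Longrightarrow> P z = 0"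
    and lipschitz: "\<And>z z1 z2. \<bar>kflux g (w z) (u z1) - kflux g (w z) (u z2)\<bar> \<le> L * \<bar>u z1 - u z2\<bar>"
      "\<And>z. \<bar>kflux g (w z) (u z)\<bar> \<le> L * \<bar>w z - u z\<bar>" "0 \<le> L"
    and kruzkov_w: "\<And>z' \<phi>. test_fun domT \<phi> \<Longrightarrow> (\<And>z. 0 \<le> \<phi> z) \<Longrightarrow>
      0 \<le> (LINT z|lborel. (\<bar>w z - u z'\<bar> * dt \<phi> z + kflux g (w z) (u z') * dx \<phi> z) * P z)"
    and kruzkov_u: "\<And>z \<phi>. test_fun domT \<phi> \<Longrightarrow> (\<And>z. 0 \<le> \<phi> z) \<Longrightarrow>
      0 \<le> (LINT z'|lborel. (\<bar>w z - u z'\<bar> * dt \<phi> z' + kflux g (w z) (u z') * dx \<phi> z') * P z')"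
begin

definition pair_flux :: "real \<Rightarrow> real \<Rightarrow> real \<times> real \<times> (real^'n) \<Rightarrow> real \<times> real \<times> (real^'n) \<Rightarrow> real" where
  "pair_flux a b z z' = \<bar>w z - u z'\<bar> * a + kflux g (w z) (u z') * b"

lemma B_nonneg: "0 \<le> B"
  using order.trans[OF abs_ge_zero bounded(1)] .

lemma weight_product_bounds: "0 \<le> P z * P z'" "P z * P z' \<le> B * B"
  by (intro mult_nonneg_nonneg mult_mono weight B_nonneg)+

lemma distance_bound: "\<bar>w z - u z'\<bar> \<le> 2 * B"
  using bounded(1)[of z] bounded(2)[of z'] by simp

lemma kflux_bound: "\<bar>kflux g (w z) (u z')\<bar> \<le> 2 * B"
  using abs_kflux_le[of g "w z" "u z'"] bounded(3)[of z] bounded(4)[of z'] by linarith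

lemma abs_pair_flux_le: "\<bar>pair_flux a b z z'\<bar> \<le> 2 * B * (\<bar>a\<bar> + \<bar>b\<bar>)"
proof -
  have "\<bar>pair_flux a b z z'\<bar> \<le> \<bar>\<bar>w z - u z'\<bar>\<bar> * \<bar>a\<bar> + \<bar>kflux g (w z) (u z')\<bar> * \<bar>b\<bar>"
    unfolding pair_flux_def abs_mult[symmetric] by (rule abs_triangle_ineq)
  also have "\<dots> \<le> 2 * B * \<bar>a\<bar> + 2 * B * \<bar>b\<bar>"
    using distance_bound kflux_bound by (intro add_mono mult_right_mono) auto
  finally show ?thesis by (simp add: distrib_left)
qed

lemma pair_flux_lipschitz:
  "\<bar>pair_flux a b z z1 - pair_flux a b z z2\<bar> \<le> (1 + L) * (\<bar>a\<bar> + \<bar>b\<bar>) * \<bar>u z1 - u z2\<bar>"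
proof -
  have "pair_flux a b z z1 - pair_flux a b z z2
      = (\<bar>w z - u z1\<bar> - \<bar>w z - u z2\<bar>) * a + (kflux g (w z) (u z1) - kflux g (w z) (u z2)) * b"
    by (simp add: pair_flux_def algebra_simps)
  also have "\<bar>\<dots>\<bar> \<le> \<bar>\<bar>w z - u z1\<bar> - \<bar>w z - u z2\<bar>\<bar> * \<bar>a\<bar> + \<bar>kflux g (w z) (u z1) - kflux g (w z) (u z2)\<bar> * \<bar>b\<bar>"
    unfolding abs_mult[symmetric] by (rule abs_triangle_ineq)
  also have "\<dots> \<le> (1 + L) * \<bar>u z1 - u z2\<bar> * \<bar>a\<bar> + (1 + L) * \<bar>u z1 - u z2\<bar> * \<bar>b\<bar>"
  proof (intro add_mono mult_right_mono)
    have "\<bar>\<bar>w z - u z1\<bar> - \<bar>w z - u z2\<bar>\<bar> \<le> 1 * \<bar>u z1 - u z2\<bar>" by simp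
    also have "\<dots> \<le> (1 + L) * \<bar>u z1 - u z2\<bar>" using lipschitz(3) by (intro mult_right_mono) auto
    finally show "\<bar>\<bar>w z - u z1\<bar> - \<bar>w z - u z2\<bar>\<bar> \<le> (1 + L) * \<bar>u z1 - u z2\<bar>" .
    have "L * \<bar>u z1 - u z2\<bar> \<le> (1 + L) * \<bar>u z1 - u z2\<bar>" by (intro mult_right_mono) auto
    with lipschitz(1)[of z z1 z2] show "\<bar>kflux g (w z) (u z1) - kflux g (w z) (u z2)\<bar> \<le> (1 + L) * \<bar>u z1 - u z2\<bar>"
      by linarith
  qed auto
  finally show ?thesis by (simp add: algebra_simps)
qed

lemma integrable_pair_flux:
  fixes a b :: "(real \<times> real \<times> (real^'n)) \<times> (real \<times> real \<times> (real^'n)) \<Rightarrow> real"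
  assumes continuous: "continuous_on UNIV a" "continuous_on UNIV b"
    and support: "\<And>z z'. \<not> (z \<in> interior_box \<tau> R \<and> z' \<in> interior_box \<tau> R) \<Longrightarrow> a (z, z') = 0 \<and> b (z, z') = 0"
  shows "integrable lborel (\<lambda>p. pair_flux (a p) (b p) (fst p) (snd p) * (P (fst p) * P (snd p)))"
proof -
  let ?K = "interior_box \<tau> R \<inter> UNIV \<times> UNIV \<times> (Gam :: (real^'n) set)"
  have K: "bounded (?K \<times> ?K)" by (intro bounded_Times compact_imp_bounded compact_interior_box_Gam)
  have support: "(a p = 0 \<and> b p = 0) \<or> P (fst p) * P (snd p) = 0" if "p \<notin> ?K \<times> ?K" for p
    using that support[of "fst p" "snd p"] weight(3)[of "fst p"] weight(3)[of "snd p"]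
    by (cases p) (auto simp: domT_def)
  note [measurable] = measurable_compose[OF fst_borel measurable(1)] measurable_compose[OF fst_borel measurable(3)]
    measurable_compose[OF snd_borel measurable(2)] measurable_compose[OF snd_borel measurable(3)]
  have factor_measurable: "(\<lambda>p. \<bar>w (fst p) - u (snd p)\<bar> * (P (fst p) * P (snd p))) \<in> borel_measurable borel"
    "(\<lambda>p. kflux g (w (fst p)) (u (snd p)) * (P (fst p) * P (snd p))) \<in> borel_measurable borel"
    unfolding kflux_def sgn_if by measurable
  have factor_bound: "\<bar>\<bar>w (fst p) - u (snd p)\<bar> * (P (fst p) * P (snd p))\<bar> \<le> 2 * B * (B * B)"
    "\<bar>kflux g (w (fst p)) (u (snd p)) * (P (fst p) * P (snd p))\<bar> \<le> 2 * B * (B * B)" for p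
    unfolding abs_mult[of _ "P _ * P _"] abs_of_nonneg[OF weight_product_bounds(1)] abs_idempotent
    by (rule mult_mono[OF distance_bound weight_product_bounds(2) _ weight_product_bounds(1)], simp add: B_nonneg)
       (rule mult_mono[OF kflux_bound weight_product_bounds(2) _ weight_product_bounds(1)], simp add: B_nonneg)
  have zero: "\<bar>w (fst p) - u (snd p)\<bar> * (P (fst p) * P (snd p)) * a p = 0"
    "kflux g (w (fst p)) (u (snd p)) * (P (fst p) * P (snd p)) * b p = 0" if "p \<notin> ?K \<times> ?K" for p
    using support[OF that] by auto
  note integrable_bounded_continuous[OF factor_measurable(1) factor_bound(1) continuous(1) K zero(1)]
    integrable_bounded_continuous[OF factor_measurable(2) factor_bound(2) continuous(2) K zero(2)]
  from Bochner_Integration.integrable_add[OF this] show ?thesis by (simp add: pair_flux_def algebra_simps)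
qed

lemma doubled_kruzkov_w:
  assumes \<phi>: "smooth \<phi>" "\<And>p. 0 \<le> \<phi> p" and \<tau>: "0 < \<tau>"
    and support: "\<And>z z'. \<phi> (z, z') \<noteq> 0 \<Longrightarrow> z \<in> interior_box \<tau> R \<and> z' \<in> interior_box \<tau> R"
  shows "0 \<le> (LINT z|lborel. pair_flux (frechet_derivative \<phi> (at (z, z')) ((0, 1, 0), 0))
    (frechet_derivative \<phi> (at (z, z')) ((1, 0, 0), 0)) z z' * (P z * P z'))"
proof -
  let ?slice = "\<lambda>z. \<phi> (z, z')"
  have smooth: "smooth ?slice" by (intro smooth_compose[OF \<phi>(1)] smooth_Pair smooth_ident smooth_const)
  have "((\<lambda>z. (z, z')) has_derivative (\<lambda>h. (h, 0))) (at z)" for z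
    by (intro has_derivative_Pair has_derivative_ident has_derivative_const)
  from frechet_derivative_at[OF has_derivative_compose[OF this smooth_has_derivative[OF \<phi>(1)]]]
  have derivative: "frechet_derivative ?slice (at z) = (\<lambda>h. frechet_derivative \<phi> (at (z, z')) (h, 0))" for z by simp
  have "test_fun domT ?slice" by (rule test_fun_interior_box[OF smooth \<tau>]) (use support in blast)
  from mult_left_mono[OF kruzkov_w[OF this \<phi>(2), of z'] weight(1)[of z']] show ?thesis
    by (simp add: pair_flux_def dt_def dx_def derivative integral_mult_right_zero[symmetric] mult_ac
        del: integral_mult_right_zero)
qed

lemma doubled_kruzkov_u:
  assumes \<phi>: "smooth \<phi>" "\<And>p. 0 \<le> \<phi> p" and \<tau>: "0 < \<tau>"
    and support: "\<And>z z'. \<phi> (z, z') \<noteq> 0 \<Longrightarrow> z \<in> interior_box \<tau> R \<and> z' \<in> interior_box \<tau> R"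
  shows "0 \<le> (LINT z'|lborel. pair_flux (frechet_derivative \<phi> (at (z, z')) (0, (0, 1, 0)))
    (frechet_derivative \<phi> (at (z, z')) (0, (1, 0, 0))) z z' * (P z * P z'))"
proof -
  let ?slice = "\<lambda>z'. \<phi> (z, z')"
  have smooth: "smooth ?slice" by (intro smooth_compose[OF \<phi>(1)] smooth_Pair smooth_ident smooth_const)
  have "((\<lambda>z'. (z, z')) has_derivative (\<lambda>h. (0, h))) (at z')" for z'
    by (intro has_derivative_Pair has_derivative_ident has_derivative_const)
  from frechet_derivative_at[OF has_derivative_compose[OF this smooth_has_derivative[OF \<phi>(1)]]]
  have derivative: "frechet_derivative ?slice (at z') = (\<lambda>h. frechet_derivative \<phi> (at (z, z')) (0, h))" for z' by simp
  have "test_fun domT ?slice" by (rule test_fun_interior_box[OF smooth \<tau>]) (use support in blast)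
  from mult_left_mono[OF kruzkov_u[OF this \<phi>(2), of z] weight(1)[of z]] show ?thesis
    by (simp add: pair_flux_def dt_def dx_def derivative integral_mult_right_zero[symmetric] mult_ac
        del: integral_mult_right_zero)
qed

lemma doubled_kruzkov:
  assumes \<phi>: "smooth \<phi>" "\<And>p. 0 \<le> \<phi> p" and \<tau>: "0 < \<tau>"
    and support: "\<And>z z'. \<phi> (z, z') \<noteq> 0 \<Longrightarrow> z \<in> interior_box \<tau> R \<and> z' \<in> interior_box \<tau> R"
  defines "H \<equiv> \<lambda>p. pair_flux (frechet_derivative \<phi> (at p) ((0, 1, 0), (0, 1, 0)))
    (frechet_derivative \<phi> (at p) ((1, 0, 0), (1, 0, 0))) (fst p) (snd p) * (P (fst p) * P (snd p))"
  shows "integrable lborel H" and "0 \<le> (LINT p|lborel. H p)"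
proof -
  let ?d = "\<lambda>h p. frechet_derivative \<phi> (at p) h"
  let ?H1 = "\<lambda>p. pair_flux (?d ((0, 1, 0), 0) p) (?d ((1, 0, 0), 0) p) (fst p) (snd p) * (P (fst p) * P (snd p))"
  let ?H2 = "\<lambda>p. pair_flux (?d (0, (0, 1, 0)) p) (?d (0, (1, 0, 0)) p) (fst p) (snd p) * (P (fst p) * P (snd p))"
  have closed: "closed (interior_box \<tau> R \<times> interior_box \<tau> R)" by (intro closed_Times closed_interior_box)
  have derivative_zero: "?d h (z, z') = 0" if "\<not> (z \<in> interior_box \<tau> R \<and> z' \<in> interior_box \<tau> R)" for h z z'
    using frechet_derivative_eq_0_outside[OF closed, of \<phi> "(z, z')"] support that by force
  have "((0, 1, 0), 0) \<in> (Basis :: ((real \<times> real \<times> (real^'n)) \<times> (real \<times> real \<times> (real^'n))) set)"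
    "((1, 0, 0), 0) \<in> (Basis :: ((real \<times> real \<times> (real^'n)) \<times> (real \<times> real \<times> (real^'n))) set)"
    "(0, (0, 1, 0)) \<in> (Basis :: ((real \<times> real \<times> (real^'n)) \<times> (real \<times> real \<times> (real^'n))) set)"
    "(0, (1, 0, 0)) \<in> (Basis :: ((real \<times> real \<times> (real^'n)) \<times> (real \<times> real \<times> (real^'n))) set)"
    by (simp_all add: Basis_prod_def zero_prod_def)
  note continuous = this[THEN smooth_frechet_derivative[OF \<phi>(1)], THEN smooth_imp_continuous_on]
  have integrable: "integrable lborel ?H1" "integrable lborel ?H2"
    by (rule integrable_pair_flux[where \<tau> = \<tau> and R = R, OF continuous(1,2)], simp add: derivative_zero)
       (rule integrable_pair_flux[where \<tau> = \<tau> and R = R, OF continuous(3,4)], simp add: derivative_zero)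
  have "?d (h, h') p = ?d (h, 0) p + ?d (0, h') p" for h h' p
    by (subst linear_add[OF has_derivative_linear[OF smooth_has_derivative[OF \<phi>(1)]], symmetric]) simp
  note this[of _ "(0, 1, 0)" "(0, 1, 0)"] this[of _ "(1, 0, 0)" "(1, 0, 0)"]
  then have H: "H = (\<lambda>p. ?H1 p + ?H2 p)"
    unfolding H_def by (intro ext) (simp only: pair_flux_def distrib_left distrib_right add.assoc add.left_commute)
  then show "integrable lborel H" using integrable by simp
  have "(LINT p|lborel. ?H1 p) = (LINT z'|lborel. LINT z|lborel. ?H1 (z, z'))"
    by (rule lborel_Fubini(2)[OF integrable(1), symmetric])
  also have "0 \<le> \<dots>"
    by (rule Bochner_Integration.integral_nonneg) (use doubled_kruzkov_w[OF \<phi> \<tau> support] in simp)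
  finally have "0 \<le> (LINT p|lborel. ?H1 p)" .
  moreover have "(LINT p|lborel. ?H2 p) = (LINT z|lborel. LINT z'|lborel. ?H2 (z, z'))"
    by (rule lborel_Fubini(1)[OF integrable(2), symmetric])
  moreover have "0 \<le> (LINT z|lborel. LINT z'|lborel. ?H2 (z, z'))"
    by (rule Bochner_Integration.integral_nonneg) (use doubled_kruzkov_u[OF \<phi> \<tau> support] in simp)
  ultimately show "0 \<le> (LINT p|lborel. H p)" unfolding H using integrable by simp
qed

definition cutoff_flux :: "(real \<times> real \<times> (real^'n) \<Rightarrow> real) \<Rightarrow> real \<times> real \<times> (real^'n) \<Rightarrow> real
    \<times> real \<times> (real^'n) \<Rightarrow> real" where
  "cutoff_flux \<psi> z z' = pair_flux (dt \<psi> z) (dx \<psi> z) z z' * (P z * P z')"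

definition shifted_flux :: "(real \<times> real \<times> (real^'n) \<Rightarrow> real) \<Rightarrow> real \<times> real \<times> (real^'n) \<Rightarrow> real" where
  "shifted_flux \<psi> \<zeta> = (LINT z|lborel. cutoff_flux \<psi> z (z + \<zeta>))"

lemma mollified_shifted_flux_nonneg:
  assumes \<psi>: "smooth \<psi>" "\<And>z. 0 \<le> \<psi> z" and support: "\<And>z. \<psi> z \<noteq> 0 \<Longrightarrow> z \<in> interior_box \<tau> R"
    and \<delta>: "0 < \<delta>" "\<delta> < \<tau>"
  shows "integrable lborel (\<lambda>\<zeta>. mollifier \<delta> \<zeta> * shifted_flux \<psi> \<zeta>)"
    and "0 \<le> (LINT \<zeta>|lborel. mollifier \<delta> \<zeta> * shifted_flux \<psi> \<zeta>)"
proof -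
  define \<phi> where "\<phi> p = \<psi> (fst p) * mollifier \<delta> (snd p - fst p)"
    for p :: "(real \<times> real \<times> (real^'n)) \<times> (real \<times> real \<times> (real^'n))"
  have smooth: "smooth \<phi>"
    unfolding \<phi>_def[abs_def]
    by (intro smooth_mult smooth_compose[OF \<psi>(1)] smooth_compose[OF smooth_mollifier] smooth_diff smooth_fst smooth_snd)
  have nonneg: "0 \<le> \<phi> p" for p by (simp add: \<phi>_def \<psi>(2) mollifier_nonneg)
  have \<phi>_support: "z \<in> interior_box (\<tau> - \<delta>) (R + \<delta>) \<and> z' \<in> interior_box (\<tau> - \<delta>) (R + \<delta>)" if "\<phi> (z, z') \<noteq> 0" for z z'
  proof -
    have z: "z \<in> interior_box \<tau> R" and "norm (z' - z) < \<delta>"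
      using that support[of z] mollifier_eq_0[of \<delta> "z' - z"] \<delta>(1) by (auto simp: \<phi>_def not_le[symmetric])
    then have "\<bar>fst z' - fst z\<bar> < \<delta>" "\<bar>fst (snd z') - fst (snd z)\<bar> < \<delta>"
      using abs_coordinates_le_norm[of "z' - z"] by auto
    then show ?thesis using z \<delta>(1) by (auto simp: interior_box_def)
  qed
  have "(\<phi> has_derivative (\<lambda>h. \<psi> (fst p) * frechet_derivative (mollifier \<delta>) (at (snd p - fst p)) (snd h - fst h)
      + frechet_derivative \<psi> (at (fst p)) (fst h) * mollifier \<delta> (snd p - fst p))) (at p)" for p
    unfolding \<phi>_def[abs_def]
    by (intro has_derivative_mult has_derivative_compose[OF _ smooth_has_derivative[OF \<psi>(1)]]
        has_derivative_compose[OF _ smooth_has_derivative[OF smooth_mollifier]] derivative_intros)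
  from frechet_derivative_at[OF this, symmetric]
  have derivative: "frechet_derivative \<phi> (at p) (h, h) = frechet_derivative \<psi> (at (fst p)) h
      * mollifier \<delta> (snd p - fst p)" for p h
    by (simp add: linear_0[OF has_derivative_linear[OF smooth_has_derivative[OF smooth_mollifier]]])
  define H where "H p = mollifier \<delta> (snd p - fst p) * cutoff_flux \<psi> (fst p) (snd p)" for p
  have "0 < \<tau> - \<delta>" using \<delta>(2) by simp
  from doubled_kruzkov[OF smooth nonneg this \<phi>_support]
  have H: "integrable lborel H" "0 \<le> (LINT p|lborel. H p)"
    unfolding derivative by (simp_all add: H_def[abs_def] cutoff_flux_def pair_flux_def dt_def dx_def algebra_simps)
  note sheared = lborel_integral_shear[OF H(1)]
  have inner: "(LINT z|lborel. H (z, z + \<zeta>)) = mollifier \<delta> \<zeta> * shifted_flux \<psi> \<zeta>" for \<zeta>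
    by (simp add: H_def shifted_flux_def)
  from lborel_Fubini(3)[OF sheared(1)] show "integrable lborel (\<lambda>\<zeta>. mollifier \<delta> \<zeta> * shifted_flux \<psi> \<zeta>)"
    by (simp add: inner)
  from lborel_Fubini(2)[OF sheared(1)] show "0 \<le> (LINT \<zeta>|lborel. mollifier \<delta> \<zeta> * shifted_flux \<psi> \<zeta>)"
    using sheared(2) H(2) by (simp add: inner)
qed

lemma cutoff_flux_eq_0:
  assumes support: "\<And>z. \<psi> z \<noteq> 0 \<Longrightarrow> z \<in> interior_box \<tau> R" and z: "z \<notin> interior_box \<tau> R \<inter> UNIV \<times> UNIV \<times> Gam"
  shows "cutoff_flux \<psi> z z' = 0"
proof (cases "z \<in> interior_box \<tau> R")
  case True
  then have "P z = 0" using z by (intro weight(3)) (auto simp: domT_def)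
  then show ?thesis by (simp add: cutoff_flux_def)
next
  case False
  have "frechet_derivative \<psi> (at z) = (\<lambda>h. 0)"
    by (rule frechet_derivative_eq_0_outside[OF closed_interior_box _ False]) (use support in blast)
  then show ?thesis by (simp add: cutoff_flux_def pair_flux_def dt_def dx_def)
qed

lemma abs_weighted_pair_flux_le:
  assumes M: "\<bar>a\<bar> + \<bar>b\<bar> \<le> M"
  shows "\<bar>pair_flux a b z z' * (P z * P z')\<bar> \<le> 2 * B * M * (B * B)"
proof -
  have "\<bar>pair_flux a b z z'\<bar> \<le> 2 * B * M"
    using abs_pair_flux_le[of a b z z'] mult_left_mono[OF M, of "2 * B"] B_nonneg by simp
  then show ?thesis
    unfolding abs_mult[of _ "P z * P z'"] abs_of_nonneg[OF weight_product_bounds(1)]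
    using B_nonneg M by (intro mult_mono weight_product_bounds) auto
qed

lemma weighted_pair_flux_lipschitz:
  assumes M: "\<bar>a\<bar> + \<bar>b\<bar> \<le> M"
  shows "\<bar>pair_flux a b z z' * (P z * P z') - pair_flux a b z z * (P z * P z)\<bar>
    \<le> (1 + L) * M * (B * B) * \<bar>u z' - u z\<bar> + 2 * B * M * B * \<bar>P z' - P z\<bar>"
proof -
  let ?f = "pair_flux a b z"
  have M_nonneg: "0 \<le> M" using M by linarith
  have flux_le: "\<bar>?f z\<bar> \<le> 2 * B * M"
    using abs_pair_flux_le[of a b z z] mult_left_mono[OF M, of "2 * B"] B_nonneg by simp
  have "\<bar>?f z' - ?f z\<bar> \<le> (1 + L) * M * \<bar>u z' - u z\<bar>"
    using pair_flux_lipschitz[of a b z z' z] M lipschitz(3)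
    by (elim order.trans) (intro mult_right_mono mult_left_mono; simp)
  then have "\<bar>?f z' - ?f z\<bar> * (P z * P z') \<le> (1 + L) * M * \<bar>u z' - u z\<bar> * (B * B)"
    using M_nonneg lipschitz(3) by (intro mult_mono weight_product_bounds) auto
  moreover have "\<bar>?f z\<bar> * (P z * \<bar>P z' - P z\<bar>) \<le> 2 * B * M * (B * \<bar>P z' - P z\<bar>)"
    using B_nonneg M_nonneg weight by (intro mult_mono flux_le mult_right_mono) auto
  moreover have "\<bar>(?f z' - ?f z) * (P z * P z') + ?f z * (P z * (P z' - P z))\<bar>
      \<le> \<bar>?f z' - ?f z\<bar> * (P z * P z') + \<bar>?f z\<bar> * (P z * \<bar>P z' - P z\<bar>)"
    using abs_triangle_ineq[of "(?f z' - ?f z) * (P z * P z')" "?f z * (P z * (P z' - P z))"] weight(1)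
    by (simp add: abs_mult)
  moreover have "?f z' * (P z * P z') - ?f z * (P z * P z)
      = (?f z' - ?f z) * (P z * P z') + ?f z * (P z * (P z' - P z))"
    by (simp add: algebra_simps)
  ultimately show ?thesis by (simp add: mult_ac)
qed

lemma cutoff_flux_bounds:
  assumes \<psi>: "smooth \<psi>" and support: "\<And>z. \<psi> z \<noteq> 0 \<Longrightarrow> z \<in> interior_box \<tau> R"
  obtains C where "0 \<le> C" "\<And>z z'. \<bar>cutoff_flux \<psi> z z'\<bar> \<le> C"
    "\<And>z z'. \<bar>cutoff_flux \<psi> z z' - cutoff_flux \<psi> z z\<bar> \<le> C * (\<bar>u z' - u z\<bar> + \<bar>P z' - P z\<bar>)"
proof -
  let ?K = "interior_box \<tau> R \<inter> UNIV \<times> UNIV \<times> (Gam :: (real^'n) set)"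
  have "continuous_on ?K (\<lambda>z. \<bar>dt \<psi> z\<bar> + \<bar>dx \<psi> z\<bar>)"
    by (intro continuous_intros smooth_imp_continuous_on smooth_dt smooth_dx \<psi>)
  then obtain M where "0 \<le> M" "\<And>z. z \<in> ?K \<Longrightarrow> \<bar>\<bar>dt \<psi> z\<bar> + \<bar>dx \<psi> z\<bar>\<bar> \<le> M"
    by (rule compact_continuous_abs_bound[OF compact_interior_box_Gam]) blast
  then have M: "0 \<le> M" "\<And>z. z \<in> ?K \<Longrightarrow> \<bar>dt \<psi> z\<bar> + \<bar>dx \<psi> z\<bar> \<le> M" by force+
  note zero = cutoff_flux_eq_0[where \<psi> = \<psi>, OF support]
  define C where "C = 2 * B * M * (B * B) + 2 * B * M * B + (1 + L) * M * (B * B)"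
  have C_terms: "0 \<le> 2 * B * M * (B * B)" "0 \<le> 2 * B * M * B" "0 \<le> (1 + L) * M * (B * B)"
    using B_nonneg M(1) lipschitz(3) by simp_all
  show ?thesis
  proof (rule that[of C])
    show "0 \<le> C" using C_terms by (simp add: C_def)
    show "\<bar>cutoff_flux \<psi> z z'\<bar> \<le> C" for z z'
    proof (cases "z \<in> ?K")
      case True
      from abs_weighted_pair_flux_le[OF M(2)[OF this], of z z'] C_terms show ?thesis
        unfolding C_def cutoff_flux_def by linarith
    qed (use zero C_terms in \<open>simp add: C_def\<close>)
    show "\<bar>cutoff_flux \<psi> z z' - cutoff_flux \<psi> z z\<bar> \<le> C * (\<bar>u z' - u z\<bar> + \<bar>P z' - P z\<bar>)" for z z'
    proof (cases "z \<in> ?K")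
      case True
      have "\<bar>cutoff_flux \<psi> z z' - cutoff_flux \<psi> z z\<bar>
          \<le> (1 + L) * M * (B * B) * \<bar>u z' - u z\<bar> + 2 * B * M * B * \<bar>P z' - P z\<bar>"
        unfolding cutoff_flux_def by (rule weighted_pair_flux_lipschitz[OF M(2)[OF True]])
      also have "\<dots> \<le> C * \<bar>u z' - u z\<bar> + C * \<bar>P z' - P z\<bar>"
        using C_terms unfolding C_def by (intro add_mono mult_right_mono) auto
      finally show ?thesis by (simp add: distrib_left)
    qed (use zero C_terms in \<open>simp add: C_def\<close>)
  qed
qed

lemma integrable_cutoff_flux:
  assumes \<psi>: "smooth \<psi>" and support: "\<And>z. \<psi> z \<noteq> 0 \<Longrightarrow> z \<in> interior_box \<tau> R"
  shows "integrable lborel (\<lambda>z. cutoff_flux \<psi> z (z + \<zeta>))"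
proof -
  obtain C where C: "\<And>z z'. \<bar>cutoff_flux \<psi> z z'\<bar> \<le> C" using cutoff_flux_bounds[OF \<psi> support] by metis
  have [measurable]: "(\<lambda>z. h (z + \<zeta>)) \<in> borel_measurable borel"
    if "h \<in> borel_measurable borel" for h :: "real \<times> real \<times> (real^'n) \<Rightarrow> real"
    by (rule measurable_compose[OF _ that]) simp
  have [measurable]: "dt \<psi> \<in> borel_measurable borel" "dx \<psi> \<in> borel_measurable borel"
    by (intro smooth_imp_borel_measurable smooth_dt smooth_dx \<psi>)+
  show ?thesis
  proof (rule integrable_lborel_bounded_support[OF _ compact_imp_bounded[OF compact_interior_box_Gam] C
      cutoff_flux_eq_0[OF support]])
    show "(\<lambda>z. cutoff_flux \<psi> z (z + \<zeta>)) \<in> borel_measurable borel"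
      unfolding cutoff_flux_def pair_flux_def kflux_def sgn_if by measurable
  qed
qed

lemma shifted_flux_tendsto:
  assumes \<psi>: "smooth \<psi>" and support: "\<And>z. \<psi> z \<noteq> 0 \<Longrightarrow> z \<in> interior_box \<tau> R"
  shows "(shifted_flux \<psi> \<longlongrightarrow> shifted_flux \<psi> 0) (at 0)"
proof -
  let ?K = "interior_box \<tau> R \<inter> UNIV \<times> UNIV \<times> (Gam :: (real^'n) set)"
  let ?T = "\<lambda>h \<zeta>. LINT z|lborel. indicator ?K z * \<bar>h (z + \<zeta>) - h z\<bar>"
  obtain C where C: "0 \<le> C" "\<And>z z'. \<bar>cutoff_flux \<psi> z z' - cutoff_flux \<psi> z z\<bar> \<le> C * (\<bar>u z' - u z\<bar> + \<bar>P z' - P z\<bar>)"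
    by (rule cutoff_flux_bounds[OF \<psi> support]) blast+
  have K: "compact ?K" "?K \<in> sets borel" using compact_interior_box_Gam borel_compact by auto
  have P_bound: "\<bar>P z\<bar> \<le> B" for z using weight by (simp add: abs_of_nonneg)
  have translation_integrable: "integrable lborel (\<lambda>z. indicator ?K z * \<bar>h (z + \<zeta>) - h z\<bar>)"
    if h: "h \<in> borel_measurable borel" "\<And>z. \<bar>h z\<bar> \<le> B" for h \<zeta>
    by (rule integrable_lborel_abs_difference[OF K(2) measurable_compose[OF _ h(1)] h(1)
        compact_imp_bounded[OF K(1)] h(2) h(2)]) simp
  note integrable = integrable_cutoff_flux[OF \<psi> support]
  have difference_le: "norm (shifted_flux \<psi> \<zeta> - shifted_flux \<psi> 0) \<le> C * (?T u \<zeta> + ?T P \<zeta>)" for \<zeta>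
  proof -
    have "\<bar>shifted_flux \<psi> \<zeta> - shifted_flux \<psi> 0\<bar> = \<bar>LINT z|lborel. cutoff_flux \<psi> z (z + \<zeta>) - cutoff_flux \<psi> z z\<bar>"
      using Bochner_Integration.integral_diff[OF integrable integrable[of 0]] by (simp add: shifted_flux_def)
    also have "\<dots> \<le> (LINT z|lborel. \<bar>cutoff_flux \<psi> z (z + \<zeta>) - cutoff_flux \<psi> z z\<bar>)" by (rule integral_abs_bound)
    also have "\<dots> \<le> (LINT z|lborel. C * (indicator ?K z * \<bar>u (z + \<zeta>) - u z\<bar> + indicator ?K z * \<bar>P (z + \<zeta>) - P z\<bar>))"
    proof (rule integral_mono)
      show "\<bar>cutoff_flux \<psi> z (z + \<zeta>) - cutoff_flux \<psi> z z\<bar>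
          \<le> C * (indicator ?K z * \<bar>u (z + \<zeta>) - u z\<bar> + indicator ?K z * \<bar>P (z + \<zeta>) - P z\<bar>)" for z
        using C(2)[of z "z + \<zeta>"] cutoff_flux_eq_0[where \<psi> = \<psi>, OF support] by (cases "z \<in> ?K") auto
    qed (use integrable[of \<zeta>] integrable[of 0] translation_integrable measurable(2,3) bounded(2) P_bound in simp_all)
    also have "\<dots> = C * (?T u \<zeta> + ?T P \<zeta>)"
      using translation_integrable[OF measurable(2) bounded(2)] translation_integrable[OF measurable(3) P_bound] by simp
    finally show ?thesis by simp
  qed
  have "((\<lambda>\<zeta>. C * (?T u \<zeta> + ?T P \<zeta>)) \<longlongrightarrow> C * (0 + 0)) (at 0)"
    by (intro tendsto_intros K(1) L1_translation_continuous[OF measurable(2) bounded(2)]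
        L1_translation_continuous[OF measurable(3) P_bound])
  then have "((\<lambda>\<zeta>. C * (?T u \<zeta> + ?T P \<zeta>)) \<longlongrightarrow> 0) (at 0)" by simp
  from Lim_null_comparison[OF always_eventually[OF allI[OF difference_le]] this]
  show ?thesis by (rule LIM_zero_cancel)
qed

lemma kato_inequality:
  assumes \<psi>: "smooth \<psi>" "\<And>z. 0 \<le> \<psi> z" and support: "\<And>z. \<psi> z \<noteq> 0 \<Longrightarrow> z \<in> interior_box \<tau> R" and \<tau>: "0 < \<tau>"
  shows "integrable lborel (\<lambda>z. pair_flux (dt \<psi> z) (dx \<psi> z) z z * (P z * P z))"
    and "0 \<le> (LINT z|lborel. pair_flux (dt \<psi> z) (dx \<psi> z) z z * (P z * P z))"
proof -
  show "integrable lborel (\<lambda>z. pair_flux (dt \<psi> z) (dx \<psi> z) z z * (P z * P z))"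
    using integrable_cutoff_flux[OF \<psi>(1) support, of 0] by (simp add: cutoff_flux_def)
  have "0 \<le> shifted_flux \<psi> 0"
    using mollified_shifted_flux_nonneg[OF \<psi> support]
    by (intro nonneg_of_mollifier_averages_nonneg[OF \<tau> shifted_flux_tendsto[OF \<psi>(1) support]])
  then show "0 \<le> (LINT z|lborel. pair_flux (dt \<psi> z) (dx \<psi> z) z z * (P z * P z))"
    by (simp add: shifted_flux_def cutoff_flux_def)
qed

end

subsection \<open>Uniqueness\<close>

context kruzkov_pair
begin

text \<open>
  The slope \<open>1 + 2 L r\<close> dominates \<open>2 L \<bar>x\<bar>\<close> inside the cone, so the time derivative of the cutoff absorbs
  the flux term and leaves a coercive remainder.
\<close>

definition light_cone :: "real \<Rightarrow> real \<times> real \<times> (real^'n) \<Rightarrow> real" where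
  "light_cone r z = r\<^sup>2 - (fst z)\<^sup>2 - (1 + 2 * L * r) * fst (snd z)"

definition cone_cutoff :: "real \<Rightarrow> real \<Rightarrow> real \<times> real \<times> (real^'n) \<Rightarrow> real" where
  "cone_cutoff \<tau> r z = smooth_step (fst (snd z) / \<tau>) * bump (light_cone r z)"

definition weighted_distance :: "real \<times> real \<times> (real^'n) \<Rightarrow> real" where
  "weighted_distance z = \<bar>w z - u z\<bar> * (P z * P z)"

lemma light_cone_inside:
  assumes r: "1 \<le> r" and z: "0 \<le> fst (snd z)" "0 < light_cone r z"
  shows "\<bar>fst z\<bar> \<le> r" "fst (snd z) \<le> r\<^sup>2"
proof -
  have slope: "1 \<le> 1 + 2 * L * r" using lipschitz(3) r by simp
  have "0 \<le> (1 + 2 * L * r) * fst (snd z)" using slope z(1) by simp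
  then have "(fst z)\<^sup>2 \<le> r\<^sup>2" using z(2) by (simp add: light_cone_def)
  then show "\<bar>fst z\<bar> \<le> r" using r by (simp add: abs_le_square_iff[symmetric])
  have "1 * fst (snd z) \<le> (1 + 2 * L * r) * fst (snd z)" using slope z(1) by (intro mult_right_mono)
  moreover have "0 \<le> (fst z)\<^sup>2" by simp
  ultimately show "fst (snd z) \<le> r\<^sup>2" using z(2) unfolding light_cone_def by linarith
qed

lemma light_cone_exhausts:
  assumes "0 \<le> fst (snd z)"
  obtains n where "0 < light_cone (real (Suc n)) z"
proof -
  let ?x = "fst z" and ?t = "fst (snd z)"
  obtain n where n: "?x\<^sup>2 + ?t + 2 * L * ?t + 1 < real n" using reals_Archimedean2 by blast
  define N where "N = real (Suc n)"
  have N: "?x\<^sup>2 + ?t + 2 * L * ?t + 1 \<le> N" "1 \<le> N" using n by (auto simp: N_def)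
  have "N * (?x\<^sup>2 + ?t + 2 * L * ?t + 1) \<le> N * N" using N by (intro mult_left_mono) auto
  moreover have "1 * (?x\<^sup>2 + ?t) \<le> N * (?x\<^sup>2 + ?t)" using N(2) assms by (intro mult_right_mono) auto
  ultimately have "0 < light_cone N z"
    using N(2) by (simp add: light_cone_def power2_eq_square[of N] algebra_simps)
  then show ?thesis unfolding N_def by (rule that)
qed

lemma weighted_distance_bounds: "0 \<le> weighted_distance z" "weighted_distance z \<le> 2 * B * (B * B)"
  and weighted_distance_eq_0: "z \<notin> domT \<Longrightarrow> weighted_distance z = 0"
  and borel_measurable_weighted_distance [measurable]: "weighted_distance \<in> borel_measurable borel"
proof -
  show "0 \<le> weighted_distance z" using weight_product_bounds(1) by (simp add: weighted_distance_def)
  show "weighted_distance z \<le> 2 * B * (B * B)"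
    unfolding weighted_distance_def using B_nonneg
    by (intro mult_mono[OF distance_bound weight_product_bounds(2) _ weight_product_bounds(1)]) simp
  show "weighted_distance z = 0" if "z \<notin> domT" using weight(3)[OF that] by (simp add: weighted_distance_def)
  show "weighted_distance \<in> borel_measurable borel" unfolding weighted_distance_def[abs_def] by measurable
qed

lemma integrable_light_cone:
  assumes r: "1 \<le> r" and c: "continuous_on UNIV c"
  shows "integrable lborel (\<lambda>z. weighted_distance z * (c (fst (snd z)) * flat_exp k (light_cone r z)))"
proof (rule integrable_bounded_continuous)
  show "\<bar>weighted_distance z\<bar> \<le> 2 * B * (B * B)" for z using weighted_distance_bounds by (simp add: abs_of_nonneg)
  show "continuous_on UNIV (\<lambda>z. c (fst (snd z)) * flat_exp k (light_cone r z))"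
    unfolding light_cone_def by (intro continuous_intros continuous_on_compose2[OF c]) auto
  show "bounded ({-r..r} \<times> {0..r\<^sup>2} \<times> (Gam :: (real^'n) set))"
    by (intro bounded_Times compact_imp_bounded[OF compact_Gam]) auto
  show "weighted_distance z * (c (fst (snd z)) * flat_exp k (light_cone r z)) = 0"
    if outside: "z \<notin> {-r..r} \<times> {0..r\<^sup>2} \<times> Gam" for z
  proof (cases "z \<in> domT \<and> 0 < light_cone r z")
    case True
    then have "0 \<le> fst (snd z)" "snd (snd z) \<in> Gam" by (auto simp: domT_def)
    with True light_cone_inside[OF r, of z] outside have False by (cases z) (auto simp: abs_le_iff)
    then show ?thesis ..
  next
    case False
    then show ?thesis using weighted_distance_eq_0[of z] flat_exp_eq_0[of "light_cone r z" k] by force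
  qed
qed measurable

lemma smooth_cone_cutoff: "smooth (cone_cutoff \<tau> r)"
proof -
  have "smooth (\<lambda>z::real \<times> real \<times> (real^'n). fst (snd z) * (1 / \<tau>))"
    by (intro smooth_mult smooth_const smooth_compose[OF smooth_fst smooth_snd])
  moreover have "smooth (light_cone r)"
    unfolding light_cone_def[abs_def] power2_eq_square[of "fst _"]
    by (intro smooth_diff smooth_mult smooth_const smooth_fst smooth_compose[OF smooth_fst smooth_snd])
  ultimately show ?thesis
    unfolding cone_cutoff_def[abs_def]
    using smooth_mult[OF smooth_compose[OF smooth_smooth_step] smooth_compose[OF smooth_flat_exp[of 0]]] by simp
qed

lemma cone_cutoff_support:
  assumes r: "1 \<le> r" and \<tau>: "0 < \<tau>" and z: "cone_cutoff \<tau> r z \<noteq> 0"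
  shows "z \<in> interior_box \<tau> (r\<^sup>2)"
proof -
  have "\<not> fst (snd z) / \<tau> \<le> 1" "\<not> light_cone r z \<le> 0"
    using z smooth_step_eq_0 flat_exp_eq_0[of "light_cone r z" 0] by (auto simp: cone_cutoff_def)
  then have "\<tau> \<le> fst (snd z)" "0 < light_cone r z" using \<tau> by (auto simp: field_simps)
  moreover have "r \<le> r\<^sup>2" using r by (simp add: power2_eq_square)
  ultimately show ?thesis using light_cone_inside[OF r, of z] \<tau> by (auto simp: interior_box_def)
qed

lemma cone_cutoff_derivatives:
  assumes "0 < \<tau>"
  shows "dt (cone_cutoff \<tau> r) z = deriv smooth_step (fst (snd z) / \<tau>) / \<tau> * bump (light_cone r z)
      - (1 + 2 * L * r) * (smooth_step (fst (snd z) / \<tau>) * flat_exp 2 (light_cone r z))"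
    and "dx (cone_cutoff \<tau> r) z = - 2 * fst z * (smooth_step (fst (snd z) / \<tau>) * flat_exp 2 (light_cone r z))"
proof -
  have cone: "(light_cone r has_derivative (\<lambda>h. - (2 * fst z * fst h) - (1 + 2 * L * r) * fst (snd h))) (at z)"
    unfolding light_cone_def[abs_def] by (auto intro!: derivative_eq_intros)
  have time: "((\<lambda>z::real \<times> real \<times> (real^'n). fst (snd z) / \<tau>) has_derivative (\<lambda>h. fst (snd h) / \<tau>)) (at z)"
    using assms by (auto intro!: derivative_eq_intros)
  have "(cone_cutoff \<tau> r has_derivative (\<lambda>h. smooth_step (fst (snd z) / \<tau>)
        * ((- (2 * fst z * fst h) - (1 + 2 * L * r) * fst (snd h)) * flat_exp 2 (light_cone r z))
      + (fst (snd h) / \<tau> * deriv smooth_step (fst (snd z) / \<tau>)) * bump (light_cone r z))) (at z)"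
    unfolding cone_cutoff_def[abs_def]
    by (rule has_derivative_mult[OF has_derivative_smooth_step_compose[OF time] has_derivative_bump_compose[OF cone]])
  note derivative = frechet_derivative_at[OF this, symmetric]
  show "dt (cone_cutoff \<tau> r) z = deriv smooth_step (fst (snd z) / \<tau>) / \<tau> * bump (light_cone r z)
      - (1 + 2 * L * r) * (smooth_step (fst (snd z) / \<tau>) * flat_exp 2 (light_cone r z))"
    unfolding dt_def derivative by (simp add: algebra_simps)
  show "dx (cone_cutoff \<tau> r) z = - 2 * fst z * (smooth_step (fst (snd z) / \<tau>) * flat_exp 2 (light_cone r z))"
    unfolding dx_def derivative by simp
qed

lemma cone_flux_le:
  assumes r: "1 \<le> r" and \<tau>: "0 < \<tau>"
  shows "pair_flux (dt (cone_cutoff \<tau> r) z) (dx (cone_cutoff \<tau> r) z) z z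
    \<le> \<bar>w z - u z\<bar> * (deriv smooth_step (fst (snd z) / \<tau>) / \<tau> * bump (light_cone r z))
      - \<bar>w z - u z\<bar> * (smooth_step (fst (snd z) / \<tau>) * flat_exp 2 (light_cone r z))"
proof -
  let ?k = "smooth_step (fst (snd z) / \<tau>) * flat_exp 2 (light_cone r z)"
  have "kflux g (w z) (u z) * (- 2 * fst z * ?k) \<le> 2 * L * r * \<bar>w z - u z\<bar> * ?k"
  proof (cases "?k = 0")
    case True
    then show ?thesis by (simp only: mult_zero_right order.refl)
  next
    case False
    then have "\<not> fst (snd z) / \<tau> \<le> 1" "\<not> light_cone r z \<le> 0"
      using smooth_step_eq_0 flat_exp_eq_0[of "light_cone r z" 2] by auto
    then have "0 \<le> fst (snd z)" "0 < light_cone r z" using \<tau> by (auto simp: field_simps)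
    then have x: "\<bar>fst z\<bar> \<le> r" by (rule light_cone_inside(1)[OF r])
    have "kflux g (w z) (u z) * (- 2 * fst z) \<le> \<bar>kflux g (w z) (u z)\<bar> * \<bar>2 * fst z\<bar>"
      by (metis abs_ge_self abs_minus_cancel abs_mult mult_minus_left)
    also have "\<dots> \<le> (L * \<bar>w z - u z\<bar>) * (2 * r)"
      using x lipschitz(2)[of z] lipschitz(3) by (intro mult_mono) auto
    also have "\<dots> = 2 * L * r * \<bar>w z - u z\<bar>" by (simp add: mult_ac)
    finally have "kflux g (w z) (u z) * (- 2 * fst z) \<le> 2 * L * r * \<bar>w z - u z\<bar>" .
    moreover have "0 \<le> ?k" by (simp add: smooth_step_nonneg flat_exp_nonneg)
    ultimately have "kflux g (w z) (u z) * (- 2 * fst z) * ?k \<le> 2 * L * r * \<bar>w z - u z\<bar> * ?k" by (rule mult_right_mono)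
    then show ?thesis by (simp only: mult.assoc)
  qed
  then show ?thesis unfolding pair_flux_def cone_cutoff_derivatives[OF \<tau>] by (simp add: algebra_simps)
qed

lemma cone_distance_le_layer:
  assumes r: "1 \<le> r" and \<tau>: "0 < \<tau>"
  shows "(LINT z|lborel. weighted_distance z * (smooth_step (fst (snd z) / \<tau>) * flat_exp 2 (light_cone r z)))
    \<le> (LINT z|lborel. weighted_distance z * (deriv smooth_step (fst (snd z) / \<tau>) / \<tau> * bump (light_cone r z)))"
proof -
  let ?X = "\<lambda>z. weighted_distance z * (smooth_step (fst (snd z) / \<tau>) * flat_exp 2 (light_cone r z))"
  let ?Y = "\<lambda>z. weighted_distance z * (deriv smooth_step (fst (snd z) / \<tau>) / \<tau> * bump (light_cone r z))"
  have X: "integrable lborel ?X"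
    by (rule integrable_light_cone[OF r, of "\<lambda>t. smooth_step (t / \<tau>)"]) (use \<tau> in \<open>auto intro!: continuous_intros\<close>)
  have Y: "integrable lborel ?Y"
    by (rule integrable_light_cone[OF r, of "\<lambda>t. deriv smooth_step (t / \<tau>) / \<tau>"])
       (use \<tau> in \<open>auto intro!: continuous_intros\<close>)
  have nonneg: "0 \<le> cone_cutoff \<tau> r z" for z by (simp add: cone_cutoff_def smooth_step_nonneg flat_exp_nonneg)
  note kato = kato_inequality[OF smooth_cone_cutoff nonneg cone_cutoff_support[OF r \<tau>] \<tau>]
  have "0 \<le> (LINT z|lborel. pair_flux (dt (cone_cutoff \<tau> r) z) (dx (cone_cutoff \<tau> r) z) z z * (P z * P z))"
    by (rule kato(2))
  also have "\<dots> \<le> (LINT z|lborel. ?Y z - ?X z)"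
  proof (rule integral_mono[OF kato(1) Bochner_Integration.integrable_diff[OF Y X]])
    show "pair_flux (dt (cone_cutoff \<tau> r) z) (dx (cone_cutoff \<tau> r) z) z z * (P z * P z) \<le> ?Y z - ?X z" for z
      using mult_right_mono[OF cone_flux_le[OF r \<tau>, of z] weight_product_bounds(1)[of z z]]
      by (simp add: weighted_distance_def algebra_simps)
  qed
  also have "\<dots> = (LINT z|lborel. ?Y z) - (LINT z|lborel. ?X z)" by (rule Bochner_Integration.integral_diff[OF Y X])
  finally show ?thesis by simp
qed

lemma layer_le_initial_mean:
  assumes r: "1 \<le> r" and \<tau>: "0 < \<tau>" and M: "\<And>s. deriv smooth_step s \<le> M"
  shows "(LINT z|lborel. weighted_distance z * (deriv smooth_step (fst (snd z) / \<tau>) / \<tau> * bump (light_cone r z)))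
    \<le> M / \<tau> * (LINT z|lborel. indicator ({-r..r} \<times> {0<..<2 * \<tau>} \<times> UNIV) z * weighted_distance z)"
proof -
  let ?A = "{-r..r} \<times> {0<..<2 * \<tau>} \<times> (UNIV :: (real^'n) set)"
  let ?layer = "\<lambda>z. weighted_distance z * (deriv smooth_step (fst (snd z) / \<tau>) / \<tau> * bump (light_cone r z))"
  have [measurable]: "?A \<in> sets borel" by (intro borel_Times) auto
  have integrable: "integrable lborel (\<lambda>z. indicator ?A z * weighted_distance z)"
  proof (rule integrable_lborel_bounded_support)
    show "bounded ({-r..r} \<times> {0..2 * \<tau>} \<times> (Gam :: (real^'n) set))"
      by (intro bounded_Times compact_imp_bounded[OF compact_Gam]) auto
    show "\<bar>indicator ?A z * weighted_distance z\<bar> \<le> 2 * B * (B * B)" for z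
      using weighted_distance_bounds[of z] B_nonneg by (auto simp: indicator_def)
    show "indicator ?A z * weighted_distance z = 0" if "z \<notin> {-r..r} \<times> {0..2 * \<tau>} \<times> Gam" for z
      using that weighted_distance_eq_0[of z] by (cases z) (auto simp: indicator_def domT_def)
  qed measurable
  have M_nonneg: "0 \<le> M" using order.trans[OF deriv_smooth_step_nonneg M] .
  have "?layer z \<le> M / \<tau> * (indicator ?A z * weighted_distance z)" for z
  proof (cases "deriv smooth_step (fst (snd z) / \<tau>) = 0 \<or> light_cone r z \<le> 0")
    case True
    then have zero: "?layer z = 0" by (auto simp: flat_exp_eq_0)
    show ?thesis unfolding zero using weighted_distance_bounds(1)[of z] M_nonneg \<tau> by simp
  next
    case False
    then have "\<not> (fst (snd z) / \<tau> \<le> 1 \<or> 2 \<le> fst (snd z) / \<tau>)" and cone: "0 < light_cone r z"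
      using deriv_smooth_step_eq_0 by auto
    then have t: "0 < fst (snd z)" "fst (snd z) < 2 * \<tau>"
      using \<tau> by (auto simp: field_simps intro: order.strict_trans)
    have "\<bar>fst z\<bar> \<le> r" by (rule light_cone_inside(1)[OF r _ cone]) (use t in simp)
    then have "z \<in> ?A" using t by (cases z) (auto simp: abs_le_iff)
    moreover have "deriv smooth_step (fst (snd z) / \<tau>) / \<tau> * bump (light_cone r z) \<le> M / \<tau> * 1"
      using M M_nonneg \<tau> bump_less_1[of "light_cone r z"]
      by (intro mult_mono divide_right_mono) (auto simp: flat_exp_nonneg)
    from mult_left_mono[OF this weighted_distance_bounds(1)[of z]]
    have "?layer z \<le> M / \<tau> * weighted_distance z" by (simp add: mult.commute)
    ultimately show ?thesis by simp
  qed
  from integral_mono[OF integrable_light_cone[OF r, of "\<lambda>t. deriv smooth_step (t / \<tau>) / \<tau>" 0]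
      integrable_mult_right[OF integrable] this]
  show ?thesis using \<tau> by (simp add: continuous_intros)
qed

lemma cone_distance_tendsto:
  assumes r: "1 \<le> r" and \<tau>: "\<And>n. 0 < \<tau> n" "\<tau> \<longlonglongrightarrow> 0"
  shows "(\<lambda>n. LINT z|lborel. weighted_distance z * (smooth_step (fst (snd z) / \<tau> n) * flat_exp 2 (light_cone r z)))
    \<longlonglongrightarrow> (LINT z|lborel. weighted_distance z * flat_exp 2 (light_cone r z))"
proof (rule integral_dominated_convergence)
  show limit_integrable: "integrable lborel (\<lambda>z. weighted_distance z * flat_exp 2 (light_cone r z))"
    using integrable_light_cone[OF r, of "\<lambda>_. 1" 2] by simp
  then show "(\<lambda>z. weighted_distance z * flat_exp 2 (light_cone r z)) \<in> borel_measurable lborel"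
    by (rule borel_measurable_integrable)
  show "(\<lambda>z. weighted_distance z * (smooth_step (fst (snd z) / \<tau> n)
      * flat_exp 2 (light_cone r z))) \<in> borel_measurable lborel" for n
    by (rule borel_measurable_integrable[OF integrable_light_cone[OF r, of "\<lambda>t. smooth_step (t / \<tau> n)"]])
       (use \<tau>(1)[of n] in \<open>auto intro!: continuous_intros\<close>)
  have "(\<lambda>n. weighted_distance z * (smooth_step (fst (snd z) / \<tau> n) * flat_exp 2 (light_cone r z)))
      \<longlonglongrightarrow> weighted_distance z * flat_exp 2 (light_cone r z)" for z
  proof (cases "z \<in> domT")
    case True
    then have "0 < fst (snd z)" by (auto simp: domT_def)
    then have "\<forall>\<^sub>F n in sequentially. 2 * \<tau> n < fst (snd z)"
      using tendsto_mult[OF tendsto_const \<tau>(2), of 2] by (intro order_tendstoD(2)) auto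
    then have "\<forall>\<^sub>F n in sequentially. smooth_step (fst (snd z) / \<tau> n) = 1"
      by eventually_elim (use \<tau>(1) in \<open>auto intro!: smooth_step_eq_1 simp: field_simps\<close>)
    then show ?thesis by (intro tendsto_eventually) (auto elim!: eventually_mono)
  qed (simp add: weighted_distance_eq_0)
  then show "AE z in lborel. (\<lambda>n. weighted_distance z * (smooth_step (fst (snd z) / \<tau> n) * flat_exp 2 (light_cone r z)))
      \<longlonglongrightarrow> weighted_distance z * flat_exp 2 (light_cone r z)" by simp
  show "AE z in lborel. norm (weighted_distance z * (smooth_step (fst (snd z) / \<tau> n) * flat_exp 2 (light_cone r z)))
      \<le> weighted_distance z * flat_exp 2 (light_cone r z)" for n
    using weighted_distance_bounds(1) smooth_step_nonneg smooth_step_le_1 flat_exp_nonneg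
    by (intro AE_I2) (auto simp: abs_mult abs_of_nonneg intro!: mult_left_mono mult_left_le_one_le)
qed

lemma cone_distance_eq_0:
  assumes r: "1 \<le> r"
    and initial: "((\<lambda>T. 1 / T * (LINT z|lborel. indicator ({-r..r} \<times> {0<..<T} \<times> UNIV) z * weighted_distance z))
        \<longlongrightarrow> 0) (at_right 0)"
  shows "AE z in lborel. 0 < light_cone r z \<longrightarrow> weighted_distance z = 0"
proof -
  let ?mean = "\<lambda>T. 1 / T * (LINT z|lborel. indicator ({-r..r} \<times> {0<..<T} \<times> UNIV) z * weighted_distance z)"
  let ?X = "\<lambda>z. weighted_distance z * flat_exp 2 (light_cone r z)"
  obtain M where M: "0 < M" "\<And>s. deriv smooth_step s \<le> M" by (rule deriv_smooth_step_bounded) blast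
  define \<tau> where "\<tau> n = inverse (real (Suc n))" for n
  have \<tau>: "0 < \<tau> n" for n by (simp add: \<tau>_def)
  have \<tau>_lim: "\<tau> \<longlonglongrightarrow> 0" unfolding \<tau>_def by (rule LIMSEQ_inverse_real_of_nat)
  have "filterlim (\<lambda>n. 2 * \<tau> n) (at_right 0) sequentially"
    using tendsto_mult[OF tendsto_const \<tau>_lim, of 2] \<tau> less_imp_neq[OF \<tau>]
    by (auto simp: filterlim_at intro!: always_eventually)
  from tendsto_mult[OF tendsto_const filterlim_compose[OF initial this], of "2 * M"]
  have mean_lim: "(\<lambda>n. 2 * M * ?mean (2 * \<tau> n)) \<longlonglongrightarrow> 0" by simp
  have "(LINT z|lborel. weighted_distance z * (smooth_step (fst (snd z) / \<tau> n) * flat_exp 2 (light_cone r z)))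
      \<le> 2 * M * ?mean (2 * \<tau> n)" for n
    using order.trans[OF cone_distance_le_layer[OF r \<tau>] layer_le_initial_mean[OF r \<tau> M(2)]] by simp
  then have "(LINT z|lborel. ?X z) \<le> 0"
    by (intro LIMSEQ_le[OF cone_distance_tendsto[OF r \<tau> \<tau>_lim] mean_lim]) auto
  moreover have X: "integrable lborel ?X" "\<And>z. 0 \<le> ?X z"
    using integrable_light_cone[OF r, of "\<lambda>_. 1" 2] weighted_distance_bounds(1) by (simp_all add: flat_exp_nonneg)
  then have "0 \<le> (LINT z|lborel. ?X z)" by simp
  ultimately have "(LINT z|lborel. ?X z) = 0" by simp
  then have "AE z in lborel. ?X z = 0" using integral_nonneg_eq_0_iff_AE[OF X(1)] X(2) by simp
  then show ?thesis
  proof eventually_elim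
    case (elim z)
    then show ?case using flat_exp_pos[of "light_cone r z" 2] by auto
  qed
qed

theorem AE_eq_of_initial_distance:
  assumes "\<And>r. 1 \<le> r \<Longrightarrow> ((\<lambda>T. 1 / T * (LINT z|lborel. indicator ({-r..r} \<times> {0<..<T} \<times> UNIV) z
      * (\<bar>w z - u z\<bar> * (P z * P z)))) \<longlongrightarrow> 0) (at_right 0)"
  shows "AE z in lborel. P z \<noteq> 0 \<longrightarrow> w z = u z"
proof -
  have "AE z in lborel. \<forall>n. 0 < light_cone (real (Suc n)) z \<longrightarrow> weighted_distance z = 0"
    unfolding AE_all_countable
    by (intro allI cone_distance_eq_0 assms[folded weighted_distance_def]) simp_all
  then show ?thesis
  proof eventually_elim
    case (elim z)
    show ?case
    proof
      assume P: "P z \<noteq> 0"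
      then have "z \<in> domT" using weight(3)[of z] by blast
      then have "0 \<le> fst (snd z)" by (auto simp: domT_def)
      then obtain n where "0 < light_cone (real (Suc n)) z" by (rule light_cone_exhausts)
      with elim have "weighted_distance z = 0" by blast
      then show "w z = u z" using P by (simp add: weighted_distance_def)
    qed
  qed
qed

end

lemma LINT_lebesgue_on_eq_lborel:
  fixes h h' :: "'a::euclidean_space \<Rightarrow> real"
  assumes S [measurable]: "S \<in> sets borel" and h' [measurable]: "h' \<in> borel_measurable borel"
    and eq: "AE z in lebesgue_on S. h z = h' z"
  shows "(LINT z|lebesgue_on S. h z) = (LINT z|lborel. indicator S z * h' z)"
proof -
  have S_lebesgue: "S \<in> sets lebesgue" by simp
  have h'_measurable: "h' \<in> borel_measurable (lebesgue_on S)" by (rule borel_measurable_lebesgue_onI[OF h'])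
  have "h \<in> borel_measurable (lebesgue_on S)"
    by (rule borel_measurable_lebesgue_on_AE[OF h'_measurable S_lebesgue]) (use eq in \<open>auto elim: eventually_mono\<close>)
  then have "(LINT z|lebesgue_on S. h z) = (LINT z|lebesgue_on S. h' z)"
    using h'_measurable eq by (intro integral_cong_AE)
  also have "\<dots> = (LINT z|lebesgue. indicator S z * h' z)" by (simp add: integral_restrict_space)
  also have "\<dots> = (LINT z|lborel. indicator S z * h' z)" by (rule integral_completion) measurable
  finally show ?thesis .
qed

lemma lipschitz_of_continuous_derivative:
  fixes f f' :: "real \<Rightarrow> real"
  assumes "{a..b} \<subseteq> I" "\<And>s. s \<in> I \<Longrightarrow> (f has_real_derivative f' s) (at s within I)" "continuous_on I f'"
  obtains L where "0 \<le> L" "\<And>s t. s \<in> {a..b} \<Longrightarrow> t \<in> {a..b} \<Longrightarrow> \<bar>f s - f t\<bar> \<le> L * \<bar>s - t\<bar>"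
proof -
  obtain L where L: "0 \<le> L" "\<And>s. s \<in> {a..b} \<Longrightarrow> \<bar>f' s\<bar> \<le> L"
    by (rule compact_continuous_abs_bound[OF compact_Icc continuous_on_subset[OF assms(3,1)]]) blast
  have "norm (f s - f t) \<le> L * norm (s - t)" if "s \<in> {a..b}" "t \<in> {a..b}" for s t
  proof (rule field_differentiable_bound[OF convex_real_interval(5) _ _ that])
    show "(f has_real_derivative f' z) (at z within {a..b})" if "z \<in> {a..b}" for z
      using that assms(1,2) by (blast intro: has_field_derivative_subset)
  qed (simp add: L(2))
  then show ?thesis by (intro that[OF L(1)]) auto
qed

lemma kflux_lipschitz:
  assumes lipschitz: "\<And>s t. s \<in> {a..b} \<Longrightarrow> t \<in> {a..b} \<Longrightarrow> \<bar>g s - g t\<bar> \<le> L * \<bar>s - t\<bar>"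
    and st: "s \<in> {a..b}" "t \<in> {a..b}"
  shows "\<bar>kflux g c s - kflux g c t\<bar> \<le> L * \<bar>s - t\<bar>"
  using st
proof (induction s t rule: linorder_wlog)
  case (le s t)
  consider "c < s" | "t < c" | "s \<le> c" "c \<le> t" by linarith
  then show ?case
  proof cases
    assume "c < s"
    then have "kflux g c s - kflux g c t = g s - g t" using le(1) by (simp add: kflux_def)
    then show ?thesis using lipschitz[OF le(2,3)] by simp
  next
    assume "t < c"
    then have "kflux g c s - kflux g c t = g t - g s" using le(1) by (simp add: kflux_def)
    then show ?thesis using lipschitz[OF le(3,2)] by (simp add: abs_minus_commute)
  next
    assume between: "s \<le> c" "c \<le> t"
    then have c: "c \<in> {a..b}" using le by auto
    have "kflux g c s = g c - g s" "kflux g c t = g t - g c" using between by (auto simp: kflux_def sgn_if)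
    then have "\<bar>kflux g c s - kflux g c t\<bar> \<le> \<bar>g c - g s\<bar> + \<bar>g t - g c\<bar>" by simp
    also have "\<dots> \<le> L * \<bar>c - s\<bar> + L * \<bar>t - c\<bar>" by (intro add_mono lipschitz c le)
    also have "\<dots> = L * \<bar>s - t\<bar>" using between by (simp add: algebra_simps)
    finally show ?thesis .
  qed
next
  case (sym s t)
  then show ?case by (simp add: abs_minus_commute)
qed

lemma abs_kflux_le_lipschitz_near:
  assumes lipschitz: "\<And>t. t \<in> {a - \<eta>..b + \<eta>} \<Longrightarrow> \<bar>g t - g s\<bar> \<le> L * \<bar>t - s\<bar>"
    and s: "s \<in> {a..b}" and \<eta>: "0 < \<eta>" and bounds: "\<bar>g s\<bar> \<le> B" "\<bar>g c\<bar> \<le> B"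
  shows "\<bar>kflux g c s\<bar> \<le> max L (2 * B / \<eta>) * \<bar>c - s\<bar>"
proof -
  have "\<bar>g c - g s\<bar> \<le> max L (2 * B / \<eta>) * \<bar>c - s\<bar>"
  proof (cases "\<bar>c - s\<bar> \<le> \<eta>")
    case True
    then have "\<bar>g c - g s\<bar> \<le> L * \<bar>c - s\<bar>" using s by (intro lipschitz) auto
    also have "\<dots> \<le> max L (2 * B / \<eta>) * \<bar>c - s\<bar>" by (intro mult_right_mono) auto
    finally show ?thesis .
  next
    case False
    have "\<bar>g c - g s\<bar> \<le> 2 * B / \<eta> * \<eta>" using bounds \<eta> by simp
    also have "\<dots> \<le> max L (2 * B / \<eta>) * \<bar>c - s\<bar>"
      using False \<eta> bounds by (intro mult_mono) (auto simp: le_max_iff_disj)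
    finally show ?thesis .
  qed
  moreover have "\<bar>kflux g c s\<bar> \<le> \<bar>g c - g s\<bar>" by (simp add: kflux_def abs_mult abs_sgn_eq)
  ultimately show ?thesis by linarith
qed

context parameter_weight
begin

lemma borel_weight:
  obtains P :: "real \<times> real \<times> (real^'n) \<Rightarrow> real" and B where "P \<in> borel_measurable borel" "\<And>z. 0 \<le> P z" "\<And>z. P z \<le> B"
    "\<And>z. z \<notin> domT \<Longrightarrow> P z = 0" "AE z in lebesgue_on domT. \<rho> (snd (snd z)) = P z"
proof -
  obtain B where B: "0 < B" "AE y in lebesgue_on Gam. \<bar>\<rho> y\<bar> \<le> B" by (rule weight_bounded)
  have "AE y in lebesgue_on Gam. \<rho> y \<in> {0..B}"
    using B(2) AE_lebesgue_on_mem[OF domains_lebesgue(3)] by eventually_elim (auto simp: weight_nonneg)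
  from borel_representative_in[OF weight_measurable domains_lebesgue(3) this, of 0] B(1)
  obtain \<rho>' where \<rho>': "\<rho>' \<in> borel_measurable borel" "\<And>y. \<rho>' y \<in> {0..B}" "AE y in lebesgue_on Gam. \<rho> y = \<rho>' y" by auto
  note [measurable] = measurable_compose[OF snd_borel measurable_compose[OF snd_borel \<rho>'(1)]]
  show ?thesis
  proof (rule that[of "\<lambda>z. indicator domT z * \<rho>' (snd (snd z))" B])
    show "AE z in lebesgue_on domT. \<rho> (snd (snd z)) = indicator domT z * \<rho>' (snd (snd z))"
      using AE_lift_Gam(2)[OF \<rho>'(3)] AE_lebesgue_on_mem[OF domains_lebesgue(1)] by eventually_elim simp
  qed (use \<rho>'(2) B(1) in \<open>auto simp: indicator_def\<close>)
qed

lemma weak_form_eq_lborel: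
  assumes \<phi>: "smooth \<phi>" and P: "P \<in> borel_measurable borel" "\<And>z. z \<notin> domT \<Longrightarrow> P z = 0"
      "AE z in lebesgue_on domT. \<rho> (snd (snd z)) = P z"
    and a: "a' \<in> borel_measurable borel" "AE z in lebesgue_on domT. a z = a' z"
    and b: "b' \<in> borel_measurable borel" "AE z in lebesgue_on domT. b z = b' z"
  shows "weak_form a b \<phi> = (LINT z|lborel. (a' z * dt \<phi> z + b' z * dx \<phi> z) * P z)"
proof -
  note [measurable] = P(1) a(1) b(1) smooth_imp_borel_measurable[OF smooth_dt[OF \<phi>]]
      smooth_imp_borel_measurable[OF smooth_dx[OF \<phi>]]
  have "weak_form a b \<phi> = (LINT z|lborel. indicator domT z * ((a' z * dt \<phi> z + b' z * dx \<phi> z) * P z))"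
    unfolding weak_form_def
  proof (rule LINT_lebesgue_on_eq_lborel)
    show "AE z in lebesgue_on domT. (a z * dt \<phi> z + b z * dx \<phi> z) * \<rho> (snd (snd z))
        = (a' z * dt \<phi> z + b' z * dx \<phi> z) * P z"
      using P(3) a(2) b(2) by eventually_elim simp
  qed measurable
  also have "\<dots> = (LINT z|lborel. (a' z * dt \<phi> z + b' z * dx \<phi> z) * P z)"
    by (rule Bochner_Integration.integral_cong) (auto simp: indicator_def P(2))
  finally show ?thesis .
qed

lemma slab_integral_eq_lborel:
  fixes h h' :: "real \<times> real \<times> (real^'n) \<Rightarrow> real" and r T :: real
  assumes h: "AE z in lebesgue_on domT. h z = h' z" "h' \<in> borel_measurable borel" "\<And>z. z \<notin> domT \<Longrightarrow> h' z = 0"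
  shows "(LINT z|lebesgue_on ({-r..r} \<times> {0<..<T} \<times> Gam). h z)
      = (LINT z|lborel. indicator ({-r..r} \<times> {0<..<T} \<times> UNIV) z * h' z)"
proof -
  let ?A = "{-r..r} \<times> {0<..<T} \<times> (Gam :: (real^'n) set)"
  have A: "?A \<in> sets borel" by (simp add: borel_Times)
  have "AE z in lborel. z \<in> domT \<longrightarrow> h z = h' z" using h(1) by (simp add: AE_lebesgue_on_iff_lborel)
  then have "AE z in lborel. z \<in> ?A \<longrightarrow> h z = h' z" by (rule eventually_mono) (auto simp: domT_def)
  then have "AE z in lebesgue_on ?A. h z = h' z" using A by (simp add: AE_lebesgue_on_iff_lborel)
  from LINT_lebesgue_on_eq_lborel[OF A h(2) this]
  have "(LINT z|lebesgue_on ?A. h z) = (LINT z|lborel. indicator ?A z * h' z)" .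
  also have "\<dots> = (LINT z|lborel. indicator ({-r..r} \<times> {0<..<T} \<times> UNIV) z * h' z)"
    by (rule Bochner_Integration.integral_cong) (use h(3) in \<open>auto simp: indicator_def domT_def\<close>)
  finally show ?thesis .
qed

lemma slab_distance_le:
  fixes v w :: "real \<times> real \<times> (real^'n) \<Rightarrow> real" and r T :: real
  assumes v: "v \<in> borel_measurable (lebesgue_on domT)" "AE z in lebesgue_on domT. \<bar>v z\<bar> \<le> M"
    and w: "w \<in> borel_measurable (lebesgue_on domT)" "AE z in lebesgue_on domT. \<bar>w z\<bar> \<le> N"
    and u0: "u0 \<in> borel_measurable (lebesgue_on dom0)" "AE p in lebesgue_on dom0. \<bar>u0 p\<bar> \<le> M0"
    and \<rho>: "AE z in lebesgue_on domT. \<rho> (snd (snd z)) \<le> B"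
  defines "A \<equiv> {-r..r} \<times> {0<..<T} \<times> (Gam :: (real^'n) set)"
  defines "distance \<equiv> \<lambda>v. LINT (x, t, y)|lebesgue_on A. norm (v (x, t, y) - u0 (x, y)) * \<rho> y"
  shows "0 \<le> (LINT z|lebesgue_on A. \<bar>v z - w z\<bar> * (\<rho> (snd (snd z)) * \<rho> (snd (snd z))))"
    and "(LINT z|lebesgue_on A. \<bar>v z - w z\<bar> * (\<rho> (snd (snd z)) * \<rho> (snd (snd z)))) \<le> B * (distance v + distance w)"
proof -
  let ?\<rho> = "\<lambda>z :: real \<times> real \<times> (real^'n). \<rho> (snd (snd z))"
  let ?f = "\<lambda>z. \<bar>v z - w z\<bar> * (?\<rho> z * ?\<rho> z)" and ?d = "\<lambda>v z. indicator A z * (\<bar>v z - u0 (drop_middle z)\<bar> * ?\<rho> z)"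
  have A: "A \<in> sets lebesgue" "A \<subseteq> domT" by (auto simp: A_def domT_def time_slab_lebesgue)
  have majorant: "has_bochner_integral (lebesgue_on domT) (\<lambda>z. B * (?d v z + ?d w z)) (B * (distance v + distance w))"
    unfolding distance_def A_def
    by (intro has_bochner_integral_mult_right has_bochner_integral_add slab_distance_integral[OF _ _ v u0]
        slab_distance_integral[OF _ _ w u0]) simp_all
  have "?f \<in> borel_measurable (lebesgue_on domT)"
    using v(1) w(1) borel_measurable_lift_Gam(2)[OF weight_measurable] by measurable
  then have measurable: "(\<lambda>z. indicator A z * ?f z) \<in> borel_measurable (lebesgue_on domT)"
    using A by (intro borel_measurable_times[OF borel_measurable_indicator]) (simp_all add: sets_restrict_space_iff)
  have nonneg: "AE z in lebesgue_on domT. 0 \<le> indicator A z * ?f z" by (intro AE_I2) simp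
  have "AE z in lebesgue_on domT. indicator A z * ?f z \<le> B * (?d v z + ?d w z)"
    using \<rho> AE_lebesgue_on_mem[OF domains_lebesgue(1)]
  proof eventually_elim
    case (elim z)
    have "0 \<le> ?\<rho> z" using elim(2) by (auto simp: domT_def intro: weight_nonneg)
    then have "?f z \<le> (\<bar>v z - u0 (drop_middle z)\<bar> + \<bar>w z - u0 (drop_middle z)\<bar>) * (?\<rho> z * B)"
      using elim(1) by (intro mult_mono mult_left_mono) auto
    from mult_left_mono[OF this, of "indicator A z"] show ?case by (simp add: algebra_simps)
  qed
  note dominated = integral_dominated_nonneg[OF measurable nonneg this majorant]
  have "(LINT z|lebesgue_on A. ?f z) = (LINT z|lebesgue_on domT. indicator A z * ?f z)"
    using has_bochner_integral_integral_eq[OF has_bochner_integral_integrable[OF dominated(1),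
          unfolded has_bochner_integral_lebesgue_on_subset[OF A(1) domains_lebesgue(1) A(2)]]] .
  then show "0 \<le> (LINT z|lebesgue_on A. ?f z)" "(LINT z|lebesgue_on A. ?f z) \<le> B * (distance v + distance w)"
    using dominated(2) integral_nonneg_AE[OF nonneg] by simp_all
qed

lemma initial_distance_tendsto:
  fixes v w :: "real \<times> real \<times> (real^'n) \<Rightarrow> real"
  assumes v: "attains_initial_data \<rho> v u0" "v \<in> borel_measurable (lebesgue_on domT)"
      "AE z in lebesgue_on domT. \<bar>v z\<bar> \<le> M"
    and w: "attains_initial_data \<rho> w u0" "w \<in> borel_measurable (lebesgue_on domT)" "AE z in lebesgue_on domT. \<bar>w z\<bar> \<le> N"
    and u0: "u0 \<in> borel_measurable (lebesgue_on dom0)" "AE p in lebesgue_on dom0. \<bar>u0 p\<bar> \<le> M0"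
    and \<rho>: "AE z in lebesgue_on domT. \<rho> (snd (snd z)) \<le> B"
  shows "((\<lambda>T. 1 / T * (LINT z|lebesgue_on ({-r..r} \<times> {0<..<T} \<times> Gam). \<bar>v z - w z\<bar>
      * (\<rho> (snd (snd z)) * \<rho> (snd (snd z))))) \<longlongrightarrow> 0) (at_right 0)"
proof -
  let ?mean = "\<lambda>v T. 1 / T * (LINT (x, t, y)|lebesgue_on ({-r..r} \<times> {0<..<T} \<times> Gam).
      norm (v (x, t, y) - u0 (x, y)) * \<rho> y)"
  let ?distance = "\<lambda>T. 1 / T * (LINT z|lebesgue_on ({-r..r} \<times> {0<..<T} \<times> Gam). \<bar>v z - w z\<bar>
      * (\<rho> (snd (snd z)) * \<rho> (snd (snd z))))"
  note slab = slab_distance_le[OF v(2,3) w(2,3) u0 \<rho>, of r]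
  have nonneg: "0 \<le> ?distance T" if "0 < T" for T
    using slab(1)[of T] that by (intro mult_nonneg_nonneg) auto
  have le: "?distance T \<le> B * (?mean v T + ?mean w T)" if "0 < T" for T
    using mult_left_mono[OF slab(2)[of T], of "1 / T"] that by (simp add: algebra_simps)
  have "((\<lambda>T. B * (?mean v T + ?mean w T)) \<longlongrightarrow> B * (0 + 0)) (at_right 0)"
    using v(1) w(1) unfolding attains_initial_data_def by (intro tendsto_intros) auto
  then have majorant_tendsto: "((\<lambda>T. B * (?mean v T + ?mean w T)) \<longlongrightarrow> 0) (at_right 0)" by simp
  show ?thesis
    by (rule tendsto_sandwich[OF eventually_mono[OF eventually_at_right_less nonneg]
          eventually_mono[OF eventually_at_right_less le] tendsto_const majorant_tendsto])
qed

lemma reduced_kruzkov_inequality: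
  assumes I: "I = pr1 ` closure D" "convex I" "I \<in> sets borel" "\<And>c. I \<noteq> {c}"
    and f: "\<And>s. s \<in> I \<Longrightarrow> (f has_real_derivative f' s) (at s within I)" "continuous_on I f'"
    and v: "weak_entropy_sol_reduced \<rho> D f u0 v" and k: "k \<in> I" and \<phi>: "test_fun domT \<phi>" "\<And>z. 0 \<le> \<phi> z"
  shows "0 \<le> weak_form (\<lambda>z. \<bar>v z - k\<bar>) (\<lambda>z. kflux f (v z) k) \<phi>"
proof -
  obtain M1 M2 where v_measurable: "v \<in> borel_measurable (lebesgue_on domT)"
    and v_mem: "AE z in lebesgue_on domT. v z \<in> I"
    and v_bounds: "AE z in lebesgue_on domT. \<bar>v z\<bar> \<le> M1" "AE z in lebesgue_on domT. \<bar>f (v z)\<bar> \<le> M2"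
    using v by (auto simp: weak_entropy_sol_reduced_def Linf_def I(1))
  have bounds: "AE z in lebesgue_on domT. \<bar>v z\<bar> \<le> max M1 M2" "AE z in lebesgue_on domT. \<bar>f (v z)\<bar> \<le> max M1 M2"
    by (rule eventually_mono[OF v_bounds(1)] eventually_mono[OF v_bounds(2)], simp add: le_max_iff_disj)+
  have derivative: "vector_derivative f (at s within I) = f' s" if s: "s \<in> I" for s
  proof (rule vector_derivative_within)
    have "s islimpt I" using connected_imp_perfect[OF convex_connected[OF I(2)] s] I(4) by blast
    then show "at s within I \<noteq> bot" by (simp add: trivial_limit_within)
    show "(f has_vector_derivative f' s) (at s within I)"
      using f(1)[OF s] by (simp add: has_real_derivative_iff_has_vector_derivative)
  qed
  show ?thesis
  proof (rule kruzkov_inequality[OF I(2,3) k f v_measurable v_mem bounds _ \<phi>(1)])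
    fix l l' l'' q
    assume l: "convex_on UNIV l" "C2_real_with I l l' l''"
      and q: "\<And>s. s \<in> I \<Longrightarrow> (q has_real_derivative l' s * f' s) (at s within I)"
    have "\<forall>s\<in>I. (q has_real_derivative l' s * vector_derivative f (at s within I)) (at s within I)"
      using q derivative by simp
    with v l \<phi> have "0 \<le> (LINT (x, t, y)|lebesgue_on domT.
        (l (v (x, t, y)) * dt \<phi> (x, t, y) + q (v (x, t, y)) * dx \<phi> (x, t, y)) * \<rho> y)"
      unfolding weak_entropy_sol_reduced_def I(1)[symmetric] by blast
    then show "0 \<le> weak_form (\<lambda>z. l (v z)) (\<lambda>z. q (v z)) \<phi>" by (simp add: weak_form_def case_prod_beta')
  qed
qed

end

locale reduced_solution_pair = parameter_weight \<rho> for \<rho> :: "real^'n \<Rightarrow> real" +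
  fixes D :: "(real^2) set" and I :: "real set" and f f' :: "real \<Rightarrow> real" and a b \<eta> :: real
    and u0 :: "real \<times> (real^'n) \<Rightarrow> real" and u w :: "real \<times> real \<times> (real^'n) \<Rightarrow> real"
  assumes I: "I = pr1 ` closure D" "convex I" "I \<in> sets borel"
    and f: "\<And>s. s \<in> I \<Longrightarrow> (f has_real_derivative f' s) (at s within I)" "continuous_on I f'"
    and ab: "a \<le> b" "{a - \<eta>..b + \<eta>} \<subseteq> I" "0 < \<eta>"
    and u: "weak_entropy_sol_reduced \<rho> D f u0 u" and w: "weak_entropy_sol_reduced \<rho> D f u0 w"
    and u_mem: "AE z in lebesgue_on domT. u z \<in> {a..b}"
begin

definition extended_flux :: "real \<Rightarrow> real" where
  "extended_flux s = indicat_real I s *\<^sub>R f s"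

lemma f_continuous: "continuous_on I f"
  using f(1) by (rule DERIV_continuous_on)

lemma ab_subset: "{a..b} \<subseteq> I"
  using ab by force

lemma extended_flux_measurable: "extended_flux \<in> borel_measurable borel"
  unfolding extended_flux_def[abs_def] by (rule borel_measurable_continuous_on_indicator[OF I(3) f_continuous])

lemma extended_flux_eq: "s \<in> I \<Longrightarrow> extended_flux s = f s"
  by (simp add: extended_flux_def)

lemma kruzkov_representative:
  assumes v: "weak_entropy_sol_reduced \<rho> D f u0 v" "v' \<in> borel_measurable borel" "\<And>z. v' z \<in> I"
      "AE z in lebesgue_on domT. v z = v' z"
    and P: "P \<in> borel_measurable borel" "\<And>z. z \<notin> domT \<Longrightarrow> P z = 0" "AE z in lebesgue_on domT. \<rho> (snd (snd z)) = P z"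
    and k: "k \<in> I" and \<phi>: "test_fun domT \<phi>" "\<And>z. 0 \<le> \<phi> z"
  shows "0 \<le> (LINT z|lborel. (\<bar>v' z - k\<bar> * dt \<phi> z + kflux extended_flux (v' z) k * dx \<phi> z) * P z)"
proof -
  have "a - \<eta> \<in> I" "b + \<eta> \<in> I" using ab by (auto simp: subset_iff)
  then have "I \<noteq> {c}" for c using ab by auto
  from reduced_kruzkov_inequality[OF I this f v(1) k \<phi>]
  have "0 \<le> weak_form (\<lambda>z. \<bar>v z - k\<bar>) (\<lambda>z. kflux f (v z) k) \<phi>" .
  also have "\<dots> = (LINT z|lborel. (\<bar>v' z - k\<bar> * dt \<phi> z + kflux extended_flux (v' z) k * dx \<phi> z) * P z)"
  proof (rule weak_form_eq_lborel[OF _ P])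
    note [measurable] = v(2) extended_flux_measurable
    show "(\<lambda>z. \<bar>v' z - k\<bar>) \<in> borel_measurable borel" "(\<lambda>z. kflux extended_flux (v' z) k) \<in> borel_measurable borel"
      unfolding kflux_def sgn_if by measurable
    show "AE z in lebesgue_on domT. \<bar>v z - k\<bar> = \<bar>v' z - k\<bar>" using v(4) by eventually_elim simp
    show "AE z in lebesgue_on domT. kflux f (v z) k = kflux extended_flux (v' z) k"
      using v(4) by eventually_elim (simp add: kflux_def extended_flux_eq v(3) k)
  qed (use \<phi>(1) in \<open>simp add: test_fun_def\<close>)
  finally show ?thesis .
qed

lemma bounded_borel_representatives:
  obtains w' u' P B where "w' \<in> borel_measurable borel" "\<And>z. w' z \<in> {s \<in> I. \<bar>s\<bar> \<le> B \<and> \<bar>extended_flux s\<bar> \<le> B}"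
    "AE z in lebesgue_on domT. w z = w' z"
    "u' \<in> borel_measurable borel" "\<And>z. u' z \<in> {a..b}" "AE z in lebesgue_on domT. u z = u' z"
    "\<And>s. s \<in> {a..b} \<Longrightarrow> \<bar>s\<bar> \<le> B \<and> \<bar>extended_flux s\<bar> \<le> B"
    "P \<in> borel_measurable borel" "\<And>z. 0 \<le> P z" "\<And>z. P z \<le> B"
    "\<And>z. z \<notin> domT \<Longrightarrow> P z = 0" "AE z in lebesgue_on domT. \<rho> (snd (snd z)) = P z"
proof -
  have u_measurable: "u \<in> borel_measurable (lebesgue_on domT)"
    using u by (auto simp: weak_entropy_sol_reduced_def Linf_def)
  obtain W1 W2 where w_measurable: "w \<in> borel_measurable (lebesgue_on domT)"
    and w_mem: "AE z in lebesgue_on domT. w z \<in> I"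
    and w_bounds: "AE z in lebesgue_on domT. \<bar>w z\<bar> \<le> W1" "AE z in lebesgue_on domT. \<bar>f (w z)\<bar> \<le> W2"
    using w by (auto simp: weak_entropy_sol_reduced_def Linf_def I(1))
  obtain P R where P: "P \<in> borel_measurable borel" "\<And>z. 0 \<le> P z" "\<And>z. P z \<le> R"
    "\<And>z. z \<notin> domT \<Longrightarrow> P z = 0" "AE z in lebesgue_on domT. \<rho> (snd (snd z)) = P z" by (rule borel_weight, rule that)
  obtain F where F: "\<And>s. s \<in> {a..b} \<Longrightarrow> \<bar>f s\<bar> \<le> F"
    by (rule compact_continuous_abs_bound[OF compact_Icc continuous_on_subset[OF f_continuous ab_subset]], rule that)
  define B where "B = Max {W1, W2, R, F, \<bar>a\<bar>, \<bar>b\<bar>}"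
  have B: "W1 \<le> B" "W2 \<le> B" "R \<le> B" "F \<le> B" "\<bar>a\<bar> \<le> B" "\<bar>b\<bar> \<le> B"
    unfolding B_def by (rule Max_ge; simp)+
  have ab_bound: "\<bar>s\<bar> \<le> B \<and> \<bar>extended_flux s\<bar> \<le> B" if "s \<in> {a..b}" for s
    using that F[OF that] B ab_subset by (auto simp: extended_flux_eq subset_iff)
  let ?A = "{s \<in> I. \<bar>s\<bar> \<le> B \<and> \<bar>extended_flux s\<bar> \<le> B}"
  note [measurable] = I(3) extended_flux_measurable
  have A: "?A \<in> sets borel" by measurable
  have w_mem_A: "AE z in lebesgue_on domT. w z \<in> ?A"
    using w_mem w_bounds by eventually_elim (use B in \<open>auto simp: extended_flux_eq\<close>)
  have a: "a \<in> {a..b}" using ab(1) by simp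
  then have a_mem_A: "a \<in> ?A" using ab_bound ab_subset by blast
  obtain w' where w': "w' \<in> borel_measurable borel" "\<And>z. w' z \<in> ?A" "AE z in lebesgue_on domT. w z = w' z"
    by (rule borel_representative_in[OF w_measurable domains_lebesgue(1) w_mem_A A a_mem_A], rule that)
  obtain u' where u': "u' \<in> borel_measurable borel" "\<And>z. u' z \<in> {a..b}" "AE z in lebesgue_on domT. u z = u' z"
    by (rule borel_representative_in[OF u_measurable domains_lebesgue(1) u_mem _ a], simp, rule that)
  show ?thesis by (rule that[OF w' u' ab_bound P(1,2) order.trans[OF P(3) B(3)] P(4,5)])
qed

lemma kruzkov_pair_representatives:
  assumes w': "w' \<in> borel_measurable borel" "\<And>z. w' z \<in> {s \<in> I. \<bar>s\<bar> \<le> B \<and> \<bar>extended_flux s\<bar> \<le> B}"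
      "AE z in lebesgue_on domT. w z = w' z"
    and u': "u' \<in> borel_measurable borel" "\<And>z. u' z \<in> {a..b}" "AE z in lebesgue_on domT. u z = u' z"
    and ab_bound: "\<And>s. s \<in> {a..b} \<Longrightarrow> \<bar>s\<bar> \<le> B \<and> \<bar>extended_flux s\<bar> \<le> B"
    and P: "P \<in> borel_measurable borel" "\<And>z. 0 \<le> P z" "\<And>z. P z \<le> B"
      "\<And>z. z \<notin> domT \<Longrightarrow> P z = 0" "AE z in lebesgue_on domT. \<rho> (snd (snd z)) = P z"
  obtains L where "kruzkov_pair w' u' P extended_flux B L"
proof -
  obtain L1 where L1: "0 \<le> L1" "\<And>s t. s \<in> {a - \<eta>..b + \<eta>} \<Longrightarrow> t \<in> {a - \<eta>..b + \<eta>} \<Longrightarrow> \<bar>f s - f t\<bar> \<le> L1 * \<bar>s - t\<bar>"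
    by (rule lipschitz_of_continuous_derivative[OF ab(2) f]) blast+
  have near: "\<bar>extended_flux s - extended_flux t\<bar> \<le> L1 * \<bar>s - t\<bar>" if "s \<in> {a - \<eta>..b + \<eta>}" "t \<in> {a - \<eta>..b + \<eta>}" for s t
    using L1(2)[OF that] that ab(2) by (simp add: extended_flux_eq subset_iff)
  define L where "L = max L1 (2 * B / \<eta>)"
  have inner: "\<bar>extended_flux s - extended_flux t\<bar> \<le> L * \<bar>s - t\<bar>" if "s \<in> {a..b}" "t \<in> {a..b}" for s t
  proof -
    have "\<bar>extended_flux s - extended_flux t\<bar> \<le> L1 * \<bar>s - t\<bar>" using that ab(3) by (intro near) auto
    also have "\<dots> \<le> L * \<bar>s - t\<bar>" by (intro mult_right_mono) (auto simp: L_def)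
    finally show ?thesis .
  qed
  have w'_mem: "w' z \<in> I" and u'_mem: "u' z \<in> I" for z using w'(2)[of z] u'(2)[of z] ab_subset by auto
  have "kruzkov_pair w' u' P extended_flux B L"
  proof
    show "\<bar>kflux extended_flux (w' z) (u' z1) - kflux extended_flux (w' z) (u' z2)\<bar> \<le> L * \<bar>u' z1 - u' z2\<bar>" for z z1 z2
      by (rule kflux_lipschitz[OF inner u'(2) u'(2)])
    show "\<bar>kflux extended_flux (w' z) (u' z)\<bar> \<le> L * \<bar>w' z - u' z\<bar>" for z
      unfolding L_def
    proof (rule abs_kflux_le_lipschitz_near[OF _ u'(2) ab(3)])
      show "\<bar>extended_flux t - extended_flux (u' z)\<bar> \<le> L1 * \<bar>t - u' z\<bar>" if "t \<in> {a - \<eta>..b + \<eta>}" for t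
        using that u'(2)[of z] ab(3) by (intro near) auto
    qed (use ab_bound[OF u'(2)] w'(2) in auto)
    show "0 \<le> (LINT z|lborel. (\<bar>w' z - u' z'\<bar> * dt \<phi> z + kflux extended_flux (w' z) (u' z') * dx \<phi> z) * P z)"
      if "test_fun domT \<phi>" "\<And>z. 0 \<le> \<phi> z" for z' \<phi>
      by (rule kruzkov_representative[OF w w'(1) w'_mem w'(3) P(1,4,5) u'_mem that])
    show "0 \<le> (LINT z'|lborel. (\<bar>w' z - u' z'\<bar> * dt \<phi> z' + kflux extended_flux (w' z) (u' z') * dx \<phi> z') * P z')"
      if "test_fun domT \<phi>" "\<And>z. 0 \<le> \<phi> z" for z \<phi>
      using kruzkov_representative[OF u u'(1) u'_mem u'(3) P(1,4,5) w'_mem[of z] that]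
      by (simp add: kflux_commute[of _ "u' _"] abs_minus_commute[of "u' _"])
  qed (use w' u' ab_bound P L1(1) extended_flux_measurable in \<open>auto simp: L_def\<close>)
  then show ?thesis by (rule that)
qed

theorem solutions_coincide: "AE (x, t, y) in lebesgue_on domT. \<rho> y \<noteq> 0 \<longrightarrow> w (x, t, y) = u (x, t, y)"
proof -
  obtain w' u' P B where w': "w' \<in> borel_measurable borel" "\<And>z. w' z \<in> {s \<in> I. \<bar>s\<bar> \<le> B \<and> \<bar>extended_flux s\<bar> \<le> B}"
      "AE z in lebesgue_on domT. w z = w' z"
    and u': "u' \<in> borel_measurable borel" "\<And>z. u' z \<in> {a..b}" "AE z in lebesgue_on domT. u z = u' z"
    and ab_bound: "\<And>s. s \<in> {a..b} \<Longrightarrow> \<bar>s\<bar> \<le> B \<and> \<bar>extended_flux s\<bar> \<le> B"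
    and P: "P \<in> borel_measurable borel" "\<And>z. 0 \<le> P z" "\<And>z. P z \<le> B"
      "\<And>z. z \<notin> domT \<Longrightarrow> P z = 0" "AE z in lebesgue_on domT. \<rho> (snd (snd z)) = P z"
    by (rule bounded_borel_representatives) blast
  obtain L where "kruzkov_pair w' u' P extended_flux B L"
    by (rule kruzkov_pair_representatives[OF w' u' ab_bound P])
  then interpret kruzkov_pair w' u' P extended_flux B L .
  have "AE z in lborel. P z \<noteq> 0 \<longrightarrow> w' z = u' z"
  proof (rule AE_eq_of_initial_distance)
    fix r :: real assume "1 \<le> r"
    obtain M0 where u0: "u0 \<in> borel_measurable (lebesgue_on dom0)" "AE p in lebesgue_on dom0. \<bar>u0 p\<bar> \<le> M0"
      using u by (auto simp: weak_entropy_sol_reduced_def Linf_def)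
    have w_bounded: "AE z in lebesgue_on domT. \<bar>w z\<bar> \<le> B" using w'(3) by eventually_elim (simp add: bounded)
    have u_bounded: "AE z in lebesgue_on domT. \<bar>u z\<bar> \<le> B" using u'(3) by eventually_elim (simp add: bounded)
    have weight_le: "AE z in lebesgue_on domT. \<rho> (snd (snd z)) \<le> B" using P(5) by eventually_elim (simp add: P(3))
    have "AE z in lebesgue_on domT. \<bar>w z - u z\<bar> * (\<rho> (snd (snd z)) * \<rho> (snd (snd z))) = \<bar>w' z - u' z\<bar> * (P z * P z)"
      using w'(3) u'(3) P(5) by eventually_elim simp
    from slab_integral_eq_lborel[OF this]
    have "(LINT z|lebesgue_on ({-r..r} \<times> {0<..<T} \<times> Gam). \<bar>w z - u z\<bar> * (\<rho> (snd (snd z)) * \<rho> (snd (snd z))))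
        = (LINT z|lborel. indicator ({-r..r} \<times> {0<..<T} \<times> UNIV) z * (\<bar>w' z - u' z\<bar> * (P z * P z)))" for T
      using w'(1) u'(1) P(1,4) by simp
    then show "((\<lambda>T. 1 / T * (LINT z|lborel. indicator ({-r..r} \<times> {0<..<T} \<times> UNIV) z
        * (\<bar>w' z - u' z\<bar> * (P z * P z)))) \<longlongrightarrow> 0) (at_right 0)"
      using initial_distance_tendsto[OF _ _ w_bounded _ _ u_bounded u0 weight_le, of r] u w
      by (auto simp: weak_entropy_sol_reduced_def Linf_def)
  qed
  then have "AE z in lebesgue_on domT. P z \<noteq> 0 \<longrightarrow> w' z = u' z"
    by (simp add: AE_lebesgue_on_iff_lborel) (auto elim: eventually_mono)
  then have "AE z in lebesgue_on domT. \<rho> (snd (snd z)) \<noteq> 0 \<longrightarrow> w z = u z"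
    using w'(3) u'(3) P(5) by eventually_elim simp
  then show ?thesis by (rule eventually_mono) auto
qed

end

subsection \<open>The relaxation limit\<close>

lemma st_expand: "st a b = a *\<^sub>R st 1 0 + b *\<^sub>R st 0 1"
  by (simp add: vec_eq_iff forall_2)

lemma continuous_on_st:
  assumes "continuous_on A f" "continuous_on A g"
  shows "continuous_on A (\<lambda>s. st (f s) (g s))"
  by (subst st_expand) (intro continuous_intros assms)

lemma borel_measurable_st:
  assumes "f \<in> borel_measurable M" "g \<in> borel_measurable M"
  shows "(\<lambda>s. st (f s) (g s)) \<in> borel_measurable M"
  by (subst st_expand) (intro borel_measurable_add borel_measurable_scaleR borel_measurable_const assms)

lemma has_derivative_st_graph:
  assumes "(e has_real_derivative e') (at s within I)"
  shows "((\<lambda>s. st s (e s)) has_derivative (\<lambda>h. h *\<^sub>R st 1 e')) (at s within I)"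
proof -
  have "(e has_derivative (\<lambda>h. h * e')) (at s within I)"
    using assms by (simp add: has_field_derivative_def mult.commute[of _ e'])
  then have "((\<lambda>s. s *\<^sub>R st 1 0 + e s *\<^sub>R st 0 1) has_derivative (\<lambda>h. h *\<^sub>R st 1 0 + (h * e') *\<^sub>R st 0 1))
      (at s within I)"
    by (auto intro!: derivative_eq_intros)
  moreover have "h *\<^sub>R st 1 0 + (h * e') *\<^sub>R st 0 1 = h *\<^sub>R st 1 e'" for h
    by (simp add: vec_eq_iff forall_2)
  ultimately show ?thesis by (simp flip: st_expand)
qed

lemma linear_pr1: "linear pr1"
  by (simp add: linear_iff)

lemma open_pr1_image: "open D \<Longrightarrow> open (pr1 ` D)"
proof (rule open_surjective_linear_image[OF _ linear_pr1])
  show "surj pr1" by (rule surjI[of _ "\<lambda>s. st s 0"]) simp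
qed

lemma convex_pr1_image: "convex D \<Longrightarrow> convex (pr1 ` D)"
  by (rule convex_linear_image[OF linear_pr1])

lemma borel_pr1_closed_image:
  assumes "closed (A :: (real^2) set)"
  shows "pr1 ` A \<in> sets borel"
proof -
  have "x \<in> (\<Union>n::nat. A \<inter> cball 0 (real n))" if "x \<in> A" for x
    using real_arch_simple[of "norm x"] that by auto
  then have "A = (\<Union>n::nat. A \<inter> cball 0 (real n))" by blast
  then have "pr1 ` A = (\<Union>n::nat. pr1 ` (A \<inter> cball 0 (real n)))" by (metis image_UN)
  moreover have "pr1 ` (A \<inter> cball 0 (real n)) \<in> sets borel" for n :: nat
    using assms by (intro borel_compact compact_continuous_image closed_Int_compact continuous_intros) auto
  ultimately show ?thesis by simp
qed

lemma compact_subset_open_interval: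
  fixes J A :: "real set"
  assumes J: "compact J" "J \<noteq> {}" "J \<subseteq> A" and A: "open A" "convex A"
  obtains a b \<delta> where "a \<le> b" "0 < \<delta>" "J \<subseteq> {a..b}" "{a - \<delta>..b + \<delta>} \<subseteq> A"
proof -
  obtain a where a: "a \<in> J" "\<forall>s\<in>J. a \<le> s" using compact_attains_inf[OF J(1,2)] by blast
  obtain b where b: "b \<in> J" "\<forall>s\<in>J. s \<le> b" using compact_attains_sup[OF J(1,2)] by blast
  obtain r where r: "0 < r" "cball a r \<subseteq> A" using A(1) a(1) J(3) by (meson open_contains_cball subsetD)
  obtain s where s: "0 < s" "cball b s \<subseteq> A" using A(1) b(1) J(3) by (meson open_contains_cball subsetD)
  have "a - min r s \<in> cball a r" "b + min r s \<in> cball b s" using r(1) s(1) by (auto simp: dist_real_def)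
  then have "closed_segment (a - min r s) (b + min r s) \<subseteq> A"
    using r(2) s(2) by (intro closed_segment_subset A(2)) auto
  moreover have "a \<le> b" using a b by blast
  ultimately have "{a - min r s..b + min r s} \<subseteq> A" using r(1) s(1)
    by (simp add: closed_segment_eq_real_ivl split: if_splits)
  then show ?thesis using a b r(1) s(1) by (intro that[of a b "min r s"]) auto
qed

lemma strictly_convex_on_imp_convex_on:
  assumes "strictly_convex_on I g"
  shows "convex_on I g"
proof (rule convex_onI)
  show "convex I" using assms by (simp add: strictly_convex_on_def)
  show "g ((1 - t) *\<^sub>R x + t *\<^sub>R y) \<le> (1 - t) * g x + t * g y" if t: "0 < t" "t < 1" and xy: "x \<in> I" "y \<in> I" for t x y
  proof (cases "x = y")
    case True
    then show ?thesis by (simp add: algebra_simps)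
  next
    case False
    then have "g ((1 - t) * x + t * y) < (1 - t) * g x + t * g y"
      using assms t xy by (simp add: strictly_convex_on_def)
    then show ?thesis by simp
  qed
qed

lemma strictly_convex_above_tangent:
  assumes g: "strictly_convex_on I g" "open I" "(g has_real_derivative g') (at b)"
    and ab: "a \<in> I" "b \<in> I" "a \<noteq> b"
  shows "g b + g' * (a - b) < g a"
proof -
  have convex: "convex I" using g(1) by (simp add: strictly_convex_on_def)
  let ?m = "(1 - 1 / 2) * a + 1 / 2 * b"
  have "?m \<in> I" using convexD[OF convex ab(1,2), of "1 / 2" "1 / 2"] by simp
  then have "g' * (?m - b) \<le> g ?m - g b"
    using g(2,3) ab(2) convex_connected[OF convex] strictly_convex_on_imp_convex_on[OF g(1)]
    by (intro convex_on_imp_above_tangent[of I g]) (auto simp: interior_open intro: DERIV_subset)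
  moreover have "g ?m < (1 - 1 / 2) * g a + 1 / 2 * g b"
    using g(1)[unfolded strictly_convex_on_def, THEN conjunct2, rule_format, OF ab(1,2), of "1 / 2"] ab(3) by simp
  ultimately show ?thesis by (simp add: field_simps)
qed

lemma C2_real_with_subset: "C2_real_with I g g' g'' \<Longrightarrow> A \<subseteq> I \<Longrightarrow> C2_real_with A g g' g''"
  unfolding C2_real_with_def by (meson DERIV_subset continuous_on_subset subsetD)

lemma C2_real_with_continuous: "C2_real_with I g g' g'' \<Longrightarrow> continuous_on I g \<and> continuous_on I g'"
  unfolding C2_real_with_def by (blast intro: DERIV_continuous_on)

lemma equilibrium_in_closure:
  assumes "relaxation_system D F DF \<Lambda>m \<Lambda>p r e" "s \<in> pr1 ` closure D"
  shows "st s (e s) \<in> closure D"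
  using assms unfolding relaxation_system_def by blast

lemma flux_continuously_differentiable:
  assumes system: "relaxation_system D F DF \<Lambda>m \<Lambda>p r e"
  obtains f' where "\<And>s. s \<in> pr1 ` closure D \<Longrightarrow> (flux F e has_real_derivative f' s) (at s within pr1 ` closure D)"
    "continuous_on (pr1 ` closure D) f'"
proof -
  let ?I = "pr1 ` closure D" and ?c = "\<lambda>s. st s (e s)"
  have "\<exists>e' e''. C2_real_with ?I e e' e''" "\<forall>i. \<exists>HF. C2_with (closure D) (\<lambda>U. F U $ i) (\<lambda>U. DF U $ i) HF"
    using system unfolding relaxation_system_def by blast+
  then obtain e' e'' HF where e: "C2_real_with ?I e e' e''"
    and F: "C2_with (closure D) (\<lambda>U. F U $ 1) (\<lambda>U. DF U $ 1) HF" by metis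
  have curve_closure: "?c ` ?I \<subseteq> closure D" using equilibrium_in_closure[OF system] by blast
  show ?thesis
  proof
    fix s assume s: "s \<in> ?I"
    then have "(?c has_derivative (\<lambda>h. h *\<^sub>R st 1 (e' s))) (at s within ?I)"
      using e unfolding C2_real_with_def by (intro has_derivative_st_graph) blast
    from has_derivative_in_compose2[OF _ curve_closure s this, of "\<lambda>U. F U $ 1" "\<lambda>U h. DF U $ 1 \<bullet> h"] F
    have "(flux F e has_derivative (\<lambda>h. DF (?c s) $ 1 \<bullet> (h *\<^sub>R st 1 (e' s)))) (at s within ?I)"
      by (simp add: C2_with_def flux_def[abs_def])
    then show "(flux F e has_real_derivative DF (?c s) $ 1 \<bullet> st 1 (e' s)) (at s within ?I)"
      by (simp add: has_field_derivative_def mult.commute[of _ "_ \<bullet> _"])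
  next
    have "continuous_on (closure D) (\<lambda>U. DF U $ 1)"
      using F by (auto simp: C2_with_def continuous_on_eq_continuous_within intro: has_derivative_continuous)
    then have "continuous_on ?I (\<lambda>s. DF (?c s) $ 1)"
      using C2_real_with_continuous[OF e]
      by (intro continuous_on_compose2[OF _ continuous_on_st[OF continuous_on_id] curve_closure]) auto
    then show "continuous_on ?I (\<lambda>s. DF (?c s) $ 1 \<bullet> st 1 (e' s))"
      using C2_real_with_continuous[OF e] by (intro continuous_on_inner continuous_on_st continuous_on_const) auto
  qed
qed

lemma (in parameter_weight) weak_form_first_component:
  assumes U: "weak_entropy_sol_full \<rho> D F DF r e \<epsilon> U0 U" and \<phi>: "test_fun domT0 \<phi>"
  shows "weak_form (\<lambda>z. U z $ 1) (\<lambda>z. F (U z) $ 1) \<phi> + initial_form (\<lambda>p. U0 p $ 1) \<phi> = 0"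
proof -
  have zero: "test_fun domT0 (\<lambda>_ :: real \<times> real \<times> (real^'n). 0)"
    unfolding test_fun_def using smooth_const by blast
  have derivatives: "dt (\<lambda>_ :: real \<times> real \<times> (real^'n). 0) z = 0" "dx (\<lambda>_ :: real \<times> real \<times> (real^'n). 0) z = 0" for z
    by (simp_all add: dt_def dx_def)
  from U \<phi> zero have "(LINT (x, t, y)|lebesgue_on domT.
           (U (x, t, y) \<bullet> st (dt \<phi> (x, t, y)) (dt (\<lambda>_. 0) (x, t, y))
            + F (U (x, t, y)) \<bullet> st (dx \<phi> (x, t, y)) (dx (\<lambda>_. 0) (x, t, y))
            - 1 / \<epsilon> * r (U (x, t, y)) * 0) * \<rho> y)
        + (LINT (x, y)|lebesgue_on dom0. (U0 (x, y) \<bullet> st (\<phi> (x, 0, y)) 0) * \<rho> y) = 0"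
    unfolding weak_entropy_sol_full_def by blast
  then show ?thesis
    by (simp add: derivatives inner_vec_def sum_2 case_prod_beta' weak_form_def initial_form_def)
qed

locale relaxation_limit =
  fixes \<rho> :: "(real^'n) \<Rightarrow> real"
    and D B B' :: "(real^2) set"
    and F :: "real^2 \<Rightarrow> real^2" and DF :: "real^2 \<Rightarrow> real^2^2"
    and \<Lambda>m \<Lambda>p r :: "real^2 \<Rightarrow> real"
    and e l1 l2 :: "real \<Rightarrow> real"
    and C \<gamma> :: real
    and \<epsilon> :: "nat \<Rightarrow> real"
    and U0 :: "nat \<Rightarrow> real \<times> (real^'n) \<Rightarrow> real^2"
    and U :: "nat \<Rightarrow> real \<times> real \<times> (real^'n) \<Rightarrow> real^2"
    and u0 v0 :: "real \<times> (real^'n) \<Rightarrow> real"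
    and u :: "real \<times> real \<times> (real^'n) \<Rightarrow> real"
    and \<sigma> :: "nat \<Rightarrow> nat"
  assumes density: "parameter_density \<rho>"
    and system: "relaxation_system D F DF \<Lambda>m \<Lambda>p r e"
    and hyp_A1: "hyp_A1 D F DF \<Lambda>m \<Lambda>p r e B B' l1 l2 C \<gamma>"
    and hyp_A2: "hyp_A2 \<rho> D F DF r e B \<gamma> \<epsilon> U0 U"
    and hyp_A3: "hyp_A3 D e U0 u0 v0"
    and hyp_A4: "hyp_A4 \<rho> D F r e B \<gamma> \<epsilon> U0 U"
    and subsequence: "strict_mono \<sigma>"
    and u_measurable: "u \<in> borel_measurable (lebesgue_on domT)"
    and u_mem: "AE z in lebesgue_on domT. u z \<in> pr1 ` closure D"
    and U_tendsto: "\<And>p. 1 \<le> p \<Longrightarrow>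
           tendsto_Lp_loc p (\<lambda>_. 1) domT (\<lambda>k. U (\<sigma> k)) (\<lambda>z. st (u z) (e (u z))) sequentially"
begin

abbreviation equilibrium :: "real \<Rightarrow> real^2" where
  "equilibrium s \<equiv> st s (e s)"

definition states :: "(real^2) set" where
  "states = closure (Bgam D e B \<gamma>)"

definition densities :: "real set" where
  "densities = {s. equilibrium s \<in> states}"

sublocale parameter_weight \<rho>
  using density by unfold_locales (simp_all add: parameter_density_def)

lemma open_pr1_D: "open (pr1 ` D)"
  and convex_pr1_D: "convex (pr1 ` D)"
  and convex_pr1_closure_D: "convex (pr1 ` closure D)"
  using system by (simp_all add: relaxation_system_def open_pr1_image convex_pr1_image)

lemma pr1_D_subset: "pr1 ` D \<subseteq> pr1 ` closure D"
  using closure_subset by (rule image_mono)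

lemma borel_pr1_closure_D: "pr1 ` closure D \<in> sets borel"
  by (rule borel_pr1_closed_image) simp

lemma continuous_on_e: "continuous_on (pr1 ` closure D) e"
proof -
  have "\<exists>e' e''. C2_real_with (pr1 ` closure D) e e' e''" using system unfolding relaxation_system_def by (elim conjE)
  then show ?thesis using C2_real_with_continuous by blast
qed

lemma continuous_on_equilibrium: "continuous_on (pr1 ` closure D) equilibrium"
  by (rule continuous_on_st[OF continuous_on_id continuous_on_e])

lemma compact_states: "compact states" and states_subset: "states \<subseteq> D" and densities_nonempty: "densities \<noteq> {}"
proof -
  have B: "B \<subseteq> D" "B \<inter> equil D e \<noteq> {}" "compactly_in B B'" "B' \<subseteq> D" "0 < \<gamma>"
    using hyp_A1 unfolding hyp_A1_def by - (elim conjE, assumption)+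
  have "states \<subseteq> closure B" unfolding states_def by (rule closure_mono) (auto simp: Bgam_def)
  then show "states \<subseteq> D" "compact states"
    using B(3,4) closed_Int_compact[of states "closure B"] by (auto simp: compactly_in_def states_def Int_absorb2)
  from B(2) obtain s where "equilibrium s \<in> B" by (auto simp: equil_def)
  then have "equilibrium s \<in> Bgam D e B \<gamma>" using B(1,5) by (auto simp: Bgam_def)
  then show "densities \<noteq> {}" using closure_subset states_def densities_def by blast
qed

lemma densities_subset: "densities \<subseteq> pr1 ` states" "densities \<subseteq> pr1 ` D" "densities \<subseteq> pr1 ` closure D"
proof -
  show "densities \<subseteq> pr1 ` states" by (force simp: densities_def image_iff)
  then show "densities \<subseteq> pr1 ` D" "densities \<subseteq> pr1 ` closure D" using states_subset pr1_D_subset by blast+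
qed

lemma compact_densities: "compact densities"
proof -
  have "compact (pr1 ` states)" using compact_states by (intro compact_continuous_image continuous_intros)
  moreover have "continuous_on (pr1 ` states) equilibrium"
    using continuous_on_equilibrium by (rule continuous_on_subset) (use states_subset pr1_D_subset in blast)
  ultimately have "closed (pr1 ` states \<inter> equilibrium -` states)"
    using compact_states by (intro continuous_closed_preimage compact_imp_closed)
  with \<open>compact (pr1 ` states)\<close> have "compact (pr1 ` states \<inter> (pr1 ` states \<inter> equilibrium -` states))"
    by (rule compact_Int_closed)
  moreover have "pr1 ` states \<inter> (pr1 ` states \<inter> equilibrium -` states) = densities"
    using densities_subset(1) by (auto simp: densities_def)
  ultimately show ?thesis by simp
qed

lemma continuous_on_compose_equilibrium:
  assumes "continuous_on states h"
  shows "continuous_on densities (\<lambda>s. h (equilibrium s))"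
  by (rule continuous_on_compose2[OF assms continuous_on_subset[OF continuous_on_equilibrium densities_subset(3)]])
     (auto simp: densities_def)

lemma full_solution:
  shows "weak_entropy_sol_full \<rho> D F DF r e (\<epsilon> n) (U0 n) (U n)" and "0 < \<epsilon> n"
    and "AE z in lebesgue_on domT. U n z \<in> states" and "AE p in lebesgue_on dom0. U0 n p \<in> states"
  using hyp_A2 unfolding hyp_A2_def states_def by - (elim conjE, erule spec)+

lemma full_solution_measurable: "U n \<in> borel_measurable (lebesgue_on domT)" "U0 n \<in> borel_measurable (lebesgue_on dom0)"
  using full_solution(1)[of n] unfolding weak_entropy_sol_full_def Linf_def by - (elim conjE, assumption)+

lemma equilibrium_u_measurable: "(\<lambda>z. equilibrium (u z)) \<in> borel_measurable (lebesgue_on domT)"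
  by (rule borel_measurable_st[OF u_measurable
        borel_measurable_compose_AE[OF domains_lebesgue(1) u_measurable borel_pr1_closure_D continuous_on_e u_mem]])

lemma convergent_subsequence:
  obtains \<theta> where "AE z in lebesgue_on domT. (\<lambda>k. U (\<theta> k) z) \<longlonglongrightarrow> equilibrium (u z)"
    "AE p in lebesgue_on dom0. (\<lambda>k. U0 (\<theta> k) p) \<longlonglongrightarrow> equilibrium (u0 p)"
proof -
  obtain \<tau> where \<tau>: "strict_mono \<tau>" and
    lim: "AE z in lebesgue_on domT. (1::real) \<noteq> 0 \<longrightarrow> (\<lambda>k. U (\<sigma> (\<tau> k)) z) \<longlonglongrightarrow> equilibrium (u z)"
    by (rule tendsto_Lp_loc_AE_subseq[OF U_tendsto[OF order.refl] full_solution_measurable(1) equilibrium_u_measurable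
          _ _ compact_exhaustion_domT]) auto
  have "AE p in lebesgue_on dom0. (\<lambda>n. U0 n p) \<longlonglongrightarrow> st (u0 p) (v0 p)" "AE p in lebesgue_on dom0. v0 p = e (u0 p)"
    using hyp_A3 unfolding hyp_A3_def by auto
  then have "AE p in lebesgue_on dom0. (\<lambda>k. U0 (\<sigma> (\<tau> k)) p) \<longlonglongrightarrow> equilibrium (u0 p)"
  proof eventually_elim
    case (elim p)
    then show ?case using LIMSEQ_subseq_LIMSEQ[OF elim(1) strict_mono_o[OF subsequence \<tau>]] by (simp add: o_def)
  qed
  with lim show ?thesis by (intro that[of "\<lambda>k. \<sigma> (\<tau> k)"]) auto
qed

lemma in_densities:
  shows "AE z in lebesgue_on domT. u z \<in> densities" and "AE p in lebesgue_on dom0. u0 p \<in> densities"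
proof -
  obtain \<theta> where lim: "AE z in lebesgue_on domT. (\<lambda>k. U (\<theta> k) z) \<longlonglongrightarrow> equilibrium (u z)"
    "AE p in lebesgue_on dom0. (\<lambda>k. U0 (\<theta> k) p) \<longlonglongrightarrow> equilibrium (u0 p)" by (rule convergent_subsequence)
  have "AE z in lebesgue_on domT. \<forall>k. U (\<theta> k) z \<in> states" "AE p in lebesgue_on dom0. \<forall>k. U0 (\<theta> k) p \<in> states"
    using full_solution(3,4) by (simp_all add: AE_all_countable)
  note in_states = this
  have limit: "s \<in> densities" if "\<forall>k. V k \<in> states" "V \<longlonglongrightarrow> equilibrium s" for V :: "nat \<Rightarrow> real^2" and s
    using closed_sequentially[OF compact_imp_closed[OF compact_states] _ that(2)] that(1) by (simp add: densities_def)
  show "AE z in lebesgue_on domT. u z \<in> densities" using in_states(1) lim(1) by eventually_elim (rule limit)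
  show "AE p in lebesgue_on dom0. u0 p \<in> densities" using in_states(2) lim(2) by eventually_elim (rule limit)
qed

lemma u0_measurable: "u0 \<in> borel_measurable (lebesgue_on dom0)"
proof -
  obtain \<theta> where lim: "AE p in lebesgue_on dom0. (\<lambda>k. U0 (\<theta> k) p) \<longlonglongrightarrow> equilibrium (u0 p)" by (rule convergent_subsequence)
  have "(\<lambda>p. U0 (\<theta> k) p $ 1) \<in> borel_measurable (lebesgue_on dom0)" for k
    by (rule borel_measurable_compose_AE[OF _ full_solution_measurable(2) borel_compact[OF compact_states] _
        full_solution(4)])
       (auto intro!: continuous_intros)
  then have "(\<lambda>p. lim (\<lambda>k. U0 (\<theta> k) p $ 1)) \<in> borel_measurable (lebesgue_on dom0)"
    by (rule borel_measurable_lim_metric)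
  moreover have "AE p in lebesgue_on dom0. lim (\<lambda>k. U0 (\<theta> k) p $ 1) = u0 p"
    using lim
  proof eventually_elim
    case (elim p)
    then have "(\<lambda>k. U0 (\<theta> k) p $ 1) \<longlonglongrightarrow> u0 p" using tendsto_vec_nth[OF elim, of 1] by simp
    then show ?case by (rule limI)
  qed
  ultimately show ?thesis by (rule borel_measurable_lebesgue_on_AE[OF _ domains_lebesgue(2)])
qed

lemma equilibrium_u0_measurable: "(\<lambda>p. equilibrium (u0 p)) \<in> borel_measurable (lebesgue_on dom0)"
  by (rule borel_measurable_st[OF u0_measurable borel_measurable_compose_AE[OF domains_lebesgue(2) u0_measurable
          borel_compact[OF compact_densities] continuous_on_subset[OF continuous_on_e densities_subset(3)]
              in_densities(2)]])

lemma weak_forms_tendsto: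
  assumes \<phi>: "test_fun domT0 \<phi>" and h: "continuous_on states h" "continuous_on states k"
  obtains \<theta> where "(\<lambda>i. weak_form (\<lambda>z. h (U (\<theta> i) z)) (\<lambda>z. k (U (\<theta> i) z)) \<phi> + initial_form (\<lambda>p. h (U0 (\<theta> i) p)) \<phi>)
    \<longlonglongrightarrow> weak_form (\<lambda>z. h (equilibrium (u z))) (\<lambda>z. k (equilibrium (u z))) \<phi> + initial_form (\<lambda>p. h (equilibrium (u0 p))) \<phi>"
proof -
  obtain \<theta> where lim: "AE z in lebesgue_on domT. (\<lambda>k. U (\<theta> k) z) \<longlonglongrightarrow> equilibrium (u z)"
    "AE p in lebesgue_on dom0. (\<lambda>k. U0 (\<theta> k) p) \<longlonglongrightarrow> equilibrium (u0 p)" by (rule convergent_subsequence)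
  show ?thesis
    using lim
    by (intro that[of \<theta>] tendsto_add weak_form_compose_tendsto[OF \<phi> compact_states h full_solution_measurable(1)
        full_solution(3)
          equilibrium_u_measurable in_densities(1)[unfolded densities_def mem_Collect_eq]]
        initial_form_compose_tendsto[OF \<phi> compact_states h(1) full_solution_measurable(2) full_solution(4)
          equilibrium_u0_measurable in_densities(2)[unfolded densities_def mem_Collect_eq]])
       (auto elim: eventually_mono)
qed

lemma F_has_derivative:
  assumes "V \<in> states"
  shows "((\<lambda>U. F U $ i) has_derivative (\<lambda>h. DF V $ i \<bullet> h)) (at V within states)"
proof -
  have "\<exists>HF. C2_with (closure D) (\<lambda>U. F U $ i) (\<lambda>U. DF U $ i) HF"
    using system unfolding relaxation_system_def by (elim conjE) (erule spec)
  moreover have "states \<subseteq> closure D" using states_subset closure_subset by blast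
  ultimately show ?thesis using assms unfolding C2_with_def by (blast intro: has_derivative_subset)
qed

lemma continuous_on_F: "continuous_on states (\<lambda>U. F U $ i)"
  using F_has_derivative by (auto simp: continuous_on_eq_continuous_within intro: has_derivative_continuous)

lemma weak_solution:
  assumes \<phi>: "test_fun domT0 \<phi>"
  shows "weak_form u (\<lambda>z. flux F e (u z)) \<phi> + initial_form u0 \<phi> = 0"
proof -
  have "continuous_on states pr1" by (intro continuous_intros)
  from weak_forms_tendsto[OF \<phi> this continuous_on_F] obtain \<theta> where
    "(\<lambda>i. weak_form (\<lambda>z. U (\<theta> i) z $ 1) (\<lambda>z. F (U (\<theta> i) z) $ 1) \<phi> + initial_form (\<lambda>p. U0 (\<theta> i) p $ 1) \<phi>)
      \<longlonglongrightarrow> weak_form u (\<lambda>z. flux F e (u z)) \<phi> + initial_form u0 \<phi>"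
    by (auto simp: flux_def)
  then show ?thesis unfolding weak_form_first_component[OF full_solution(1) \<phi>] LIMSEQ_const_iff by simp
qed

lemma entropy_inequality:
  assumes pair: "convex_entropy_pair (equil D e) states r F DF \<eta> D\<eta> H\<eta> Q"
    and \<phi>: "test_fun domT0 \<phi>" "\<And>z. z \<in> domT0 \<Longrightarrow> 0 \<le> \<phi> z"
  shows "0 \<le> weak_form (\<lambda>z. \<eta> (equilibrium (u z))) (\<lambda>z. Q (equilibrium (u z))) \<phi>
    + initial_form (\<lambda>p. \<eta> (equilibrium (u0 p))) \<phi>"
proof -
  interpret weighted_entropy_pair "equil D e" states r F DF \<eta> D\<eta> H\<eta> Q \<rho>
    using pair parameter_weight_axioms by (rule weighted_entropy_pair.intro)
  have full_inequality: "0 \<le> weak_form (\<lambda>z. \<eta> (U n z)) (\<lambda>z. Q (U n z)) \<phi> + initial_form (\<lambda>p. \<eta> (U0 n p)) \<phi>" for n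
  proof -
    from hyp_A4 obtain W0 W where W: "\<forall>\<nu>>0. smooth_on dom0 (W0 \<nu>) \<and>
         W \<nu> \<in> borel_measurable (lebesgue_on domT) \<and>
         classical_viscous_sol F r (\<epsilon> n) \<nu> (W0 \<nu>) (W \<nu>) \<and>
         (\<forall>z\<in>dom0. W0 \<nu> z \<in> states) \<and> (\<forall>z\<in>domT. W \<nu> z \<in> states)"
      "tendsto_Lp_loc 1 (\<lambda>(x, y). \<rho> y) dom0 W0 (U0 n) (at_right 0)"
      "tendsto_Lp_loc 1 (\<lambda>(x, t, y). (\<rho> y)\<^sup>2) domT W (U n) (at_right 0)"
      unfolding hyp_A4_def states_def by blast
    show ?thesis
      by (rule entropy_inequality_vanishing_viscosity[OF full_solution(2) _ _ _ _ _ W(2,3) full_solution_measurable(1)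
            full_solution(3) full_solution_measurable(2) full_solution(4) \<phi>]) (use W(1) in blast)+
  qed
  obtain \<theta> where "(\<lambda>i. weak_form (\<lambda>z. \<eta> (U (\<theta> i) z)) (\<lambda>z. Q (U (\<theta> i) z)) \<phi> + initial_form (\<lambda>p. \<eta> (U0 (\<theta> i) p)) \<phi>)
    \<longlonglongrightarrow> weak_form (\<lambda>z. \<eta> (equilibrium (u z))) (\<lambda>z. Q (equilibrium (u z))) \<phi> + initial_form (\<lambda>p. \<eta> (equilibrium (u0 p))) \<phi>"
    by (rule weak_forms_tendsto[OF \<phi>(1) continuous_entropy(1,3)])
  then show ?thesis by (rule LIMSEQ_le_const) (use full_inequality in blast)
qed

lemma strictly_convex_entropy:
  obtains \<eta> D\<eta> H\<eta> Q where "convex_entropy_pair (equil D e) states r F DF \<eta> D\<eta> H\<eta> Q"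
    "\<And>s. s \<in> densities \<Longrightarrow> \<eta> (equilibrium s) = l1 s"
proof -
  have "\<forall>l\<in>{l1, l2}. \<exists>\<eta> D\<eta> H\<eta> Q.
        strongly_convex_entropy (equil D e) DF r states \<eta> D\<eta> H\<eta> \<and> entropy_flux DF states D\<eta> Q \<and>
        (\<forall>s\<in>pr1 ` states. \<eta> (equilibrium s) = l s) \<and>
        (\<forall>U\<in>states - equil D e. D\<eta> U $ 2 * r U > 0) \<and> (\<forall>s\<in>pr1 ` states. D\<eta> (equilibrium s) $ 2 = 0)"
    using hyp_A1 unfolding hyp_A1_def states_def by (elim conjE)
  then obtain \<eta> D\<eta> H\<eta> Q where "strongly_convex_entropy (equil D e) DF r states \<eta> D\<eta> H\<eta>"
    and "entropy_flux DF states D\<eta> Q" and "\<forall>s\<in>pr1 ` states. \<eta> (equilibrium s) = l1 s" by blast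
  moreover from this(3) have extends: "\<eta> (equilibrium s) = l1 s" if "s \<in> densities" for s
    using densities_subset(1) that by blast
  ultimately have "convex_entropy_pair (equil D e) states r F DF \<eta> D\<eta> H\<eta> Q"
    using compact_states F_has_derivative by unfold_locales (simp_all add: strongly_convex_entropy_def)
  then show ?thesis using extends by (rule that)
qed

theorem attains_initial_data: "attains_initial_data \<rho> u u0"
proof -
  have l1: "strictly_convex_on (pr1 ` D) l1" "\<exists>l1' l1''. C2_real_with (pr1 ` D) l1 l1' l1''"
    using hyp_A1 unfolding hyp_A1_def by - (elim conjE, assumption)+
  from l1(2) obtain l' l'' where C2: "C2_real_with (pr1 ` D) l1 l' l''" by blast
  have l1_deriv: "(l1 has_real_derivative l' s) (at s)" if "s \<in> densities" for s
    using C2 densities_subset(2) that at_within_open[OF _ open_pr1_D, of s] unfolding C2_real_with_def by force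
  obtain \<eta> D\<eta> H\<eta> Q where pair: "convex_entropy_pair (equil D e) states r F DF \<eta> D\<eta> H\<eta> Q"
    and extends: "\<And>s. s \<in> densities \<Longrightarrow> \<eta> (equilibrium s) = l1 s" by (rule strictly_convex_entropy, rule that)
  have continuous_l': "continuous_on densities l'"
    using C2_real_with_continuous[OF C2] densities_subset(2) by (auto intro: continuous_on_subset)
  interpret convex_entropy_pair "equil D e" states r F DF \<eta> D\<eta> H\<eta> Q by (rule pair)
  interpret initial_layer \<rho> densities "\<lambda>s. \<eta> (equilibrium s)" l' "flux F e" "\<lambda>s. Q (equilibrium s)" u u0
  proof
    show "continuous_on densities (\<lambda>s. \<eta> (equilibrium s))" "continuous_on densities (\<lambda>s. Q (equilibrium s))"
      by (rule continuous_on_compose_equilibrium continuous_entropy)+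
    show "continuous_on densities (flux F e)"
      using continuous_on_compose_equilibrium[OF continuous_on_F] by (simp add: flux_def[abs_def])
    show "\<eta> (equilibrium b) + l' b * (a - b) < \<eta> (equilibrium a)" if "a \<in> densities" "b \<in> densities" "a \<noteq> b" for a b
      using strictly_convex_above_tangent[OF l1(1) open_pr1_D l1_deriv[OF that(2)], of a] that densities_subset(2)
      by (auto simp: extends)
  qed (use compact_densities continuous_l' u_measurable in_densities u0_measurable weak_solution
      entropy_inequality[OF pair] in auto)
  show ?thesis by (rule attains_initial_data)
qed

lemma vector_derivative_flux:
  assumes "s \<in> pr1 ` D"
  shows "at s within pr1 ` closure D = at s" "vector_derivative (flux F e) (at s) = deriv (flux F e) s"
proof -
  show interior: "at s within pr1 ` closure D = at s"
    by (rule at_within_interior) (use interior_maximal[OF pr1_D_subset open_pr1_D] assms in blast)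
  have s: "s \<in> pr1 ` closure D" using assms pr1_D_subset by blast
  obtain f' where "\<And>s. s \<in> pr1 ` closure D \<Longrightarrow> (flux F e has_real_derivative f' s) (at s within pr1 ` closure D)"
    using flux_continuously_differentiable[OF system] by blast
  from this[OF s] have deriv: "(flux F e has_real_derivative f' s) (at s)" by (simp only: interior)
  then have "vector_derivative (flux F e) (at s) = f' s"
    by (intro vector_derivative_at) (simp add: has_real_derivative_iff_has_vector_derivative)
  then show "vector_derivative (flux F e) (at s) = deriv (flux F e) s" using DERIV_imp_deriv[OF deriv] by simp
qed

theorem weak_entropy_sol_reduced:
  assumes entropy: "\<forall>l l' l'' q \<phi>.
      convex_on (pr1 ` D) l \<and> C2_real_with (pr1 ` D) l l' l'' \<and>
      (\<forall>s\<in>pr1 ` D. (q has_real_derivative l' s * deriv (flux F e) s) (at s)) \<and>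
      test_fun domT \<phi> \<and> (\<forall>z\<in>domT. 0 \<le> \<phi> z) \<longrightarrow>
      (LINT (x, t, y)|lebesgue_on domT.
        (l (u (x, t, y)) * dt \<phi> (x, t, y) + q (u (x, t, y)) * dx \<phi> (x, t, y)) * \<rho> y) \<ge> 0"
  shows "weak_entropy_sol_reduced \<rho> D (flux F e) u0 u"
  unfolding weak_entropy_sol_reduced_def
proof (intro conjI allI impI)
  let ?I = "pr1 ` closure D" and ?f = "flux F e"
  obtain M where M: "\<And>s. s \<in> densities \<Longrightarrow> \<bar>s\<bar> \<le> M"
    by (rule compact_continuous_abs_bound[OF compact_densities continuous_on_id], rule that)
  show "Linf dom0 u0" unfolding Linf_def real_norm_def
    using u0_measurable in_densities(2) M by (auto intro!: exI[of _ M] elim!: eventually_mono)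
  show Linf_u: "Linf domT u" unfolding Linf_def real_norm_def
    using u_measurable in_densities(1) M by (auto intro!: exI[of _ M] elim!: eventually_mono)
  have "continuous_on densities ?f"
    using continuous_on_compose_equilibrium[OF continuous_on_F] by (simp add: flux_def[abs_def])
  from Linf_compose[OF domains_lebesgue(1) Linf_u compact_imp_closed[OF compact_densities] this in_densities(1)]
  show "Linf domT (\<lambda>z. ?f (u z))" .
  show "AE z in lebesgue_on domT. u z \<in> ?I" by (rule u_mem)
  show "AE p in lebesgue_on dom0. u0 p \<in> ?I"
    using in_densities(2) by eventually_elim (use densities_subset(3) in blast)
  show "(LINT (x, t, y)|lebesgue_on domT. (u (x, t, y) * dt \<phi> (x, t, y) + ?f (u (x, t, y)) * dx \<phi> (x, t, y)) * \<rho> y)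
      + (LINT (x, y)|lebesgue_on dom0. u0 (x, y) * \<phi> (x, 0, y) * \<rho> y) = 0" if "test_fun domT0 \<phi>" for \<phi>
    using weak_solution[OF that] by (simp add: weak_form_def initial_form_def case_prod_beta')
  show "attains_initial_data \<rho> u u0" by (rule attains_initial_data)
  show "0 \<le> (LINT (x, t, y)|lebesgue_on domT. (l (u (x, t, y)) * dt \<phi> (x, t, y)
      + q (u (x, t, y)) * dx \<phi> (x, t, y)) * \<rho> y)"
    if pair: "convex_on UNIV l \<and> C2_real_with ?I l l' l'' \<and>
      (\<forall>s\<in>?I. (q has_real_derivative l' s * vector_derivative ?f (at s within ?I)) (at s within ?I)) \<and>
      test_fun domT \<phi> \<and> (\<forall>z\<in>domT. 0 \<le> \<phi> z)" for l l' l'' q \<phi>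
  proof (rule entropy[rule_format], intro conjI ballI)
    show "convex_on (pr1 ` D) l" using pair convex_pr1_D convex_on_subset by blast
    show "C2_real_with (pr1 ` D) l l' l''" using pair C2_real_with_subset[OF _ pr1_D_subset] by blast
    show "(q has_real_derivative l' s * deriv ?f s) (at s)" if s: "s \<in> pr1 ` D" for s
    proof -
      have "(q has_real_derivative l' s * vector_derivative ?f (at s within ?I)) (at s within ?I)"
        using pair s pr1_D_subset by blast
      then show ?thesis by (simp only: vector_derivative_flux[OF s])
    qed
  qed (use pair in auto)
qed

theorem weak_entropy_sol_reduced_unique:
  assumes u: "weak_entropy_sol_reduced \<rho> D (flux F e) u0 u"
  shows "unique_weak_entropy_sol_reduced \<rho> D (flux F e) u0 u"
proof -
  obtain a b \<delta> where ab: "a \<le> b" "0 < \<delta>" "densities \<subseteq> {a..b}" "{a - \<delta>..b + \<delta>} \<subseteq> pr1 ` D"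
    using compact_subset_open_interval[OF compact_densities densities_nonempty densities_subset(2) open_pr1_D
        convex_pr1_D] by blast
  obtain f' where f: "\<And>s. s \<in> pr1 ` closure D \<Longrightarrow> (flux F e has_real_derivative f' s) (at s within pr1 ` closure D)"
    "continuous_on (pr1 ` closure D) f'" using flux_continuously_differentiable[OF system] by blast
  have ab_subset: "{a - \<delta>..b + \<delta>} \<subseteq> pr1 ` closure D" using ab(4) pr1_D_subset by blast
  have u_mem_ab: "AE z in lebesgue_on domT. u z \<in> {a..b}" using in_densities(1) by eventually_elim (use ab(3) in blast)
  have "AE (x, t, y) in lebesgue_on domT. \<rho> y \<noteq> 0 \<longrightarrow> w (x, t, y) = u (x, t, y)"
    if "weak_entropy_sol_reduced \<rho> D (flux F e) u0 w" for w
  proof -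
    interpret reduced_solution_pair \<rho> D "pr1 ` closure D" "flux F e" f' a b \<delta> u0 u w
      using convex_pr1_closure_D borel_pr1_closure_D f ab(1,2) ab_subset u that u_mem_ab by unfold_locales simp_all
    show ?thesis by (rule solutions_coincide)
  qed
  with u show ?thesis by (simp add: unique_weak_entropy_sol_reduced_def)
qed

end

theorem theorem3p12:
  fixes \<rho> :: "(real^'n) \<Rightarrow> real"
    and D B B' :: "(real^2) set"
    and F :: "real^2 \<Rightarrow> real^2" and DF :: "real^2 \<Rightarrow> real^2^2"
    and \<Lambda>m \<Lambda>p r :: "real^2 \<Rightarrow> real"
    and e l1 l2 :: "real \<Rightarrow> real"
    and C \<gamma> :: real
    and \<epsilon> :: "nat \<Rightarrow> real"
    and U0 :: "nat \<Rightarrow> real \<times> (real^'n) \<Rightarrow> real^2"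
    and U :: "nat \<Rightarrow> real \<times> real \<times> (real^'n) \<Rightarrow> real^2"
    and u0 v0 :: "real \<times> (real^'n) \<Rightarrow> real"
    and u :: "real \<times> real \<times> (real^'n) \<Rightarrow> real"
    and \<sigma> :: "nat \<Rightarrow> nat"
  assumes "parameter_density \<rho>"
    and "relaxation_system D F DF \<Lambda>m \<Lambda>p r e"
    and "hyp_A1 D F DF \<Lambda>m \<Lambda>p r e B B' l1 l2 C \<gamma>"
    and "hyp_A2 \<rho> D F DF r e B \<gamma> \<epsilon> U0 U"
    and "hyp_A3 D e U0 u0 v0"
    and "hyp_A4 \<rho> D F r e B \<gamma> \<epsilon> U0 U"
    and "strict_mono \<sigma>"
    and "u \<in> borel_measurable (lebesgue_on domT)"
    and "AE z in lebesgue_on domT. u z \<in> pr1 ` closure D"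
    and "\<And>p. 1 \<le> p \<Longrightarrow>
           tendsto_Lp_loc p (\<lambda>_. 1) domT (\<lambda>k. U (\<sigma> k)) (\<lambda>z. st (u z) (e (u z))) sequentially"
  shows "(\<forall>V. V \<in> sets lebesgue \<and> bounded V \<longrightarrow>
            ((\<lambda>T. 1 / T * (LINT (x, t, y)|lebesgue_on (V \<times> {0<..<T} \<times> Gam).
                     \<bar>u (x, t, y) - u0 (x, y)\<bar> * \<rho> y)) \<longlongrightarrow> 0) (at_right 0)) \<and>
         ((\<forall>l l' l'' q \<phi>.
             convex_on (pr1 ` D) l \<and> C2_real_with (pr1 ` D) l l' l'' \<and>
             (\<forall>s\<in>pr1 ` D. (q has_real_derivative l' s * deriv (flux F e) s) (at s)) \<and>
             test_fun domT \<phi> \<and> (\<forall>z\<in>domT. 0 \<le> \<phi> z) \<longrightarrow>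
             (LINT (x, t, y)|lebesgue_on domT.
                (l (u (x, t, y)) * dt \<phi> (x, t, y) + q (u (x, t, y)) * dx \<phi> (x, t, y)) * \<rho> y) \<ge> 0)
          \<longrightarrow> unique_weak_entropy_sol_reduced \<rho> D (flux F e) u0 u)"
    (is "?initial_trace \<and> (?entropy_inequalities \<longrightarrow> ?unique_solution)")
proof (intro conjI impI)
  interpret relaxation_limit \<rho> D B B' F DF \<Lambda>m \<Lambda>p r e l1 l2 C \<gamma> \<epsilon> U0 U u0 v0 u \<sigma>
    using assms by (rule relaxation_limit.intro)
  show ?initial_trace
    using attains_initial_data unfolding attains_initial_data_def real_norm_def .
  assume entropy_inequalities: ?entropy_inequalities
  show ?unique_solution
    by (rule weak_entropy_sol_reduced_unique[OF weak_entropy_sol_reduced[OF entropy_inequalities]])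
qed

end
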